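(* Let $F$ be a nonarchimedean local field with $\mathrm{char}(F)\neq2$, $B$ the quaternion division $F$-algebra, $O_B$ its maximal order, and $*$ an orthogonal involution on $B$, given by $\alpha^*=\gamma\bar\alpha\gamma^{-1}$ with $\gamma\in B^\times$, $\gamma+\bar\gamma=0$. Assume that $\mathrm{ord}_B(\gamma)$ is odd. Let $L$ be an $(O_B,O_B)$-bilattice with structural invariant $(r_1,r_2,t_1,t_2)\in\mathbb{Z}_{\ge0}^4$, that is, $L\simeq\mathbb{O}^{\oplus r_1}\oplus\mathbb{P}^{\oplus r_2}\oplus\mathbb{L}_1^{\oplus t_1}\oplus\mathbb{L}_2^{\oplus t_2}$. Then there exists a perfect hermitian $(O_B,*,O_B)$-pairing $\langle\ ,\ \rangle$ on $L$ if and only if $r_1=r_2$. In this case, $(L,\langle\ ,\ \rangle_u)$ is isometric to the orthogonal direct sum $$\mathbb{M}_1^{\boxplus t_1}\boxplus\mathbb{M}_2^{\boxplus t_2}\boxplus\mathbb{M}_3^{\boxplus r}\quad\text{with } r:=r_1=r_2.$$ In particular, up to isometry there exists a unique self-dual hermitian $(O_B,*,O_B)$-bilattice with given structural invariant $(r,r,t_1,t_2)$.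
   Context: Bilattices: an $(O_B,O_B)$-bilattice is a finitely generated $O_F$-torsion-free $(O_B,O_B)$-bimodule with agreeing left and right $O_F$-actions. An $O_F$-algebra embedding $\varphi:O_B\hookrightarrow\mathrm{Mat}_n(O_B)$ makes the right module $O_B^{\oplus n}$ of column vectors a bilattice $(O_B^{\oplus n},\varphi)$ with left action $\alpha\cdot x=\varphi(\alpha)x$. Let $K/F$ be the unramified quadratic extension with nontrivial automorphism $\sigma$, embedded in $B$, $\pi$ a fixed uniformizer of $F$, and $\Pi\in O_B$ with $O_B=O_K\oplus O_K\Pi$, $\Pi^2=\pi$, $\Pi a=a^\sigma\Pi$ ($a\in O_K$). Let $\mathrm{id}(\alpha)=\alpha$, $\tau(\alpha)=\Pi^{-1}\alpha\Pi$, $\varphi_1(\Pi)=\varphi_2(\Pi)=\begin{bmatrix}0&\pi\\1&0\end{bmatrix}$, $\varphi_1(a)=\mathrm{diag}(a,a^\sigma)$, $\varphi_2(a)=\mathrm{diag}(a^\sigma,a)$ for $a\in O_K$, and $\varphi_3=\mathrm{id}\oplus\tau$ (block diagonal). Put $\mathbb{O}=(O_B,\mathrm{id})$, $\mathbb{P}=(O_B,\tau)$, $\mathbb{L}_i=(O_B^{\oplus2},\varphi_i)$ for $i=1,2,3$. Every bilattice is isomorphic to $\mathbb{O}^{\oplus r_1}\oplus\mathbb{P}^{\oplus r_2}\oplus\mathbb{L}_1^{\oplus t_1}\oplus\mathbb{L}_2^{\oplus t_2}$ for a unique quadruple, its structural invariant. Hermitian forms: for an involution $\star$ of $O_B$,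 a hermitian (resp. skew-hermitian) $(O_B,\star,O_B)$-pairing on $L$ is an $O_F$-bilinear pairing $\langle\ ,\ \rangle:L\times L\to B$, non-degenerate on $L\otimes_{O_F}F$, with $\langle x,y\rangle=\overline{\langle y,x\rangle}$ (resp. $=-\overline{\langle y,x\rangle}$), $\langle x\alpha,y\beta\rangle=\bar\alpha\langle x,y\rangle\beta$ and $\langle\alpha x,y\rangle=\langle x,\alpha^{\star}y\rangle$ for $x,y\in L$, $\alpha,\beta\in O_B$; here $\bar{\ }$ is the canonical involution. The pairing is perfect (and $L$ with it is self-dual) if $\{x\in L\otimes F:\langle x,L\rangle\subseteq O_B\}=L$; equivalently, its Gram matrix in a right $O_B$-basis of $L$ is invertible over $O_B$. Isometries are bimodule isomorphisms preserving pairings; $\boxplus$ is orthogonal direct sum. $\mathrm{ord}_B$ is the normalized discrete valuation of $B$. Auxiliary objects: since $\gamma$ is determined by $*$ only up to $F^\times$, normalize $\mathrm{ord}_B(\gamma)=1$ and write $\gamma=u\Pi$ with $u\in O_B^\times$. For a hermitian $(O_B,*,O_B)$-pairing $\langle\ ,\ \rangle$ put $\langle x,y\rangle_u=\langle x,uy\rangle$; this is a hermitian $(O_B,{}',O_B)$-pairing, where $\alpha'=\Pi\bar\alpha\Pi^{-1}$. Fix $c\in O_K^\times$ with $c+c^\sigma=0$. For $i=1,2,3$, $\mathbb{M}_i$ is the self-dual hermitian $(O_B,{}',O_B)$-bilattice with underlying bilattice $\mathbb{L}_i$ and Gram matrix $C_i$ in the standard right $O_B$-basis, where $$C_1=C_2=\begin{bmatrix}0&c\\-c&0\end{bmatrix},\qquad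 C_3=\begin{bmatrix}0&1\\1&0\end{bmatrix}.$$ *)

theory Defs
  imports "Jordan_Normal_Form.Matrix"
begin

section \<open>Local fields and quaternion division algebras\<close>

text \<open>
  Values of a valuation at \<open>0\<close> are irrelevant: every use is guarded by \<open>x \<noteq> 0\<close>.
\<close>

definition discrete_valuation :: "('a::division_ring \<Rightarrow> int) \<Rightarrow> bool" where
  "discrete_valuation v \<longleftrightarrow>
     (\<forall>x y. x \<noteq> 0 \<and> y \<noteq> 0 \<longrightarrow> v (x * y) = v x + v y) \<and>
     (\<forall>x y. x \<noteq> 0 \<and> y \<noteq> 0 \<and> x + y \<noteq> 0 \<longrightarrow> min (v x) (v y) \<le> v (x + y)) \<and>
     v ` (UNIV - {0}) = UNIV"

definition valuation_ring :: "('a::division_ring \<Rightarrow> int) \<Rightarrow> 'a set" where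
  "valuation_ring v = {x. x = 0 \<or> 0 \<le> v x}"

definition valuation_ideal :: "('a::division_ring \<Rightarrow> int) \<Rightarrow> 'a set" where
  "valuation_ideal v = {x. x = 0 \<or> 0 < v x}"

definition valuation_complete :: "('a::division_ring \<Rightarrow> int) \<Rightarrow> bool" where
  "valuation_complete v \<longleftrightarrow>
     (\<forall>X :: nat \<Rightarrow> 'a.
        (\<forall>N. \<exists>M. \<forall>m\<ge>M. \<forall>n\<ge>M. X m = X n \<or> N \<le> v (X m - X n)) \<longrightarrow>
        (\<exists>l. \<forall>N. \<exists>M. \<forall>n\<ge>M. X n = l \<or> N \<le> v (X n - l)))"

definition nonarch_local_field :: "('f::field \<Rightarrow> int) \<Rightarrow> bool" where
  "nonarch_local_field v \<longleftrightarrow>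
     discrete_valuation v \<and> valuation_complete v \<and>
     finite (valuation_ring v //
       {(x, y). x \<in> valuation_ring v \<and> y \<in> valuation_ring v \<and> x - y \<in> valuation_ideal v})"

definition unit_set :: "'a::division_ring set \<Rightarrow> 'a set" where
  "unit_set R = {x \<in> R. x \<noteq> 0 \<and> inverse x \<in> R}"

text \<open>
  The division algebra is the whole type \<open>'b\<close>; it is an \<open>'f\<close>-algebra through the
  embedding \<open>emb\<close>. Simplicity is automatic for a division ring, so ``central simple of
  dimension four'' reduces to the following.
\<close>

definition quaternion_division_algebra :: "('f::field \<Rightarrow> 'b::division_ring) \<Rightarrow> bool" where
  "quaternion_division_algebra emb \<longleftrightarrow>
     emb 1 = 1 \<and> (\<forall>a b. emb (a + b) = emb a + emb b) \<and> (\<forall>a b. emb (a * b) = emb a * emb b) \<and>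
     range emb = {x. \<forall>y. x * y = y * x} \<and>
     vector_space.dim (\<lambda>a x. emb a * x) (UNIV :: 'b set) = 4"

definition canonical_involution :: "('f::field \<Rightarrow> 'b::division_ring) \<Rightarrow> ('b \<Rightarrow> 'b) \<Rightarrow> bool" where
  "canonical_involution emb cj \<longleftrightarrow>
     (\<forall>x y. cj (x + y) = cj x + cj y) \<and> (\<forall>x y. cj (x * y) = cj y * cj x) \<and>
     (\<forall>x. cj (cj x) = x) \<and> (\<forall>a. cj (emb a) = emb a) \<and>
     (\<forall>x. x + cj x \<in> range emb) \<and> (\<forall>x. x * cj x \<in> range emb)"

definition is_order ::
    "('f::field \<Rightarrow> int) \<Rightarrow> ('f \<Rightarrow> 'b::division_ring) \<Rightarrow> 'b set \<Rightarrow> bool" where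
  "is_order vF emb R \<longleftrightarrow>
     1 \<in> R \<and> (\<forall>x\<in>R. \<forall>y\<in>R. x - y \<in> R) \<and> (\<forall>x\<in>R. \<forall>y\<in>R. x * y \<in> R) \<and>
     (\<exists>S. finite S \<and> R = {\<Sum>s\<in>S. emb (k s) * s | k. k ` S \<subseteq> valuation_ring vF}) \<and>
     Modules.module.span (\<lambda>a x. emb a * x) R = UNIV"

definition maximal_order ::
    "('f::field \<Rightarrow> int) \<Rightarrow> ('f \<Rightarrow> 'b::division_ring) \<Rightarrow> 'b set \<Rightarrow> bool" where
  "maximal_order vF emb R \<longleftrightarrow>
     is_order vF emb R \<and> (\<forall>R'. is_order vF emb R' \<and> R \<subseteq> R' \<longrightarrow> R' = R)"

definition valuation_extends ::
    "('f::field \<Rightarrow> int) \<Rightarrow> ('f \<Rightarrow> 'b::division_ring) \<Rightarrow> ('b \<Rightarrow> int) \<Rightarrow> bool" where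
  "valuation_extends vF emb vB \<longleftrightarrow> (\<exists>e>0. \<forall>a. a \<noteq> 0 \<longrightarrow> vB (emb a) = e * vF a)"

text \<open>
  The valuation of the subfield \<open>K\<close> is the restriction of \<open>vB\<close>. ``Unramified'' means
  ramification index one; separability of the residue extension is automatic over a
  finite residue field.
\<close>

definition unramified_quadratic_subfield ::
    "('f::field \<Rightarrow> 'b::division_ring) \<Rightarrow> ('b \<Rightarrow> int) \<Rightarrow> 'b set \<Rightarrow> bool" where
  "unramified_quadratic_subfield emb vB K \<longleftrightarrow>
     range emb \<subseteq> K \<and> (\<forall>x\<in>K. \<forall>y\<in>K. x - y \<in> K) \<and> (\<forall>x\<in>K. \<forall>y\<in>K. x * y \<in> K) \<and>
     (\<forall>x\<in>K. inverse x \<in> K) \<and> (\<forall>x\<in>K. \<forall>y\<in>K. x * y = y * x) \<and>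
     vector_space.dim (\<lambda>a x. emb a * x) K = 2 \<and>
     vB ` (K - {0}) = vB ` (range emb - {0})"

definition nontrivial_automorphism ::
    "('f::field \<Rightarrow> 'b::division_ring) \<Rightarrow> 'b set \<Rightarrow> ('b \<Rightarrow> 'b) \<Rightarrow> bool" where
  "nontrivial_automorphism emb K sg \<longleftrightarrow>
     bij_betw sg K K \<and> (\<forall>x\<in>K. \<forall>y\<in>K. sg (x + y) = sg x + sg y) \<and>
     (\<forall>x\<in>K. \<forall>y\<in>K. sg (x * y) = sg x * sg y) \<and> (\<forall>a. sg (emb a) = emb a) \<and>
     (\<exists>x\<in>K. sg x \<noteq> x)"


section \<open>Bilattices\<close>

text \<open>
  As for modules in HOL-Algebra, the multiplicative fields of the \<open>ring\<close> record are unused.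
  Actions are only meaningful for scalars in the order \<open>OB\<close>.
\<close>

record ('b, 'l) bimodule = "'l ring" +
  lact :: "'b \<Rightarrow> 'l \<Rightarrow> 'l"
  ract :: "'l \<Rightarrow> 'b \<Rightarrow> 'l"

definition bimodule_axioms :: "'b::division_ring set \<Rightarrow> ('b, 'l) bimodule \<Rightarrow> bool" where
  "bimodule_axioms OB L \<longleftrightarrow>
     abelian_group L \<and>
     (\<forall>\<alpha>\<in>OB. \<forall>x\<in>carrier L. lact L \<alpha> x \<in> carrier L \<and> ract L x \<alpha> \<in> carrier L) \<and>
     (\<forall>\<alpha>\<in>OB. \<forall>x\<in>carrier L. \<forall>y\<in>carrier L.
        lact L \<alpha> (x \<oplus>\<^bsub>L\<^esub> y) = lact L \<alpha> x \<oplus>\<^bsub>L\<^esub> lact L \<alpha> y \<and>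
        ract L (x \<oplus>\<^bsub>L\<^esub> y) \<alpha> = ract L x \<alpha> \<oplus>\<^bsub>L\<^esub> ract L y \<alpha>) \<and>
     (\<forall>\<alpha>\<in>OB. \<forall>\<beta>\<in>OB. \<forall>x\<in>carrier L.
        lact L (\<alpha> + \<beta>) x = lact L \<alpha> x \<oplus>\<^bsub>L\<^esub> lact L \<beta> x \<and>
        ract L x (\<alpha> + \<beta>) = ract L x \<alpha> \<oplus>\<^bsub>L\<^esub> ract L x \<beta> \<and>
        lact L (\<alpha> * \<beta>) x = lact L \<alpha> (lact L \<beta> x) \<and>
        ract L x (\<alpha> * \<beta>) = ract L (ract L x \<alpha>) \<beta> \<and>
        lact L \<alpha> (ract L x \<beta>) = ract L (lact L \<alpha> x) \<beta>) \<and>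
     (\<forall>x\<in>carrier L. lact L 1 x = x \<and> ract L x 1 = x)"

definition sub_bimodule :: "'b::division_ring set \<Rightarrow> ('b, 'l) bimodule \<Rightarrow> 'l set \<Rightarrow> bool" where
  "sub_bimodule OB L N \<longleftrightarrow>
     N \<subseteq> carrier L \<and> \<zero>\<^bsub>L\<^esub> \<in> N \<and> (\<forall>x\<in>N. \<forall>y\<in>N. x \<oplus>\<^bsub>L\<^esub> y \<in> N) \<and>
     (\<forall>\<alpha>\<in>OB. \<forall>x\<in>N. lact L \<alpha> x \<in> N \<and> ract L x \<alpha> \<in> N)"

definition bilattice ::
    "'f::field set \<Rightarrow> ('f \<Rightarrow> 'b::division_ring) \<Rightarrow> 'b set \<Rightarrow> ('b, 'l) bimodule \<Rightarrow> bool" where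
  "bilattice OF emb OB L \<longleftrightarrow>
     bimodule_axioms OB L \<and>
     (\<forall>a\<in>OF. \<forall>x\<in>carrier L. lact L (emb a) x = ract L x (emb a)) \<and>
     (\<forall>a\<in>OF. \<forall>x\<in>carrier L. ract L x (emb a) = \<zero>\<^bsub>L\<^esub> \<longrightarrow> a = 0 \<or> x = \<zero>\<^bsub>L\<^esub>) \<and>
     (\<exists>S. finite S \<and> S \<subseteq> carrier L \<and> (\<forall>N. sub_bimodule OB L N \<and> S \<subseteq> N \<longrightarrow> N = carrier L))"

definition bilattice_iso ::
    "'b set \<Rightarrow> ('b, 'l) bimodule \<Rightarrow> ('b, 'm) bimodule \<Rightarrow> ('l \<Rightarrow> 'm) \<Rightarrow> bool" where
  "bilattice_iso OB L M f \<longleftrightarrow>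
     bij_betw f (carrier L) (carrier M) \<and>
     (\<forall>x\<in>carrier L. \<forall>y\<in>carrier L. f (x \<oplus>\<^bsub>L\<^esub> y) = f x \<oplus>\<^bsub>M\<^esub> f y) \<and>
     (\<forall>\<alpha>\<in>OB. \<forall>x\<in>carrier L. f (lact L \<alpha> x) = lact M \<alpha> (f x) \<and> f (ract L x \<alpha>) = ract M (f x) \<alpha>)"

definition bilattices_isomorphic ::
    "'b set \<Rightarrow> ('b, 'l) bimodule \<Rightarrow> ('b, 'm) bimodule \<Rightarrow> bool" where
  "bilattices_isomorphic OB L M \<longleftrightarrow> (\<exists>f. bilattice_iso OB L M f)"

text \<open>The external direct sum of a finite family; its elements are lists of components.\<close>

definition direct_sum :: "('b, 'l) bimodule list \<Rightarrow> ('b, 'l list) bimodule" where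
  "direct_sum Ms =
     \<lparr> carrier = {xs. list_all2 (\<lambda>M x. x \<in> carrier M) Ms xs},
       mult = undefined, one = undefined,
       zero = map zero Ms,
       add = (\<lambda>xs ys. map (\<lambda>(M, x, y). x \<oplus>\<^bsub>M\<^esub> y) (zip Ms (zip xs ys))),
       lact = (\<lambda>\<alpha> xs. map2 (\<lambda>M x. lact M \<alpha> x) Ms xs),
       ract = (\<lambda>xs \<alpha>. map2 (\<lambda>M x. ract M x \<alpha>) Ms xs) \<rparr>"

text \<open>
  The bilattice \<open>(O\<^sub>B\<^sup>n, \<phi>)\<close>. Scalars act on the right entrywise; \<open>\<cdot>\<^sub>v\<close> of the matrix
  library is not usable here since it multiplies from the left.
\<close>

definition column_bilattice ::
    "'b::division_ring set \<Rightarrow> nat \<Rightarrow> ('b \<Rightarrow> 'b mat) \<Rightarrow> ('b, 'b vec) bimodule" where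
  "column_bilattice OB n \<phi> =
     \<lparr> carrier = {x \<in> carrier_vec n. set\<^sub>v x \<subseteq> OB},
       mult = undefined, one = undefined,
       zero = 0\<^sub>v n, add = (+),
       lact = (\<lambda>\<alpha> x. \<phi> \<alpha> *\<^sub>v x),
       ract = (\<lambda>x \<beta>. map_vec (\<lambda>z. z * \<beta>) x) \<rparr>"


section \<open>The standard bilattices\<close>

definition diag2 :: "'b::zero \<Rightarrow> 'b \<Rightarrow> 'b mat" where
  "diag2 x y = mat_of_rows_list 2 [[x, 0], [0, y]]"

text \<open>
  \<open>OK_coords OK PiB \<alpha>\<close> is the pair \<open>(a, b)\<close> with \<open>\<alpha> = a + b \<PiB>\<close>; it is well defined on
  \<open>O\<^sub>B = O\<^sub>K \<oplus> O\<^sub>K \<PiB>\<close>.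
\<close>

definition OK_coords :: "'b::division_ring set \<Rightarrow> 'b \<Rightarrow> 'b \<Rightarrow> 'b \<times> 'b" where
  "OK_coords OK PiB = inv_into (OK \<times> OK) (\<lambda>(a, b). a + b * PiB)"

definition emb_tau :: "'b::division_ring \<Rightarrow> 'b \<Rightarrow> 'b" where
  "emb_tau PiB \<alpha> = inverse PiB * \<alpha> * PiB"

text \<open>
  \<open>emb_phi1\<close> and \<open>emb_phi2\<close> are the ring homomorphisms determined by their values on \<open>O\<^sub>K\<close>
  and on \<open>\<PiB>\<close>, evaluated at \<open>a + b \<PiB>\<close>. The argument \<open>p\<close> is the uniformizer, viewed in \<open>'b\<close>.
\<close>

definition emb_phi1 ::
    "'b::division_ring set \<Rightarrow> ('b \<Rightarrow> 'b) \<Rightarrow> 'b \<Rightarrow> 'b \<Rightarrow> 'b \<Rightarrow> 'b mat" where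
  "emb_phi1 OK sg p PiB \<alpha> = (case OK_coords OK PiB \<alpha> of (a, b) \<Rightarrow>
     diag2 a (sg a) + diag2 b (sg b) * mat_of_rows_list 2 [[0, p], [1, 0]])"

definition emb_phi2 ::
    "'b::division_ring set \<Rightarrow> ('b \<Rightarrow> 'b) \<Rightarrow> 'b \<Rightarrow> 'b \<Rightarrow> 'b \<Rightarrow> 'b mat" where
  "emb_phi2 OK sg p PiB \<alpha> = (case OK_coords OK PiB \<alpha> of (a, b) \<Rightarrow>
     diag2 (sg a) a + diag2 (sg b) b * mat_of_rows_list 2 [[0, p], [1, 0]])"

lemma emb_phi_values:
  fixes PiB :: "'b::division_ring"
  assumes "inj_on (\<lambda>(a, b). a + b * PiB) (OK \<times> OK)"
    and "0 \<in> OK" "1 \<in> OK" "sg 0 = 0" "sg 1 = 1"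
  shows "a \<in> OK \<Longrightarrow> emb_phi1 OK sg p PiB a = diag2 a (sg a)"
    and "a \<in> OK \<Longrightarrow> emb_phi2 OK sg p PiB a = diag2 (sg a) a"
    and "emb_phi1 OK sg p PiB PiB = mat_of_rows_list 2 [[0, p], [1, 0]]"
    and "emb_phi2 OK sg p PiB PiB = mat_of_rows_list 2 [[0, p], [1, 0]]"
proof -
  have *: "OK_coords OK PiB (a + b * PiB) = (a, b)" if "a \<in> OK" "b \<in> OK" for a b
    using inv_into_f_f[OF assms(1), of "(a, b)"] that by (simp add: OK_coords_def)
  have a: "OK_coords OK PiB a = (a, 0)" if "a \<in> OK" for a
    using *[of a 0] that assms by simp
  have P: "OK_coords OK PiB PiB = (0, 1)"
    using *[of 0 1] assms by simp
  have z: "diag2 0 0 = (0\<^sub>m 2 2 :: 'b mat)" and o: "diag2 1 1 = (1\<^sub>m 2 :: 'b mat)"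
    by (auto simp: diag2_def mat_of_rows_list_def less_2_cases_iff intro!: eq_matI)
  have c: "diag2 x y \<in> carrier_mat 2 2" "mat_of_rows_list 2 [[0, p], [1, 0]] \<in> carrier_mat 2 2"
    for x y :: 'b
    by (auto simp: diag2_def mat_of_rows_list_def)
  show "a \<in> OK \<Longrightarrow> emb_phi1 OK sg p PiB a = diag2 a (sg a)"
    and "a \<in> OK \<Longrightarrow> emb_phi2 OK sg p PiB a = diag2 (sg a) a"
    and "emb_phi1 OK sg p PiB PiB = mat_of_rows_list 2 [[0, p], [1, 0]]"
    and "emb_phi2 OK sg p PiB PiB = mat_of_rows_list 2 [[0, p], [1, 0]]"
    using c assms by (simp_all add: emb_phi1_def emb_phi2_def a P z o)
qed

definition emb_phi3 :: "'b::division_ring \<Rightarrow> 'b \<Rightarrow> 'b mat" where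
  "emb_phi3 PiB \<alpha> = diag2 \<alpha> (emb_tau PiB \<alpha>)"

definition lat_O :: "'b::division_ring set \<Rightarrow> ('b, 'b vec) bimodule" where
  "lat_O OB = column_bilattice OB 1 (\<lambda>\<alpha>. mat_of_rows_list 1 [[\<alpha>]])"

definition lat_P :: "'b::division_ring set \<Rightarrow> 'b \<Rightarrow> ('b, 'b vec) bimodule" where
  "lat_P OB PiB = column_bilattice OB 1 (\<lambda>\<alpha>. mat_of_rows_list 1 [[emb_tau PiB \<alpha>]])"

definition lat_L1 where
  "lat_L1 OB OK sg p PiB = column_bilattice OB 2 (emb_phi1 OK sg p PiB)"

definition lat_L2 where
  "lat_L2 OB OK sg p PiB = column_bilattice OB 2 (emb_phi2 OK sg p PiB)"

definition lat_L3 where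
  "lat_L3 OB PiB = column_bilattice OB 2 (emb_phi3 PiB)"

definition has_structural_invariant ::
    "'b::division_ring set \<Rightarrow> 'b set \<Rightarrow> ('b \<Rightarrow> 'b) \<Rightarrow> 'b \<Rightarrow> 'b \<Rightarrow>
     ('b, 'l) bimodule \<Rightarrow> nat \<times> nat \<times> nat \<times> nat \<Rightarrow> bool" where
  "has_structural_invariant OB OK sg p PiB L = (\<lambda>(r1, r2, t1, t2).
     bilattices_isomorphic OB L
       (direct_sum (replicate r1 (lat_O OB) @ replicate r2 (lat_P OB PiB) @
          replicate t1 (lat_L1 OB OK sg p PiB) @ replicate t2 (lat_L2 OB OK sg p PiB))))"


section \<open>Hermitian pairings\<close>

text \<open>
  \<open>L \<otimes> F\<close> for a torsion-free \<open>O\<^sub>F\<close>-module \<open>L\<close>, constructed as the module of fractions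
  \<open>x / s\<close> with \<open>x \<in> L\<close> and \<open>0 \<noteq> s \<in> O\<^sub>F\<close>: \<open>x / s = y / t\<close> iff \<open>x t = y s\<close>.
\<close>

definition frac_rel ::
    "'f::field set \<Rightarrow> ('f \<Rightarrow> 'b::division_ring) \<Rightarrow> ('b, 'l) bimodule \<Rightarrow> (('l \<times> 'f) \<times> ('l \<times> 'f)) set" where
  "frac_rel OF emb L =
     {((x, s), (y, t)) | x s y t. x \<in> carrier L \<and> y \<in> carrier L \<and> s \<in> OF - {0} \<and> t \<in> OF - {0} \<and>
        ract L x (emb t) = ract L y (emb s)}"

definition scalar_ext ::
    "'f::field set \<Rightarrow> ('f \<Rightarrow> 'b::division_ring) \<Rightarrow> ('b, 'l) bimodule \<Rightarrow> ('l \<times> 'f) set set" where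
  "scalar_ext OF emb L = (carrier L \<times> (OF - {0})) // frac_rel OF emb L"

definition scalar_ext_incl ::
    "'f::field set \<Rightarrow> ('f \<Rightarrow> 'b::division_ring) \<Rightarrow> ('b, 'l) bimodule \<Rightarrow> 'l \<Rightarrow> ('l \<times> 'f) set" where
  "scalar_ext_incl OF emb L x = frac_rel OF emb L `` {(x, 1)}"

text \<open>The \<open>F\<close>-bilinear extension \<open>\<langle>x / s, y / t\<rangle> = (s t)\<^sup>-\<^sup>1 \<langle>x, y\<rangle>\<close>.\<close>

definition ext_pairing ::
    "('f::field \<Rightarrow> 'b::division_ring) \<Rightarrow> ('l \<Rightarrow> 'l \<Rightarrow> 'b) \<Rightarrow>
     ('l \<times> 'f) set \<Rightarrow> ('l \<times> 'f) set \<Rightarrow> 'b" where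
  "ext_pairing emb h X Y =
     the_elem {emb (inverse (s * t)) * h x y | x s y t. (x, s) \<in> X \<and> (y, t) \<in> Y}"

definition nondegenerate ::
    "'f::field set \<Rightarrow> ('f \<Rightarrow> 'b::division_ring) \<Rightarrow> ('b, 'l) bimodule \<Rightarrow> ('l \<Rightarrow> 'l \<Rightarrow> 'b) \<Rightarrow> bool" where
  "nondegenerate OF emb L h \<longleftrightarrow>
     (\<forall>X\<in>scalar_ext OF emb L.
        (\<forall>Y\<in>scalar_ext OF emb L. ext_pairing emb h X Y = 0) \<longrightarrow>
        X = scalar_ext_incl OF emb L \<zero>\<^bsub>L\<^esub>) \<and>
     (\<forall>Y\<in>scalar_ext OF emb L.
        (\<forall>X\<in>scalar_ext OF emb L. ext_pairing emb h X Y = 0) \<longrightarrow>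
        Y = scalar_ext_incl OF emb L \<zero>\<^bsub>L\<^esub>)"

definition hermitian_pairing ::
    "'f::field set \<Rightarrow> ('f \<Rightarrow> 'b::division_ring) \<Rightarrow> ('b \<Rightarrow> 'b) \<Rightarrow> 'b set \<Rightarrow> ('b \<Rightarrow> 'b) \<Rightarrow>
     ('b, 'l) bimodule \<Rightarrow> ('l \<Rightarrow> 'l \<Rightarrow> 'b) \<Rightarrow> bool" where
  "hermitian_pairing OF emb cj OB star L h \<longleftrightarrow>
     (\<forall>x\<in>carrier L. \<forall>y\<in>carrier L. \<forall>z\<in>carrier L.
        h (x \<oplus>\<^bsub>L\<^esub> y) z = h x z + h y z \<and> h x (y \<oplus>\<^bsub>L\<^esub> z) = h x y + h x z) \<and>
     (\<forall>a\<in>OF. \<forall>x\<in>carrier L. \<forall>y\<in>carrier L.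
        h (ract L x (emb a)) y = emb a * h x y \<and> h x (ract L y (emb a)) = emb a * h x y) \<and>
     nondegenerate OF emb L h \<and>
     (\<forall>x\<in>carrier L. \<forall>y\<in>carrier L. h x y = cj (h y x)) \<and>
     (\<forall>\<alpha>\<in>OB. \<forall>\<beta>\<in>OB. \<forall>x\<in>carrier L. \<forall>y\<in>carrier L.
        h (ract L x \<alpha>) (ract L y \<beta>) = cj \<alpha> * h x y * \<beta>) \<and>
     (\<forall>\<alpha>\<in>OB. \<forall>x\<in>carrier L. \<forall>y\<in>carrier L. h (lact L \<alpha> x) y = h x (lact L (star \<alpha>) y))"

definition perfect_pairing ::
    "'f::field set \<Rightarrow> ('f \<Rightarrow> 'b::division_ring) \<Rightarrow> 'b set \<Rightarrow>
     ('b, 'l) bimodule \<Rightarrow> ('l \<Rightarrow> 'l \<Rightarrow> 'b) \<Rightarrow> bool" where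
  "perfect_pairing OF emb OB L h \<longleftrightarrow>
     {X \<in> scalar_ext OF emb L.
        \<forall>y\<in>carrier L. ext_pairing emb h X (scalar_ext_incl OF emb L y) \<in> OB}
     = scalar_ext_incl OF emb L ` carrier L"

definition self_dual_hermitian_bilattice ::
    "'f::field set \<Rightarrow> ('f \<Rightarrow> 'b::division_ring) \<Rightarrow> ('b \<Rightarrow> 'b) \<Rightarrow> 'b set \<Rightarrow> ('b \<Rightarrow> 'b) \<Rightarrow>
     ('b, 'l) bimodule \<Rightarrow> ('l \<Rightarrow> 'l \<Rightarrow> 'b) \<Rightarrow> bool" where
  "self_dual_hermitian_bilattice OF emb cj OB star L h \<longleftrightarrow>
     bilattice OF emb OB L \<and> hermitian_pairing OF emb cj OB star L h \<and>
     perfect_pairing OF emb OB L h"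

text \<open>A lattice with pairing is a pair \<open>(L, h)\<close>.\<close>

definition isometric ::
    "'b set \<Rightarrow> ('b, 'l) bimodule \<times> ('l \<Rightarrow> 'l \<Rightarrow> 'b) \<Rightarrow>
     ('b, 'm) bimodule \<times> ('m \<Rightarrow> 'm \<Rightarrow> 'b) \<Rightarrow> bool" where
  "isometric OB = (\<lambda>(L, h) (M, k).
     \<exists>f. bilattice_iso OB L M f \<and>
         (\<forall>x\<in>carrier L. \<forall>y\<in>carrier L. k (f x) (f y) = h x y))"

definition orthogonal_sum ::
    "(('b::division_ring, 'l) bimodule \<times> ('l \<Rightarrow> 'l \<Rightarrow> 'b)) list \<Rightarrow>
     ('b, 'l list) bimodule \<times> ('l list \<Rightarrow> 'l list \<Rightarrow> 'b)" where
  "orthogonal_sum Ps =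
     (direct_sum (map fst Ps), \<lambda>xs ys. \<Sum>i<length Ps. snd (Ps ! i) (xs ! i) (ys ! i))"

definition gram_pairing ::
    "('b::division_ring \<Rightarrow> 'b) \<Rightarrow> 'b mat \<Rightarrow> 'b vec \<Rightarrow> 'b vec \<Rightarrow> 'b" where
  "gram_pairing cj C x y =
     (\<Sum>i<dim_vec x. \<Sum>j<dim_vec y. cj (x $ i) * (C $$ (i, j)) * (y $ j))"

definition lat_M1 where
  "lat_M1 cj OB OK sg p PiB c =
     (lat_L1 OB OK sg p PiB, gram_pairing cj (mat_of_rows_list 2 [[0, c], [- c, 0]]))"

definition lat_M2 where
  "lat_M2 cj OB OK sg p PiB c =
     (lat_L2 OB OK sg p PiB, gram_pairing cj (mat_of_rows_list 2 [[0, c], [- c, 0]]))"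

definition lat_M3 where
  "lat_M3 cj OB PiB = (lat_L3 OB PiB, gram_pairing cj (mat_of_rows_list 2 [[0, 1], [1, 0]]))"

end

theory Submission
  imports Defs "HOL-Library.Function_Algebras"
begin

text \<open>
  After twisting by \<open>u\<close>, the pairing is hermitian for \<open>\<alpha>' = \<Pi> cj(\<alpha>) \<Pi>\<^sup>-\<^sup>1\<close>. A bilattice has a right
  \<open>O\<^sub>B\<close>-basis of typed vectors: vectors on which the left action is \<open>id\<close> or \<open>\<tau>\<close> (kind \<open>GK\<close>),
  and pairs \<open>e, \<Pi> e\<close> on which \<open>O\<^sub>K\<close> acts through \<open>id\<close> or \<open>\<sigma>\<close> (kinds \<open>EK\<close>, \<open>FK\<close>). Every typed
  vector is isotropic because the hermitian symmetry forces \<open>h x x = - h x x\<close>.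
  The dual \<open>y\<close> of a basis vector \<open>x\<close> of kind \<open>GK\<close> has the opposite type, and \<open>x, y\<close> span a
  hyperbolic plane; for \<open>e\<close> of kind \<open>EK\<close> some \<open>z\<close> of the same type makes
  \<open>h z (\<Pi> z)\<close> a unit of trace zero, which surjectivity of the unramified norm on units
  normalises to \<open>c\<close>. In both cases a valuation argument shows that the plane can be exchanged
  against basis vectors of the matching kinds, so its orthogonal complement again has a typed
  basis. Induction yields a standard Gram matrix, and \<open>r\<^sub>1 = r\<^sub>2\<close> because vectors of kind \<open>GK\<close>
  are removed in pairs of opposite type.
\<close>

section \<open>Discrete valuations\<close>

text \<open>The obstacle that shapes the arithmetic is residue characteristic 2, which
  \<open>CHAR('f) \<noteq> 2\<close> allows. The trace-zero unit \<open>c\<close> satisfies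
  \<open>c - sg c = 2 * c\<close>, which then lies in the maximal ideal. So the pairing values are
  controlled by exact commutation with \<open>c\<close> over B, while statements about units rest on
  a \<open>\<theta>\<close> in O_K for which \<open>\<theta> - sg \<theta>\<close> is a unit; its
  existence is proved separately according to whether 2 is a unit. The second obstacle is that the
  complement of a plane has to be decomposed again. Instead of a decomposition theorem for
  bilattices together with cancellation, the induction carries an explicit typed basis and alters it
  only at positions with unit coefficient, so the number of vectors of each kind stays visible. All
  lattices of the induction are subsets of one bimodule of functions on
  \<open>kind \<times> nat\<close>, and self-duality is expressed inside the lattice through
  divisibility by scalars of O_F. Thus neither the type nor the scalar extension changes while
  planes are removed.\<close>

definition vge :: "('a::division_ring \<Rightarrow> int) \<Rightarrow> int \<Rightarrow> 'a \<Rightarrow> bool" where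
  "vge v n x \<longleftrightarrow> x = 0 \<or> n \<le> v x"

context
  fixes v :: "'a::division_ring \<Rightarrow> int"
  assumes v: "discrete_valuation v"
begin

lemma val_mult: "x \<noteq> 0 \<Longrightarrow> y \<noteq> 0 \<Longrightarrow> v (x * y) = v x + v y"
  using v by (auto simp: discrete_valuation_def)

lemma val_add: "x \<noteq> 0 \<Longrightarrow> y \<noteq> 0 \<Longrightarrow> x + y \<noteq> 0 \<Longrightarrow> min (v x) (v y) \<le> v (x + y)"
  using v by (auto simp: discrete_valuation_def)

lemma val_surj: "\<exists>x. x \<noteq> 0 \<and> v x = n"
proof -
  have "n \<in> v ` (UNIV - {0})" using v by (auto simp: discrete_valuation_def)
  then show ?thesis by auto
qed

lemma val_one: "v 1 = 0"
  using val_mult[of 1 1] by simp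

lemma val_neg_one: "v (- 1) = 0"
  using val_mult[of "-1" "-1"] val_one by simp

lemma val_minus: "v (- x) = v x"
proof (cases "x = 0")
  case False
  then show ?thesis using val_mult[of "-1" x] val_neg_one by simp
qed simp

lemma val_inverse: "x \<noteq> 0 \<Longrightarrow> v (inverse x) = - v x"
  using val_mult[of x "inverse x"] val_one by simp

lemma val_power: "x \<noteq> 0 \<Longrightarrow> v (x ^ n) = int n * v x"
  by (induction n) (simp_all add: val_one val_mult algebra_simps)

lemma vge_zero: "vge v n 0"
  by (simp add: vge_def)

lemma vge_minus_iff: "vge v n (- x) \<longleftrightarrow> vge v n x"
  by (simp add: vge_def val_minus)

text \<open>Since \<open>vge\<close> counts 0 as having infinite valuation, the bound is closed
  under sums without the side conditions of \<open>val_add\<close>.\<close>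

lemma vge_add: "vge v n x \<Longrightarrow> vge v n y \<Longrightarrow> vge v n (x + y)"
  unfolding vge_def using val_add[of x y] by force

lemma vge_diff: "vge v n x \<Longrightarrow> vge v n y \<Longrightarrow> vge v n (x - y)"
  using vge_add[of n x "- y"] by (simp add: vge_minus_iff)

lemma vge_mult: "vge v n x \<Longrightarrow> vge v m y \<Longrightarrow> vge v (n + m) (x * y)"
  unfolding vge_def using val_mult[of x y] by force

lemma vge_mono: "vge v n x \<Longrightarrow> m \<le> n \<Longrightarrow> vge v m x"
  unfolding vge_def by auto

text \<open>Equality case of the ultrametric inequality: \<open>x = (x + y) - y\<close> gives
  \<open>min (v (x + y)) (v y) \<le> v x\<close>, and \<open>v x < v y\<close> excludes the second
  term of the minimum.\<close>

lemma val_add_eq: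
  assumes "x \<noteq> 0" "y \<noteq> 0" "v x < v y"
  shows "x + y \<noteq> 0" "v (x + y) = v x"
proof -
  show *: "x + y \<noteq> 0"
  proof
    assume "x + y = 0"
    then have "x = - y" by (simp add: eq_neg_iff_add_eq_0)
    then have "v x = v y" using val_minus[of y] by simp
    then show False using assms by simp
  qed
  have "min (v (x + y)) (v y) \<le> v x"
    using val_add[of "x + y" "- y"] assms * by (simp add: val_minus)
  then show "v (x + y) = v x"
    using val_add[of x y] assms * by auto
qed

lemma val_add_neq:
  assumes "x \<noteq> 0" "y \<noteq> 0" "v x \<noteq> v y"
  shows "x + y \<noteq> 0" "v (x + y) = min (v x) (v y)"
  using assms val_add_eq[of x y] val_add_eq[of y x]
  by (cases "v x < v y"; auto simp: add.commute)+

lemma vge_sum: "(\<And>i. i \<in> I \<Longrightarrow> vge v n (f i)) \<Longrightarrow> vge v n (sum f I)"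
  by (induction I rule: infinite_finite_induct) (auto simp: vge_zero vge_add)

end

section \<open>The quaternion algebra over its unramified subfield: commutation rules, valuations,
  coordinates\<close>

locale quaternion_setting =
  fixes vF :: "'f::field \<Rightarrow> int"
    and emb :: "'f \<Rightarrow> 'b::division_ring"
    and cj sg :: "'b \<Rightarrow> 'b"
    and vB :: "'b \<Rightarrow> int"
    and OF :: "'f set" and OB OK K :: "'b set"
    and \<pi> :: 'f and PiB c :: 'b
  assumes F: "nonarch_local_field vF" and charF: "CHAR('f) \<noteq> 2"
    and OF: "OF = valuation_ring vF"
    and B: "quaternion_division_algebra emb"
    and cj: "canonical_involution emb cj"
    and OB: "maximal_order vF emb OB"
    and vB: "discrete_valuation vB" "valuation_extends vF emb vB"
    and K: "unramified_quadratic_subfield emb vB K"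
    and OK: "OK = K \<inter> valuation_ring vB"
    and sg: "nontrivial_automorphism emb K sg"
    and pi: "\<pi> \<noteq> 0" "vF \<pi> = 1"
    and PiB: "PiB \<in> OB" "bij_betw (\<lambda>(a, b). a + b * PiB) (OK \<times> OK) OB"
            "PiB * PiB = emb \<pi>" "\<And>a. a \<in> OK \<Longrightarrow> PiB * a = sg a * PiB"
    and c: "c \<in> unit_set OK" "c + sg c = 0"
begin

lemma vF: "discrete_valuation vF"
  using F by (simp add: nonarch_local_field_def)

lemma emb_one: "emb 1 = 1"
  and emb_add: "emb (a + b) = emb a + emb b"
  and emb_mult: "emb (a * b) = emb a * emb b"
  and emb_range: "range emb = {x. \<forall>y. x * y = y * x}"
  using B by (auto simp: quaternion_division_algebra_def)

lemma emb_zero: "emb 0 = 0"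
  using emb_add[of 0 0] by simp

lemma emb_minus: "emb (- a) = - emb a"
  using emb_add[of a "- a"] emb_zero by (simp add: eq_neg_iff_add_eq_0 add.commute)

lemma emb_diff: "emb (a - b) = emb a - emb b"
  using emb_add[of a "- b"] by (simp add: emb_minus)

lemma emb_inverse: "emb (inverse a) = inverse (emb a)"
proof (cases "a = 0")
  case False
  then have "emb a * emb (inverse a) = 1"
    by (simp flip: emb_mult add: emb_one)
  then show ?thesis by (simp add: inverse_unique)
qed (simp add: emb_zero)

lemma emb_eq_0_iff: "emb a = 0 \<longleftrightarrow> a = 0"
proof
  assume *: "emb a = 0"
  show "a = 0"
  proof (rule ccontr)
    assume "a \<noteq> 0"
    then have "emb a * emb (inverse a) = 1" by (simp flip: emb_mult add: emb_one)
    then show False using * by simp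
  qed
qed (simp add: emb_zero)

lemma emb_central: "x * emb a = emb a * x"
proof -
  have "emb a \<in> {x. \<forall>y. x * y = y * x}" using emb_range by blast
  then show ?thesis by auto
qed

lemma emb_central2: "x * (emb a * y) = emb a * (x * y)"
  by (metis emb_central mult.assoc)

lemma centre_emb: "(\<And>y. x * y = y * x) \<Longrightarrow> \<exists>a. x = emb a"
  using emb_range by blast

lemma two_F: "(2::'f) \<noteq> 0"
proof
  assume "(2::'f) = 0"
  then have "of_nat 2 = (0::'f)" by simp
  then have "CHAR('f) dvd 2" by (simp only: of_nat_eq_0_iff_char_dvd)
  then have "CHAR('f) = 1 \<or> CHAR('f) = 2"
    using dvd_imp_le[of "CHAR('f)" 2] by (cases "CHAR('f)"; force)
  then show False using charF CHAR_not_1 by auto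
qed

lemma emb_two: "emb 2 = 2"
  using emb_add[of 1 1] by (simp add: emb_one)

lemma two_B: "(2::'b) \<noteq> 0"
  using two_F emb_eq_0_iff[of 2] emb_two by simp

lemma self_neg_zero: "x = - x \<Longrightarrow> x = (0::'b)"
proof -
  assume "x = - x"
  then have "2 * x = 0" by (simp add: mult_2 eq_neg_iff_add_eq_0)
  then show ?thesis using two_B by simp
qed

lemma cj_add: "cj (x + y) = cj x + cj y"
  and cj_mult: "cj (x * y) = cj y * cj x"
  and cj_cj: "cj (cj x) = x"
  and cj_emb: "cj (emb a) = emb a"
  and cj_trace: "x + cj x \<in> range emb"
  and cj_norm: "x * cj x \<in> range emb"
  using cj by (auto simp: canonical_involution_def)

lemma cj_zero: "cj 0 = 0"
  using cj_emb[of 0] by (simp add: emb_zero)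

lemma cj_one: "cj 1 = 1"
  using cj_emb[of 1] by (simp add: emb_one)

lemma cj_minus: "cj (- x) = - cj x"
  using cj_add[of x "- x"] cj_zero by (simp add: eq_neg_iff_add_eq_0 add.commute)

lemma cj_diff: "cj (x - y) = cj x - cj y"
  using cj_add[of x "- y"] by (simp add: cj_minus)

lemma cj_sum: "cj (sum f I) = (\<Sum>i\<in>I. cj (f i))"
  by (induction I rule: infinite_finite_induct) (auto simp: cj_zero cj_add)

lemma cj_inverse: "cj (inverse x) = inverse (cj x)"
proof (cases "x = 0")
  case False
  then have "cj (inverse x) * cj x = 1" by (simp flip: cj_mult add: cj_one)
  then show ?thesis by (metis inverse_unique nonzero_inverse_inverse_eq inverse_zero mult_zero_left mult_zero_right zero_neq_one inverse_inverse_eq)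
qed (simp add: cj_zero)

lemma cj_eq_0_iff: "cj x = 0 \<longleftrightarrow> x = 0"
  using cj_cj cj_zero by metis

lemma K_emb: "emb a \<in> K"
  and K_diff: "x \<in> K \<Longrightarrow> y \<in> K \<Longrightarrow> x - y \<in> K"
  and K_mult: "x \<in> K \<Longrightarrow> y \<in> K \<Longrightarrow> x * y \<in> K"
  and K_inverse: "x \<in> K \<Longrightarrow> inverse x \<in> K"
  and K_comm: "x \<in> K \<Longrightarrow> y \<in> K \<Longrightarrow> x * y = y * x"
  and K_val: "vB ` (K - {0}) = vB ` (range emb - {0})"
  using K by (auto simp: unramified_quadratic_subfield_def)

lemma K_zero: "0 \<in> K" and K_one: "1 \<in> K"
  using K_emb[of 0] K_emb[of 1] by (auto simp: emb_zero emb_one)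

lemma K_minus: "x \<in> K \<Longrightarrow> - x \<in> K"
  using K_diff[of 0 x] K_zero by simp

lemma K_add: "x \<in> K \<Longrightarrow> y \<in> K \<Longrightarrow> x + y \<in> K"
  using K_diff[of x "- y"] K_minus by simp

lemma sg_K: "x \<in> K \<Longrightarrow> sg x \<in> K"
  and sg_add: "x \<in> K \<Longrightarrow> y \<in> K \<Longrightarrow> sg (x + y) = sg x + sg y"
  and sg_mult: "x \<in> K \<Longrightarrow> y \<in> K \<Longrightarrow> sg (x * y) = sg x * sg y"
  and sg_emb: "sg (emb a) = emb a"
  using sg by (auto simp: nontrivial_automorphism_def bij_betw_def)

lemma sg_zero: "sg 0 = 0" and sg_one: "sg 1 = 1"
  using sg_emb[of 0] sg_emb[of 1] by (auto simp: emb_zero emb_one)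

lemma sg_minus: "x \<in> K \<Longrightarrow> sg (- x) = - sg x"
  using sg_add[of x "- x"] K_minus[of x] sg_zero by (simp add: eq_neg_iff_add_eq_0 add.commute)

lemma sg_diff: "x \<in> K \<Longrightarrow> y \<in> K \<Longrightarrow> sg (x - y) = sg x - sg y"
  using sg_add[of x "- y"] K_minus[of y] sg_minus[of y] by simp

lemma Pi_ne0: "PiB \<noteq> 0"
proof
  assume "PiB = 0"
  then have "emb \<pi> = 0" using PiB(3) by simp
  then show False using pi(1) emb_eq_0_iff by blast
qed

lemma val_emb_ex: "\<exists>e>0. \<forall>a. a \<noteq> 0 \<longrightarrow> vB (emb a) = e * vF a"
  using vB(2) by (auto simp: valuation_extends_def)

lemma Pi_pos: "0 < vB PiB"
proof -
  obtain e where "e > 0" "vB (emb \<pi>) = e" using val_emb_ex pi by force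
  then show ?thesis using val_mult[OF vB(1) Pi_ne0 Pi_ne0] PiB(3) by auto
qed

lemma K_val_emb: "x \<in> K \<Longrightarrow> x \<noteq> 0 \<Longrightarrow> \<exists>a. a \<noteq> 0 \<and> vB x = vB (emb a)"
proof -
  assume "x \<in> K" "x \<noteq> 0"
  then have "vB x \<in> vB ` (range emb - {0})" using K_val by blast
  then obtain a where "emb a \<noteq> 0" "vB x = vB (emb a)" by auto
  then show ?thesis using emb_eq_0_iff by blast
qed

text \<open>Being unramified, K has no values beyond those of F; these are generated by the value of
  \<open>\<pi>\<close>, and \<open>\<pi>\<close> is the square of \<open>PiB\<close>.\<close>

lemma val_K: "x \<in> K \<Longrightarrow> x \<noteq> 0 \<Longrightarrow> \<exists>k. vB x = 2 * k * vB PiB"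
proof -
  assume "x \<in> K" "x \<noteq> 0"
  then obtain a where a: "a \<noteq> 0" "vB x = vB (emb a)"
    using K_val_emb by blast
  obtain e where e: "e > 0" "\<forall>a. a \<noteq> 0 \<longrightarrow> vB (emb a) = e * vF a" using val_emb_ex by auto
  then have "vB (emb \<pi>) = e" using pi by auto
  then have "e = 2 * vB PiB" using val_mult[OF vB(1) Pi_ne0 Pi_ne0] PiB(3) by auto
  then show ?thesis using e a by (intro exI[of _ "vF a"]) auto
qed

text \<open>The rule is given on O_K only. As K is unramified, a nonzero element of K is a central
  scalar times an element of valuation 0, and the scalar passes through \<open>PiB\<close>.\<close>

lemma Pi_K: "x \<in> K \<Longrightarrow> PiB * x = sg x * PiB"
proof (cases "x = 0")
  case False
  assume x: "x \<in> K"
  then obtain a where a: "a \<noteq> 0" "vB x = vB (emb a)"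
    using K_val_emb False by blast
  define y where "y = x * emb (inverse a)"
  have ne: "emb (inverse a) \<noteq> 0" "emb a \<noteq> 0" using a by (auto simp: emb_eq_0_iff)
  have "vB y = vB x + vB (emb (inverse a))"
    unfolding y_def using val_mult[OF vB(1) False ne(1)] .
  then have "vB y = 0" using a ne by (simp add: emb_inverse val_inverse[OF vB(1)])
  then have "y \<in> OK" using x by (simp add: OK valuation_ring_def y_def K_mult K_emb)
  then have y: "PiB * y = sg y * PiB" by (rule PiB(4))
  have xy: "x = y * emb a" unfolding y_def using ne
    by (simp add: mult.assoc flip: emb_mult) (simp add: a emb_one)
  have yK: "y \<in> K" using x by (simp add: y_def K_mult K_emb)
  have "PiB * x = sg y * PiB * emb a" using y xy by (metis mult.assoc)
  also have "\<dots> = sg y * emb a * PiB" using emb_central by (metis mult.assoc)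
  also have "sg y * emb a = sg x" unfolding xy using yK sg_mult[OF yK K_emb] sg_emb by simp
  finally show ?thesis .
qed (simp add: sg_zero)

text \<open>Applying \<open>sg\<close> twice is conjugation by \<open>PiB * PiB\<close>, which is
  central.\<close>

lemma sg_sg: "x \<in> K \<Longrightarrow> sg (sg x) = x"
proof -
  assume x: "x \<in> K"
  have "emb \<pi> * x = sg (sg x) * emb \<pi>"
    using x Pi_K sg_K by (metis PiB(3) mult.assoc)
  then show ?thesis using pi emb_central emb_eq_0_iff by (metis mult_cancel_left)
qed

lemma OK_K: "x \<in> OK \<Longrightarrow> x \<in> K" by (simp add: OK)

lemma OB_decomp: "x \<in> OB \<longleftrightarrow> (\<exists>a\<in>OK. \<exists>b\<in>OK. x = a + b * PiB)"
  using PiB(2) by (force simp: bij_betw_def)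

text \<open>K + K \<open>PiB\<close> is an F-subspace containing the order, and an order spans B
  over F.\<close>

lemma decomp_ex: "\<exists>a\<in>K. \<exists>b\<in>K. x = a + b * PiB"
proof -
  interpret vs: vector_space "\<lambda>a x. emb a * x"
    by unfold_locales (auto simp: emb_add emb_mult emb_one algebra_simps)
  let ?S = "{x. \<exists>a\<in>K. \<exists>b\<in>K. x = a + b * PiB}"
  have "vs.subspace ?S"
  proof (rule vs.subspaceI)
    show "0 \<in> ?S" using K_zero by force
    fix x y assume "x \<in> ?S" "y \<in> ?S"
    then obtain a b a' b' where "a \<in> K" "b \<in> K" "a' \<in> K" "b' \<in> K" "x = a + b * PiB" "y = a' + b' * PiB"
      by blast
    then have "a + a' \<in> K" "b + b' \<in> K" "x + y = (a + a') + (b + b') * PiB"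
      by (auto simp: K_add algebra_simps)
    then show "x + y \<in> ?S" by blast
  next
    fix r x assume "x \<in> ?S"
    then obtain a b where "a \<in> K" "b \<in> K" "x = a + b * PiB" by blast
    then have "emb r * a \<in> K" "emb r * b \<in> K" "emb r * x = emb r * a + emb r * b * PiB"
      by (auto simp: K_mult K_emb algebra_simps)
    then show "emb r * x \<in> ?S" by blast
  qed
  moreover have "OB \<subseteq> ?S" using OB_decomp OK_K by blast
  ultimately have "vs.span OB \<subseteq> ?S" by (simp add: vs.span_minimal)
  moreover have "vs.span OB = UNIV" using OB by (simp add: maximal_order_def is_order_def)
  ultimately show ?thesis by blast
qed

text \<open>Parity argument: in units of \<open>vB PiB\<close>, elements of K have even valuation
  and elements of K \<open>PiB\<close> odd valuation. Hence no cancellation of leading terms can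
  occur in \<open>a + b * PiB\<close>.\<close>

lemma val_K_Pi_neq:
  assumes "a \<in> K" "b \<in> K" "a \<noteq> 0" "b \<noteq> 0"
  shows "vB a \<noteq> vB (b * PiB)"
proof
  assume *: "vB a = vB (b * PiB)"
  obtain k l where "vB a = 2 * k * vB PiB" "vB b = 2 * l * vB PiB" using assms val_K by metis
  then have "2 * k * vB PiB = 2 * l * vB PiB + vB PiB"
    using * assms val_mult[OF vB(1) _ Pi_ne0] by auto
  then have "(2 * k - 2 * l - 1) * vB PiB = 0" by (simp add: algebra_simps)
  then have "2 * k - 2 * l - 1 = 0" using Pi_pos by auto
  then show False by presburger
qed

lemma val_decomp:
  assumes "a \<in> K" "b \<in> K"
  shows "a + b * PiB = 0 \<longleftrightarrow> a = 0 \<and> b = 0"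
    and "a \<noteq> 0 \<Longrightarrow> b \<noteq> 0 \<Longrightarrow> vB (a + b * PiB) = min (vB a) (vB b + vB PiB)"
proof -
  have *: "a + b * PiB \<noteq> 0 \<and> vB (a + b * PiB) = min (vB a) (vB b + vB PiB)" if "a \<noteq> 0" "b \<noteq> 0"
    using val_add_neq[OF vB(1) that(1) _ val_K_Pi_neq[OF assms that]] that Pi_ne0
      val_mult[OF vB(1) that(2) Pi_ne0] by auto
  then show "a + b * PiB = 0 \<longleftrightarrow> a = 0 \<and> b = 0" using Pi_ne0
    by (cases "a = 0"; cases "b = 0") auto
  show "a \<noteq> 0 \<Longrightarrow> b \<noteq> 0 \<Longrightarrow> vB (a + b * PiB) = min (vB a) (vB b + vB PiB)" using * by blast
qed

text \<open>By \<open>val_decomp\<close> every value of \<open>vB\<close> is a multiple of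
  \<open>vB PiB\<close>; the valuation is normalized, so 1 is a value and the generator must be
  1.\<close>

lemma val_Pi: "vB PiB = 1"
proof -
  obtain x where x: "x \<noteq> 0" "vB x = 1" using val_surj[OF vB(1)] by blast
  obtain a b where ab: "a \<in> K" "b \<in> K" "x = a + b * PiB" using decomp_ex by blast
  have "vB PiB dvd vB x"
  proof (cases "a = 0 \<or> b = 0")
    case True
    show ?thesis
    proof (cases "a = 0")
      case True
      then have b: "b \<noteq> 0" "x = b * PiB" using ab x by auto
      then obtain k where "vB b = 2 * k * vB PiB" using val_K ab by blast
      then have "vB x = (2 * k + 1) * vB PiB" using b val_mult[OF vB(1) b(1) Pi_ne0] by (simp add: algebra_simps)
      then show ?thesis by simp
    next
      case False
      then have "x = a" using True ab by simp
      then show ?thesis using val_K[OF ab(1) False] by auto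
    qed
  next
    case False
    obtain k l where "vB a = 2 * k * vB PiB" "vB b = 2 * l * vB PiB" using ab False val_K by metis
    then show ?thesis using val_decomp(2)[OF ab(1,2)] False ab(3) by (auto simp: min_def)
  qed
  then have "vB PiB dvd 1" using x(2) by simp
  then show ?thesis using Pi_pos by simp
qed

lemma val_K_even: "x \<in> K \<Longrightarrow> x \<noteq> 0 \<Longrightarrow> even (vB x)"
  using val_K val_Pi by fastforce

lemma val_emb: "a \<noteq> 0 \<Longrightarrow> vB (emb a) = 2 * vF a"
proof -
  assume a: "a \<noteq> 0"
  obtain e where e: "e > 0" "\<forall>a. a \<noteq> 0 \<longrightarrow> vB (emb a) = e * vF a" using val_emb_ex by auto
  then have "vB (emb \<pi>) = e" using pi by auto
  then have "e = 2" using val_mult[OF vB(1) Pi_ne0 Pi_ne0] PiB(3) val_Pi by auto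
  then show ?thesis using e a by simp
qed

abbreviation "ge \<equiv> vge vB"

lemmas ge_rules = vge_zero[OF vB(1)] vge_add[OF vB(1)] vge_diff[OF vB(1)] vge_minus_iff[OF vB(1)]

lemma ge_mult0: "ge 0 x \<Longrightarrow> ge 0 y \<Longrightarrow> ge 0 (x * y)"
  and ge_mult1l: "ge 1 x \<Longrightarrow> ge 0 y \<Longrightarrow> ge 1 (x * y)"
  and ge_mult1r: "ge 0 x \<Longrightarrow> ge 1 y \<Longrightarrow> ge 1 (x * y)"
  using vge_mult[OF vB(1), of 0 x 0 y] vge_mult[OF vB(1), of 1 x 0 y] vge_mult[OF vB(1), of 0 x 1 y]
  by auto

lemma OK_iff: "x \<in> OK \<longleftrightarrow> x \<in> K \<and> ge 0 x"
  by (auto simp: OK valuation_ring_def vge_def)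

text \<open>The valuation of \<open>b\<close> is even, so the shift by one caused by
  \<open>PiB\<close> does not affect the condition of being nonnegative.\<close>

lemma ge_decomp:
  assumes "a \<in> K" "b \<in> K"
  shows "ge 0 (a + b * PiB) \<longleftrightarrow> ge 0 a \<and> ge 0 b"
proof (cases "b = 0")
  case True
  then show ?thesis by (simp add: vge_def)
next
  case b: False
  have ev: "even (vB b)" using val_K_even[OF assms(2) b] .
  show ?thesis
  proof (cases "a = 0")
    case True
    have "0 \<le> vB (b * PiB) \<longleftrightarrow> 0 \<le> vB b"
      using val_mult[OF vB(1) b Pi_ne0] val_Pi ev by presburger
    then show ?thesis using True b Pi_ne0 by (simp add: vge_def)
  next
    case False
    then have "vB (a + b * PiB) = min (vB a) (vB b + 1)" "a + b * PiB \<noteq> 0"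
      using val_decomp[OF assms] val_Pi b by auto
    moreover have "0 \<le> vB b + 1 \<longleftrightarrow> 0 \<le> vB b" using ev by presburger
    ultimately show ?thesis using False b by (simp add: vge_def)
  qed
qed

text \<open>Comparing O_K + O_K \<open>PiB\<close> with K + K \<open>PiB\<close> through
  \<open>ge_decomp\<close> identifies the order with the valuation ring. Membership in
  \<open>OB\<close> becomes a valuation inequality, and \<open>\<not> ge 1\<close> picks out the
  units among its elements.\<close>

lemma OB_iff: "x \<in> OB \<longleftrightarrow> ge 0 x"
  using OB_decomp[of x] OK_iff decomp_ex[of x] ge_decomp by metis

lemma OF_iff: "a \<in> OF \<longleftrightarrow> ge 0 (emb a)"
  using val_emb[of a] by (cases "a = 0") (auto simp: OF valuation_ring_def vge_def emb_eq_0_iff)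

text \<open>Coordinates along K + K \<open>PiB\<close>, available on all of B; on \<open>OB\<close>
  they agree with \<open>OK_coords\<close> by \<open>OK_coords_eq\<close>.\<close>

definition k1 :: "'b \<Rightarrow> 'b" where "k1 x = fst (SOME (a, b). a \<in> K \<and> b \<in> K \<and> x = a + b * PiB)"
definition k2 :: "'b \<Rightarrow> 'b" where "k2 x = snd (SOME (a, b). a \<in> K \<and> b \<in> K \<and> x = a + b * PiB)"

lemma k12: "k1 x \<in> K" "k2 x \<in> K" "x = k1 x + k2 x * PiB"
proof -
  obtain a b where "a \<in> K \<and> b \<in> K \<and> x = a + b * PiB" using decomp_ex by blast
  then have "case (a, b) of (a, b) \<Rightarrow> a \<in> K \<and> b \<in> K \<and> x = a + b * PiB" by simp
  then have "case (SOME (a, b). a \<in> K \<and> b \<in> K \<and> x = a + b * PiB) of (a, b) \<Rightarrow> a \<in> K \<and> b \<in> K \<and> x = a + b * PiB"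
    by (rule someI)
  then show "k1 x \<in> K" "k2 x \<in> K" "x = k1 x + k2 x * PiB"
    by (auto simp: k1_def k2_def split: prod.splits)
qed

lemma k12_eq: "a \<in> K \<Longrightarrow> b \<in> K \<Longrightarrow> k1 (a + b * PiB) = a \<and> k2 (a + b * PiB) = b"
proof -
  assume ab: "a \<in> K" "b \<in> K"
  let ?x = "a + b * PiB"
  have "(a - k1 ?x) + (b - k2 ?x) * PiB = 0" using k12(3)[of ?x] by (simp add: algebra_simps)
  then show ?thesis using val_decomp(1)[of "a - k1 ?x" "b - k2 ?x"] ab k12 K_diff by auto
qed

lemma k12_OK: "x \<in> OB \<Longrightarrow> k1 x \<in> OK \<and> k2 x \<in> OK"
  using ge_decomp[of "k1 x" "k2 x"] k12[of x] OK_iff OB_iff by simp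

lemma k12_add: "k1 (x + y) = k1 x + k1 y" "k2 (x + y) = k2 x + k2 y"
proof -
  have "x + y = (k1 x + k1 y) + (k2 x + k2 y) * PiB"
    using k12(3)[of x] k12(3)[of y] by (simp add: algebra_simps)
  then show "k1 (x + y) = k1 x + k1 y" "k2 (x + y) = k2 x + k2 y"
    using k12_eq[of "k1 x + k1 y" "k2 x + k2 y"] k12 K_add by auto
qed

lemma k12_mult: "k1 (x * y) = k1 x * k1 y + emb \<pi> * (k2 x * sg (k2 y))"
  "k2 (x * y) = k1 x * k2 y + k2 x * sg (k1 y)"
proof -
  define a b a' b' where d: "a = k1 x" "b = k2 x" "a' = k1 y" "b' = k2 y"
  have m: "a \<in> K" "b \<in> K" "a' \<in> K" "b' \<in> K" "sg a' \<in> K" "sg b' \<in> K" using d k12 sg_K by auto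
  have "x * y = (a + b * PiB) * (a' + b' * PiB)" using k12(3)[of x] k12(3)[of y] d by simp
  also have "\<dots> = a * a' + a * b' * PiB + b * (PiB * a') + b * (PiB * b') * PiB"
    by (simp add: algebra_simps)
  also have "\<dots> = a * a' + a * b' * PiB + b * sg a' * PiB + b * sg b' * emb \<pi>"
    using Pi_K[OF m(3)] Pi_K[OF m(4)] PiB(3) by (simp add: mult.assoc)
  also have "\<dots> = (a * a' + emb \<pi> * (b * sg b')) + (a * b' + b * sg a') * PiB"
    using emb_central[of "b * sg b'" \<pi>] by (simp add: algebra_simps)
  finally have "x * y = (a * a' + emb \<pi> * (b * sg b')) + (a * b' + b * sg a') * PiB" .
  then show "k1 (x * y) = k1 x * k1 y + emb \<pi> * (k2 x * sg (k2 y))"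
    "k2 (x * y) = k1 x * k2 y + k2 x * sg (k1 y)"
    using k12_eq[of "a * a' + emb \<pi> * (b * sg b')" "a * b' + b * sg a'"] m K_add K_mult K_emb
    unfolding d by auto
qed

lemma k12_K: "a \<in> K \<Longrightarrow> k1 a = a" "a \<in> K \<Longrightarrow> k2 a = 0"
  using k12_eq[of a 0] K_zero by auto

lemma k12_Pi: "k1 PiB = 0" "k2 PiB = 1"
  using k12_eq[of 0 1] K_zero K_one by auto

lemma OK_coords_eq: "x \<in> OB \<Longrightarrow> OK_coords OK PiB x = (k1 x, k2 x)"
  unfolding OK_coords_def
  using inv_into_f_f[of "\<lambda>(a, b). a + b * PiB" "OK \<times> OK" "(k1 x, k2 x)"] PiB(2) k12_OK[of x] k12(3)[of x]
  by (simp add: bij_betw_def)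

lemma c_K: "c \<in> K" and c_ne0: "c \<noteq> 0" and c_val: "vB c = 0" and sg_c: "sg c = - c"
proof -
  show 1: "c \<in> K" "c \<noteq> 0" using c(1) OK_K by (auto simp: unit_set_def)
  have "ge 0 c" "ge 0 (inverse c)" using c(1) OK_iff by (auto simp: unit_set_def)
  then show "vB c = 0" using 1 val_inverse[OF vB(1) 1(2)] by (auto simp: vge_def)
  show "sg c = - c" using c(2) by (simp add: eq_neg_iff_add_eq_0 add.commute)
qed

text \<open>Characteristic different from 2 enters here, since \<open>c - sg c\<close> is
  \<open>2 * c\<close>. The conclusion is only that it is nonzero: it is not claimed to be a
  unit.\<close>

lemma cc: "c - sg c \<noteq> 0"
proof
  assume "c - sg c = 0"
  then have "c = sg c" by simp
  then have "c = - c" unfolding sg_c .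
  then show False using self_neg_zero c_ne0 by blast
qed

text \<open>An element of K fixed by \<open>sg\<close> commutes with K and with \<open>PiB\<close>,
  hence with K + K \<open>PiB\<close>, so it lies in the centre F.\<close>

lemma fixed_emb: "x \<in> K \<Longrightarrow> sg x = x \<Longrightarrow> x \<in> range emb"
proof -
  assume x: "x \<in> K" "sg x = x"
  have "x * y = y * x" for y
  proof -
    have "x * (k1 y + k2 y * PiB) = x * k1 y + x * k2 y * PiB" by (simp add: distrib_left mult.assoc)
    also have "\<dots> = k1 y * x + k2 y * (PiB * x)"
      unfolding K_comm[OF x(1) k12(1)[of y]] K_comm[OF x(1) k12(2)[of y]] Pi_K[OF x(1)] x(2)
      by (simp only: mult.assoc)
    also have "\<dots> = (k1 y + k2 y * PiB) * x" by (simp only: distrib_right mult.assoc)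
    finally show ?thesis using k12(3)[of y] by simp
  qed
  then show ?thesis using centre_emb by blast
qed

text \<open>Both \<open>x\<close> and \<open>sg x\<close> are roots of the polynomial
  \<open>X * X - t * X + n\<close> with the trace and norm of \<open>x\<close>, because
  \<open>sg\<close> fixes F. If \<open>sg x \<noteq> x\<close>, then \<open>sg x\<close> is the
  other root \<open>t - x\<close>, which is \<open>cj x\<close>.\<close>

lemma cj_K: "x \<in> K \<Longrightarrow> cj x = sg x"
proof (cases "sg x = x")
  case True
  assume "x \<in> K"
  then show ?thesis using fixed_emb True cj_emb by force
next
  case False
  assume x: "x \<in> K"
  obtain t n where t: "x + cj x = emb t" and n: "x * cj x = emb n" using cj_trace[of x] cj_norm[of x] by blast
  have cjx: "cj x = emb t - x" using t by (simp add: eq_diff_eq add.commute)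
  then have cK: "cj x \<in> K" using K_diff[OF K_emb x] by simp
  have "sg (x * cj x) = x * cj x" using n sg_emb by simp
  moreover have "sg (cj x) = emb t - sg x" using cjx sg_diff[OF K_emb x] sg_emb by simp
  ultimately have "sg x * (emb t - sg x) = x * (emb t - x)" using sg_mult[OF x cK] cjx by simp
  then have "(sg x - x) * (emb t - x - sg x) = 0"
    using K_comm[OF x sg_K[OF x]] by (simp add: algebra_simps)
  then have "emb t - x - sg x = 0" using False by auto
  then show ?thesis using cjx by simp
qed

text \<open>\<open>PiB\<close> times its own trace lies in F. A nonzero trace would therefore put
  \<open>PiB\<close> into the centre, against \<open>PiB * c = sg c * PiB\<close>.\<close>

lemma cj_Pi: "cj PiB = - PiB"
proof -
  obtain t where t: "PiB + cj PiB = emb t" using cj_trace[of PiB] by blast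
  obtain n where n: "PiB * cj PiB = emb n" using cj_norm[of PiB] by blast
  have "PiB * (PiB + cj PiB) = emb \<pi> + emb n" using PiB(3) n by (simp add: algebra_simps)
  then have e: "PiB * emb t = emb (\<pi> + n)" using t by (simp add: emb_add)
  have "t = 0"
  proof (rule ccontr)
    assume "t \<noteq> 0"
    have "PiB = emb ((\<pi> + n) * inverse t)"
    proof -
      have "PiB = PiB * emb t * inverse (emb t)" using \<open>t \<noteq> 0\<close> by (simp add: mult.assoc emb_eq_0_iff)
      then show ?thesis unfolding e by (simp add: emb_mult emb_inverse)
    qed
    then have "PiB * c = c * PiB" using emb_central[of c] by simp
    then have "sg c * PiB = c * PiB" using Pi_K[OF c_K] by simp
    then show False using Pi_ne0 cc by simp
  qed
  then show ?thesis using t by (simp add: emb_zero eq_neg_iff_add_eq_0 add.commute)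
qed

text \<open>In coordinates \<open>cj (a + b * PiB) = sg a - b * PiB\<close>, and \<open>sg\<close>
  preserves valuations because it is conjugation by \<open>PiB\<close>.\<close>

lemma val_cj: "x \<noteq> 0 \<Longrightarrow> vB (cj x) = vB x"
proof -
  have sgv: "vB (sg a) = vB a" if "a \<in> K" "a \<noteq> 0" for a
  proof -
    have "sg a \<noteq> 0" using that sg_sg[of a] sg_zero by auto
    then show ?thesis
      using Pi_K[OF that(1)] val_mult[OF vB(1) Pi_ne0 that(2)] val_mult[OF vB(1) _ Pi_ne0, of "sg a"] by simp
  qed
  have sg0: "sg a = 0 \<longleftrightarrow> a = 0" if "a \<in> K" for a using that sg_sg[of a] sg_zero by auto
  assume x: "x \<noteq> 0"
  define a b where "a = k1 x" "b = k2 x"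
  then have ab: "a \<in> K" "b \<in> K" "x = a + b * PiB" using k12[of x] by auto
  have "cj x = sg a + (- b) * PiB"
    using ab cj_K[OF ab(1)] cj_K[OF ab(2)] Pi_K[OF sg_K[OF ab(2)]] sg_sg[OF ab(2)]
    by (simp add: cj_add cj_mult cj_Pi)
  then show ?thesis
    using val_decomp(2)[of a b] val_decomp(2)[of "sg a" "- b"] ab x sgv[of a] sg0[of a] sg_K[of a] K_minus[of b]
      val_minus[OF vB(1), of b] val_minus[OF vB(1), of "b * PiB"] by (cases "a = 0"; cases "b = 0") auto
qed

lemma ge_cj: "ge n (cj x) \<longleftrightarrow> ge n x"
  using val_cj[of x] cj_eq_0_iff[of x] by (auto simp: vge_def)

end

section \<open>Units of the unramified extension\<close>

lemma vge_square: "discrete_valuation v \<Longrightarrow> vge v 1 (x * x) \<Longrightarrow> vge v 1 x"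
  using val_mult[of v x x] by (cases "x = 0") (auto simp: vge_def)

context quaternion_setting begin

abbreviation "geF \<equiv> vge vF"

lemma vF_mult0: "geF 0 x \<Longrightarrow> geF 0 y \<Longrightarrow> geF 0 (x * y)"
  and vF_mult1: "geF 0 x \<Longrightarrow> geF 1 y \<Longrightarrow> geF 1 (x * y)"
  using vge_mult[OF vF, of 0 x 0 y] vge_mult[OF vF, of 0 x 1 y] by auto

lemma OF_ge: "x \<in> OF \<longleftrightarrow> geF 0 x"
  by (simp add: OF valuation_ring_def vge_def)

lemma ge1_emb: "ge 1 (emb x) \<longleftrightarrow> geF 1 x"
  using val_emb[of x] by (cases "x = 0") (auto simp: vge_def emb_eq_0_iff)

lemma geF_prime: "geF 1 (x * y) \<Longrightarrow> geF 0 x \<Longrightarrow> geF 0 y \<Longrightarrow> geF 1 x \<or> geF 1 y"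
  using val_mult[OF vF, of x y] by (cases "x = 0"; cases "y = 0") (auto simp: vge_def)

text \<open>Finiteness of the residue field, in a form suited to counting: a chosen representative
  in each class turns subsets of the residue field into finite subsets of F.\<close>

lemma residue_representatives:
  obtains rep where "\<And>x. geF 0 x \<Longrightarrow> geF 0 (rep x) \<and> geF 1 (x - rep x)"
    "\<And>x y. geF 0 x \<Longrightarrow> geF 0 y \<Longrightarrow> rep x = rep y \<longleftrightarrow> geF 1 (x - y)"
    "finite (rep ` OF)"
proof -
  define r where "r = {(x, y). x \<in> valuation_ring vF \<and> y \<in> valuation_ring vF \<and> x - y \<in> valuation_ideal vF}"
  have r: "(x, y) \<in> r \<longleftrightarrow> geF 0 x \<and> geF 0 y \<and> geF 1 (x - y)" for x y
    by (auto simp: r_def valuation_ring_def valuation_ideal_def vge_def)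
  have fin: "finite (OF // r)" using F by (simp add: nonarch_local_field_def r_def OF)
  define rep where "rep x = (SOME y. y \<in> r `` {x})" for x
  have rep: "(x, rep x) \<in> r" if "geF 0 x" for x
  proof -
    have "x \<in> r `` {x}" using that r vge_zero[OF vF] by simp
    then have "rep x \<in> r `` {x}" unfolding rep_def by (rule someI)
    then show ?thesis by simp
  qed
  have "rep ` OF \<subseteq> (\<lambda>C. SOME y. y \<in> C) ` (OF // r)"
  proof
    fix z assume "z \<in> rep ` OF"
    then obtain x where x: "x \<in> OF" "z = (SOME y. y \<in> r `` {x})" by (auto simp: rep_def)
    then have "r `` {x} \<in> OF // r" by (simp add: quotientI)
    then show "z \<in> (\<lambda>C. SOME y. y \<in> C) ` (OF // r)" using x(2) by blast
  qed
  then have "finite (rep ` OF)" using fin finite_surj by blast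
  moreover have "rep x = rep y \<longleftrightarrow> geF 1 (x - y)" if "geF 0 x" "geF 0 y" for x y
  proof
    assume "rep x = rep y"
    then have "geF 1 (x - rep x)" "geF 1 (y - rep x)" using rep[OF that(1)] rep[OF that(2)] r by auto
    then show "geF 1 (x - y)" using vge_diff[OF vF, of 1 "x - rep x" "y - rep x"] by simp
  next
    assume *: "geF 1 (x - y)"
    have "r `` {x} = r `` {y}"
    proof -
      have "geF 1 (x - z) \<longleftrightarrow> geF 1 (y - z)" for z
        using * vge_diff[OF vF, of 1 "x - z" "x - y"] vge_add[OF vF, of 1 "y - z" "x - y"] by auto
      then show ?thesis using that r by auto
    qed
    then show "rep x = rep y" by (simp add: rep_def)
  qed
  ultimately show ?thesis using that rep r by blast
qed

text \<open>In residue characteristic 2 squaring is the Frobenius map of the residue field: it is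
  injective, hence surjective on a finite set.\<close>

lemma residue_square_root:
  assumes two: "geF 1 2" and n: "geF 0 n"
  shows "\<exists>m. geF 0 m \<and> geF 1 (m * m - n)"
proof -
  obtain rep where rep: "\<And>x. geF 0 x \<Longrightarrow> geF 0 (rep x) \<and> geF 1 (x - rep x)"
    "\<And>x y. geF 0 x \<Longrightarrow> geF 0 y \<Longrightarrow> rep x = rep y \<longleftrightarrow> geF 1 (x - y)"
    "finite (rep ` OF)" using residue_representatives by metis
  define f where "f r = rep (r * r)" for r
  have R: "geF 0 r" "rep r = r" if r: "r \<in> rep ` OF" for r
  proof -
    obtain x where x: "geF 0 x" "r = rep x" using r OF_ge by auto
    have g: "geF 0 (rep x)" "geF 1 (x - rep x)" using rep(1)[OF x(1)] by blast+
    show "geF 0 r" unfolding x(2) by (rule g(1))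
    show "rep r = r" unfolding x(2) using rep(2)[OF x(1) g(1)] g(2) by metis
  qed
  have "inj_on f (rep ` OF)"
  proof (rule inj_onI)
    fix r s assume rs: "r \<in> rep ` OF" "s \<in> rep ` OF" and "f r = f s"
    have q: "geF 0 r" "geF 0 s" using rs R(1) by blast+
    have "geF 1 (r * r - s * s)"
      using \<open>f r = f s\<close> rep(2)[OF vF_mult0[OF q(1) q(1)] vF_mult0[OF q(2) q(2)]] by (simp add: f_def)
    \<comment> \<open>The correction that turns \<open>r * r - s * s\<close> into the square
      \<open>(r - s) * (r - s)\<close>; it is negligible because 2 lies in the maximal
      ideal.\<close>
    moreover have "geF 1 (s * (r - s) * 2)"
      using vF_mult1[OF vF_mult0[OF q(2) vge_diff[OF vF q]] two] .
    ultimately have "geF 1 (r * r - s * s - s * (r - s) * 2)" using vge_diff[OF vF] by blast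
    moreover have "r * r - s * s - s * (r - s) * 2 = (r - s) * (r - s)" by (simp add: algebra_simps)
    ultimately have "geF 1 (r - s)" using geF_prime[of "r - s" "r - s"] vge_diff[OF vF q] by simp
    then have "rep r = rep s" using rep(2)[OF q] by simp
    then show "r = s" using R(2)[OF rs(1)] R(2)[OF rs(2)] by simp
  qed
  moreover have "f ` rep ` OF \<subseteq> rep ` OF"
  proof
    fix z assume "z \<in> f ` rep ` OF"
    then obtain r where r: "r \<in> rep ` OF" "z = rep (r * r)" by (auto simp: f_def)
    then have "r * r \<in> OF" using vF_mult0[OF R(1) R(1)] OF_ge by blast
    then show "z \<in> rep ` OF" using r by blast
  qed
  ultimately have "f ` rep ` OF = rep ` OF" using rep(3) by (simp add: endo_inj_surj)
  then have "rep n \<in> f ` rep ` OF" using n OF_ge by auto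
  then obtain r where r: "r \<in> rep ` OF" "rep n = rep (r * r)" by (auto simp: f_def)
  then have "geF 1 (r * r - n)" using rep(2)[OF vF_mult0[OF R(1) R(1)] n] by metis
  then show ?thesis using R(1) r by blast
qed

text \<open>Pigeonhole: more than half of the residue classes are squares, so the squares meet
  their image under \<open>s \<mapsto> u + d s\<close>.\<close>

lemma residue_norm_form:
  assumes d: "d \<noteq> 0" "vF d = 0" and u: "geF 0 u"
  shows "\<exists>x y. geF 0 x \<and> geF 0 y \<and> geF 1 (x * x - d * (y * y) - u)"
proof -
  obtain rep where rep: "\<And>x. geF 0 x \<Longrightarrow> geF 0 (rep x) \<and> geF 1 (x - rep x)"
    "\<And>x y. geF 0 x \<Longrightarrow> geF 0 y \<Longrightarrow> rep x = rep y \<longleftrightarrow> geF 1 (x - y)"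
    "finite (rep ` OF)" using residue_representatives by metis
  define Q where "Q = rep ` OF"
  define f where "f r = rep (r * r)" for r
  define g where "g s = rep (u + d * s)" for s
  have R: "geF 0 r" "rep r = r" if r: "r \<in> Q" for r
  proof -
    obtain x where x: "geF 0 x" "r = rep x" using r OF_ge Q_def by auto
    have g: "geF 0 (rep x)" "geF 1 (x - rep x)" using rep(1)[OF x(1)] by blast+
    show "geF 0 r" unfolding x(2) by (rule g(1))
    show "rep r = r" unfolding x(2) using rep(2)[OF x(1) g(1)] g(2) by metis
  qed
  have dge: "geF 0 d" and dnot: "\<not> geF 1 d" using d by (simp_all add: vge_def)
  have repQ: "rep x \<in> Q" if "geF 0 x" for x using that OF_ge Q_def by auto
  have fQ: "f r \<in> Q" if "r \<in> Q" for r unfolding f_def using repQ vF_mult0 R(1)[OF that] by blast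
  have gQ: "g r \<in> Q" if "r \<in> Q" for r
    unfolding g_def using repQ vF_mult0 R(1)[OF that] vge_add[OF vF] u dge by blast
  define S where "S = f ` Q"
  have SQ: "S \<subseteq> Q" using fQ S_def by auto
  have finQ: "finite Q" using rep(3) Q_def by simp
  have finS: "finite S" using SQ finQ finite_subset by blast
  have "inj_on g S"
  proof (rule inj_onI)
    fix r s assume rs: "r \<in> S" "s \<in> S" and "g r = g s"
    then have q: "geF 0 r" "geF 0 s" "rep r = r" "rep s = s" using SQ R by auto
    then have "geF 1 ((u + d * r) - (u + d * s))"
      using \<open>g r = g s\<close> rep(2) vge_add[OF vF u vF_mult0[OF dge]] unfolding g_def by blast
    then have "geF 1 (d * (r - s))" by (simp add: algebra_simps)
    then have "geF 1 (r - s)" using geF_prime[OF _ dge vge_diff[OF vF q(1,2)]] dnot by blast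
    then show "r = s" using rep(2) q by metis
  qed
  then have card_g: "card (g ` S) = card S" by (rule card_image)
  define q where "q s = (SOME r. r \<in> Q \<and> f r = s)" for s
  have q: "q s \<in> Q \<and> f (q s) = s" if s: "s \<in> S" for s
  proof -
    obtain r where "r \<in> Q \<and> f r = s" using s unfolding S_def by blast
    then show ?thesis unfolding q_def by (rule someI)
  qed
  define A where "A = q ` S"
  define A' where "A' = (\<lambda>s. rep (- q s)) ` S"
  have z: "geF 0 0" by (simp add: vge_def)
  \<comment> \<open>A residue class has at most two square roots, up to sign the same, so the chosen
    roots \<open>q s\<close> and their negatives reach every class.\<close>
  have fib: "r' = r \<or> r' = rep (- r)" if "r \<in> Q" "r' \<in> Q" "f r = f r'" for r r'
  proof -
    have "geF 1 (r * r - r' * r')" using that rep(2) R vF_mult0 unfolding f_def by blast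
    moreover have "r * r - r' * r' = (r - r') * (r + r')" by (simp add: algebra_simps)
    ultimately have "geF 1 (r - r') \<or> geF 1 (r + r')"
      using geF_prime vge_diff[OF vF] vge_add[OF vF] R that by auto
    then show ?thesis
    proof
      assume "geF 1 (r - r')" then show ?thesis using rep(2) R that by metis
    next
      assume "geF 1 (r + r')"
      then have "geF 1 (- (- r - r'))" by (simp add: add.commute)
      then have "geF 1 (- r - r')" using vge_minus_iff[OF vF] by blast
      then have "rep (- r) = rep r'" using rep(2)[of "- r" r'] R that vge_minus_iff[OF vF] by blast
      then show ?thesis using R that by simp
    qed
  qed
  have "Q \<subseteq> A \<union> A'"
  proof
    fix r assume r: "r \<in> Q"
    then have "f r \<in> S" by (simp add: S_def)
    then have "q (f r) \<in> Q" "f (q (f r)) = f r" using q by auto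
    then have "r = q (f r) \<or> r = rep (- q (f r))" using fib r by metis
    then show "r \<in> A \<union> A'" using \<open>f r \<in> S\<close> A_def A'_def by auto
  qed
  have r0: "rep 0 \<in> Q" using repQ z by simp
  \<comment> \<open>The class of 0 lies in both halves. This common element makes the count strict:
    \<open>card Q < 2 * card S\<close>, in every residue characteristic.\<close>
  have "rep 0 \<in> A \<inter> A'"
  proof -
    have g0: "geF 0 (rep 0)" "geF 1 (rep 0)" using rep(1)[OF z] by (auto simp: vge_minus_iff[OF vF])
    have f0: "f (rep 0) = rep 0" unfolding f_def using rep(2)[of "rep 0 * rep 0" 0] g0 z vF_mult0 vF_mult1 by auto
    then have S0: "rep 0 \<in> S" using r0 S_def by force
    then have q0: "q (rep 0) \<in> Q" "f (q (rep 0)) = rep 0" using q by auto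
    then have gq: "geF 0 (q (rep 0))" using R by simp
    have "geF 1 (q (rep 0) * q (rep 0) - 0)"
      using q0(2) rep(2)[OF vF_mult0[OF gq gq] z] unfolding f_def by simp
    then have g1: "geF 1 (q (rep 0))" using geF_prime gq by auto
    have "rep (q (rep 0)) = rep 0" "rep (- q (rep 0)) = rep 0"
      using rep(2)[OF gq z] rep(2)[of "- q (rep 0)" 0] gq z g1 by (auto simp: vge_minus_iff[OF vF])
    then show ?thesis using S0 q0 R unfolding A_def A'_def by (metis IntI image_eqI)
  qed
  moreover have finA: "finite A" "finite A'" using finS by (simp_all add: A_def A'_def)
  ultimately have "card (A \<inter> A') > 0" using card_gt_0_iff finite_Int by blast
  moreover have "card A + card A' = card (A \<union> A') + card (A \<inter> A')"
    using card_Un_Int[OF finA] .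
  moreover have "card A \<le> card S" "card A' \<le> card S" unfolding A_def A'_def using finS by (simp_all add: card_image_le)
  moreover have "card Q \<le> card (A \<union> A')" using \<open>Q \<subseteq> A \<union> A'\<close> finA by (simp add: card_mono)
  ultimately have lt: "card Q < 2 * card S" by linarith
  have "S \<inter> g ` S \<noteq> {}"
  proof
    assume "S \<inter> g ` S = {}"
    then have "card (S \<union> g ` S) = 2 * card S" using card_Un_disjoint[of S "g ` S"] finS card_g by simp
    moreover have "S \<union> g ` S \<subseteq> Q" using SQ gQ by auto
    ultimately have "2 * card S \<le> card Q" using card_mono[OF finQ] by metis
    then show False using lt by simp
  qed
  then obtain r s where rs: "r \<in> Q" "s \<in> Q" "f r = g (f s)" by (auto simp: S_def)
  have g: "geF 0 r" "geF 0 s" using rs R by auto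
  have "geF 1 (r * r - (u + d * f s))"
    using rs rep(2)[OF vF_mult0[OF g(1) g(1)] vge_add[OF vF u vF_mult0[OF dge R(1)[OF fQ[OF rs(2)]]]]]
    unfolding f_def[of r] g_def by simp
  moreover have "geF 1 (d * (s * s - f s))"
    unfolding f_def using rep(1)[OF vF_mult0[OF g(2) g(2)]] vF_mult1 dge by blast
  ultimately have "geF 1 ((r * r - (u + d * f s)) - d * (s * s - f s))" using vge_diff[OF vF] by blast
  moreover have "(r * r - (u + d * f s)) - d * (s * s - f s) = r * r - d * (s * s) - u"
    by (simp add: algebra_simps)
  ultimately show ?thesis using g by metis
qed

text \<open>A special case of Hensel's lemma, obtained by iterating
  \<open>x \<mapsto> D - n * (x * x)\<close> from 0. On the maximal ideal this map is a contraction,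
  and completeness supplies the fixed point. It corrects a norm that is right only modulo the
  maximal ideal.\<close>

lemma quadratic_contraction:
  assumes D: "geF 1 D" and n: "geF 0 n"
  shows "\<exists>x. geF 0 x \<and> x = D - n * (x * x)"
proof -
  define X where "X = rec_nat 0 (\<lambda>_ x. D - n * (x * x))"
  have X0: "X 0 = 0" and XS: "X (Suc k) = D - n * (X k * X k)" for k by (auto simp: X_def)
  have X1: "geF 1 (X k)" for k
  proof (induction k)
    case (Suc k)
    have "geF 1 (n * (X k * X k))" using Suc n vF_mult1 vge_mono[OF vF Suc, of 0] by simp
    then show ?case using XS D vge_diff[OF vF] by simp
  qed (simp add: X0 vge_zero[OF vF])
  \<comment> \<open>The factor \<open>x + y\<close> of the difference of squares lies in the maximal
    ideal, so each application gains one unit of valuation.\<close>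
  have sq: "geF N (n * (x * x) - n * (y * y))" if "geF 1 x" "geF 1 y" "geF (N - 1) (x - y)" for x y N
  proof -
    have "n * (x * x) - n * (y * y) = n * ((x + y) * (x - y))" by (simp add: algebra_simps)
    then show ?thesis
      using vge_mult[OF vF n vge_mult[OF vF vge_add[OF vF that(1,2)] that(3)]] by simp
  qed
  have step: "geF (int k + 1) (X (Suc k) - X k)" for k
  proof (induction k)
    case 0 then show ?case using D X0 XS[of 0] by simp
  next
    case (Suc k)
    have "geF (int (Suc k) + 1) (n * (X k * X k) - n * (X (Suc k) * X (Suc k)))"
      using sq[of "X k" "X (Suc k)" "int (Suc k) + 1"] X1 Suc vge_minus_iff[OF vF, of "int k + 1" "X (Suc k) - X k"]
      by (simp add: add.commute)
    then show ?case using XS by simp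
  qed
  have far: "geF (int M + 1) (X (M + k) - X M)" for M k
  proof (induction k)
    case (Suc k)
    have "geF (int M + 1) (X (Suc (M + k)) - X (M + k))" using vge_mono[OF vF step[of "M + k"]] by simp
    then show ?case using vge_add[OF vF _ Suc] by fastforce
  qed (simp add: vge_zero[OF vF])
  have far2: "geF (int M + 1) (X m - X m')" if "m \<ge> M" "m' \<ge> M" for m m' M
    using far[of M "m - M"] far[of M "m' - M"] that vge_diff[OF vF, of "int M + 1" "X m - X M" "X m' - X M"] by simp
  have cau: "\<forall>N. \<exists>M. \<forall>m\<ge>M. \<forall>m'\<ge>M. X m = X m' \<or> N \<le> vF (X m - X m')"
  proof (intro exI allI impI)
    fix N
    fix m m' assume "nat N \<le> m" "nat N \<le> m'"
    then have "geF (int (nat N) + 1) (X m - X m')" using far2 by blast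
    then have "geF N (X m - X m')" by (rule vge_mono[OF vF]) simp
    then show "X m = X m' \<or> N \<le> vF (X m - X m')" by (auto simp: vge_def)
  qed
  have "valuation_complete vF" using F by (simp add: nonarch_local_field_def)
  then obtain l where l: "\<forall>N. \<exists>M. \<forall>m\<ge>M. X m = l \<or> N \<le> vF (X m - l)"
    using cau unfolding valuation_complete_def by blast
  have l': "\<exists>M. \<forall>m\<ge>M. geF N (X m - l)" for N
    using spec[OF l, of N] unfolding vge_def by simp
  have l1: "geF 1 l"
  proof -
    obtain M where "geF 1 (X M - l)" using l'[of 1] by blast
    then show ?thesis using X1[of M] vge_diff[OF vF, of 1 "X M" "X M - l"] by simp
  qed
  have "geF N (l - (D - n * (l * l)))" for N
  proof -
    obtain M1 where M1: "\<And>m. m \<ge> M1 \<Longrightarrow> geF N (X m - l)" using l' by blast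
    obtain M2 where M2: "\<And>m. m \<ge> M2 \<Longrightarrow> geF (N - 1) (X m - l)" using l' by blast
    define m where "m = max M1 M2"
    have "geF N (X (Suc m) - l)" "geF (N - 1) (X m - l)" using M1 M2 m_def by auto
    moreover have "geF N (n * (X m * X m) - n * (l * l))" using sq X1 l1 calculation(2) by blast
    ultimately have "geF N (- (X (Suc m) - l) - (n * (X m * X m) - n * (l * l)))"
      using vge_diff[OF vF] vge_minus_iff[OF vF] by blast
    moreover have "- (X (Suc m) - l) - (n * (X m * X m) - n * (l * l)) = l - (D - n * (l * l))"
      by (simp add: XS algebra_simps)
    ultimately show ?thesis by metis
  qed
  \<comment> \<open>A nonzero element would violate the bound for \<open>N\<close> equal to its
    valuation plus one.\<close>
  then have "l - (D - n * (l * l)) = 0"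
    using vge_def[of vF "vF (l - (D - n * (l * l))) + 1" "l - (D - n * (l * l))"] by auto
  then show ?thesis using vge_mono[OF vF l1, of 0] by auto
qed

section \<open>Residue generators, traces and norms in the unramified extension\<close>

lemma K_ge_even: "x \<in> K \<Longrightarrow> ge 1 x \<Longrightarrow> ge 2 x"
proof (cases "x = 0")
  case False
  assume "x \<in> K" "ge 1 x"
  then have "even (vB x)" "1 \<le> vB x" using val_K_even[of x] False by (auto simp: vge_def)
  then have "2 \<le> vB x" by presburger
  then show ?thesis by (simp add: vge_def)
qed (simp add: vge_def)

lemma ge_sg: "x \<in> K \<Longrightarrow> ge n (sg x) \<longleftrightarrow> ge n x"
  using ge_cj cj_K by metis

lemma sg_inverse: "x \<in> K \<Longrightarrow> sg (inverse x) = inverse (sg x)"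
  using cj_inverse[of x] cj_K[of x] cj_K[OF K_inverse[of x]] by simp

text \<open>If \<open>sg\<close> were trivial modulo the maximal ideal, every element of O_K would
  be congruent to an element of F: to a square root of its norm when the residue characteristic is
  2, and to half its trace otherwise. Dividing the difference by \<open>\<pi>\<close> and repeating
  makes \<open>x - sg x\<close> arbitrarily divisible, which contradicts
  \<open>sg c \<noteq> c\<close>.\<close>

lemma unramified_generator: "\<exists>\<theta>\<in>OK. \<not> ge 1 (\<theta> - sg \<theta>)"
proof (rule ccontr)
  assume "\<not> ?thesis"
  then have H: "\<And>x. x \<in> K \<Longrightarrow> ge 0 x \<Longrightarrow> ge 1 (x - sg x)" using OK_iff by blast
  have R: "\<exists>m. ge 0 (emb m) \<and> ge 1 (x - emb m)" if x: "x \<in> K" "ge 0 x" for x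
  proof (cases "geF 1 2")
    case True
    have sx: "sg x \<in> K" "ge 0 (sg x)" using x sg_K ge_sg by auto
    obtain n where n: "x * sg x = emb n" using cj_norm[of x] cj_K[OF x(1)] by auto
    have "geF 0 n" using ge_mult0[OF x(2) sx(2)] OF_iff OF_ge n by simp
    then obtain m where m: "geF 0 m" "geF 1 (m * m - n)" using residue_square_root[OF True] by blast
    have m0: "ge 0 (emb m)" using m OF_iff OF_ge by simp
    have 1: "ge 1 (x * (x - sg x))" using ge_mult1r[OF x(2) H[OF x]] .
    have 2: "ge 1 (emb m * emb m - emb n)" using m(2) ge1_emb[of "m * m - n"] by (simp add: emb_diff emb_mult)
    have 3: "ge 1 (2 * (emb m * (emb m - x)))"
      using ge_mult1l[of 2 "emb m * (emb m - x)"] ge1_emb[of 2] True emb_two m0 x ge_mult0 ge_rules by simp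
    \<comment> \<open>With \<open>n\<close> the norm of \<open>x\<close> and \<open>m\<close> a
      square root of it modulo the maximal ideal, all three summands on the right are non-units, so
      \<open>m\<close> is congruent to \<open>x\<close>.\<close>
    have "(x - emb m) * (x - emb m) = x * (x - sg x) + 2 * (emb m * (emb m - x)) - (emb m * emb m - emb n)"
      using n emb_central[of x m] by (simp add: algebra_simps mult_2)
    then have "ge 1 ((x - emb m) * (x - emb m))" using 1 2 3 ge_rules by simp
    then have "ge 1 (x - emb m)" by (rule vge_square[OF vB(1)])
    then show ?thesis using m0 by blast
  next
    case False
    have "(2::'f) = 1 + 1" by simp
    then have "geF 0 2" using vge_add[OF vF, of 0 1 1] by (simp add: vge_def val_one[OF vF])
    then have v2: "vF 2 = 0" using False two_F by (auto simp: vge_def)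
    obtain t where t: "x + sg x = emb t" using cj_trace[of x] cj_K[OF x(1)] by auto
    define hf where "hf = inverse (2::'f)"
    have hf: "hf * 2 = 1" "vF hf = 0" "hf \<noteq> 0"
      unfolding hf_def using val_inverse[OF vF two_F] v2 two_F by simp_all
    then have h: "ge 0 (emb hf)" by (simp add: vge_def val_emb)
    define m where "m = t * hf"
    have "ge 0 (emb m)"
      unfolding m_def emb_mult t[symmetric] using h x ge_sg ge_rules ge_mult0 by simp
    moreover have "x - emb m = (x - sg x) * emb hf"
    proof -
      have "emb (hf * 2) = 1" using hf emb_one by simp
      then have "emb hf + emb hf = 1" unfolding emb_mult emb_two by (simp add: mult_2_right)
      then have e: "x * emb hf + x * emb hf = x" by (simp flip: distrib_left)
      have "x - emb m = (x * emb hf + x * emb hf) - (x + sg x) * emb hf"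
        unfolding e m_def emb_mult t[symmetric] ..
      also have "\<dots> = (x - sg x) * emb hf" by (simp add: algebra_simps)
      finally show ?thesis .
    qed
    ultimately show ?thesis using ge_mult1l[OF H[OF x] h] by metis
  qed
  \<comment> \<open>Successive approximation: from \<open>x = m + y * \<pi>\<close> with
    \<open>m\<close> in F one gets \<open>x - sg x = (y - sg y) * \<pi>\<close>. The quotient
    \<open>y\<close> is integral since a non-unit of K has valuation at least 2.\<close>
  have N: "ge (int k) (x - sg x)" if "x \<in> K" "ge 0 x" for k x
    using that
  proof (induction k arbitrary: x)
    case 0
    then show ?case using ge_sg ge_rules by simp
  next
    case (Suc k)
    obtain m where m: "ge 0 (emb m)" "ge 1 (x - emb m)" using R[OF Suc.prems] by blast
    define y where "y = (x - emb m) * emb (inverse \<pi>)"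
    have xm: "x - emb m \<in> K" using Suc.prems K_diff K_emb by simp
    have vi: "vB (emb (inverse \<pi>)) = - 2" "emb (inverse \<pi>) \<noteq> 0"
      using val_emb[of "inverse \<pi>"] val_inverse[OF vF pi(1)] pi emb_eq_0_iff[of "inverse \<pi>"] by simp_all
    have y: "y \<in> K" "ge 0 y"
      unfolding y_def
      using xm K_mult K_emb vge_mult[OF vB(1) K_ge_even[OF xm m(2)], of "-2" "emb (inverse \<pi>)"] vi
      by (simp_all add: vge_def)
    have "x = emb m + y * emb \<pi>"
      unfolding y_def mult.assoc emb_mult[symmetric] using pi by (simp add: emb_one)
    moreover from this have "sg x = emb m + sg y * emb \<pi>"
      using y K_emb K_mult sg_add sg_mult sg_emb by simp
    ultimately have "x - sg x = (y - sg y) * emb \<pi>" by (simp add: algebra_simps)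
    moreover have "ge 1 (emb \<pi>)" using pi ge1_emb by (simp add: vge_def)
    ultimately show ?case using vge_mult[OF vB(1) Suc.IH[OF y], of 1 "emb \<pi>"] by (simp add: add.commute)
  qed
  have "ge (int k) (c - sg c)" for k using N[OF c_K] c_val by (simp add: vge_def)
  then have "int k \<le> vB (c - sg c)" for k using cc by (simp add: vge_def)
  from this[of 0] this[of "nat (vB (c - sg c)) + 1"] show False by linarith
qed

text \<open>The unit \<open>\<delta> = \<theta> - sg \<theta>\<close> is negated by
  \<open>sg\<close>, so \<open>\<theta> * inverse \<delta>\<close> has trace
  \<open>(\<theta> - sg \<theta>) * inverse \<delta> = 1\<close>. This replaces one half, which need
  not be integral.\<close>

lemma trace_one: "\<exists>w\<in>OK. w + sg w = 1"
proof -
  obtain \<theta> where t: "\<theta> \<in> K" "ge 0 \<theta>" "\<not> ge 1 (\<theta> - sg \<theta>)"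
    using unramified_generator OK_iff by blast
  define \<delta> where "\<delta> = \<theta> - sg \<theta>"
  have d: "\<delta> \<in> K" "\<delta> \<noteq> 0" "sg \<delta> = - \<delta>" "ge 0 \<delta>"
    unfolding \<delta>_def using K_diff[OF t(1) sg_K[OF t(1)]] sg_diff[OF t(1) sg_K[OF t(1)]] sg_sg[OF t(1)]
      ge_sg[OF t(1), of 0] vge_diff[OF vB(1) t(2), of "sg \<theta>"] t(2,3) vge_zero[OF vB(1), of 1] by auto
  have "vB \<delta> = 0" using t(3) d unfolding \<delta>_def[symmetric] by (auto simp: vge_def)
  then have di: "ge 0 (inverse \<delta>)" using val_inverse[OF vB(1) d(2)] by (simp add: vge_def)
  have "\<theta> * inverse \<delta> + sg (\<theta> * inverse \<delta>) = (\<theta> - sg \<theta>) * inverse \<delta>"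
    using t d K_inverse sg_mult sg_inverse by (simp add: algebra_simps)
  also have "\<dots> = 1" using d by (simp flip: \<delta>_def)
  finally show ?thesis using t d di K_mult K_inverse ge_mult0 OK_iff by (intro bexI[of _ "\<theta> * inverse \<delta>"]) auto
qed

text \<open>The residue field gives an \<open>a\<close> whose norm \<open>u0\<close> is congruent to
  \<open>u\<close>. Moving \<open>a\<close> along a direction \<open>w\<close> with
  \<open>a * sg w + w * sg a = 1\<close> changes the norm by \<open>x + n * x * x\<close>, where
  \<open>n\<close> is the norm of \<open>w\<close>; the quadratic equation for the missing amount is
  then solved by contraction.\<close>

lemma norm_surj:
  assumes u: "u \<noteq> 0" "vF u = 0"
  shows "\<exists>a\<in>OK. a * sg a = emb u"
proof -
  obtain d' where d': "c * cj c = emb d'" using cj_norm[of c] by blast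
  define d where "d = - d'"
  have ccd: "c * c = emb d" 
  proof -
    have "emb d' = - (c * c)" using d' cj_K[OF c_K] sg_c by simp
    then show ?thesis by (simp add: d_def emb_minus)
  qed
  have d0: "d \<noteq> 0"
  proof
    assume "d = 0"
    then have "c * c = 0" using ccd emb_zero by simp
    then show False using c_ne0 by simp
  qed
  then have dv: "vF d = 0" using val_emb[OF d0] ccd val_mult[OF vB(1) c_ne0 c_ne0] c_val by simp
  obtain x y where xy: "geF 0 x" "geF 0 y" "geF 1 (x * x - d * (y * y) - u)"
    using residue_norm_form[OF d0 dv, of u] u by (auto simp: vge_def)
  define u0 where "u0 = x * x - d * (y * y)"
  \<comment> \<open>Since \<open>c * c = emb d\<close> and \<open>sg c = - c\<close>, the norm of
    this element is the binary form \<open>x * x - d * (y * y)\<close>.\<close>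
  define a where "a = emb x + emb y * c"
  have ge_xyc: "ge 0 (emb x)" "ge 0 (emb y)" "ge 0 c" using xy OF_iff OF_ge c_val by (auto simp: vge_def)
  have aK: "a \<in> K" "ge 0 a" unfolding a_def using K_add K_mult K_emb c_K ge_xyc ge_rules ge_mult0 by auto
  have sa: "sg a = emb x - emb y * c"
    unfolding a_def using sg_add sg_mult K_mult K_emb c_K sg_emb sg_c by simp
  have Na: "a * sg a = emb u0"
  proof -
    have "a * sg a = emb x * emb x - emb x * (emb y * c) + emb y * (c * emb x) - emb y * (c * emb y) * c"
      unfolding sa unfolding a_def by (simp add: algebra_simps)
    also have "c * emb x = emb x * c" by (rule emb_central)
    also have "c * emb y = emb y * c" by (rule emb_central)
    also have "emb y * (emb x * c) = emb x * (emb y * c)" by (rule emb_central2)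
    also have "emb y * (emb y * c) * c = emb (d * (y * y))"
    proof -
      have "emb y * (emb y * c) * c = emb y * emb y * (c * c)" by (simp add: mult.assoc)
      also have "\<dots> = emb (d * (y * y))" unfolding ccd by (simp flip: emb_mult add: mult.commute)
      finally show ?thesis .
    qed
    finally show ?thesis by (simp add: u0_def emb_diff emb_mult)
  qed
  have D: "geF 1 (u - u0)" using xy(3) vge_minus_iff[OF vF, of 1 "u0 - u"] by (simp add: u0_def)
  have u0: "u0 \<noteq> 0" "vF u0 = 0"
  proof -
    have *: "\<not> geF 1 u" using u by (simp add: vge_def)
    have "\<not> geF 1 u0" using vge_add[OF vF D, of u0] * by auto
    moreover have "geF 0 u0" using vge_diff[OF vF, of 0 u "u - u0"] vge_mono[OF vF D, of 0] u by (simp add: vge_def)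
    ultimately show "u0 \<noteq> 0" "vF u0 = 0" by (auto simp: vge_def)
  qed
  have a0: "a \<noteq> 0" using Na u0 emb_eq_0_iff by force
  have s0: "sg a \<noteq> 0" using Na u0 emb_eq_0_iff by force
  have va: "vB a = 0"
    using val_mult[OF vB(1) a0 s0] val_emb[OF u0(1)] u0(2) Na val_cj[OF a0] cj_K[OF aK(1)] by simp
  obtain w0 where w0: "w0 \<in> K" "ge 0 w0" "w0 + sg w0 = 1" using trace_one OK_iff by blast
  \<comment> \<open>Chosen so that \<open>a * sg w\<close> is \<open>w0\<close> and
    \<open>w * sg a\<close> is \<open>sg w0\<close>: the linear term of the norm then has
    coefficient 1.\<close>
  define w where "w = sg (w0 * inverse a)"
  have wi: "w0 * inverse a \<in> K" "ge 0 (w0 * inverse a)"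
  proof -
    have "ge 0 (inverse a)" using val_inverse[OF vB(1) a0] va by (simp add: vge_def)
    then show "w0 * inverse a \<in> K" "ge 0 (w0 * inverse a)"
      using w0 aK K_mult K_inverse ge_mult0 by blast+
  qed
  have wK: "w \<in> K" "ge 0 w" "sg w = w0 * inverse a" using wi sg_K ge_sg sg_sg by (auto simp: w_def)
  have tr: "a * sg w + w * sg a = 1"
  proof -
    have "a * sg w = w0" unfolding wK(3) K_comm[OF w0(1) K_inverse[OF aK(1)]] using a0
      by (simp flip: mult.assoc)
    moreover have "w * sg a = sg w0"
      unfolding w_def sg_mult[OF wi(1) aK(1), symmetric] mult.assoc using a0 by simp
    ultimately show ?thesis using w0(3) by simp
  qed
  obtain n where n: "w * sg w = emb n" using cj_norm[of w] cj_K[OF wK(1)] by auto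
  have "ge 0 (sg w)" unfolding wK(3) by (rule wi(2))
  then have "geF 0 n" using ge_mult0[OF wK(2)] n OF_iff OF_ge by metis
  then obtain x where x: "geF 0 x" "x = (u - u0) - n * (x * x)" using quadratic_contraction[OF D] by blast
  define z where "z = a + emb x * w"
  have "z \<in> OK"
  proof -
    have "ge 0 (emb x)" using x(1) OF_iff OF_ge by blast
    then show ?thesis
      unfolding z_def OK_iff using K_add[OF aK(1) K_mult[OF K_emb wK(1)]]
        vge_add[OF vB(1) aK(2) ge_mult0[OF _ wK(2)]] by blast
  qed
  moreover have "z * sg z = emb u"
  proof -
    have sz: "sg z = sg a + emb x * sg w"
      unfolding z_def using aK wK K_mult K_emb sg_add sg_mult sg_emb by simp
    have "z * sg z = a * sg a + a * emb x * sg w + emb x * (w * sg a) + emb x * (w * emb x) * sg w"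
      unfolding sz unfolding z_def by (simp add: algebra_simps)
    also have "\<dots> = a * sg a + emb x * (a * sg w + w * sg a) + emb x * emb x * (w * sg w)"
      unfolding emb_central[of a x] emb_central[of w x] by (simp add: algebra_simps)
    also have "\<dots> = emb (u0 + x + x * x * n)"
      unfolding Na tr n by (simp add: emb_add emb_mult)
    also have "u0 + x + x * x * n = u"
      using x(2) by (simp add: algebra_simps)
    finally show ?thesis .
  qed
  ultimately show ?thesis by blast
qed

end

section \<open>Linear equations over a division ring\<close>

text \<open>Gaussian elimination with coefficients acting from the left: a homogeneous system with
  fewer equations than unknowns has a nontrivial solution. One equation and one unknown are
  eliminated at a time, with attention to the order of factors.\<close>

lemma homogeneous_solution:
  fixes M :: "'i \<Rightarrow> 'j \<Rightarrow> 'a::division_ring"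
  assumes "finite J" "finite I" "card J < card I"
  shows "\<exists>x. (\<exists>i\<in>I. x i \<noteq> 0) \<and> (\<forall>j\<in>J. (\<Sum>i\<in>I. x i * M i j) = 0)"
  using assms
proof (induction J arbitrary: I M rule: finite_induct)
  case empty
  then obtain i where "i \<in> I" by (metis card.empty ex_in_conv less_irrefl)
  then show ?case by (intro exI[of _ "\<lambda>_. 1"]) auto
next
  case (insert j J)
  show ?case
  proof (cases "\<forall>i\<in>I. M i j = 0")
    case True
    have "card J < card I" using insert by simp
    then obtain x where "\<exists>i\<in>I. x i \<noteq> 0" "\<forall>j\<in>J. (\<Sum>i\<in>I. x i * M i j) = 0"
      using insert.IH[OF insert.prems(1), of M] by blast
    then show ?thesis using True by (intro exI[of _ x]) auto
  next
    case False
    then obtain p where p: "p \<in> I" "M p j \<noteq> 0" by blast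
    define I' where "I' = I - {p}"
    have I: "finite I'" "card J < card I'" "p \<notin> I'"
      using insert p by (auto simp: I'_def card_Diff_singleton)
    \<comment> \<open>Row \<open>i\<close> minus the left multiple of the pivot row that clears
      column \<open>j\<close>; \<open>y\<close> below assigns the pivot row the coefficient
      compensating for these multiples.\<close>
    define M' where "M' i k = M i k - M i j * inverse (M p j) * M p k" for i k
    obtain x where x: "\<exists>i\<in>I'. x i \<noteq> 0" "\<forall>k\<in>J. (\<Sum>i\<in>I'. x i * M' i k) = 0"
      using insert.IH[OF I(1,2), of M'] by blast
    define y where "y = x(p := - (\<Sum>i\<in>I'. x i * M i j) * inverse (M p j))"
    have *: "(\<Sum>i\<in>I. y i * M i k) = (\<Sum>i\<in>I'. x i * M' i k)" for k
    proof -
      have "(\<Sum>i\<in>I. y i * M i k) = y p * M p k + (\<Sum>i\<in>I'. y i * M i k)"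
        unfolding I'_def using insert.prems(1) p(1) by (rule sum.remove)
      also have "(\<Sum>i\<in>I'. y i * M i k) = (\<Sum>i\<in>I'. x i * M i k)"
        using I(3) by (intro sum.cong) (auto simp: y_def)
      also have "y p * M p k = - (\<Sum>i\<in>I'. x i * M i j * inverse (M p j) * M p k)"
        by (simp add: y_def sum_distrib_right)
      finally show ?thesis
        by (simp add: M'_def sum_subtractf right_diff_distrib mult.assoc)
    qed
    have "M' i j = 0" for i by (simp add: M'_def p mult.assoc)
    then have "\<forall>k\<in>insert j J. (\<Sum>i\<in>I. y i * M i k) = 0" using * x(2) by simp
    moreover have "\<exists>i\<in>I. y i \<noteq> 0" using x(1) I(3) by (auto simp: y_def I'_def)
    ultimately show ?thesis by blast
  qed
qed

text \<open>The unit vector is adjoined as an extra row, indexed by \<open>None\<close>. There are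
  then more rows than columns, so the rows are dependent; injectivity forces a nonzero coefficient
  at the extra row, and dividing by it solves the inhomogeneous system.\<close>

lemma left_inverse_row:
  fixes G :: "'i \<Rightarrow> 'i \<Rightarrow> 'a::division_ring"
  assumes J: "finite J" and inj: "\<And>x. (\<forall>j\<in>J. (\<Sum>i\<in>J. x i * G i j) = 0) \<Longrightarrow> \<forall>i\<in>J. x i = 0"
  shows "\<exists>y. \<forall>j\<in>J. (\<Sum>i\<in>J. y i * G i j) = (if j = k then 1 else 0)"
proof -
  define M where "M i j = (case i of None \<Rightarrow> if j = k then 1 else 0 | Some i \<Rightarrow> G i j)" for i j
  define I where "I = insert None (Some ` J)"
  have I: "finite I" "card J < card I" using J by (auto simp: I_def card_image)
  have sumI: "(\<Sum>i\<in>I. x i * M i j) = x None * (if j = k then 1 else 0) + (\<Sum>i\<in>J. x (Some i) * G i j)" for x j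
  proof -
    have "(\<Sum>i\<in>I. x i * M i j) = x None * M None j + (\<Sum>i\<in>Some ` J. x i * M i j)"
      unfolding I_def using J by (subst sum.insert) auto
    also have "(\<Sum>i\<in>Some ` J. x i * M i j) = (\<Sum>i\<in>J. x (Some i) * M (Some i) j)"
      by (subst sum.reindex) auto
    finally show ?thesis by (simp add: M_def)
  qed
  obtain x where x: "\<exists>i\<in>I. x i \<noteq> 0" "\<forall>j\<in>J. (\<Sum>i\<in>I. x i * M i j) = 0"
    using homogeneous_solution[OF J I, of M] by blast
  have x0: "x None \<noteq> 0"
  proof
    assume "x None = 0"
    then have "\<forall>i\<in>J. x (Some i) = 0" using inj[of "\<lambda>i. x (Some i)"] x(2) sumI by simp
    then show False using x(1) \<open>x None = 0\<close> by (auto simp: I_def)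
  qed
  define y where "y i = - inverse (x None) * x (Some i)" for i
  have "(\<Sum>i\<in>J. y i * G i j) = (if j = k then 1 else 0)" if "j \<in> J" for j
  proof -
    have "(\<Sum>i\<in>J. x (Some i) * G i j) = - (x None * (if j = k then 1 else 0))"
      using x(2) that sumI[of x j] by (simp add: eq_neg_iff_add_eq_0 add.commute)
    moreover have "(\<Sum>i\<in>J. y i * G i j) = - inverse (x None) * (\<Sum>i\<in>J. x (Some i) * G i j)"
      by (simp add: y_def sum_distrib_left mult.assoc)
    ultimately show ?thesis using x0 by (simp add: mult.assoc[symmetric])
  qed
  then show ?thesis by blast
qed

section \<open>Lattices in an ambient bimodule\<close>

text \<open>\<open>GK\<close> marks generators of the rank-one bilattices, with True for the
  identity embedding and False for \<open>\<tau>\<close>. \<open>EK s\<close> and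
  \<open>FK s\<close> mark the two basis vectors of a rank-two bilattice, the second being
  \<open>\<Pi>\<close> times the first; True belongs to L_1 and False to L_2.\<close>

datatype kind = GK bool | EK bool | FK bool

context quaternion_setting begin

definition pr :: "'b \<Rightarrow> 'b" where "pr \<alpha> = PiB * cj \<alpha> * inverse PiB"

definition tau :: "bool \<Rightarrow> 'b \<Rightarrow> 'b" where
  "tau s \<alpha> = (if s then \<alpha> else inverse PiB * \<alpha> * PiB)"

definition sig :: "bool \<Rightarrow> 'b \<Rightarrow> 'b" where
  "sig s a = (if s then a else sg a)"

lemma conj_Pi_val: "x \<noteq> 0 \<Longrightarrow> vB (PiB * x * inverse PiB) = vB x" "x \<noteq> 0 \<Longrightarrow> vB (inverse PiB * x * PiB) = vB x"
  using val_mult[OF vB(1)] val_inverse[OF vB(1)] Pi_ne0 by simp_all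

lemma Pi_cancel: "PiB * (inverse PiB * x) = x" "inverse PiB * (PiB * x) = x"
  using Pi_ne0 by (simp_all flip: mult.assoc)

lemma pr_OB: "\<alpha> \<in> OB \<Longrightarrow> pr \<alpha> \<in> OB"
  using conj_Pi_val(1)[of "cj \<alpha>"] cj_eq_0_iff[of \<alpha>] val_cj[of \<alpha>]
  by (cases "\<alpha> = 0") (auto simp: OB_iff vge_def pr_def cj_zero)

lemma tau_OB: "\<alpha> \<in> OB \<Longrightarrow> tau s \<alpha> \<in> OB"
  using conj_Pi_val(2)[of \<alpha>] by (cases "\<alpha> = 0") (auto simp: OB_iff vge_def tau_def)

lemma pr_pr: "pr (pr \<alpha>) = \<alpha>"
  using Pi_ne0 by (simp add: pr_def cj_mult cj_inverse cj_cj cj_Pi mult.assoc Pi_cancel)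

lemma pr_K: "a \<in> K \<Longrightarrow> pr a = a"
  using Pi_K[OF sg_K, of a] sg_sg[of a] cj_K[of a] Pi_ne0 by (simp add: pr_def mult.assoc)

lemma pr_Pi: "pr PiB = - PiB"
  using Pi_ne0 by (simp add: pr_def cj_Pi mult.assoc)

text \<open>This is the source of the opposite types in a hyperbolic plane: passing through the
  adjoint exchanges the identity embedding with \<open>\<tau>\<close>.\<close>

lemma cj_tau: "cj (tau (\<not> s) \<alpha>) = tau s (pr \<alpha>)"
  using Pi_ne0 by (simp add: pr_def tau_def cj_mult cj_inverse cj_Pi mult.assoc Pi_cancel)

lemma tau_Pi: "tau s PiB = PiB"
  using Pi_ne0 by (simp add: tau_def mult.assoc)

lemma tau_K: "a \<in> K \<Longrightarrow> tau s a = sig s a"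
  using Pi_K[OF sg_K, of a] sg_sg[of a] Pi_cancel(2)[of "sg a"] by (simp add: tau_def sig_def mult.assoc)

lemma sig_K: "a \<in> K \<Longrightarrow> sig s a \<in> K" by (simp add: sig_def sg_K)

lemma sig_OK: "a \<in> OK \<Longrightarrow> sig s a \<in> OK" by (simp add: sig_def OK_iff sg_K ge_sg)

lemma cj_sig: "a \<in> K \<Longrightarrow> cj (sig s a) = sig (\<not> s) a"
  by (simp add: sig_def cj_K sg_K sg_sg)

lemma sig_sg: "a \<in> K \<Longrightarrow> sig s (sg a) = sig (\<not> s) a"
  by (simp add: sig_def sg_sg)

lemma OB_zero: "0 \<in> OB" and OB_one: "1 \<in> OB"
  and OB_add: "x \<in> OB \<Longrightarrow> y \<in> OB \<Longrightarrow> x + y \<in> OB"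
  and OB_diff: "x \<in> OB \<Longrightarrow> y \<in> OB \<Longrightarrow> x - y \<in> OB"
  and OB_minus: "x \<in> OB \<Longrightarrow> - x \<in> OB"
  and OB_mult: "x \<in> OB \<Longrightarrow> y \<in> OB \<Longrightarrow> x * y \<in> OB"
  and OB_cj: "x \<in> OB \<Longrightarrow> cj x \<in> OB"
  using vge_add[OF vB(1)] vge_diff[OF vB(1)] vge_minus_iff[OF vB(1)] ge_mult0 ge_cj val_one[OF vB(1)]
  by (simp_all add: OB_iff) (simp_all add: vge_def)

lemma OB_OK: "a \<in> OK \<Longrightarrow> a \<in> OB" by (simp add: OB_iff OK_iff)

lemma OB_emb: "s \<in> OF \<Longrightarrow> emb s \<in> OB" by (simp add: OB_iff OF_iff)

lemma OB_inverse: "x \<in> OB \<Longrightarrow> \<not> ge 1 x \<Longrightarrow> x \<noteq> 0 \<and> inverse x \<in> OB"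
  using val_inverse[OF vB(1), of x] by (auto simp: OB_iff vge_def)

lemma ge_Pi: "ge 1 PiB" by (simp add: vge_def val_Pi)

lemma ge_pi: "ge 1 (emb \<pi>)" using ge1_emb pi by (simp add: vge_def)

lemma c_OB: "c \<in> OB" and c_unit: "\<not> ge 1 c" and ci_OB: "inverse c \<in> OB" and c_OK: "c \<in> OK"
  using c_K c_val c_ne0 val_inverse[OF vB(1) c_ne0] by (auto simp: OB_iff OK_iff vge_def)

text \<open>For \<open>k = a + b * PiB\<close> the element \<open>c\<close> commutes with
  \<open>a\<close> and anticommutes with \<open>PiB\<close>, while commuting with \<open>b\<close>.
  Anticommutation therefore kills \<open>a\<close>. The remaining \<open>b * PiB\<close> is skew,
  and for integral \<open>k\<close> it is a non-unit: isotropy and the valuation arguments both come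
  from this.\<close>

lemma anticommuting:
  assumes "- (c * k) = k * c"
  shows "k = k2 k * PiB" "k \<in> OB \<Longrightarrow> ge 1 k" "cj k = - k"
proof -
  define a b where "a = k1 k" "b = k2 k"
  have k: "a \<in> K" "b \<in> K" "k = a + b * PiB" using k12 a_b_def by auto
  have "- (c * a) + (- (c * b)) * PiB = a * c + (b * sg c) * PiB"
    using assms Pi_K[OF c_K] unfolding k(3) by (simp add: algebra_simps)
  then have "k1 (- (c * a) + (- (c * b)) * PiB) = k1 (a * c + (b * sg c) * PiB)" by simp
  then have "- (c * a) = a * c"
    using k12_eq[OF K_minus[OF K_mult[OF c_K k(1)]] K_minus[OF K_mult[OF c_K k(2)]]]
      k12_eq[OF K_mult[OF k(1) c_K] K_mult[OF k(2) sg_K[OF c_K]]] by metis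
  then have "c * a = - (c * a)" using K_comm[OF k(1) c_K] by simp
  then have "c * a = 0" by (rule self_neg_zero)
  then have "a = 0" using c_ne0 by simp
  then have b: "k = b * PiB" using k(3) by simp
  then show "k = k2 k * PiB" unfolding a_b_def(2) .
  show "cj k = - k"
    unfolding b using cj_K[OF k(2)] Pi_K[OF sg_K[OF k(2)]] sg_sg[OF k(2)] by (simp add: cj_mult cj_Pi)
  assume "k \<in> OB"
  then have "ge 0 b" using ge_decomp[OF K_zero k(2)] b OB_iff by simp
  then show "ge 1 k" unfolding b by (rule ge_mult1r[OF _ ge_Pi])
qed

text \<open>The complementary computation: here the \<open>PiB\<close> component is forced to
  vanish.\<close>

lemma commuting_c:
  assumes "c * k = k * c"
  shows "k \<in> K"
proof -
  define a b where "a = k1 k" "b = k2 k"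
  have k: "a \<in> K" "b \<in> K" "k = a + b * PiB" using k12 a_b_def by auto
  have "c * a + (c * b) * PiB = a * c + (b * sg c) * PiB"
    using assms Pi_K[OF c_K] unfolding k(3) by (simp add: algebra_simps)
  then have "k2 (c * a + (c * b) * PiB) = k2 (a * c + (b * sg c) * PiB)" by simp
  then have "c * b = b * sg c"
    using k12_eq[OF K_mult[OF c_K k(1)] K_mult[OF c_K k(2)]]
      k12_eq[OF K_mult[OF k(1) c_K] K_mult[OF k(2) sg_K[OF c_K]]] by metis
  then have "c * b = - (c * b)" using K_comm[OF k(2) c_K] sg_c by simp
  then have "c * b = 0" by (rule self_neg_zero)
  then have "b = 0" using c_ne0 by simp
  then have "k = a" using k(3) by simp
  then show ?thesis using k(1) by blast
qed

lemma clear_denominators: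
  assumes "finite J"
  shows "\<exists>s\<in>OF. s \<noteq> 0 \<and> (\<forall>i\<in>J. emb s * x i \<in> OB)"
  using assms
proof (induction J rule: finite_induct)
  case empty
  have "1 \<in> OF" using OF_iff emb_one OB_one OB_iff by simp
  then show ?case by (intro bexI[of _ 1]) auto
next
  case (insert i J)
  then obtain s where s: "s \<in> OF" "s \<noteq> 0" "\<forall>i\<in>J. emb s * x i \<in> OB" by blast
  define n where "n = nat (- vB (x i))"
  define t where "t = \<pi> ^ n"
  have t: "t \<noteq> 0" "vF t = int n" using pi val_power[OF vF pi(1)] by (auto simp: t_def)
  have tO: "t \<in> OF" using t OF_ge by (simp add: vge_def)
  have "emb t * x i \<in> OB"
  proof (cases "x i = 0")
    case False
    have "vB (emb t * x i) = 2 * int n + vB (x i)"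
      using val_mult[OF vB(1) _ False, of "emb t"] emb_eq_0_iff t val_emb by simp
    then show ?thesis unfolding OB_iff vge_def n_def by linarith
  qed (simp add: OB_zero)
  then have "emb (s * t) * x i \<in> OB" using OB_mult[OF OB_emb[OF s(1)]] by (simp add: emb_mult mult.assoc)
  moreover have "emb (s * t) * x j \<in> OB" if "j \<in> J" for j
    using OB_mult[OF OB_emb[OF tO]] s(3) that by (simp add: emb_mult mult.assoc mult.commute[of s])
  moreover have "s * t \<in> OF" using s tO vF_mult0 OF_ge by simp
  ultimately show ?case using s t by (intro bexI[of _ "s * t"]) auto
qed

end

text \<open>A bimodule over all of B. Bilattices become subsets of it, so a lattice and its
  orthogonal complements share one type, total operations and scalar division.\<close>

locale ambient_bimodule = quaternion_setting vF emb cj sg vB OF OB OK K \<pi> PiB c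
  for vF :: "'f::field \<Rightarrow> int" and emb :: "'f \<Rightarrow> 'b::division_ring" and cj sg vB OF OB OK K \<pi> PiB c +
  fixes lm :: "'b \<Rightarrow> 'v::ab_group_add \<Rightarrow> 'v" (infixr "\<triangleright>" 76)
    and rm :: "'v \<Rightarrow> 'b \<Rightarrow> 'v" (infixl "\<triangleleft>" 75)
  assumes lm_add: "\<alpha> \<triangleright> (x + y) = \<alpha> \<triangleright> x + \<alpha> \<triangleright> y"
    and rm_add: "(x + y) \<triangleleft> \<alpha> = x \<triangleleft> \<alpha> + y \<triangleleft> \<alpha>"
    and lm_addl: "(\<alpha> + \<beta>) \<triangleright> x = \<alpha> \<triangleright> x + \<beta> \<triangleright> x"
    and rm_addr: "x \<triangleleft> (\<alpha> + \<beta>) = x \<triangleleft> \<alpha> + x \<triangleleft> \<beta>"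
    and lm_mult: "(\<alpha> * \<beta>) \<triangleright> x = \<alpha> \<triangleright> (\<beta> \<triangleright> x)"
    and rm_mult: "x \<triangleleft> (\<alpha> * \<beta>) = x \<triangleleft> \<alpha> \<triangleleft> \<beta>"
    and lm_rm: "\<alpha> \<triangleright> (x \<triangleleft> \<beta>) = \<alpha> \<triangleright> x \<triangleleft> \<beta>"
    and lm_one: "1 \<triangleright> x = x" and rm_one: "x \<triangleleft> 1 = x"
    and lm_emb: "emb a \<triangleright> x = x \<triangleleft> emb a"
begin

lemma rm_zero: "x \<triangleleft> 0 = 0" using rm_addr[of x 0 0] by simp
lemma zero_rm: "0 \<triangleleft> \<alpha> = 0" using rm_add[of 0 0 \<alpha>] by simp
lemma lm_zero: "\<alpha> \<triangleright> 0 = 0" using lm_add[of \<alpha> 0 0] by simp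
lemma zero_lm: "0 \<triangleright> x = 0" using lm_addl[of 0 0 x] by simp
lemma rm_minus: "x \<triangleleft> (- \<alpha>) = - (x \<triangleleft> \<alpha>)"
  using rm_addr[of x \<alpha> "- \<alpha>"] by (simp add: rm_zero eq_neg_iff_add_eq_0 add.commute)
lemma minus_rm: "(- x) \<triangleleft> \<alpha> = - (x \<triangleleft> \<alpha>)"
  using rm_add[of x "- x" \<alpha>] by (simp add: zero_rm eq_neg_iff_add_eq_0 add.commute)
lemma minus_lm: "(- \<alpha>) \<triangleright> x = - (\<alpha> \<triangleright> x)"
  using lm_addl[of \<alpha> "- \<alpha>" x] by (simp add: zero_lm eq_neg_iff_add_eq_0 add.commute)
lemma rm_diff: "(x - y) \<triangleleft> \<alpha> = x \<triangleleft> \<alpha> - y \<triangleleft> \<alpha>"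
  using rm_add[of x "- y" \<alpha>] by (simp add: minus_rm)
lemma lm_sum: "\<alpha> \<triangleright> (sum f I) = (\<Sum>i\<in>I. \<alpha> \<triangleright> f i)"
  by (induction I rule: infinite_finite_induct) (auto simp: lm_zero lm_add)
lemma sum_rm: "sum f I \<triangleleft> \<alpha> = (\<Sum>i\<in>I. f i \<triangleleft> \<alpha>)"
  by (induction I rule: infinite_finite_induct) (auto simp: zero_rm rm_add)

definition lat :: "'v set \<Rightarrow> bool" where
  "lat N \<longleftrightarrow> 0 \<in> N \<and> (\<forall>x\<in>N. \<forall>y\<in>N. x + y \<in> N) \<and>
     (\<forall>x\<in>N. \<forall>\<alpha>\<in>OB. \<alpha> \<triangleright> x \<in> N \<and> x \<triangleleft> \<alpha> \<in> N)"

text \<open>The last clause is self-duality without denominators: \<open>x / s\<close> belongs to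
  the dual lattice exactly when \<open>h x\<close> takes values in \<open>s\<close> O_B, and the
  clause then makes \<open>x / s\<close> an element of the lattice.\<close>

definition sd :: "'v set \<Rightarrow> ('v \<Rightarrow> 'v \<Rightarrow> 'b) \<Rightarrow> bool" where
  "sd N h \<longleftrightarrow> lat N \<and>
     (\<forall>x\<in>N. \<forall>y\<in>N. \<forall>z\<in>N. h (x + y) z = h x z + h y z) \<and>
     (\<forall>x\<in>N. \<forall>y\<in>N. h x y = cj (h y x)) \<and>
     (\<forall>x\<in>N. \<forall>y\<in>N. \<forall>\<alpha>\<in>OB. h x (y \<triangleleft> \<alpha>) = h x y * \<alpha>) \<and>
     (\<forall>x\<in>N. \<forall>y\<in>N. \<forall>\<alpha>\<in>OB. h (\<alpha> \<triangleright> x) y = h x (pr \<alpha> \<triangleright> y)) \<and>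
     (\<forall>x\<in>N. \<forall>y\<in>N. h x y \<in> OB) \<and>
     (\<forall>x\<in>N. (\<forall>y\<in>N. h x y = 0) \<longrightarrow> x = 0) \<and>
     (\<forall>x\<in>N. \<forall>s\<in>OF - {0}. (\<forall>y\<in>N. \<exists>\<beta>\<in>OB. h x y = emb s * \<beta>) \<longrightarrow> (\<exists>x'\<in>N. x = x' \<triangleleft> emb s))"

definition lincomb :: "'i set \<Rightarrow> ('i \<Rightarrow> 'v) \<Rightarrow> ('i \<Rightarrow> 'b) \<Rightarrow> 'v" where
  "lincomb J b a = (\<Sum>j\<in>J. b j \<triangleleft> a j)"

definition rbasis :: "'i set \<Rightarrow> ('i \<Rightarrow> 'v) \<Rightarrow> 'v set \<Rightarrow> bool" where
  "rbasis J b N \<longleftrightarrow> finite J \<and> N = {lincomb J b a | a. \<forall>j\<in>J. a j \<in> OB} \<and>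
     (\<forall>a. (\<forall>j\<in>J. a j \<in> OB) \<longrightarrow> lincomb J b a = 0 \<longrightarrow> (\<forall>j\<in>J. a j = 0))"

definition ty :: "bool \<Rightarrow> 'v \<Rightarrow> bool" where
  "ty s x \<longleftrightarrow> (\<forall>\<alpha>\<in>OB. \<alpha> \<triangleright> x = x \<triangleleft> tau s \<alpha>)"

text \<open>Only the action of O_K is prescribed. This common part of all kinds suffices for
  isotropy, and it is what survives on the members of an E-F pair.\<close>

definition te :: "bool \<Rightarrow> 'v \<Rightarrow> bool" where
  "te s x \<longleftrightarrow> (\<forall>a\<in>OK. a \<triangleright> x = x \<triangleleft> sig s a)"

definition typed :: "(kind \<times> nat) set \<Rightarrow> (kind \<times> nat \<Rightarrow> 'v) \<Rightarrow> bool" where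
  "typed J b \<longleftrightarrow>
     (\<forall>s i. (GK s, i) \<in> J \<longrightarrow> ty s (b (GK s, i))) \<and>
     (\<forall>s i. (EK s, i) \<in> J \<longrightarrow> te s (b (EK s, i)) \<and> (FK s, i) \<in> J \<and> b (FK s, i) = PiB \<triangleright> b (EK s, i)) \<and>
     (\<forall>s i. (FK s, i) \<in> J \<longrightarrow> (EK s, i) \<in> J)"

lemma ty_te: "ty s x \<Longrightarrow> te s x"
  unfolding ty_def te_def using tau_K OB_OK OK_K by simp

lemma te_Pi: "te s x \<Longrightarrow> te (\<not> s) (PiB \<triangleright> x)"
proof -
  assume t: "te s x"
  show ?thesis unfolding te_def
  proof
    fix a assume a: "a \<in> OK"
    have sa: "sg a \<in> OK" using sig_OK[OF a, of False] by (simp add: sig_def)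
    have "a \<triangleright> (PiB \<triangleright> x) = (PiB * sg a) \<triangleright> x"
      using Pi_K[OF sg_K[OF OK_K[OF a]]] sg_sg[OF OK_K[OF a]] by (simp add: lm_mult[symmetric])
    also have "\<dots> = PiB \<triangleright> (x \<triangleleft> sig s (sg a))" using t sa by (simp add: lm_mult te_def)
    finally show "a \<triangleright> (PiB \<triangleright> x) = PiB \<triangleright> x \<triangleleft> sig (\<not> s) a"
      using sig_sg[OF OK_K[OF a]] by (simp add: lm_rm)
  qed
qed

lemma lincomb_remove:
  "finite J \<Longrightarrow> k \<in> J \<Longrightarrow> lincomb J b a = b k \<triangleleft> a k + lincomb (J - {k}) b a"
  unfolding lincomb_def by (rule sum.remove)

lemma lincomb_cong: "(\<And>j. j \<in> J \<Longrightarrow> b j = b' j) \<Longrightarrow> (\<And>j. j \<in> J \<Longrightarrow> a j = a' j) \<Longrightarrow> lincomb J b a = lincomb J b' a'"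
  unfolding lincomb_def by (intro sum.cong) auto

lemma lincomb_add: "lincomb J b a + lincomb J b a' = lincomb J b (\<lambda>j. a j + a' j)"
  unfolding lincomb_def by (simp add: rm_addr sum.distrib)

lemma lincomb_minus: "- lincomb J b a = lincomb J b (\<lambda>j. - a j)"
  unfolding lincomb_def by (simp add: rm_minus sum_negf)

lemma lincomb_rm: "lincomb J b a \<triangleleft> \<alpha> = lincomb J b (\<lambda>j. a j * \<alpha>)"
  unfolding lincomb_def by (simp add: sum_rm rm_mult)

lemma lat_sum: "lat N \<Longrightarrow> (\<And>j. j \<in> J \<Longrightarrow> f j \<in> N) \<Longrightarrow> sum f J \<in> N"
  by (induction J rule: infinite_finite_induct) (auto simp: lat_def)

lemma lat_lincomb: "lat N \<Longrightarrow> (\<And>j. j \<in> J \<Longrightarrow> b j \<in> N) \<Longrightarrow> (\<And>j. j \<in> J \<Longrightarrow> a j \<in> OB) \<Longrightarrow> lincomb J b a \<in> N"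
  unfolding lincomb_def by (rule lat_sum) (auto simp: lat_def)

lemma rbasis_mem: "rbasis J b N \<Longrightarrow> x \<in> N \<longleftrightarrow> (\<exists>a. (\<forall>j\<in>J. a j \<in> OB) \<and> x = lincomb J b a)"
  unfolding rbasis_def by auto

lemma rbasisI:
  assumes "finite J" "\<And>a. (\<And>j. j \<in> J \<Longrightarrow> a j \<in> OB) \<Longrightarrow> lincomb J b a \<in> N"
    "\<And>x. x \<in> N \<Longrightarrow> \<exists>a. (\<forall>j\<in>J. a j \<in> OB) \<and> x = lincomb J b a"
    "\<And>a j. (\<And>j. j \<in> J \<Longrightarrow> a j \<in> OB) \<Longrightarrow> lincomb J b a = 0 \<Longrightarrow> j \<in> J \<Longrightarrow> a j = 0"
  shows "rbasis J b N"
proof -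
  have "N = {lincomb J b a | a. \<forall>j\<in>J. a j \<in> OB}"
  proof (intro equalityI subsetI)
    fix x assume "x \<in> N"
    then show "x \<in> {lincomb J b a | a. \<forall>j\<in>J. a j \<in> OB}" using assms(3) by blast
  next
    fix x assume "x \<in> {lincomb J b a | a. \<forall>j\<in>J. a j \<in> OB}"
    then obtain a where "\<forall>j\<in>J. a j \<in> OB" "x = lincomb J b a" by blast
    then show "x \<in> N" using assms(2)[of a] by blast
  qed
  moreover have "\<forall>a. (\<forall>j\<in>J. a j \<in> OB) \<longrightarrow> lincomb J b a = 0 \<longrightarrow> (\<forall>j\<in>J. a j = 0)"
    using assms(4) by blast
  ultimately show ?thesis using assms(1) unfolding rbasis_def by (intro conjI)
qed

lemma rbasis_in: "rbasis J b N \<Longrightarrow> j \<in> J \<Longrightarrow> b j \<in> N"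
proof -
  assume b: "rbasis J b N" and j: "j \<in> J"
  define a :: "'a \<Rightarrow> 'b" where "a i = (if i = j then 1 else 0)" for i
  have "lincomb J b a = b j \<triangleleft> a j + lincomb (J - {j}) b a" using b j by (simp add: rbasis_def lincomb_remove)
  also have "lincomb (J - {j}) b a = 0" unfolding lincomb_def a_def by (intro sum.neutral) (auto simp: rm_zero)
  also have "a j = 1" by (simp add: a_def)
  finally have "lincomb J b a = b j" by (simp only: rm_one add_0_right)
  moreover have "\<forall>j\<in>J. a j \<in> OB" by (simp add: a_def OB_zero OB_one)
  ultimately show ?thesis unfolding rbasis_mem[OF b] by metis
qed

lemma rbasis_expand:
  assumes "rbasis J b N" "x \<in> N"
  obtains a where "\<And>j. j \<in> J \<Longrightarrow> a j \<in> OB" "x = lincomb J b a"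
proof -
  obtain a where "\<forall>j\<in>J. a j \<in> OB" "x = lincomb J b a" using assms(2) rbasis_mem[OF assms(1)] by metis
  then show ?thesis using that[of a] by blast
qed

lemma rbasis_indep: "rbasis J b N \<Longrightarrow> (\<And>j. j \<in> J \<Longrightarrow> a j \<in> OB) \<Longrightarrow> lincomb J b a = 0 \<Longrightarrow> j \<in> J \<Longrightarrow> a j = 0"
  unfolding rbasis_def by blast

text \<open>Steinitz exchange over the local ring O_B: a basis vector can be replaced when its
  coefficient lies outside the maximal ideal and is therefore invertible.\<close>

lemma rbasis_exchange:
  assumes b: "rbasis J b N" and N: "lat N" and a: "\<And>j. j \<in> J \<Longrightarrow> a j \<in> OB" and z: "z = lincomb J b a"
    and k: "k \<in> J" "\<not> ge 1 (a k)"
  shows "rbasis J (b(k := z)) N"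
proof -
  have J: "finite J" using b by (simp add: rbasis_def)
  let ?b = "b(k := z)"
  define u where "u = inverse (a k)"
  have u: "u \<in> OB" "a k \<noteq> 0" using OB_inverse[OF a[OF k(1)] k(2)] by (auto simp: u_def)
  have bN: "b j \<in> N" if "j \<in> J" for j using rbasis_in[OF b that] .
  have zN: "z \<in> N" unfolding z using lat_lincomb[OF N bN a] .
  have key: "lincomb J ?b x = lincomb J b (\<lambda>j. if j = k then a k * x k else a j * x k + x j)" for x
  proof -
    have "lincomb J ?b x = z \<triangleleft> x k + lincomb (J - {k}) ?b x" using lincomb_remove[OF J k(1), of ?b x] by simp
    also have "lincomb (J - {k}) ?b x = lincomb (J - {k}) b x" by (rule lincomb_cong) auto
    also have "z \<triangleleft> x k = b k \<triangleleft> (a k * x k) + lincomb (J - {k}) b (\<lambda>j. a j * x k)"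
      unfolding z lincomb_rm by (rule lincomb_remove[OF J k(1)])
    finally have e: "lincomb J ?b x = b k \<triangleleft> (a k * x k) + lincomb (J - {k}) b (\<lambda>j. a j * x k + x j)"
      unfolding add.assoc lincomb_add .
    define g where "g = (\<lambda>j. if j = k then a k * x k else a j * x k + x j)"
    have "lincomb (J - {k}) b (\<lambda>j. a j * x k + x j) = lincomb (J - {k}) b g"
      by (rule lincomb_cong) (auto simp: g_def)
    moreover have "a k * x k = g k" by (simp add: g_def)
    ultimately show ?thesis unfolding g_def[symmetric] e lincomb_remove[OF J k(1), of b g] by simp
  qed
  show ?thesis
  proof (rule rbasisI[OF J])
    fix x :: "'a \<Rightarrow> 'b" assume "\<And>j. j \<in> J \<Longrightarrow> x j \<in> OB"
    then show "lincomb J ?b x \<in> N" using lat_lincomb[OF N, of J ?b x] bN zN by simp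
  next
    fix v assume "v \<in> N"
    then obtain y where y: "\<And>j. j \<in> J \<Longrightarrow> y j \<in> OB" "v = lincomb J b y" using rbasis_expand[OF b] by blast
    \<comment> \<open>Solution of the triangular system read off from \<open>key\<close>: first
      \<open>a k * x k = y k\<close>, then \<open>a j * x k + x j = y j\<close> for the other
      indices.\<close>
    define x where "x j = (if j = k then u * y k else y j - a j * (u * y k))" for j
    have xk: "a k * x k = y k" using u(2) by (simp add: x_def u_def mult.assoc[symmetric])
    have "v = lincomb J b (\<lambda>j. if j = k then a k * x k else a j * x k + x j)"
      unfolding y(2) by (rule lincomb_cong) (use xk in \<open>simp_all add: x_def\<close>)
    then have "v = lincomb J ?b x" unfolding key .
    moreover have "\<forall>j\<in>J. x j \<in> OB" using y(1) a u(1) k by (simp add: x_def OB_mult OB_diff)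
    ultimately show "\<exists>x. (\<forall>j\<in>J. x j \<in> OB) \<and> v = lincomb J ?b x" by (intro exI[of _ x] conjI)
  next
    fix x :: "'a \<Rightarrow> 'b" and j assume x: "\<And>j. j \<in> J \<Longrightarrow> x j \<in> OB" "lincomb J ?b x = 0" and j: "j \<in> J"
    have *: "(if j = k then a k * x k else a j * x k + x j) = 0" if "j \<in> J" for j
      by (rule rbasis_indep[OF b _ _ that]) (use x key a k in \<open>auto simp: OB_mult OB_add\<close>)
    have "x k = 0" using *[OF k(1)] u(2) by simp
    show "x j = 0" using *[OF j] \<open>x k = 0\<close> by (cases "j = k") simp_all
  qed
qed

text \<open>The projection \<open>\<rho>\<close> has image \<open>N'\<close> and its kernel lies in
  the span of the \<open>b i\<close> with \<open>i \<in> I\<close>. The images of the other basis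
  vectors therefore generate, and a relation among them lifts to a relation in the original
  basis.\<close>

lemma rbasis_complement:
  assumes b: "rbasis J b N" and N': "lat N'" "N' \<subseteq> N" and I: "I \<subseteq> J"
    and \<rho>: "\<And>x. x \<in> N \<Longrightarrow> \<rho> x \<in> N'" "\<And>x. x \<in> N' \<Longrightarrow> \<rho> x = x"
      "\<And>a. (\<And>j. j \<in> J \<Longrightarrow> a j \<in> OB) \<Longrightarrow> \<rho> (lincomb J b a) = lincomb J (\<lambda>j. \<rho> (b j)) a"
      "\<And>i. i \<in> I \<Longrightarrow> \<rho> (b i) = 0"
      "\<And>x. x \<in> N \<Longrightarrow> \<exists>a. (\<forall>i\<in>I. a i \<in> OB) \<and> x - \<rho> x = lincomb I b a"
  shows "rbasis (J - I) (\<lambda>j. \<rho> (b j)) N'"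
proof -
  have J: "finite J" using b by (simp add: rbasis_def)
  have drop: "lincomb J (\<lambda>j. \<rho> (b j)) a = lincomb (J - I) (\<lambda>j. \<rho> (b j)) a" for a
    unfolding lincomb_def by (rule sum.mono_neutral_right) (use J \<rho>(4) zero_rm in auto)
  have drop2: "lincomb J b (\<lambda>j. if j \<in> I then 0 else a j) = lincomb (J - I) b a" for a
  proof -
    have "lincomb J b (\<lambda>j. if j \<in> I then 0 else a j) = lincomb (J - I) b (\<lambda>j. if j \<in> I then 0 else a j)"
      unfolding lincomb_def by (rule sum.mono_neutral_right) (use J rm_zero in auto)
    also have "\<dots> = lincomb (J - I) b a" by (rule lincomb_cong) auto
    finally show ?thesis .
  qed
  have drop3: "lincomb J b (\<lambda>j. if j \<in> I then a j else 0) = lincomb I b a" for a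
  proof -
    have "lincomb J b (\<lambda>j. if j \<in> I then a j else 0) = lincomb I b (\<lambda>j. if j \<in> I then a j else 0)"
      unfolding lincomb_def by (rule sum.mono_neutral_right) (use J I rm_zero in auto)
    also have "\<dots> = lincomb I b a" by (rule lincomb_cong) auto
    finally show ?thesis .
  qed
  show ?thesis
  proof (rule rbasisI)
    show "finite (J - I)" using J by simp
  next
    fix x :: "'a \<Rightarrow> 'b" assume "\<And>j. j \<in> J - I \<Longrightarrow> x j \<in> OB"
    then show "lincomb (J - I) (\<lambda>j. \<rho> (b j)) x \<in> N'"
      using lat_lincomb[OF N'(1), of "J - I" "\<lambda>j. \<rho> (b j)" x] \<rho>(1) rbasis_in[OF b] by simp
  next
    fix v assume v: "v \<in> N'"
    then have "v \<in> N" using N'(2) by blast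
    then obtain y where y: "\<And>j. j \<in> J \<Longrightarrow> y j \<in> OB" "v = lincomb J b y" using rbasis_expand[OF b] by blast
    have "v = lincomb (J - I) (\<lambda>j. \<rho> (b j)) y"
    proof -
      have "\<rho> (lincomb J b y) = lincomb J (\<lambda>j. \<rho> (b j)) y" by (rule \<rho>(3)) (rule y(1))
      then show ?thesis using \<rho>(2)[OF v] unfolding drop y(2)[symmetric] by simp
    qed
    then show "\<exists>x. (\<forall>j\<in>J - I. x j \<in> OB) \<and> v = lincomb (J - I) (\<lambda>j. \<rho> (b j)) x"
      using y(1) by (intro exI[of _ y] conjI ballI) simp_all
  next
    fix x :: "'a \<Rightarrow> 'b" and j
    assume x: "\<And>j. j \<in> J - I \<Longrightarrow> x j \<in> OB" "lincomb (J - I) (\<lambda>j. \<rho> (b j)) x = 0" and j: "j \<in> J - I"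
    \<comment> \<open>Extension by zero on \<open>I\<close>. The combination is killed by
      \<open>\<rho>\<close>, so it also lies in the span of the vectors indexed by \<open>I\<close>;
      uniqueness of coordinates makes the coefficients outside \<open>I\<close> vanish.\<close>
    define y where "y = (\<lambda>j. if j \<in> I then 0 else x j)"
    have yO: "y j \<in> OB" if "j \<in> J" for j using x(1) that by (simp add: y_def OB_zero)
    have yN: "lincomb J b y \<in> N" using rbasis_mem[OF b] yO by blast
    have "lincomb J (\<lambda>j. \<rho> (b j)) y = lincomb (J - I) (\<lambda>j. \<rho> (b j)) x"
      unfolding drop by (rule lincomb_cong) (auto simp: y_def)
    moreover have "\<rho> (lincomb J b y) = lincomb J (\<lambda>j. \<rho> (b j)) y" by (rule \<rho>(3)) (rule yO)
    ultimately have r0: "\<rho> (lincomb J b y) = 0" using x(2) by simp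
    obtain a where a: "\<forall>i\<in>I. a i \<in> OB" "lincomb J b y = lincomb I b a"
      using \<rho>(5)[OF yN] unfolding r0 diff_0_right by blast
    have "lincomb J b (\<lambda>j. y j + - (if j \<in> I then a j else 0)) = lincomb J b y + - lincomb I b a"
      by (simp only: lincomb_add[symmetric] lincomb_minus[symmetric] drop3)
    also have "\<dots> = 0" using a(2) by simp
    finally have z: "lincomb J b (\<lambda>j. y j + - (if j \<in> I then a j else 0)) = 0" .
    have "y j + - (if j \<in> I then a j else 0) = 0" if "j \<in> J" for j
      by (rule rbasis_indep[OF b _ z that]) (use yO a(1) in \<open>auto simp: OB_diff OB_zero\<close>)
    then have "y j + - (if j \<in> I then a j else 0) = 0" using j by blast
    then show "x j = 0" using j by (simp add: y_def)
  qed
qed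

end

section \<open>Splitting off hyperbolic planes\<close>

locale selfdual = ambient_bimodule vF emb cj sg vB OF OB OK K \<pi> PiB c lm rm
  for vF :: "'f::field \<Rightarrow> int" and emb :: "'f \<Rightarrow> 'b::division_ring" and cj sg vB OF OB OK K \<pi> PiB c
    and lm :: "'b \<Rightarrow> 'v::ab_group_add \<Rightarrow> 'v" (infixr "\<triangleright>" 76)
    and rm :: "'v \<Rightarrow> 'b \<Rightarrow> 'v" (infixl "\<triangleleft>" 75) +
  fixes N :: "'v set" and h :: "'v \<Rightarrow> 'v \<Rightarrow> 'b"
  assumes sd: "sd N h"
begin

lemmas sd_parts = sd[unfolded sd_def]

lemma lat: "lat N"
  using sd_parts by (rule conjunct1)

lemma h_addl: "x \<in> N \<Longrightarrow> y \<in> N \<Longrightarrow> z \<in> N \<Longrightarrow> h (x + y) z = h x z + h y z"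
  using sd_parts[THEN conjunct2, THEN conjunct1] by blast

lemma h_sym: "x \<in> N \<Longrightarrow> y \<in> N \<Longrightarrow> h x y = cj (h y x)"
  using sd_parts[THEN conjunct2, THEN conjunct2, THEN conjunct1] by blast

lemma h_rm: "x \<in> N \<Longrightarrow> y \<in> N \<Longrightarrow> \<alpha> \<in> OB \<Longrightarrow> h x (y \<triangleleft> \<alpha>) = h x y * \<alpha>"
  using sd_parts[THEN conjunct2, THEN conjunct2, THEN conjunct2, THEN conjunct1] by blast

lemma h_lm: "x \<in> N \<Longrightarrow> y \<in> N \<Longrightarrow> \<alpha> \<in> OB \<Longrightarrow> h (\<alpha> \<triangleright> x) y = h x (pr \<alpha> \<triangleright> y)"
  using sd_parts[THEN conjunct2, THEN conjunct2, THEN conjunct2, THEN conjunct2, THEN conjunct1] by blast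

lemma h_OB: "x \<in> N \<Longrightarrow> y \<in> N \<Longrightarrow> h x y \<in> OB"
  using sd_parts[THEN conjunct2, THEN conjunct2, THEN conjunct2, THEN conjunct2, THEN conjunct2,
      THEN conjunct1] by blast

lemma h_nondeg: "x \<in> N \<Longrightarrow> (\<And>y. y \<in> N \<Longrightarrow> h x y = 0) \<Longrightarrow> x = 0"
  using sd_parts[THEN conjunct2, THEN conjunct2, THEN conjunct2, THEN conjunct2, THEN conjunct2,
      THEN conjunct2, THEN conjunct1] by simp

lemma h_perfect: "x \<in> N \<Longrightarrow> s \<in> OF \<Longrightarrow> s \<noteq> 0 \<Longrightarrow> (\<And>y. y \<in> N \<Longrightarrow> \<exists>\<beta>\<in>OB. h x y = emb s * \<beta>) \<Longrightarrow>
    \<exists>x'\<in>N. x = x' \<triangleleft> emb s"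
  using sd_parts[THEN conjunct2, THEN conjunct2, THEN conjunct2, THEN conjunct2, THEN conjunct2,
      THEN conjunct2, THEN conjunct2] by simp

lemma N_zero: "0 \<in> N" and N_add: "x \<in> N \<Longrightarrow> y \<in> N \<Longrightarrow> x + y \<in> N"
  and N_lm: "x \<in> N \<Longrightarrow> \<alpha> \<in> OB \<Longrightarrow> \<alpha> \<triangleright> x \<in> N" and N_rm: "x \<in> N \<Longrightarrow> \<alpha> \<in> OB \<Longrightarrow> x \<triangleleft> \<alpha> \<in> N"
  using lat by (auto simp: lat_def)

lemma N_minus: "x \<in> N \<Longrightarrow> - x \<in> N"
  using N_rm[of x "- 1"] OB_minus[OF OB_one] by (simp add: rm_minus rm_one)

lemma N_diff: "x \<in> N \<Longrightarrow> y \<in> N \<Longrightarrow> x - y \<in> N"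
  using N_add[of x "- y"] N_minus by simp

lemma h_addr: "x \<in> N \<Longrightarrow> y \<in> N \<Longrightarrow> z \<in> N \<Longrightarrow> h z (x + y) = h z x + h z y"
  by (simp add: h_sym[of z "x + y"] h_sym[of z x] h_sym[of z y] h_addl N_add cj_add)

lemma h_rml: "x \<in> N \<Longrightarrow> y \<in> N \<Longrightarrow> \<alpha> \<in> OB \<Longrightarrow> h (x \<triangleleft> \<alpha>) y = cj \<alpha> * h x y"
  unfolding h_sym[OF N_rm, of x \<alpha> y] by (simp add: h_rm cj_mult h_sym[of x y])

lemma h_lmr: "x \<in> N \<Longrightarrow> y \<in> N \<Longrightarrow> \<alpha> \<in> OB \<Longrightarrow> h x (\<alpha> \<triangleright> y) = h (pr \<alpha> \<triangleright> x) y"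
  using h_lm[of x y "pr \<alpha>"] pr_OB by (simp add: pr_pr)

lemma h_zero: "x \<in> N \<Longrightarrow> h x 0 = 0" "x \<in> N \<Longrightarrow> h 0 x = 0"
  using h_rm[of x 0 0] h_rml[of 0 x 0] N_zero OB_zero by (simp_all add: rm_zero cj_zero)

lemma h_minus: "x \<in> N \<Longrightarrow> y \<in> N \<Longrightarrow> h x (- y) = - h x y" "x \<in> N \<Longrightarrow> y \<in> N \<Longrightarrow> h (- x) y = - h x y"
  using h_rm[of x y "- 1"] h_rml[of x y "- 1"] OB_minus[OF OB_one]
  by (simp_all add: rm_minus rm_one cj_minus cj_one)

lemma h_diff: "x \<in> N \<Longrightarrow> y \<in> N \<Longrightarrow> z \<in> N \<Longrightarrow> h z (x - y) = h z x - h z y"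
  "x \<in> N \<Longrightarrow> y \<in> N \<Longrightarrow> z \<in> N \<Longrightarrow> h (x - y) z = h x z - h y z"
  using h_addr[of x "- y" z] h_addl[of x "- y" z] h_minus[of z y] h_minus[of y z] N_minus by simp_all

lemma h_sum: "x \<in> N \<Longrightarrow> (\<And>j. j \<in> J \<Longrightarrow> f j \<in> N) \<Longrightarrow> h x (sum f J) = (\<Sum>j\<in>J. h x (f j))"
proof (induction J rule: infinite_finite_induct)
  case (insert j J)
  then have "sum f J \<in> N" using lat_sum[OF lat] by blast
  then show ?case using insert h_addr by simp
qed (auto simp: h_zero)

lemma h_lincomb:
  assumes "x \<in> N" "\<And>j. j \<in> J \<Longrightarrow> b j \<in> N" "\<And>j. j \<in> J \<Longrightarrow> a j \<in> OB"
  shows "h x (lincomb J b a) = (\<Sum>j\<in>J. h x (b j) * a j)"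
  unfolding lincomb_def using assms h_sum[of x J "\<lambda>j. b j \<triangleleft> a j"] N_rm h_rm by simp

lemma h_ext:
  assumes b: "rbasis J b N" and x: "x \<in> N" "y \<in> N" and eq: "\<And>j. j \<in> J \<Longrightarrow> h x (b j) = h y (b j)"
  shows "x = y"
proof -
  have "x - y = 0"
  proof (rule h_nondeg)
    show "x - y \<in> N" using x N_diff by blast
    fix z assume "z \<in> N"
    then obtain a where a: "\<And>j. j \<in> J \<Longrightarrow> a j \<in> OB" "z = lincomb J b a" using rbasis_expand[OF b] by blast
    have "h w z = (\<Sum>j\<in>J. h w (b j) * a j)" if "w \<in> N" for w
      unfolding a(2) by (rule h_lincomb) (use that a rbasis_in[OF b] in auto)
    then have "h x z = h y z" using x eq by simp
    then show "h (x - y) z = 0" using x \<open>z \<in> N\<close> h_diff by simp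
  qed
  then show ?thesis by simp
qed

text \<open>Nondegeneracy makes the Gram matrix injective over B, which produces the dual vector
  with denominators. A scalar multiple of it lies in the lattice, and self-duality allows division
  by that scalar.\<close>

lemma dual_vector:
  assumes b: "rbasis J b N" and k: "k \<in> J"
  shows "\<exists>y\<in>N. \<forall>j\<in>J. h y (b j) = (if j = k then 1 else 0)"
proof -
  have J: "finite J" using b by (simp add: rbasis_def)
  have bN: "b j \<in> N" if "j \<in> J" for j using rbasis_in[OF b that] .
  define G where "G i j = h (b i) (b j)" for i j
  \<comment> \<open>The conjugation compensates for the semilinearity of \<open>h\<close> in its
    first argument, so that pairing with \<open>b j\<close> yields a row of the system for
    \<open>G\<close>.\<close>
  define vec where "vec s x = lincomb J b (\<lambda>i. cj (emb s * x i))" for s x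
  have vec: "vec s x \<in> N" "j \<in> J \<Longrightarrow> h (vec s x) (b j) = emb s * (\<Sum>i\<in>J. x i * G i j)"
    if s: "\<forall>i\<in>J. emb s * x i \<in> OB" for s x j
  proof -
    have c: "cj (emb s * x i) \<in> OB" if "i \<in> J" for i using s that OB_cj by blast
    show v: "vec s x \<in> N" unfolding vec_def by (rule lat_lincomb[OF lat bN c])
    assume j: "j \<in> J"
    have "h (b j) (vec s x) = (\<Sum>i\<in>J. h (b j) (b i) * cj (emb s * x i))"
      unfolding vec_def by (rule h_lincomb[OF bN[OF j] bN c])
    then have "cj (h (b j) (vec s x)) = (\<Sum>i\<in>J. emb s * x i * cj (h (b j) (b i)))"
      by (simp add: cj_sum cj_mult cj_cj cj_emb mult.assoc emb_central)
    also have "\<dots> = (\<Sum>i\<in>J. emb s * x i * G i j)"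
      by (rule sum.cong[OF refl]) (simp add: G_def h_sym[OF bN bN[OF j], symmetric])
    also have "\<dots> = emb s * (\<Sum>i\<in>J. x i * G i j)" by (simp add: sum_distrib_left mult.assoc)
    finally show "h (vec s x) (b j) = emb s * (\<Sum>i\<in>J. x i * G i j)"
      using h_sym[OF v bN[OF j]] by simp
  qed
  have inj: "\<forall>i\<in>J. x i = 0" if x: "\<forall>j\<in>J. (\<Sum>i\<in>J. x i * G i j) = 0" for x
  proof
    fix i assume i: "i \<in> J"
    obtain s where s: "s \<in> OF" "s \<noteq> 0" "\<forall>i\<in>J. emb s * x i \<in> OB" using clear_denominators[OF J] by blast
    have "vec s x = 0"
      by (rule h_ext[OF b vec(1)[OF s(3)] N_zero]) (use vec(2)[OF s(3)] x h_zero bN in simp)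
    then have "lincomb J b (\<lambda>i. cj (emb s * x i)) = 0" by (simp add: vec_def)
    moreover have "cj (emb s * x i) \<in> OB" if "i \<in> J" for i using s(3) OB_cj that by blast
    ultimately have "cj (emb s * x i) = 0"
      using rbasis_indep[OF b, of "\<lambda>i. cj (emb s * x i)" i] i by simp
    then show "x i = 0" using s(2) cj_eq_0_iff emb_eq_0_iff by simp
  qed
  have "\<exists>y. \<forall>j\<in>J. (\<Sum>i\<in>J. y i * G i j) = (if j = k then 1 else 0)"
    by (rule left_inverse_row[OF J]) (rule inj)
  then obtain y where y: "\<forall>j\<in>J. (\<Sum>i\<in>J. y i * G i j) = (if j = k then 1 else 0)" ..
  obtain s where s: "s \<in> OF" "s \<noteq> 0" "\<forall>i\<in>J. emb s * y i \<in> OB" using clear_denominators[OF J] by blast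
  have v: "vec s y \<in> N" using vec(1)[OF s(3)] .
  have hv: "h (vec s y) (b j) = emb s * (if j = k then 1 else 0)" if "j \<in> J" for j
    using vec(2)[OF s(3) that] y that by simp
  \<comment> \<open>All pairings of the scaled vector are divisible by \<open>s\<close>, so the
    self-duality clause removes the scalar again.\<close>
  have "\<exists>x'\<in>N. vec s y = x' \<triangleleft> emb s"
  proof (rule h_perfect[OF v s(1,2)])
    fix z assume "z \<in> N"
    then obtain a where a: "\<And>j. j \<in> J \<Longrightarrow> a j \<in> OB" "z = lincomb J b a" using rbasis_expand[OF b] by blast
    have "h (vec s y) z = (\<Sum>j\<in>J. h (vec s y) (b j) * a j)"
      unfolding a(2) by (rule h_lincomb[OF v bN a(1)])
    also have "\<dots> = (\<Sum>j\<in>J. if j = k then emb s * a k else 0)"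
      by (rule sum.cong[OF refl]) (simp add: hv)
    also have "\<dots> = emb s * a k" using J k by simp
    finally show "\<exists>\<beta>\<in>OB. h (vec s y) z = emb s * \<beta>" using a(1)[OF k] by blast
  qed
  then obtain x' where x': "x' \<in> N" "vec s y = x' \<triangleleft> emb s" by blast
  have "h x' (b j) = (if j = k then 1 else 0)" if "j \<in> J" for j
  proof -
    have "emb s * h x' (b j) = emb s * (if j = k then 1 else 0)"
      using hv[OF that] h_rml[OF x'(1) bN[OF that] OB_emb[OF s(1)]] unfolding x'(2)[symmetric] cj_emb by simp
    then show ?thesis using s(2) emb_eq_0_iff by (simp only: mult_cancel_left) simp
  qed
  then show ?thesis using x'(1) by blast
qed

lemma coefficient:
  assumes b: "rbasis J b N" and k: "k \<in> J" and y: "y \<in> N" "\<forall>j\<in>J. h y (b j) = (if j = k then 1 else 0)"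
    and a: "\<And>j. j \<in> J \<Longrightarrow> a j \<in> OB"
  shows "h y (lincomb J b a) = a k"
proof -
  have J: "finite J" using b by (simp add: rbasis_def)
  have "h y (lincomb J b a) = (\<Sum>j\<in>J. h y (b j) * a j)" by (rule h_lincomb[OF y(1) rbasis_in[OF b] a])
  also have "\<dots> = (\<Sum>j\<in>J. if j = k then a k else 0)" by (rule sum.cong[OF refl]) (simp add: y(2))
  also have "\<dots> = a k" using J k by simp
  finally show ?thesis .
qed

lemma te_c: "te s x \<Longrightarrow> x \<in> N \<Longrightarrow> y \<in> N \<Longrightarrow> te s' y \<Longrightarrow> cj (sig s c) * h x y = h x y * sig s' c"
  using h_lm[of x y c] h_rml[of x y "sig s c"] h_rm[of x y "sig s' c"] c_OB c_OK sig_OK OB_OK pr_K[OF c_K]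
  by (simp add: te_def)

text \<open>\<open>c\<close> is its own adjoint for \<open>pr\<close> but is negated by conjugation,
  so for equal types moving \<open>c\<close> through the pairing produces anticommutation with
  \<open>c\<close>.\<close>

lemma te_same:
  assumes "te s x" "te s y" "x \<in> N" "y \<in> N"
  shows "- (c * h x y) = h x y * c" "ge 1 (h x y)"
proof -
  have "cj (sig s c) * h x y = h x y * sig s c" using te_c assms by blast
  then show 1: "- (c * h x y) = h x y * c"
    using cj_K[OF c_K] cj_K[OF sg_K[OF c_K]] sg_sg[OF c_K] sg_c by (cases s) (simp_all add: sig_def)
  show "ge 1 (h x y)" using anticommuting(2)[OF 1] h_OB assms by blast
qed

lemma te_isotropic: "te s x \<Longrightarrow> x \<in> N \<Longrightarrow> h x x = 0"
  using anticommuting(3)[OF te_same(1), of s x x] h_sym[of x x] self_neg_zero[of "h x x"] by simp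

text \<open>For opposite types the sign from conjugation and the sign from \<open>sig\<close>
  cancel, leaving commutation with \<open>c\<close>.\<close>

lemma te_opposite:
  assumes "te s x" "te (\<not> s) y" "x \<in> N" "y \<in> N"
  shows "h x y \<in> K"
proof (rule commuting_c)
  have "cj (sig s c) * h x y = h x y * sig (\<not> s) c" using te_c assms by blast
  then show "c * h x y = h x y * c"
    using cj_K[OF c_K] cj_K[OF sg_K[OF c_K]] sg_sg[OF c_K] sg_c by (cases s) (simp_all add: sig_def)
qed

lemma h_Pi: "x \<in> N \<Longrightarrow> y \<in> N \<Longrightarrow> h x (PiB \<triangleright> y) = - h (PiB \<triangleright> x) y"
  using h_lmr[of x y PiB] PiB(1) N_lm[of x PiB] h_minus(2)[of "PiB \<triangleright> x" y] by (simp add: pr_Pi minus_lm)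

lemma ty_Pi: "ty s x \<Longrightarrow> PiB \<triangleright> x = x \<triangleleft> PiB"
  using PiB(1) by (simp add: ty_def tau_Pi)

section \<open>The orthogonal complement of a hyperbolic plane\<close>

context
  fixes p q :: 'v and g :: 'b
  assumes pq: "p \<in> N" "q \<in> N" and g: "h p q = g" "inverse g \<in> OB" "g \<noteq> 0" and iso: "h p p = 0" "h q q = 0"
    and st: "\<And>\<alpha>. \<alpha> \<in> OB \<Longrightarrow> \<exists>\<beta>\<in>OB. \<exists>\<delta>\<in>OB. \<alpha> \<triangleright> p = p \<triangleleft> \<beta> + q \<triangleleft> \<delta>"
      "\<And>\<alpha>. \<alpha> \<in> OB \<Longrightarrow> \<exists>\<beta>\<in>OB. \<exists>\<delta>\<in>OB. \<alpha> \<triangleright> q = p \<triangleleft> \<beta> + q \<triangleleft> \<delta>"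
begin

definition perp :: "'v set" where "perp = {x \<in> N. h p x = 0 \<and> h q x = 0}"
text \<open>Both vectors are isotropic, so the coefficient of \<open>p\<close> is read off by
  pairing with \<open>q\<close> and vice versa. Integrality comes from \<open>g\<close> being a
  unit.\<close>

definition proj :: "'v \<Rightarrow> 'v" where
  "proj x = x - (p \<triangleleft> (inverse (cj g) * h q x) + q \<triangleleft> (inverse g * h p x))"

lemma hqp: "h q p = cj g" using h_sym[OF pq(2,1)] g(1) by simp

lemma cg: "cj g \<noteq> 0" "inverse (cj g) \<in> OB"
  using g(3) cj_eq_0_iff OB_cj[OF g(2)] by (auto simp: cj_inverse)

lemma proj_coeffs: "x \<in> N \<Longrightarrow> inverse (cj g) * h q x \<in> OB" "x \<in> N \<Longrightarrow> inverse g * h p x \<in> OB"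
  using h_OB pq g cg OB_mult by blast+

lemma pq_comb:
  assumes "\<beta> \<in> OB" "\<delta> \<in> OB"
  shows "p \<triangleleft> \<beta> + q \<triangleleft> \<delta> \<in> N" "h p (p \<triangleleft> \<beta> + q \<triangleleft> \<delta>) = g * \<delta>" "h q (p \<triangleleft> \<beta> + q \<triangleleft> \<delta>) = cj g * \<beta>"
    "x \<in> N \<Longrightarrow> h (p \<triangleleft> \<beta> + q \<triangleleft> \<delta>) x = cj \<beta> * h p x + cj \<delta> * h q x"
  using assms pq N_rm N_add h_addr h_addl h_rm h_rml by (simp_all add: iso g(1) hqp)

lemma proj_N: "x \<in> N \<Longrightarrow> proj x \<in> N"
  unfolding proj_def using N_diff pq_comb(1)[OF proj_coeffs] by blast

lemma proj_perp: "x \<in> N \<Longrightarrow> proj x \<in> perp"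
proof -
  assume x: "x \<in> N"
  note k = pq_comb[OF proj_coeffs[OF x]]
  have "h p (proj x) = h p x - g * (inverse g * h p x)"
    unfolding proj_def h_diff(1)[OF x k(1) pq(1)] k(2) ..
  moreover have "h q (proj x) = h q x - cj g * (inverse (cj g) * h q x)"
    unfolding proj_def h_diff(1)[OF x k(1) pq(2)] k(3) ..
  ultimately show ?thesis using proj_N[OF x] g(3) cg by (simp add: perp_def mult.assoc[symmetric])
qed

lemma proj_id: "x \<in> perp \<Longrightarrow> proj x = x"
  by (simp add: perp_def proj_def rm_zero)

lemma proj_add: "x \<in> N \<Longrightarrow> y \<in> N \<Longrightarrow> proj (x + y) = proj x + proj y"
  using pq h_addr by (simp add: proj_def distrib_left rm_addr)

lemma proj_rm: "x \<in> N \<Longrightarrow> \<alpha> \<in> OB \<Longrightarrow> proj (x \<triangleleft> \<alpha>) = proj x \<triangleleft> \<alpha>"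
  using pq h_rm by (simp add: proj_def rm_diff rm_add rm_mult[symmetric] mult.assoc)

lemma proj_pq: "\<beta> \<in> OB \<Longrightarrow> \<delta> \<in> OB \<Longrightarrow> proj (p \<triangleleft> \<beta> + q \<triangleleft> \<delta>) = 0"
  using pq_comb[of \<beta> \<delta>] g(3) cg by (simp add: proj_def mult.assoc[symmetric])

lemma proj_p: "proj p = 0" and proj_q: "proj q = 0"
  using proj_pq[OF OB_one OB_zero] proj_pq[OF OB_zero OB_one] by (simp_all add: rm_one rm_zero)

lemma perp_N: "x \<in> perp \<Longrightarrow> x \<in> N" by (simp add: perp_def)

text \<open>Left multiplication on the complement is moved by the adjoint onto \<open>p\<close> and
  \<open>q\<close>, and their span is stable under the left action.\<close>

lemma lat_perp: "lat perp"
proof -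
  have "\<alpha> \<triangleright> x \<in> perp" if x: "x \<in> perp" and a: "\<alpha> \<in> OB" for x \<alpha>
  proof -
    have xN: "x \<in> N" "h p x = 0" "h q x = 0" using x by (auto simp: perp_def)
    obtain \<beta> \<delta> where 1: "\<beta> \<in> OB" "\<delta> \<in> OB" "pr \<alpha> \<triangleright> p = p \<triangleleft> \<beta> + q \<triangleleft> \<delta>" using st(1)[OF pr_OB[OF a]] by blast
    obtain \<beta>' \<delta>' where 2: "\<beta>' \<in> OB" "\<delta>' \<in> OB" "pr \<alpha> \<triangleright> q = p \<triangleleft> \<beta>' + q \<triangleleft> \<delta>'" using st(2)[OF pr_OB[OF a]] by blast
    have "h p (\<alpha> \<triangleright> x) = 0"
      unfolding h_lmr[OF pq(1) xN(1) a] 1(3) pq_comb(4)[OF 1(1,2) xN(1)] xN by simp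
    moreover have "h q (\<alpha> \<triangleright> x) = 0"
      unfolding h_lmr[OF pq(2) xN(1) a] 2(3) pq_comb(4)[OF 2(1,2) xN(1)] xN by simp
    ultimately show ?thesis using N_lm[OF xN(1) a] by (simp add: perp_def)
  qed
  then show ?thesis
    using pq N_zero N_add N_rm h_zero h_addr h_rm by (simp add: lat_def perp_def)
qed

text \<open>\<open>x\<close> differs from its projection by a vector of the plane. The plane is
  stable on the left and is killed by the projection, while the complement is stable and fixed by
  it.\<close>

lemma proj_lm: "x \<in> N \<Longrightarrow> \<alpha> \<in> OB \<Longrightarrow> proj (\<alpha> \<triangleright> x) = \<alpha> \<triangleright> proj x"
proof -
  assume x: "x \<in> N" and a: "\<alpha> \<in> OB"
  define u where "u = p \<triangleleft> (inverse (cj g) * h q x) + q \<triangleleft> (inverse g * h p x)"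
  have u: "u \<in> N" unfolding u_def by (rule pq_comb(1)[OF proj_coeffs[OF x]])
  have xe: "x = proj x + u" by (simp add: proj_def u_def)
  obtain \<beta> \<delta> where 1: "\<beta> \<in> OB" "\<delta> \<in> OB" "\<alpha> \<triangleright> p = p \<triangleleft> \<beta> + q \<triangleleft> \<delta>" using st(1)[OF a] by blast
  obtain \<beta>' \<delta>' where 2: "\<beta>' \<in> OB" "\<delta>' \<in> OB" "\<alpha> \<triangleright> q = p \<triangleleft> \<beta>' + q \<triangleleft> \<delta>'" using st(2)[OF a] by blast
  have "proj (\<alpha> \<triangleright> p) = 0" "proj (\<alpha> \<triangleright> q) = 0" unfolding 1(3) 2(3) using proj_pq 1 2 by simp_all
  then have "proj (\<alpha> \<triangleright> u) = 0"
    unfolding u_def lm_add lm_rm using pq proj_coeffs[OF x] a N_lm N_rm proj_add proj_rm by (simp add: zero_rm)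
  moreover have "proj (\<alpha> \<triangleright> proj x) = \<alpha> \<triangleright> proj x"
    using proj_perp[OF x] lat_perp a by (intro proj_id) (simp add: lat_def)
  moreover have "proj (\<alpha> \<triangleright> x) = proj (\<alpha> \<triangleright> proj x) + proj (\<alpha> \<triangleright> u)"
    using proj_add[OF N_lm[OF proj_N[OF x] a] N_lm[OF u a]] xe by (metis lm_add)
  ultimately show ?thesis by simp
qed

lemma h_proj: "x \<in> perp \<Longrightarrow> y \<in> N \<Longrightarrow> h x (proj y) = h x y"
proof -
  assume x: "x \<in> perp" and y: "y \<in> N"
  have xN: "x \<in> N" "h p x = 0" "h q x = 0" using x by (auto simp: perp_def)
  have "h x p = 0" "h x q = 0" using h_sym[OF xN(1) pq(1)] h_sym[OF xN(1) pq(2)] xN cj_zero by simp_all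
  then have "h x (p \<triangleleft> (inverse (cj g) * h q y) + q \<triangleleft> (inverse g * h p y)) = 0"
    using h_addr h_rm pq xN(1) N_rm proj_coeffs[OF y] by simp
  then show ?thesis
    unfolding proj_def h_diff(1)[OF y pq_comb(1)[OF proj_coeffs[OF y]] xN(1)] by simp
qed

text \<open>For \<open>x\<close> in the complement, pairing with \<open>y\<close> equals pairing
  with \<open>proj y\<close>. A nondegeneracy or divisibility test against the complement is thus a
  test against all of \<open>N\<close>; the quotient by a scalar stays in the complement since B has
  no zero divisors.\<close>

lemma sd_perp: "sd perp h"
proof -
  have nd: "x = 0" if x: "x \<in> perp" "\<forall>y\<in>perp. h x y = 0" for x
  proof (rule h_nondeg[OF perp_N[OF x(1)]])
    fix y assume y: "y \<in> N"
    show "h x y = 0" using h_proj[OF x(1) y] x(2) proj_perp[OF y] by simp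
  qed
  have pf: "\<exists>x'\<in>perp. x = x' \<triangleleft> emb s"
    if x: "x \<in> perp" "s \<in> OF - {0}" "\<forall>y\<in>perp. \<exists>\<beta>\<in>OB. h x y = emb s * \<beta>" for x s
  proof -
    have s: "s \<in> OF" "s \<noteq> 0" using x(2) by auto
    have "\<exists>x'\<in>N. x = x' \<triangleleft> emb s"
    proof (rule h_perfect[OF perp_N[OF x(1)] s])
      fix y assume y: "y \<in> N"
      show "\<exists>\<beta>\<in>OB. h x y = emb s * \<beta>" using x(3) proj_perp[OF y] unfolding h_proj[OF x(1) y, symmetric] by blast
    qed
    then obtain x' where x': "x' \<in> N" "x = x' \<triangleleft> emb s" by blast
    have "h p x' * emb s = 0" "h q x' * emb s = 0"
      using x(1) unfolding h_rm[OF pq(1) x'(1) OB_emb[OF s(1)], symmetric]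
        h_rm[OF pq(2) x'(1) OB_emb[OF s(1)], symmetric] x'(2)[symmetric] by (simp_all add: perp_def)
    then have "x' \<in> perp" using s(2) emb_eq_0_iff x'(1) by (simp add: perp_def)
    then show ?thesis using x'(2) by blast
  qed
  show ?thesis
    unfolding sd_def
  proof (intro conjI)
    show "\<forall>x\<in>perp. \<forall>y\<in>perp. \<forall>z\<in>perp. h (x + y) z = h x z + h y z" using h_addl perp_N by simp
    show "\<forall>x\<in>perp. \<forall>y\<in>perp. h x y = cj (h y x)" using h_sym perp_N by blast
    show "\<forall>x\<in>perp. \<forall>y\<in>perp. \<forall>\<alpha>\<in>OB. h x (y \<triangleleft> \<alpha>) = h x y * \<alpha>" using h_rm perp_N by simp
    show "\<forall>x\<in>perp. \<forall>y\<in>perp. \<forall>\<alpha>\<in>OB. h (\<alpha> \<triangleright> x) y = h x (pr \<alpha> \<triangleright> y)" using h_lm perp_N by simp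
    show "\<forall>x\<in>perp. \<forall>y\<in>perp. h x y \<in> OB" using h_OB perp_N by simp
  qed (use lat_perp nd pf in \<open>assumption | blast\<close>)+
qed

lemma perp_orth: "x \<in> perp \<Longrightarrow> h p x = 0 \<and> h q x = 0 \<and> h x p = 0 \<and> h x q = 0"
  using h_sym[of x p] h_sym[of x q] pq by (simp add: perp_def cj_zero)

lemma proj_basis:
  assumes b: "rbasis J b N" and I: "i1 \<in> J" "i2 \<in> J" "i1 \<noteq> i2" "b i1 = p" "b i2 = q"
  shows "rbasis (J - {i1, i2}) (\<lambda>j. proj (b j)) perp"
proof (rule rbasis_complement[OF b lat_perp])
  show "perp \<subseteq> N" by (auto simp: perp_def)
  show "{i1, i2} \<subseteq> J" using I by simp
  show "proj x \<in> perp" if "x \<in> N" for x using proj_perp[OF that] .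
  show "proj x = x" if "x \<in> perp" for x using proj_id[OF that] .
  show "proj (b i) = 0" if "i \<in> {i1, i2}" for i using that I proj_p proj_q by auto
  show "\<exists>a. (\<forall>i\<in>{i1, i2}. a i \<in> OB) \<and> x - proj x = lincomb {i1, i2} b a" if x: "x \<in> N" for x
    using I proj_coeffs[OF x]
    by (intro exI[of _ "\<lambda>i. if i = i1 then inverse (cj g) * h q x else inverse g * h p x"])
      (simp add: proj_def lincomb_def)
next
  fix a :: "'a \<Rightarrow> 'b" assume a: "\<And>j. j \<in> J \<Longrightarrow> a j \<in> OB"
  have bN: "b j \<in> N" if "j \<in> J" for j using rbasis_in[OF b that] .
  have "proj (lincomb J' b a) = lincomb J' (\<lambda>j. proj (b j)) a" if "finite J'" "J' \<subseteq> J" for J'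
    using that
  proof (induction J' rule: finite_induct)
    case empty
    then show ?case using proj_pq[OF OB_zero OB_zero] by (simp add: lincomb_def rm_zero)
  next
    case (insert j J')
    have "lincomb J' b a \<in> N" by (rule lat_lincomb[OF lat]) (use insert bN a in auto)
    then show ?case using insert bN a N_rm proj_add proj_rm by (simp add: lincomb_def)
  qed
  then show "proj (lincomb J b a) = lincomb J (\<lambda>j. proj (b j)) a" using b by (simp add: rbasis_def)
qed

lemma extend_basis:
  assumes b: "rbasis J b perp" and I: "i1 \<notin> J" "i2 \<notin> J" "i1 \<noteq> i2"
  shows "rbasis (insert i1 (insert i2 J)) (b(i1 := p, i2 := q)) N"
proof -
  have J: "finite J" using b by (simp add: rbasis_def)
  let ?b = "b(i1 := p, i2 := q)"
  have e: "lincomb (insert i1 (insert i2 J)) ?b a = p \<triangleleft> a i1 + q \<triangleleft> a i2 + lincomb J b a" for a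
  proof -
    have "lincomb J ?b a = lincomb J b a" by (rule lincomb_cong) (use I in auto)
    then show ?thesis using I J unfolding lincomb_def by (simp add: add.assoc)
  qed
  show ?thesis
  proof (rule rbasisI)
    show "finite (insert i1 (insert i2 J))" using J by simp
  next
    fix a :: "'a \<Rightarrow> 'b" assume a: "\<And>j. j \<in> insert i1 (insert i2 J) \<Longrightarrow> a j \<in> OB"
    have "lincomb J b a \<in> perp" by (rule lat_lincomb[OF lat_perp rbasis_in[OF b]]) (use a in auto)
    then show "lincomb (insert i1 (insert i2 J)) ?b a \<in> N"
      unfolding e using N_add pq_comb(1)[of "a i1" "a i2"] a perp_N by simp
  next
    fix x assume x: "x \<in> N"
    obtain y where y: "\<And>j. j \<in> J \<Longrightarrow> y j \<in> OB" "proj x = lincomb J b y"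
      using rbasis_expand[OF b proj_perp[OF x]] by blast
    define a where "a = y(i1 := inverse (cj g) * h q x, i2 := inverse g * h p x)"
    have "lincomb J b a = proj x" unfolding y(2) by (rule lincomb_cong) (use I in \<open>auto simp: a_def\<close>)
    then have "x = lincomb (insert i1 (insert i2 J)) ?b a"
      unfolding e using I by (simp add: a_def proj_def)
    moreover have "\<forall>j\<in>insert i1 (insert i2 J). a j \<in> OB" using y(1) proj_coeffs[OF x] by (simp add: a_def)
    ultimately show "\<exists>a. (\<forall>j\<in>insert i1 (insert i2 J). a j \<in> OB) \<and> x = lincomb (insert i1 (insert i2 J)) ?b a"
      by (intro exI[of _ a] conjI)
  next
    fix a :: "'a \<Rightarrow> 'b" and j assume a: "\<And>j. j \<in> insert i1 (insert i2 J) \<Longrightarrow> a j \<in> OB"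
      and z: "lincomb (insert i1 (insert i2 J)) ?b a = 0" and j: "j \<in> insert i1 (insert i2 J)"
    have aJ: "a j \<in> OB" if "j \<in> J" for j using a that by simp
    have a12: "a i1 \<in> OB" "a i2 \<in> OB" using a by auto
    have l: "lincomb J b a \<in> perp" by (rule lat_lincomb[OF lat_perp rbasis_in[OF b] aJ])
    have s: "p \<triangleleft> a i1 + q \<triangleleft> a i2 + lincomb J b a = 0" using z unfolding e .
    have "h p (p \<triangleleft> a i1 + q \<triangleleft> a i2 + lincomb J b a) = g * a i2"
      unfolding h_addr[OF pq_comb(1)[OF a12] perp_N[OF l] pq(1)] pq_comb(2)[OF a12] using perp_orth[OF l] by simp
    then have a2: "a i2 = 0" unfolding s using g(3) h_zero(1)[OF pq(1)] by simp
    have "h q (p \<triangleleft> a i1 + q \<triangleleft> a i2 + lincomb J b a) = cj g * a i1"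
      unfolding h_addr[OF pq_comb(1)[OF a12] perp_N[OF l] pq(2)] pq_comb(3)[OF a12] using perp_orth[OF l] by simp
    then have a1: "a i1 = 0" unfolding s using cg h_zero(1)[OF pq(2)] by simp
    have "lincomb J b a = 0" using s a1 a2 by (simp add: rm_zero)
    then have "a j = 0" if "j \<in> J" for j using rbasis_indep[OF b, of a j] aJ that by simp
    then show "a j = 0" using j a1 a2 by blast
  qed
qed

lemma proj_ty: "x \<in> N \<Longrightarrow> ty s x \<Longrightarrow> ty s (proj x)"
  unfolding ty_def using proj_lm[of x, symmetric] proj_rm[of x, symmetric] tau_OB by simp

lemma proj_te: "x \<in> N \<Longrightarrow> te s x \<Longrightarrow> te s (proj x)"
  unfolding te_def using proj_lm[of x, symmetric] proj_rm[of x, symmetric] sig_OK OB_OK by simp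

text \<open>After the exchange only the slots outside \<open>J'\<close> may have lost their kind, so
  types are taken from the old basis \<open>b\<close>. Removing both members of an E-F pair, or
  neither, keeps the pairing of indices intact.\<close>

lemma proj_typed:
  assumes bN: "\<And>j. j \<in> J \<Longrightarrow> b j \<in> N" and t: "typed J b" and J': "J' \<subseteq> J"
    "\<And>s i. (EK s, i) \<in> J' \<longleftrightarrow> (FK s, i) \<in> J'" and b': "\<And>j. j \<in> J' \<Longrightarrow> b' j = b j"
  shows "typed J' (\<lambda>j. proj (b' j))"
  unfolding typed_def
proof (intro conjI allI impI)
  fix s i
  show "ty s (proj (b' (GK s, i)))" if "(GK s, i) \<in> J'"
    using that proj_ty bN t J' b' by (metis (no_types) subsetD typed_def)
  show "te s (proj (b' (EK s, i)))" if "(EK s, i) \<in> J'"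
    using that proj_te bN t J' b' by (metis (no_types) subsetD typed_def)
  show F: "(FK s, i) \<in> J'" if "(EK s, i) \<in> J'" using J'(2) that by simp
  show "proj (b' (FK s, i)) = PiB \<triangleright> proj (b' (EK s, i))" if E: "(EK s, i) \<in> J'"
  proof -
    have "b (FK s, i) = PiB \<triangleright> b (EK s, i)" using t E J'(1) unfolding typed_def by blast
    then show ?thesis using b'[OF E] b'[OF F[OF E]] proj_lm[OF bN PiB(1)] E J'(1) by auto
  qed
  show "(EK s, i) \<in> J'" if "(FK s, i) \<in> J'" using J'(2) that by simp
qed

end

section \<open>Typed bases, types of dual vectors, and exchange\<close>

lemma typed_Pi:
  assumes t: "typed J b" and j: "j \<in> J"
  shows "PiB \<triangleright> b j = (case j of (GK s, i) \<Rightarrow> b j \<triangleleft> PiB | (EK s, i) \<Rightarrow> b (FK s, i)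
    | (FK s, i) \<Rightarrow> b (EK s, i) \<triangleleft> emb \<pi>)"
proof -
  obtain k i where ji: "j = (k, i)" by (cases j)
  show ?thesis
  proof (cases k)
    case (GK s)
    then have "ty s (b j)" using t j ji unfolding typed_def by blast
    then show ?thesis using ty_Pi ji GK by simp
  next
    case (EK s)
    then have "b (FK s, i) = PiB \<triangleright> b j" using t j ji unfolding typed_def by blast
    then show ?thesis using ji EK by simp
  next
    case (FK s)
    then have "(EK s, i) \<in> J" using t j ji unfolding typed_def by blast
    then have "b j = PiB \<triangleright> b (EK s, i)" using t ji FK unfolding typed_def by blast
    then have "PiB \<triangleright> b j = emb \<pi> \<triangleright> b (EK s, i)" by (simp add: lm_mult[symmetric] PiB(3))
    then show ?thesis using ji FK by (simp add: lm_emb)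
  qed
qed

text \<open>The character by which O_K acts on a basis vector of the given kind; it flips on
  \<open>FK\<close> because \<open>\<Pi>\<close> conjugates K by \<open>sg\<close>.\<close>

fun parity :: "kind \<Rightarrow> bool" where
  "parity (GK s) = s" | "parity (EK s) = s" | "parity (FK s) = (\<not> s)"

lemma typed_te:
  assumes t: "typed J b" and j: "(k, i) \<in> J"
  shows "te (parity k) (b (k, i))"
proof (cases k)
  case (GK s)
  then show ?thesis using t j ty_te unfolding typed_def by simp
next
  case (EK s)
  then show ?thesis using t j unfolding typed_def by simp
next
  case (FK s)
  then have "(EK s, i) \<in> J" using t j unfolding typed_def by simp
  then have "te s (b (EK s, i))" "b (FK s, i) = PiB \<triangleright> b (EK s, i)" using t unfolding typed_def by simp_all
  then show ?thesis using te_Pi FK by simp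
qed

text \<open>The non-units of O_B form a two-sided ideal, so a sum of products outside it has a term
  whose two factors are both units.\<close>

lemma unit_summand:
  assumes "finite J" "\<not> ge 1 (\<Sum>j\<in>J. f j * a j)" "\<And>j. j \<in> J \<Longrightarrow> f j \<in> OB \<and> a j \<in> OB"
  shows "\<exists>j\<in>J. \<not> ge 1 (f j) \<and> \<not> ge 1 (a j)"
proof (rule ccontr)
  assume n: "\<not> ?thesis"
  have "ge 1 (f j * a j)" if "j \<in> J" for j
    using n that ge_mult1l[of "f j" "a j"] ge_mult1r[of "f j" "a j"] assms(3)[OF that] OB_iff by blast
  then have "ge 1 (\<Sum>j\<in>J. f j * a j)" by (rule vge_sum[OF vB(1)])
  then show False using assms(2) by contradiction
qed

text \<open>The \<open>E\<close>-coefficient of a vector is the \<open>F\<close>-coefficient of its image under \<open>\<Pi>\<close>.\<close>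

lemma Pi_coefficient:
  assumes b: "rbasis J b N" and t: "typed J b" and E: "(EK s, i) \<in> J"
    and d: "d \<in> N" "\<forall>j\<in>J. h d (b j) = (if j = (FK s, i) then 1 else 0)"
    and a: "\<And>j. j \<in> J \<Longrightarrow> a j \<in> OB"
  shows "h d (PiB \<triangleright> lincomb J b a) = a (EK s, i)"
proof -
  have J: "finite J" using b by (simp add: rbasis_def)
  have bN: "b j \<in> N" if "j \<in> J" for j using rbasis_in[OF b that] .
  have PN: "PiB \<triangleright> b j \<in> N" if "j \<in> J" for j using N_lm[OF bN[OF that] PiB(1)] .
  have "PiB \<triangleright> lincomb J b a = lincomb J (\<lambda>j. PiB \<triangleright> b j) a"
    unfolding lincomb_def lm_sum by (simp add: lm_rm)
  then have "h d (PiB \<triangleright> lincomb J b a) = (\<Sum>j\<in>J. h d (PiB \<triangleright> b j) * a j)"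
    using h_lincomb[OF d(1), of J "\<lambda>j. PiB \<triangleright> b j" a] PN a by simp
  also have "\<dots> = (\<Sum>j\<in>J. if j = (EK s, i) then a (EK s, i) else 0)"
  proof (rule sum.cong[OF refl])
    fix j assume j: "j \<in> J"
    \<comment> \<open>\<open>\<Pi>\<close> sends a \<open>GK\<close> vector or an \<open>FK\<close>
      vector to a right multiple of a \<open>GK\<close> or \<open>EK\<close> vector, both invisible
      to \<open>d\<close>; only the partner of the chosen \<open>FK\<close> vector is carried onto
      it.\<close>
    have "h d (PiB \<triangleright> b j) = (if j = (EK s, i) then 1 else 0)"
    proof -
      obtain k l where kl: "j = (k, l)" by (cases j)
      show ?thesis
      proof (cases k)
        case (GK s')
        then show ?thesis using typed_Pi[OF t j] kl d j h_rm[OF d(1) bN[OF j] PiB(1)] by simp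
      next
        case (EK s')
        then have F: "(FK s', l) \<in> J" using t j kl unfolding typed_def by blast
        show ?thesis using typed_Pi[OF t j] kl EK d(2) F by simp
      next
        case (FK s')
        then have E': "(EK s', l) \<in> J" using t j kl unfolding typed_def by blast
        have "emb \<pi> \<in> OB" using ge_pi vge_mono[OF vB(1), of 1 "emb \<pi>" 0] OB_iff by simp
        then show ?thesis using typed_Pi[OF t j] kl FK d(2) E' h_rm[OF d(1) bN[OF E']] by simp
      qed
    qed
    then show "h d (PiB \<triangleright> b j) * a j = (if j = (EK s, i) then a (EK s, i) else 0)" by simp
  qed
  also have "\<dots> = a (EK s, i)" using J E by simp
  finally show ?thesis .
qed

lemma te_mult_zero:
  assumes "te s x" "x \<in> N" "y \<in> N" "h y x = 0" "a \<in> OK"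
  shows "h y (a \<triangleright> x) = 0"
  using assms h_rm[of y x "sig s a"] sig_OK OB_OK by (simp add: te_def)

text \<open>A vector is determined by its pairings with a basis. The adjoint shifts the left action
  onto the basis, where \<open>y\<close> sees only the chosen \<open>GK\<close> vector because every
  E-F pair spans a stable submodule; \<open>cj_tau\<close> then turns the type \<open>s\<close> of
  that vector into the opposite type of \<open>y\<close>.\<close>

lemma dual_of_ty:
  assumes b: "rbasis J b N" and t: "typed J b" and G: "(GK s, i) \<in> J"
    and y: "y \<in> N" "\<forall>j\<in>J. h y (b j) = (if j = (GK s, i) then 1 else 0)"
  shows "ty (\<not> s) y"
  unfolding ty_def
proof
  fix \<alpha> assume \<alpha>: "\<alpha> \<in> OB"
  have bN: "b j \<in> N" if "j \<in> J" for j using rbasis_in[OF b that] .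
  have tb: "ty s (b (GK s, i))" using t G unfolding typed_def by blast
  have main: "h y (\<beta> \<triangleright> b j) = (if j = (GK s, i) then tau s \<beta> else 0)" if j: "j \<in> J" and \<beta>: "\<beta> \<in> OB" for j \<beta>
  proof -
    obtain k l where kl: "j = (k, l)" by (cases j)
    \<comment> \<open>An arbitrary scalar is \<open>k1 \<beta> + k2 \<beta> * PiB\<close>, so it
      suffices that \<open>y\<close> is orthogonal to the vector and to its image under
      \<open>\<Pi>\<close>.\<close>
    have gen: "h y (\<beta> \<triangleright> b j) = 0" if z: "h y (b j) = 0" and Pz: "\<exists>s'. te s' (PiB \<triangleright> b j) \<and> h y (PiB \<triangleright> b j) = 0"
    proof -
      obtain s' where s': "te s' (PiB \<triangleright> b j)" "h y (PiB \<triangleright> b j) = 0" using Pz by blast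
      have K: "k1 \<beta> \<in> OK" "k2 \<beta> \<in> OK" using k12_OK[OF \<beta>] by blast+
      have tj: "te (parity k) (b j)" using typed_te[OF t] j kl by simp
      have "h y (k1 \<beta> \<triangleright> b j) = 0" by (rule te_mult_zero[OF tj bN[OF j] y(1) z K(1)])
      moreover have "h y (k2 \<beta> \<triangleright> (PiB \<triangleright> b j)) = 0"
        by (rule te_mult_zero[OF s'(1) N_lm[OF bN[OF j] PiB(1)] y(1) s'(2) K(2)])
      moreover have "\<beta> \<triangleright> b j = k1 \<beta> \<triangleright> b j + k2 \<beta> \<triangleright> (PiB \<triangleright> b j)"
        by (subst k12(3)[of \<beta>]) (simp add: lm_addl lm_mult)
      ultimately show ?thesis
        using h_addr[OF N_lm[OF bN[OF j] OB_OK[OF K(1)]] N_lm[OF N_lm[OF bN[OF j] PiB(1)] OB_OK[OF K(2)]] y(1)]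
        by simp
    qed
    have tP: "te (\<not> parity k) (PiB \<triangleright> b j)" using te_Pi[OF typed_te[OF t]] j kl by simp
    show ?thesis
    proof (cases k)
      case (GK s')
      then have "\<beta> \<triangleright> b j = b j \<triangleleft> tau s' \<beta>" using t j kl \<beta> unfolding typed_def ty_def by blast
      then show ?thesis using h_rm[OF y(1) bN[OF j] tau_OB[OF \<beta>]] y(2) j kl GK by simp
    next
      case (EK s')
      then have F: "(FK s', l) \<in> J" using t j kl unfolding typed_def by blast
      have "h y (PiB \<triangleright> b j) = 0" using typed_Pi[OF t j] kl EK y(2) F by simp
      then show ?thesis using gen tP y(2) j kl EK by auto
    next
      case (FK s')
      then have E': "(EK s', l) \<in> J" using t j kl unfolding typed_def by blast
      have "emb \<pi> \<in> OB" using ge_pi vge_mono[OF vB(1), of 1 "emb \<pi>" 0] OB_iff by simp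
      then have "h y (PiB \<triangleright> b j) = 0" using typed_Pi[OF t j] kl FK y(2) E' h_rm[OF y(1) bN[OF E']] by simp
      then show ?thesis using gen tP y(2) j kl FK by auto
    qed
  qed
  show "\<alpha> \<triangleright> y = y \<triangleleft> tau (\<not> s) \<alpha>"
  proof (rule h_ext[OF b N_lm[OF y(1) \<alpha>] N_rm[OF y(1) tau_OB[OF \<alpha>]]])
    fix j assume j: "j \<in> J"
    have "h (\<alpha> \<triangleright> y) (b j) = h y (pr \<alpha> \<triangleright> b j)" by (rule h_lm[OF y(1) bN[OF j] \<alpha>])
    also have "\<dots> = (if j = (GK s, i) then tau s (pr \<alpha>) else 0)" by (rule main[OF j pr_OB[OF \<alpha>]])
    also have "\<dots> = h (y \<triangleleft> tau (\<not> s) \<alpha>) (b j)"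
      using h_rml[OF y(1) bN[OF j] tau_OB[OF \<alpha>]] cj_tau y(2) j by simp
    finally show "h (\<alpha> \<triangleright> y) (b j) = h (y \<triangleleft> tau (\<not> s) \<alpha>) (b j)" .
  qed
qed

text \<open>Two flips cancel: O_K acts on the \<open>FK s\<close> vector through the opposite
  character, and conjugation in the first argument flips once more. The dual of
  \<open>\<Pi> e\<close> therefore has the type of \<open>e\<close>.\<close>

lemma dual_of_F:
  assumes b: "rbasis J b N" and t: "typed J b" and Fj: "(FK s, i) \<in> J"
    and y: "y \<in> N" "\<forall>j\<in>J. h y (b j) = (if j = (FK s, i) then 1 else 0)"
  shows "te s y"
  unfolding te_def
proof
  fix a assume a: "a \<in> OK"
  have bN: "b j \<in> N" if "j \<in> J" for j using rbasis_in[OF b that] .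
  show "a \<triangleright> y = y \<triangleleft> sig s a"
  proof (rule h_ext[OF b N_lm[OF y(1) OB_OK[OF a]] N_rm[OF y(1) OB_OK[OF sig_OK[OF a]]]])
    fix j assume j: "j \<in> J"
    obtain k l where kl: "j = (k, l)" by (cases j)
    have tj: "te (parity k) (b j)" using typed_te[OF t] j kl by simp
    have "h (a \<triangleright> y) (b j) = h y (a \<triangleright> b j)"
      using h_lm[OF y(1) bN[OF j] OB_OK[OF a]] pr_K[OF OK_K[OF a]] by simp
    also have "\<dots> = h y (b j) * sig (parity k) a"
      using tj a h_rm[OF y(1) bN[OF j] OB_OK[OF sig_OK[OF a]]] by (simp add: te_def)
    also have "\<dots> = cj (sig s a) * h y (b j)"
    proof (cases "k = FK s \<and> l = i")
      case True
      then show ?thesis using y(2) j cj_sig[OF OK_K[OF a], of s] unfolding kl by simp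
    next
      case False
      then have "h y (b j) = 0" using y(2) j unfolding kl by auto
      then show ?thesis by simp
    qed
    also have "\<dots> = h (y \<triangleleft> sig s a) (b j)"
      by (rule h_rml[OF y(1) bN[OF j] OB_OK[OF sig_OK[OF a]], symmetric])
    finally show "h (a \<triangleright> y) (b j) = h (y \<triangleleft> sig s a) (b j)" .
  qed
qed

text \<open>The coefficient is the pairing of \<open>z\<close> with the dual of the
  \<open>FK s\<close> vector, and these two vectors have the same type.\<close>

lemma F_coefficient_nonunit:
  assumes b: "rbasis J b N" and t: "typed J b" and Fj: "(FK s, i) \<in> J" and z: "z \<in> N" "te s z"
    and a: "\<And>j. j \<in> J \<Longrightarrow> a j \<in> OB" "z = lincomb J b a"
  shows "ge 1 (a (FK s, i))"
proof -
  obtain d where d: "d \<in> N" "\<forall>j\<in>J. h d (b j) = (if j = (FK s, i) then 1 else 0)"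
    using dual_vector[OF b Fj] by blast
  have "te s d" by (rule dual_of_F[OF b t Fj d])
  then have "ge 1 (h d z)" using te_same(2) z d(1) by blast
  moreover have "h d z = a (FK s, i)" unfolding a(2) by (rule coefficient[OF b Fj d a(1)])
  ultimately show ?thesis by simp
qed

text \<open>Exchange: a generator of the opposite type can be replaced by the dual of a generator
  of type \<open>GK s\<close>, because every other summand contributes a non-unit to \<open>h x y = 1\<close>.\<close>

lemma split_G:
  assumes b: "rbasis J b N" and t: "typed J b" and G: "(GK s, i) \<in> J"
  shows "\<exists>y k. (GK (\<not> s), k) \<in> J \<and> y \<in> N \<and> ty (\<not> s) y \<and> h (b (GK s, i)) y = 1 \<and>
    rbasis J (b((GK (\<not> s), k) := y)) N"
proof -
  have J: "finite J" using b by (simp add: rbasis_def)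
  have bN: "b j \<in> N" if "j \<in> J" for j using rbasis_in[OF b that] .
  define x where "x = b (GK s, i)"
  have x: "x \<in> N" "ty s x" using bN[OF G] t G unfolding typed_def x_def by blast+
  have xe: "te s x" using ty_te x by blast
  obtain y where y: "y \<in> N" "\<forall>j\<in>J. h y (b j) = (if j = (GK s, i) then 1 else 0)"
    using dual_vector[OF b G] by blast
  have yt: "ty (\<not> s) y" by (rule dual_of_ty[OF b t G y])
  have "h y x = 1" using y(2) G by (simp add: x_def)
  then have xy: "h x y = 1" using h_sym[OF x(1) y(1)] cj_one by simp
  obtain a where a: "\<And>j. j \<in> J \<Longrightarrow> a j \<in> OB" "y = lincomb J b a" using rbasis_expand[OF b y(1)] by blast
  have "h x y = (\<Sum>j\<in>J. h x (b j) * a j)" unfolding a(2) by (rule h_lincomb[OF x(1) bN a(1)])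
  then have "\<not> ge 1 (\<Sum>j\<in>J. h x (b j) * a j)" using xy by (simp add: vge_def val_one[OF vB(1)])
  then obtain j where j: "j \<in> J" "\<not> ge 1 (h x (b j))" "\<not> ge 1 (a j)"
    using unit_summand[OF J, of "\<lambda>j. h x (b j)" a] h_OB[OF x(1) bN] a(1) by blast
  obtain k l where kl: "j = (k, l)" by (cases j)
  have "k = GK (\<not> s)"
  proof (cases k)
    case (GK s')
    have "s' \<noteq> s"
    proof
      assume "s' = s"
      then have "te s (b j)" using typed_te[OF t] j kl GK by force
      then show False using te_same(2)[OF xe _ x(1) bN[OF j(1)]] j by blast
    qed
    then show ?thesis using GK by simp
  next
    case (EK s')
    have E: "(EK s', l) \<in> J" "(FK s', l) \<in> J" using t j kl EK unfolding typed_def by blast+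
    obtain d where d: "d \<in> N" "\<forall>j\<in>J. h d (b j) = (if j = (FK s', l) then 1 else 0)"
      using dual_vector[OF b E(2)] by blast
    \<comment> \<open>The \<open>EK\<close> coefficient of \<open>y\<close> is the \<open>FK\<close>
      coefficient of \<open>\<Pi> y = y \<Pi>\<close>, hence a multiple of
      \<open>\<Pi>\<close>.\<close>
    have "a (EK s', l) = h d (PiB \<triangleright> y)"
      unfolding a(2) by (rule Pi_coefficient[OF b t E(1) d a(1), symmetric])
    also have "\<dots> = h d y * PiB" unfolding ty_Pi[OF yt] by (rule h_rm[OF d(1) y(1) PiB(1)])
    finally have "ge 1 (a (EK s', l))" using ge_mult1r[OF _ ge_Pi] h_OB[OF d(1) y(1)] OB_iff by simp
    then show ?thesis using j kl EK by simp
  next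
    case (FK s')
    have E: "(EK s', l) \<in> J" using t j kl FK unfolding typed_def by blast
    have "b j = PiB \<triangleright> b (EK s', l)" using t E kl FK unfolding typed_def by blast
    \<comment> \<open>Now the other factor is a non-unit: \<open>\<Pi>\<close> moves from
      \<open>b j\<close> to \<open>x\<close>, where it acts as right multiplication and comes out of
      the pairing.\<close>
    then have "h x (b j) = - h (x \<triangleleft> PiB) (b (EK s', l))"
      using h_Pi[OF x(1) bN[OF E]] ty_Pi[OF x(2)] by simp
    also have "\<dots> = PiB * h x (b (EK s', l))" using h_rml[OF x(1) bN[OF E] PiB(1)] by (simp add: cj_Pi)
    finally have "ge 1 (h x (b j))" using ge_mult1l[OF ge_Pi] h_OB[OF x(1) bN[OF E]] OB_iff by simp
    then show ?thesis using j by simp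
  qed
  then have k: "(GK (\<not> s), l) \<in> J" "\<not> ge 1 (a (GK (\<not> s), l))" using j kl by auto
  have "rbasis J (b((GK (\<not> s), l) := y)) N" by (rule rbasis_exchange[OF b lat a k])
  then show ?thesis using k(1) y(1) yt xy unfolding x_def by blast
qed

lemma Pi_form:
  assumes "te s x" "x \<in> N"
  shows "h x (PiB \<triangleright> x) \<in> K" "cj (h x (PiB \<triangleright> x)) = - h x (PiB \<triangleright> x)"
proof -
  have P: "PiB \<triangleright> x \<in> N" using N_lm[OF assms(2) PiB(1)] .
  show "h x (PiB \<triangleright> x) \<in> K" by (rule te_opposite[OF assms(1) te_Pi[OF assms(1)] assms(2) P])
  have "h (PiB \<triangleright> x) x = cj (h x (PiB \<triangleright> x))" by (rule h_sym[OF P assms(2)])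
  then show "cj (h x (PiB \<triangleright> x)) = - h x (PiB \<triangleright> x)" using h_Pi[OF assms(2,2)] by simp
qed

text \<open>The dual \<open>y\<close> of \<open>\<Pi> e\<close> has the type of \<open>e\<close>,
  with cross pairings 1 and -1. If neither \<open>e\<close> nor \<open>y\<close> works, twisting
  \<open>y\<close> by a residue generator \<open>\<theta>\<close> of O_K makes the cross terms of
  the sum contribute the unit \<open>sg \<theta> - \<theta>\<close>.\<close>

lemma unit_Pi_form:
  assumes b: "rbasis J b N" and t: "typed J b" and E: "(EK s, i) \<in> J"
  shows "\<exists>z\<in>N. te s z \<and> \<not> ge 1 (h z (PiB \<triangleright> z))"
proof -
  have Fj: "(FK s, i) \<in> J" and eF: "b (FK s, i) = PiB \<triangleright> b (EK s, i)" and ee: "te s (b (EK s, i))"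
    using t E unfolding typed_def by blast+
  define e where "e = b (EK s, i)"
  have e: "e \<in> N" "te s e" "PiB \<triangleright> e \<in> N" using rbasis_in[OF b E] ee N_lm PiB(1) by (auto simp: e_def)
  obtain y where y: "y \<in> N" "\<forall>j\<in>J. h y (b j) = (if j = (FK s, i) then 1 else 0)"
    using dual_vector[OF b Fj] by blast
  have yt: "te s y" by (rule dual_of_F[OF b t Fj y])
  have yN: "PiB \<triangleright> y \<in> N" using N_lm[OF y(1) PiB(1)] .
  have "h y (b (FK s, i)) = 1" using y(2) Fj by simp
  then have ye: "h y (PiB \<triangleright> e) = 1" unfolding eF e_def .
  have ey: "h e (PiB \<triangleright> y) = - 1"
    using h_Pi[OF e(1) y(1)] h_sym[OF e(3) y(1)] ye cj_one by simp
  show ?thesis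
  proof (cases "ge 1 (h e (PiB \<triangleright> e)) \<and> ge 1 (h y (PiB \<triangleright> y))")
    case False
    then show ?thesis using e y yt by blast
  next
    case True
    obtain \<theta> where th: "\<theta> \<in> OK" "\<not> ge 1 (\<theta> - sg \<theta>)" using unramified_generator by blast
    have thO: "\<theta> \<in> OB" "cj \<theta> = sg \<theta>" "sg \<theta> \<in> OB"
      using th OB_OK cj_K OK_K OB_cj[OF OB_OK[OF th(1)]] by auto
    \<comment> \<open>Right multiplication by an element of K preserves the type. Without the factor
      \<open>\<theta>\<close> the two cross terms would cancel.\<close>
    define w where "w = y \<triangleleft> \<theta>"
    have w: "w \<in> N" "PiB \<triangleright> w \<in> N" "PiB \<triangleright> w = PiB \<triangleright> y \<triangleleft> \<theta>"
      using N_rm[OF y(1) thO(1)] N_lm[OF N_rm[OF y(1) thO(1)] PiB(1)] by (simp_all add: w_def lm_rm)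
    have "te s w"
      unfolding te_def
    proof
      fix a assume a: "a \<in> OK"
      have "a \<triangleright> w = y \<triangleleft> (sig s a * \<theta>)" using yt a by (simp add: w_def lm_rm te_def rm_mult)
      also have "sig s a * \<theta> = \<theta> * sig s a" by (rule K_comm[OF sig_K[OF OK_K[OF a]] OK_K[OF th(1)]])
      finally show "a \<triangleright> w = w \<triangleleft> sig s a" by (simp add: w_def rm_mult)
    qed
    then have te: "te s (e + w)" using e(2) by (simp add: te_def lm_add rm_add)
    have hw: "h w u = sg \<theta> * h y u" if "u \<in> N" for u
      using h_rml[OF y(1) that thO(1)] thO(2) by (simp add: w_def)
    have hw': "h u (PiB \<triangleright> w) = h u (PiB \<triangleright> y) * \<theta>" if "u \<in> N" for u
      unfolding w(3) by (rule h_rm[OF that yN thO(1)])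
    have "h (e + w) (PiB \<triangleright> (e + w)) =
        h e (PiB \<triangleright> e) + h e (PiB \<triangleright> w) + (h w (PiB \<triangleright> e) + h w (PiB \<triangleright> w))"
      unfolding lm_add using h_addl[OF e(1) w(1) N_add[OF e(3) w(2)]]
        h_addr[OF e(3) w(2) e(1)] h_addr[OF e(3) w(2) w(1)] by simp
    also have "\<dots> = h e (PiB \<triangleright> e) + sg \<theta> * h y (PiB \<triangleright> y) * \<theta> - (\<theta> - sg \<theta>)"
      unfolding hw'[OF e(1)] hw'[OF w(1)] hw[OF e(3)] hw[OF yN] ye ey by (simp add: algebra_simps)
    finally have eq: "h (e + w) (PiB \<triangleright> (e + w)) =
      h e (PiB \<triangleright> e) + sg \<theta> * h y (PiB \<triangleright> y) * \<theta> - (\<theta> - sg \<theta>)" .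
    have "ge 1 (sg \<theta> * h y (PiB \<triangleright> y) * \<theta>)"
      using ge_mult1l[OF ge_mult1r] True thO OB_iff by blast
    then have g: "ge 1 (h e (PiB \<triangleright> e) + sg \<theta> * h y (PiB \<triangleright> y) * \<theta>)"
      using True vge_add[OF vB(1)] by blast
    have "\<not> ge 1 (h (e + w) (PiB \<triangleright> (e + w)))"
    proof
      assume "ge 1 (h (e + w) (PiB \<triangleright> (e + w)))"
      from vge_diff[OF vB(1) g this] have "ge 1 (\<theta> - sg \<theta>)" unfolding eq by simp
      then show False using th(2) by contradiction
    qed
    then show ?thesis using te N_add[OF e(1) w(1)] by blast
  qed
qed

text \<open>Both \<open>k\<close> and \<open>c\<close> are negated by \<open>sg\<close>, so their
  quotient is a unit of F and hence a norm \<open>a * sg a\<close>. Scaling \<open>z\<close> by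
  \<open>a\<close> multiplies the value \<open>k\<close> by exactly this norm.\<close>

lemma normalised_Pi_form:
  assumes b: "rbasis J b N" and t: "typed J b" and E: "(EK s, i) \<in> J"
  shows "\<exists>z\<in>N. te s z \<and> h z (PiB \<triangleright> z) = c"
proof -
  obtain z where z: "z \<in> N" "te s z" "\<not> ge 1 (h z (PiB \<triangleright> z))" using unit_Pi_form[OF assms] by blast
  define k where "k = h z (PiB \<triangleright> z)"
  have zN: "PiB \<triangleright> z \<in> N" using N_lm[OF z(1) PiB(1)] .
  have k: "k \<in> K" "sg k = - k" using Pi_form[OF z(2,1)] cj_K unfolding k_def by auto
  have k0: "k \<noteq> 0" "vB k = 0"
    using z(3) h_OB[OF z(1) zN] unfolding k_def OB_iff by (auto simp: vge_def)
  define d where "d = c * inverse k"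
  have dK: "d \<in> K" using k c_K K_mult K_inverse by (simp add: d_def)
  have "sg d = d"
    unfolding d_def sg_mult[OF c_K K_inverse[OF k(1)]] sg_inverse[OF k(1)] k(2) sg_c by simp
  then obtain u where u: "d = emb u" using fixed_emb[OF dK] by blast
  have d0: "d \<noteq> 0" using k0 c_ne0 by (simp add: d_def)
  then have u0: "u \<noteq> 0" using u emb_zero by auto
  have "vB d = 0" unfolding d_def using val_mult[OF vB(1) c_ne0, of "inverse k"] val_inverse[OF vB(1) k0(1)] k0 c_val
    by simp
  then have "vF u = 0" using val_emb[OF u0] u by simp
  then obtain a where a: "a \<in> OK" "a * sg a = emb u" using norm_surj[OF u0] by blast
  have aK: "a \<in> K" "a \<in> OB" "cj a = sg a" using a OK_K OB_OK cj_K by auto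
  define z' where "z' = z \<triangleleft> a"
  have z'N: "z' \<in> N" using N_rm[OF z(1) aK(2)] by (simp add: z'_def)
  have te': "te s z'"
    unfolding te_def
  proof
    fix x assume x: "x \<in> OK"
    have "x \<triangleright> z' = z \<triangleleft> (sig s x * a)" using z(2) x by (simp add: z'_def lm_rm te_def rm_mult)
    also have "sig s x * a = a * sig s x" by (rule K_comm[OF sig_K[OF OK_K[OF x]] aK(1)])
    finally show "x \<triangleright> z' = z' \<triangleleft> sig s x" by (simp add: z'_def rm_mult)
  qed
  have "h z' (PiB \<triangleright> z') = sg a * (k * a)"
    unfolding z'_def lm_rm h_rml[OF z(1) N_rm[OF zN aK(2)] aK(2)] h_rm[OF z(1) zN aK(2)] aK(3) k_def ..
  also have "k * a = a * k" by (rule K_comm[OF k(1) aK(1)])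
  also have "sg a * (a * k) = a * sg a * k" using K_comm[OF aK(1) sg_K[OF aK(1)]] by (simp add: mult.assoc[symmetric])
  also have "\<dots> = c" unfolding a(2) u[symmetric] d_def using k0 by (simp add: mult.assoc)
  finally show ?thesis using z'N te' by blast
qed

text \<open>Two exchanges. Expanding \<open>c = h z (\<Pi> z)\<close> finds a unit coefficient of
  \<open>z\<close>, necessarily at a vector of kind \<open>EK s\<close>: the other contributions
  contain a factor \<open>\<Pi>\<close> or \<open>\<pi>\<close>, or pair vectors of equal type. The
  partner slot then receives \<open>\<Pi> z\<close>.\<close>

lemma split_E:
  assumes b: "rbasis J b N" and t: "typed J b" and E: "(EK s, i) \<in> J"
  shows "\<exists>z k. (EK s, k) \<in> J \<and> z \<in> N \<and> te s z \<and> h z (PiB \<triangleright> z) = c \<and>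
    rbasis J (b((EK s, k) := z, (FK s, k) := PiB \<triangleright> z)) N"
proof -
  have J: "finite J" using b by (simp add: rbasis_def)
  have bN: "b j \<in> N" if "j \<in> J" for j using rbasis_in[OF b that] .
  obtain z where z: "z \<in> N" "te s z" "h z (PiB \<triangleright> z) = c" using normalised_Pi_form[OF assms] by blast
  have zN: "PiB \<triangleright> z \<in> N" using N_lm[OF z(1) PiB(1)] .
  obtain a where a: "\<And>j. j \<in> J \<Longrightarrow> a j \<in> OB" "z = lincomb J b a" using rbasis_expand[OF b z(1)] by blast
  have PN: "PiB \<triangleright> b j \<in> N" if "j \<in> J" for j using N_lm[OF bN[OF that] PiB(1)] .
  have "PiB \<triangleright> z = lincomb J (\<lambda>j. PiB \<triangleright> b j) a"
    unfolding a(2) lincomb_def lm_sum by (simp add: lm_rm)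
  then have "c = (\<Sum>j\<in>J. h z (PiB \<triangleright> b j) * a j)"
    using h_lincomb[OF z(1), of J "\<lambda>j. PiB \<triangleright> b j" a] PN a(1) z(3) by simp
  then have "\<not> ge 1 (\<Sum>j\<in>J. h z (PiB \<triangleright> b j) * a j)" using c_unit by simp
  then obtain j where j: "j \<in> J" "\<not> ge 1 (h z (PiB \<triangleright> b j))" "\<not> ge 1 (a j)"
    using unit_summand[OF J, of "\<lambda>j. h z (PiB \<triangleright> b j)" a] h_OB[OF z(1) PN] a(1) by blast
  obtain k l where kl: "j = (k, l)" by (cases j)
  have "k = EK s"
  proof (cases k)
    case (GK s')
    then have "h z (PiB \<triangleright> b j) = h z (b j) * PiB"
      using typed_Pi[OF t j(1)] kl h_rm[OF z(1) bN[OF j(1)] PiB(1)] by simp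
    then show ?thesis using j ge_mult1r[OF _ ge_Pi] h_OB[OF z(1) bN[OF j(1)]] OB_iff by simp
  next
    case (FK s')
    then have E': "(EK s', l) \<in> J" using t j kl unfolding typed_def by blast
    have "emb \<pi> \<in> OB" using ge_pi vge_mono[OF vB(1), of 1 "emb \<pi>" 0] OB_iff by simp
    then have "h z (PiB \<triangleright> b j) = h z (b (EK s', l)) * emb \<pi>"
      using typed_Pi[OF t j(1)] kl FK h_rm[OF z(1) bN[OF E']] by simp
    then show ?thesis using j ge_mult1r[OF _ ge_pi] h_OB[OF z(1) bN[OF E']] OB_iff by simp
  next
    case (EK s')
    have "s' = s"
    proof (rule ccontr)
      assume "s' \<noteq> s"
      then have "te s (PiB \<triangleright> b j)" using te_Pi[OF typed_te[OF t, of k l]] j kl EK by (cases s; cases s') simp_all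
      then show False using te_same(2)[OF z(2) _ z(1) PN[OF j(1)]] j by blast
    qed
    then show ?thesis using EK by simp
  qed
  then have k: "(EK s, l) \<in> J" "\<not> ge 1 (a (EK s, l))" using j kl by auto
  have Fj: "(FK s, l) \<in> J" using t k unfolding typed_def by blast
  define b1 where "b1 = b((EK s, l) := z)"
  have b1: "rbasis J b1 N" unfolding b1_def by (rule rbasis_exchange[OF b lat a k])
  obtain a' where a': "\<And>j. j \<in> J \<Longrightarrow> a' j \<in> OB" "PiB \<triangleright> z = lincomb J b1 a'" using rbasis_expand[OF b1 zN] by blast
  \<comment> \<open>The dual vector belongs to the basis before the first exchange, so it also sees
    the new vector \<open>z\<close>, with value \<open>a (FK s, l)\<close>. This is the second term
    in the comparison of coefficients below.\<close>
  obtain d where d: "d \<in> N" "\<forall>j\<in>J. h d (b j) = (if j = (FK s, l) then 1 else 0)"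
    using dual_vector[OF b Fj] by blast
  have 1: "h d (PiB \<triangleright> z) = a (EK s, l)" unfolding a(2) by (rule Pi_coefficient[OF b t k(1) d a(1)])
  have dz: "h d z = a (FK s, l)" unfolding a(2) by (rule coefficient[OF b Fj d a(1)])
  have "h d (PiB \<triangleright> z) = (\<Sum>j\<in>J. h d (b1 j) * a' j)"
    unfolding a'(2) by (rule h_lincomb[OF d(1) rbasis_in[OF b1] a'(1)])
  also have "\<dots> = (\<Sum>j\<in>J. (if j = (FK s, l) then a' (FK s, l) else 0)
      + (if j = (EK s, l) then a (FK s, l) * a' (EK s, l) else 0))"
    by (rule sum.cong[OF refl]) (use d(2) dz in \<open>auto simp: b1_def\<close>)
  also have "\<dots> = a' (FK s, l) + a (FK s, l) * a' (EK s, l)"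
    using J Fj k(1) by (simp add: sum.distrib)
  finally have 2: "a (EK s, l) = a' (FK s, l) + a (FK s, l) * a' (EK s, l)" using 1 by simp
  \<comment> \<open>The extra term is a non-unit by \<open>F_coefficient_nonunit\<close>. As the
    left-hand side \<open>a (EK s, l)\<close> is a unit, so is the coefficient needed for the second
    exchange.\<close>
  have "ge 1 (a (FK s, l) * a' (EK s, l))"
    using ge_mult1l F_coefficient_nonunit[OF b t Fj z(1,2) a] a'(1)[OF k(1)] OB_iff by blast
  then have "\<not> ge 1 (a' (FK s, l))" using k(2) 2 vge_add[OF vB(1)] by metis
  then have "rbasis J (b1((FK s, l) := PiB \<triangleright> z)) N"
    using rbasis_exchange[OF b1 lat, of a' "PiB \<triangleright> z" "(FK s, l)"] a' Fj by blast
  then show ?thesis using k(1) z unfolding b1_def by blast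
qed

end

context selfdual begin

text \<open>One step of the induction in a form valid for both kinds of planes. The last property
  leaves the index set of the complement and the names of the two new indices free, since the
  induction renumbers its basis.\<close>

lemma split_step:
  fixes b b1 :: "kind \<times> nat \<Rightarrow> 'v"
  assumes pq: "p \<in> N" "q \<in> N" "h p q = g" "inverse g \<in> OB" "g \<noteq> 0" "h p p = 0" "h q q = 0"
    and st: "\<And>\<alpha>. \<alpha> \<in> OB \<Longrightarrow> \<exists>\<beta>\<in>OB. \<exists>\<delta>\<in>OB. \<alpha> \<triangleright> p = p \<triangleleft> \<beta> + q \<triangleleft> \<delta>"
      "\<And>\<alpha>. \<alpha> \<in> OB \<Longrightarrow> \<exists>\<beta>\<in>OB. \<exists>\<delta>\<in>OB. \<alpha> \<triangleright> q = p \<triangleleft> \<beta> + q \<triangleleft> \<delta>"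
    and b: "rbasis J b N" "typed J b" and b1: "rbasis J b1 N" "b1 i1 = p" "b1 i2 = q"
      "\<And>j. j \<in> J - {i1, i2} \<Longrightarrow> b1 j = b j"
    and I: "i1 \<in> J" "i2 \<in> J" "i1 \<noteq> i2"
      "\<And>s i. (EK s, i) \<in> J - {i1, i2} \<longleftrightarrow> (FK s, i) \<in> J - {i1, i2}"
  obtains N' b' where "sd N' h" "rbasis (J - {i1, i2}) b' N'" "typed (J - {i1, i2}) b'" "N' \<subseteq> N"
    "\<And>x. x \<in> N' \<Longrightarrow> h p x = 0 \<and> h q x = 0 \<and> h x p = 0 \<and> h x q = 0"
    "\<And>(J2 :: (kind \<times> nat) set) b2 j1 j2. rbasis J2 b2 N' \<Longrightarrow> j1 \<notin> J2 \<Longrightarrow> j2 \<notin> J2 \<Longrightarrow> j1 \<noteq> j2 \<Longrightarrow>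
       rbasis (insert j1 (insert j2 J2)) (b2(j1 := p, j2 := q)) N"
proof -
  note A = pq st
  show ?thesis
  proof (rule that)
    show "sd (perp p q) h" by (rule sd_perp[OF A])
    show "rbasis (J - {i1, i2}) (\<lambda>j. proj p q g (b1 j)) (perp p q)"
      by (rule proj_basis[OF A b1(1) I(1,2,3) b1(2,3)])
    show "typed (J - {i1, i2}) (\<lambda>j. proj p q g (b1 j))"
      by (rule proj_typed[OF A rbasis_in[OF b(1)] b(2) Diff_subset I(4) b1(4)])
    show "perp p q \<subseteq> N" using perp_N[OF A] by blast
    show "h p x = 0 \<and> h q x = 0 \<and> h x p = 0 \<and> h x q = 0" if "x \<in> perp p q" for x
      by (rule perp_orth[OF A that])
    show "rbasis (insert j1 (insert j2 J2)) (b2(j1 := p, j2 := q)) N"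
      if "rbasis J2 b2 (perp p q)" "j1 \<notin> J2" "j2 \<notin> J2" "j1 \<noteq> j2" for J2 :: "(kind \<times> nat) set" and b2 j1 j2
      by (rule extend_basis[OF A that])
  qed
qed

end

section \<open>Standard index sets, standard Gram matrices, and the induction on planes\<close>

context quaternion_setting begin

text \<open>Arbitrary finite index sets, one for each sign of \<open>GK\<close> and one for each
  kind of E-F pair: the planes removed in the induction sit at indices that cannot be
  prescribed.\<close>

definition JJ :: "(bool \<Rightarrow> nat set) \<Rightarrow> (bool \<Rightarrow> nat set) \<Rightarrow> (kind \<times> nat) set" where
  "JJ A C = {(k, i). case k of GK s \<Rightarrow> i \<in> A s | EK s \<Rightarrow> i \<in> C s | FK s \<Rightarrow> i \<in> C s}"

lemma JJ_iff: "(GK s, i) \<in> JJ A C \<longleftrightarrow> i \<in> A s" "(EK s, i) \<in> JJ A C \<longleftrightarrow> i \<in> C s" "(FK s, i) \<in> JJ A C \<longleftrightarrow> i \<in> C s"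
  by (simp_all add: JJ_def)

lemma JJ_eq: "JJ A C = Pair (GK True) ` A True \<union> Pair (GK False) ` A False
    \<union> (Pair (EK True) ` C True \<union> Pair (FK True) ` C True) \<union> (Pair (EK False) ` C False \<union> Pair (FK False) ` C False)"
proof (rule Set.set_eqI)
  fix j :: "kind \<times> nat"
  obtain k i where j: "j = (k, i)" by (cases j)
  show "j \<in> JJ A C \<longleftrightarrow> j \<in> Pair (GK True) ` A True \<union> Pair (GK False) ` A False
    \<union> (Pair (EK True) ` C True \<union> Pair (FK True) ` C True) \<union> (Pair (EK False) ` C False \<union> Pair (FK False) ` C False)"
  proof (cases k)
    case (GK s) then show ?thesis unfolding j by (cases s) (auto simp: JJ_def)
  next
    case (EK s) then show ?thesis unfolding j by (cases s) (auto simp: JJ_def)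
  next
    case (FK s) then show ?thesis unfolding j by (cases s) (auto simp: JJ_def)
  qed
qed

lemma finite_JJ: "(\<And>s. finite (A s)) \<Longrightarrow> (\<And>s. finite (C s)) \<Longrightarrow> finite (JJ A C)"
  unfolding JJ_eq by simp

lemma sum_JJ:
  fixes f :: "kind \<times> nat \<Rightarrow> 'x::comm_monoid_add"
  assumes "\<And>s. finite (A s)" "\<And>s. finite (C s)"
  shows "sum f (JJ A C) = (\<Sum>i\<in>A True. f (GK True, i)) + (\<Sum>i\<in>A False. f (GK False, i))
    + (\<Sum>i\<in>C True. f (EK True, i) + f (FK True, i)) + (\<Sum>i\<in>C False. f (EK False, i) + f (FK False, i))"
proof -
  have r: "sum f (Pair k ` X) = (\<Sum>i\<in>X. f (k, i))" for k and X :: "nat set"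
    by (subst sum.reindex) (auto simp: inj_on_def)
  have fin: "finite (Pair k ` A s)" "finite (Pair k ` C s)" for k :: kind and s using assms by simp_all
  show ?thesis
    unfolding JJ_eq
    apply (subst sum.union_disjoint)
       apply (use fin in simp)
      apply (use fin in simp)
     apply force
    apply (subst sum.union_disjoint)
       apply (use fin in simp)
      apply (use fin in simp)
     apply force
    apply (subst sum.union_disjoint)
       apply (use fin in simp)
      apply (use fin in simp)
     apply force
    apply (subst sum.union_disjoint)
       apply (use fin in simp)
      apply (use fin in simp)
     apply force
    apply (subst sum.union_disjoint)
       apply (use fin in simp)
      apply (use fin in simp)
     apply force
    unfolding r sum.distrib by (rule refl)
qed

text \<open>The blocks are \<open>C_3\<close> on the two signs of \<open>GK\<close> and
  \<open>C_1 = C_2\<close> on an E-F pair.\<close>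

fun gram :: "kind \<Rightarrow> kind \<Rightarrow> 'b" where
  "gram (GK s) (GK s') = (if s' = s then 0 else 1)"
| "gram (EK s) (FK s') = (if s' = s then c else 0)"
| "gram (FK s) (EK s') = (if s' = s then - c else 0)"
| "gram _ _ = 0"

definition Gram :: "kind \<times> nat \<Rightarrow> kind \<times> nat \<Rightarrow> 'b" where
  "Gram i j = (if snd i = snd j then gram (fst i) (fst j) else 0)"

definition std_index :: "nat \<Rightarrow> (bool \<Rightarrow> nat) \<Rightarrow> (kind \<times> nat) set" where
  "std_index r t = JJ (\<lambda>_. {..<r}) (\<lambda>s. {..<t s})"

end

context ambient_bimodule begin

definition hyperbolic :: "'v set \<Rightarrow> ('v \<Rightarrow> 'v \<Rightarrow> 'b) \<Rightarrow> nat \<Rightarrow> (bool \<Rightarrow> nat) \<Rightarrow> (kind \<times> nat \<Rightarrow> 'v) \<Rightarrow> bool" where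
  "hyperbolic N h r t b \<longleftrightarrow> rbasis (std_index r t) b N \<and> typed (std_index r t) b \<and>
     (\<forall>i\<in>std_index r t. \<forall>j\<in>std_index r t. h (b i) (b j) = Gram i j)"

lemma hyperbolic_extend:
  assumes H: "hyperbolic N' h r t b" and new: "j1 \<notin> std_index r t" "j2 \<notin> std_index r t" "j1 \<noteq> j2"
    and J: "insert j1 (insert j2 (std_index r t)) = std_index r' t'"
    and bas: "rbasis (insert j1 (insert j2 (std_index r t))) (b(j1 := p, j2 := q)) N"
    and ty: "typed (insert j1 (insert j2 (std_index r t))) (b(j1 := p, j2 := q))"
    and orth: "\<And>x. x \<in> N' \<Longrightarrow> h p x = 0 \<and> h q x = 0 \<and> h x p = 0 \<and> h x q = 0"
    and Gr: "\<And>j. j \<in> std_index r t \<Longrightarrow> Gram j1 j = 0 \<and> Gram j2 j = 0 \<and> Gram j j1 = 0 \<and> Gram j j2 = 0"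
    and h: "h p p = Gram j1 j1" "h p q = Gram j1 j2" "h q p = Gram j2 j1" "h q q = Gram j2 j2"
  shows "hyperbolic N h r' t' (b(j1 := p, j2 := q))"
proof -
  have b: "rbasis (std_index r t) b N'" and g: "\<And>i j. i \<in> std_index r t \<Longrightarrow> j \<in> std_index r t \<Longrightarrow> h (b i) (b j) = Gram i j"
    using H by (auto simp: hyperbolic_def)
  let ?b = "b(j1 := p, j2 := q)"
  have old: "?b j = b j" if "j \<in> std_index r t" for j using that new by auto
  have new': "?b j1 = p" "?b j2 = q" using new by auto
  have "h (?b i) (?b j) = Gram i j"
    if i: "i \<in> insert j1 (insert j2 (std_index r t))" and j: "j \<in> insert j1 (insert j2 (std_index r t))" for i j
  proof -
    consider "i = j1" | "i = j2" | "i \<in> std_index r t" using i by blast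
    then show ?thesis
    proof cases
      case 1
      consider "j = j1" | "j = j2" | "j \<in> std_index r t" using j by blast
      then show ?thesis using orth[OF rbasis_in[OF b]] Gr h new' old 1 by cases metis+
    next
      case 2
      consider "j = j1" | "j = j2" | "j \<in> std_index r t" using j by blast
      then show ?thesis using orth[OF rbasis_in[OF b]] Gr h new' old 2 by cases metis+
    next
      case 3
      consider "j = j1" | "j = j2" | "j \<in> std_index r t" using j by blast
      then show ?thesis using orth[OF rbasis_in[OF b]] Gr g new' old 3 by cases metis+
    qed
  qed
  then show ?thesis using bas ty unfolding hyperbolic_def J by blast
qed

text \<open>Induction on the number of planes and generators left. Vectors of kind \<open>GK\<close>
  are treated first; every step removes one of each sign, which is where the equality of the two
  counts comes from. Once they are exhausted, E-F pairs are removed one at a time.\<close>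

lemma hyperbolic_basis:
  assumes "sd N h" "rbasis (JJ A C) b N" "typed (JJ A C) b" "\<And>s. finite (A s)" "\<And>s. finite (C s)"
  shows "card (A True) = card (A False) \<and> (\<exists>b'. hyperbolic N h (card (A True)) (\<lambda>s. card (C s)) b')"
  using assms
proof (induction "card (A True) + card (A False) + card (C True) + card (C False)" arbitrary: N A C b rule: less_induct)
  case less
  note b = less.prems(2) and t = less.prems(3) and fin = less.prems(4,5)
  interpret selfdual vF emb cj sg vB OF OB OK K \<pi> PiB c lm rm N h by unfold_locales (rule less.prems(1))
  show ?case
  proof (cases "\<exists>s i. i \<in> A s")
    case True
    then obtain s i where si: "i \<in> A s" by blast
    have G: "(GK s, i) \<in> JJ A C" using si by (simp add: JJ_iff)
    obtain y k where yk: "(GK (\<not> s), k) \<in> JJ A C" "y \<in> N" "ty (\<not> s) y" "h (b (GK s, i)) y = 1"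
      "rbasis (JJ A C) (b((GK (\<not> s), k) := y)) N" using split_G[OF b t G] by blast
    define p where "p = b (GK s, i)"
    have p: "p \<in> N" "ty s p" using rbasis_in[OF b G] t G unfolding typed_def p_def by blast+
    have stp: "\<exists>\<beta>\<in>OB. \<exists>\<delta>\<in>OB. \<alpha> \<triangleright> p = p \<triangleleft> \<beta> + y \<triangleleft> \<delta>" if "\<alpha> \<in> OB" for \<alpha>
      using p(2) that tau_OB[OF that] OB_zero by (intro bexI[of _ "tau s \<alpha>"] bexI[of _ 0]) (simp_all add: ty_def rm_zero)
    have sty: "\<exists>\<beta>\<in>OB. \<exists>\<delta>\<in>OB. \<alpha> \<triangleright> y = p \<triangleleft> \<beta> + y \<triangleleft> \<delta>" if "\<alpha> \<in> OB" for \<alpha>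
      using yk(3) that tau_OB[OF that] OB_zero by (intro bexI[of _ 0] bexI[of _ "tau (\<not> s) \<alpha>"]) (simp_all add: ty_def rm_zero)
    define i1 i2 where "i1 = (GK s, i)" and "i2 = (GK (\<not> s), k)"
    define A' where "A' = A(s := A s - {i}, \<not> s := A (\<not> s) - {k})"
    have kA: "k \<in> A (\<not> s)" using yk(1) by (simp add: JJ_iff)
    have JA: "JJ A C - {i1, i2} = JJ A' C"
    proof (rule Set.set_eqI)
      fix j :: "kind \<times> nat"
      obtain q l where ql: "j = (q, l)" by (cases j)
      show "j \<in> JJ A C - {i1, i2} \<longleftrightarrow> j \<in> JJ A' C"
        unfolding ql by (cases q) (auto simp: JJ_iff i1_def i2_def A'_def)
    qed
    obtain N' b' where N': "sd N' h" "rbasis (JJ A C - {i1, i2}) b' N'" "typed (JJ A C - {i1, i2}) b'" "N' \<subseteq> N"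
      and orth: "\<And>x. x \<in> N' \<Longrightarrow> h p x = 0 \<and> h y x = 0 \<and> h x p = 0 \<and> h x y = 0"
      and ext: "\<And>(J2 :: (kind \<times> nat) set) b2 j1 j2. rbasis J2 b2 N' \<Longrightarrow> j1 \<notin> J2 \<Longrightarrow> j2 \<notin> J2 \<Longrightarrow> j1 \<noteq> j2 \<Longrightarrow>
         rbasis (insert j1 (insert j2 J2)) (b2(j1 := p, j2 := y)) N"
    proof (rule split_step[of p y 1 "JJ A C" b "b((GK (\<not> s), k) := y)" i1 i2])
      show "h p p = 0" "h y y = 0" using te_isotropic ty_te p yk by blast+
      show "(EK s', l) \<in> JJ A C - {i1, i2} \<longleftrightarrow> (FK s', l) \<in> JJ A C - {i1, i2}" for s' l
        by (simp add: JJ_iff i1_def i2_def)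
    qed (use p yk stp sty b t OB_one G in \<open>auto simp: p_def i1_def i2_def\<close>)
    have finA': "finite (A' s')" for s' using fin by (simp add: A'_def)
    have cA: "card (A' s) = card (A s) - 1" "card (A' (\<not> s)) = card (A (\<not> s)) - 1"
      "card (A s) > 0" "card (A (\<not> s)) > 0"
      using si kA fin(1) by (auto simp: A'_def card_gt_0_iff)
    have lt: "card (A' True) + card (A' False) + card (C True) + card (C False)
        < card (A True) + card (A False) + card (C True) + card (C False)"
      using cA by (cases s) simp_all
    have IH: "card (A' True) = card (A' False) \<and> (\<exists>b'. hyperbolic N' h (card (A' True)) (\<lambda>s. card (C s)) b')"
      using less.hyps[OF lt N'(1) _ _ finA' fin(2)] N'(2,3) unfolding JA by blast
    define r where "r = card (A' True)"
    obtain b2 where b2: "hyperbolic N' h r (\<lambda>s. card (C s)) b2" using IH r_def by blast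
    \<comment> \<open>The removed plane used one vector of each sign, so equality for the complement
      carries over.\<close>
    have r: "card (A True) = Suc r" "card (A False) = Suc r" using IH cA r_def by (cases s; simp)+
    \<comment> \<open>The plane is reinserted at the first free index, the same for both signs,
      since \<open>Gram\<close> couples equal indices only.\<close>
    define j1 j2 where "j1 = (GK s, r)" and "j2 = (GK (\<not> s), r)"
    let ?J = "std_index r (\<lambda>s. card (C s))"
    have nj: "j1 \<notin> ?J" "j2 \<notin> ?J" "j1 \<noteq> j2" by (auto simp: j1_def j2_def std_index_def JJ_iff)
    have J: "insert j1 (insert j2 ?J) = std_index (Suc r) (\<lambda>s. card (C s))"
    proof (rule Set.set_eqI)
      fix j :: "kind \<times> nat"
      obtain q l where ql: "j = (q, l)" by (cases j)
      show "j \<in> insert j1 (insert j2 ?J) \<longleftrightarrow> j \<in> std_index (Suc r) (\<lambda>s. card (C s))"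
        unfolding ql by (cases q) (auto simp: std_index_def JJ_iff j1_def j2_def)
    qed
    have b2': "rbasis ?J b2 N'" "typed ?J b2" using b2 by (auto simp: hyperbolic_def)
    have "hyperbolic N h (Suc r) (\<lambda>s. card (C s)) (b2(j1 := p, j2 := y))"
    proof (rule hyperbolic_extend[OF b2 nj J ext[OF b2'(1) nj] _ orth])
      show "typed (insert j1 (insert j2 ?J)) (b2(j1 := p, j2 := y))"
        using b2'(2) p(2) yk(3) unfolding typed_def by (auto simp: j1_def j2_def)
      show "Gram j1 j = 0 \<and> Gram j2 j = 0 \<and> Gram j j1 = 0 \<and> Gram j j2 = 0" if "j \<in> ?J" for j
      proof -
        obtain q l where ql: "j = (q, l)" by (cases j)
        show ?thesis using that unfolding ql by (cases q) (auto simp: std_index_def JJ_iff j1_def j2_def Gram_def)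
      qed
      have "h y p = 1" using h_sym[OF yk(2) p(1)] yk(4) cj_one by (simp add: p_def)
      then show "h p p = Gram j1 j1" "h p y = Gram j1 j2" "h y p = Gram j2 j1" "h y y = Gram j2 j2"
        using te_isotropic[OF ty_te[OF p(2)] p(1)] te_isotropic[OF ty_te[OF yk(3)] yk(2)] yk(4)
        by (simp_all add: Gram_def j1_def j2_def p_def)
    qed
    then show ?thesis using r by auto
  next
    case False
    then have A0: "A s = {}" for s by blast
    show ?thesis
    proof (cases "\<exists>s i. i \<in> C s")
      case True
      then obtain s i where si: "i \<in> C s" by blast
      have E: "(EK s, i) \<in> JJ A C" using si by (simp add: JJ_iff)
      obtain z k where zk: "(EK s, k) \<in> JJ A C" "z \<in> N" "te s z" "h z (PiB \<triangleright> z) = c"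
        "rbasis (JJ A C) (b((EK s, k) := z, (FK s, k) := PiB \<triangleright> z)) N" using split_E[OF b t E] by blast
      define q where "q = PiB \<triangleright> z"
      have q: "q \<in> N" "te (\<not> s) q" using N_lm[OF zk(2) PiB(1)] te_Pi[OF zk(3)] by (simp_all add: q_def)
      have Pq: "PiB \<triangleright> q = z \<triangleleft> emb \<pi>" by (simp add: q_def lm_mult[symmetric] PiB(3) lm_emb)
      have piO: "emb \<pi> \<in> OB" using ge_pi vge_mono[OF vB(1), of 1 "emb \<pi>" 0] OB_iff by simp
      have stz: "\<exists>\<beta>\<in>OB. \<exists>\<delta>\<in>OB. \<alpha> \<triangleright> z = z \<triangleleft> \<beta> + q \<triangleleft> \<delta>" if a: "\<alpha> \<in> OB" for \<alpha>
      proof -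
        have "\<alpha> \<triangleright> z = k1 \<alpha> \<triangleright> z + k2 \<alpha> \<triangleright> q" unfolding q_def by (subst k12(3)[of \<alpha>]) (simp add: lm_addl lm_mult)
        then show ?thesis using zk(3) q(2) k12_OK[OF a] OB_OK[OF sig_OK] unfolding te_def
          by (intro bexI[of _ "sig s (k1 \<alpha>)"] bexI[of _ "sig (\<not> s) (k2 \<alpha>)"]) simp_all
      qed
      have stq: "\<exists>\<beta>\<in>OB. \<exists>\<delta>\<in>OB. \<alpha> \<triangleright> q = z \<triangleleft> \<beta> + q \<triangleleft> \<delta>" if a: "\<alpha> \<in> OB" for \<alpha>
      proof -
        have "\<alpha> \<triangleright> q = k1 \<alpha> \<triangleright> q + k2 \<alpha> \<triangleright> (PiB \<triangleright> q)" by (subst k12(3)[of \<alpha>]) (simp add: lm_addl lm_mult)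
        also have "\<dots> = z \<triangleleft> (sig s (k2 \<alpha>) * emb \<pi>) + q \<triangleleft> sig (\<not> s) (k1 \<alpha>)"
          unfolding Pq using zk(3) q(2) k12_OK[OF a] unfolding te_def by (simp add: lm_rm rm_mult add.commute)
        finally show ?thesis using OB_mult[OF OB_OK[OF sig_OK] piO] OB_OK[OF sig_OK] k12_OK[OF a] by blast
      qed
      define i1 i2 where "i1 = (EK s, k)" and "i2 = (FK s, k)"
      define C' where "C' = C(s := C s - {k})"
      have kC: "k \<in> C s" using zk(1) by (simp add: JJ_iff)
      have JC: "JJ A C - {i1, i2} = JJ A C'"
      proof (rule Set.set_eqI)
        fix j :: "kind \<times> nat"
        obtain q l where ql: "j = (q, l)" by (cases j)
        show "j \<in> JJ A C - {i1, i2} \<longleftrightarrow> j \<in> JJ A C'"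
          unfolding ql by (cases q) (auto simp: JJ_iff i1_def i2_def C'_def)
      qed
      obtain N' b' where N': "sd N' h" "rbasis (JJ A C - {i1, i2}) b' N'" "typed (JJ A C - {i1, i2}) b'" "N' \<subseteq> N"
        and orth: "\<And>x. x \<in> N' \<Longrightarrow> h z x = 0 \<and> h q x = 0 \<and> h x z = 0 \<and> h x q = 0"
        and ext: "\<And>(J2 :: (kind \<times> nat) set) b2 j1 j2. rbasis J2 b2 N' \<Longrightarrow> j1 \<notin> J2 \<Longrightarrow> j2 \<notin> J2 \<Longrightarrow> j1 \<noteq> j2 \<Longrightarrow>
           rbasis (insert j1 (insert j2 J2)) (b2(j1 := z, j2 := q)) N"
      proof (rule split_step[of z q c "JJ A C" b "b((EK s, k) := z, (FK s, k) := PiB \<triangleright> z)" i1 i2])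
        show "h z z = 0" "h q q = 0" using te_isotropic zk q by blast+
        show "(EK s', l) \<in> JJ A C - {i1, i2} \<longleftrightarrow> (FK s', l) \<in> JJ A C - {i1, i2}" for s' l
          by (auto simp: JJ_iff i1_def i2_def)
        show "i2 \<in> JJ A C" using kC by (simp add: i2_def JJ_iff)
      qed (use zk q stz stq b t ci_OB c_ne0 in \<open>auto simp: q_def i1_def i2_def\<close>)
      have finC': "finite (C' s')" for s' using fin by (simp add: C'_def)
      have cC: "card (C s) = Suc (card (C' s))" "card (C' (\<not> s)) = card (C (\<not> s))"
        using card_Suc_Diff1[OF fin(2) kC] by (simp_all add: C'_def)
      have lt: "card (A True) + card (A False) + card (C' True) + card (C' False)
          < card (A True) + card (A False) + card (C True) + card (C False)"
        using cC by (cases s) simp_all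
      have IH: "\<exists>b'. hyperbolic N' h (card (A True)) (\<lambda>s. card (C' s)) b'"
        using less.hyps[OF lt N'(1) _ _ fin(1) finC'] N'(2,3) unfolding JC by blast
      define r where "r = card (A True)"
      obtain b2 where b2: "hyperbolic N' h r (\<lambda>s. card (C' s)) b2" using IH r_def by blast
      define m where "m = card (C' s)"
      define j1 j2 where "j1 = (EK s, m)" and "j2 = (FK s, m)"
      let ?J = "std_index r (\<lambda>s. card (C' s))"
      have nj: "j1 \<notin> ?J" "j2 \<notin> ?J" "j1 \<noteq> j2" by (auto simp: j1_def j2_def std_index_def JJ_iff m_def)
      have cCs: "card (C s') = (if s' = s then Suc m else card (C' s'))" for s'
        using cC m_def by (cases "s' = s") (auto simp: C'_def)
      have J: "insert j1 (insert j2 ?J) = std_index r (\<lambda>s. card (C s))"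
      proof (rule Set.set_eqI)
        fix j :: "kind \<times> nat"
        obtain q l where ql: "j = (q, l)" by (cases j)
        show "j \<in> insert j1 (insert j2 ?J) \<longleftrightarrow> j \<in> std_index r (\<lambda>s. card (C s))"
          unfolding ql by (cases q) (auto simp: std_index_def JJ_iff j1_def j2_def cCs m_def)
      qed
      have b2': "rbasis ?J b2 N'" "typed ?J b2" using b2 by (auto simp: hyperbolic_def)
      have "hyperbolic N h r (\<lambda>s. card (C s)) (b2(j1 := z, j2 := q))"
      proof (rule hyperbolic_extend[OF b2 nj J ext[OF b2'(1) nj] _ orth])
        show "typed (insert j1 (insert j2 ?J)) (b2(j1 := z, j2 := q))"
          using b2'(2) zk(3) nj unfolding typed_def by (auto simp: j1_def j2_def q_def)
        show "Gram j1 j = 0 \<and> Gram j2 j = 0 \<and> Gram j j1 = 0 \<and> Gram j j2 = 0" if "j \<in> ?J" for j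
        proof -
          obtain q l where ql: "j = (q, l)" by (cases j)
          show ?thesis using that unfolding ql by (cases q) (auto simp: std_index_def JJ_iff j1_def j2_def Gram_def m_def)
        qed
        have "h q z = - c" using h_sym[OF q(1) zk(2)] zk(4) cj_K[OF c_K] sg_c by (simp add: q_def)
        then show "h z z = Gram j1 j1" "h z q = Gram j1 j2" "h q z = Gram j2 j1" "h q q = Gram j2 j2"
          using te_isotropic[OF zk(3,2)] te_isotropic[OF q(2,1)] zk(4)
          by (simp_all add: Gram_def j1_def j2_def q_def)
      qed
      then show ?thesis using A0 r_def by auto
    next
      case False
      then have C0: "C s = {}" for s by blast
      have "JJ A C = std_index 0 (\<lambda>s. 0)"
        unfolding std_index_def JJ_eq using A0 C0 by simp
      moreover have "std_index 0 (\<lambda>s. 0) = {}" unfolding std_index_def JJ_eq by simp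
      ultimately have "hyperbolic N h 0 (\<lambda>s. 0) b" using b t by (simp add: hyperbolic_def)
      then show ?thesis using A0 C0 by auto
    qed
  qed
qed

end

section \<open>Pairings without scalar extension\<close>

context quaternion_setting begin

text \<open>The conditions of \<open>sd\<close> for a record bimodule;
  \<open>pairing_iff_intr\<close> shows that for bilattices they say exactly that the pairing is
  hermitian and perfect.\<close>

definition intr :: "('b \<Rightarrow> 'b) \<Rightarrow> ('b, 'l) bimodule \<Rightarrow> ('l \<Rightarrow> 'l \<Rightarrow> 'b) \<Rightarrow> bool" where
  "intr star L h \<longleftrightarrow>
     (\<forall>x\<in>carrier L. \<forall>y\<in>carrier L. \<forall>z\<in>carrier L. h (x \<oplus>\<^bsub>L\<^esub> y) z = h x z + h y z) \<and>
     (\<forall>x\<in>carrier L. \<forall>y\<in>carrier L. h x y = cj (h y x)) \<and>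
     (\<forall>x\<in>carrier L. \<forall>y\<in>carrier L. \<forall>\<alpha>\<in>OB. h x (ract L y \<alpha>) = h x y * \<alpha>) \<and>
     (\<forall>x\<in>carrier L. \<forall>y\<in>carrier L. \<forall>\<alpha>\<in>OB. h (lact L \<alpha> x) y = h x (lact L (star \<alpha>) y)) \<and>
     (\<forall>x\<in>carrier L. \<forall>y\<in>carrier L. h x y \<in> OB) \<and>
     (\<forall>x\<in>carrier L. (\<forall>y\<in>carrier L. h x y = 0) \<longrightarrow> x = \<zero>\<^bsub>L\<^esub>) \<and>
     (\<forall>x\<in>carrier L. \<forall>s\<in>OF - {0}. (\<forall>y\<in>carrier L. \<exists>\<beta>\<in>OB. h x y = emb s * \<beta>) \<longrightarrow>
        (\<exists>x'\<in>carrier L. x = ract L x' (emb s)))"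

lemma OF_one: "1 \<in> OF"
  using OF_ge val_one[OF vF] by (simp add: vge_def)

lemma idem_zero: "abelian_group G \<Longrightarrow> a \<in> carrier G \<Longrightarrow> a \<oplus>\<^bsub>G\<^esub> a = a \<Longrightarrow> a = \<zero>\<^bsub>G\<^esub>"
  by (metis abelian_group.r_neg1 abelian_group.l_neg)

lemma emb_cancel:
  assumes "A \<noteq> 0" "B \<noteq> 0" "emb A * x = emb B * y"
  shows "emb (inverse B) * x = emb (inverse A) * y"
proof -
  have "emb (inverse B) * x = emb (inverse B) * (emb (inverse A) * (emb A * x))"
    using assms(1) emb_eq_0_iff[of A] by (simp add: emb_inverse mult.assoc[symmetric])
  also have "\<dots> = emb (inverse A) * (emb (inverse B) * (emb B * y))"
    unfolding assms(3) by (rule emb_central2)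
  also have "\<dots> = emb (inverse A) * y"
    using assms(2) emb_eq_0_iff[of B] by (simp add: emb_inverse mult.assoc[symmetric])
  finally show ?thesis .
qed

context
  fixes L :: "('b, 'l) bimodule"
  assumes L: "bilattice OF emb OB L"
begin

lemma L_group: "abelian_group L" and L_monoid: "abelian_monoid L"
  using L by (simp_all add: bilattice_def bimodule_axioms_def abelian_group.axioms)

lemma L_bimodule: "bimodule_axioms OB L"
  using L unfolding bilattice_def by (rule conjunct1)

lemmas L_parts = L_bimodule[unfolded bimodule_axioms_def, THEN conjunct2]

lemma L_ract: "x \<in> carrier L \<Longrightarrow> \<alpha> \<in> OB \<Longrightarrow> ract L x \<alpha> \<in> carrier L"
  using L_parts[THEN conjunct1] by blast

lemma L_lact: "x \<in> carrier L \<Longrightarrow> \<alpha> \<in> OB \<Longrightarrow> lact L \<alpha> x \<in> carrier L"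
  using L_parts[THEN conjunct1] by blast

lemma L_ract_add: "x \<in> carrier L \<Longrightarrow> y \<in> carrier L \<Longrightarrow> \<alpha> \<in> OB \<Longrightarrow>
    ract L (x \<oplus>\<^bsub>L\<^esub> y) \<alpha> = ract L x \<alpha> \<oplus>\<^bsub>L\<^esub> ract L y \<alpha>"
  using L_parts[THEN conjunct2, THEN conjunct1] by blast

lemma L_ract_mult: "x \<in> carrier L \<Longrightarrow> \<alpha> \<in> OB \<Longrightarrow> \<beta> \<in> OB \<Longrightarrow> ract L x (\<alpha> * \<beta>) = ract L (ract L x \<alpha>) \<beta>"
  using L_parts[THEN conjunct2, THEN conjunct2, THEN conjunct1] by blast

lemma L_ract_one: "x \<in> carrier L \<Longrightarrow> ract L x 1 = x"
  using L_parts[THEN conjunct2, THEN conjunct2, THEN conjunct2] by blast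

lemma L_torsion: "a \<in> OF \<Longrightarrow> x \<in> carrier L \<Longrightarrow> ract L x (emb a) = \<zero>\<^bsub>L\<^esub> \<Longrightarrow> a = 0 \<or> x = \<zero>\<^bsub>L\<^esub>"
  using L[unfolded bilattice_def, THEN conjunct2, THEN conjunct2, THEN conjunct1] by blast

lemma L_zero: "\<zero>\<^bsub>L\<^esub> \<in> carrier L"
  using L_monoid by (rule abelian_monoid.zero_closed)

lemma L_zero_ract: "\<alpha> \<in> OB \<Longrightarrow> ract L \<zero>\<^bsub>L\<^esub> \<alpha> = \<zero>\<^bsub>L\<^esub>"
  using idem_zero[OF L_group L_ract[OF L_zero]] L_ract_add[OF L_zero L_zero, of \<alpha>]
    abelian_monoid.l_zero[OF L_monoid L_zero] by simp

lemma L_cancel: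
  assumes y: "y \<in> carrier L" and z: "z \<in> carrier L" and s: "s \<in> OF" "s \<noteq> 0"
    and eq: "ract L y (emb s) = ract L z (emb s)"
  shows "y = z"
proof -
  have e: "emb s \<in> OB" using s OB_emb by simp
  have nz: "\<ominus>\<^bsub>L\<^esub> z \<in> carrier L" using abelian_group.a_inv_closed[OF L_group z] .
  have c: "y \<oplus>\<^bsub>L\<^esub> \<ominus>\<^bsub>L\<^esub> z \<in> carrier L" using abelian_monoid.a_closed[OF L_monoid y nz] .
  have "ract L (y \<oplus>\<^bsub>L\<^esub> \<ominus>\<^bsub>L\<^esub> z) (emb s) = ract L (z \<oplus>\<^bsub>L\<^esub> \<ominus>\<^bsub>L\<^esub> z) (emb s)"
    using L_ract_add[OF y nz e] L_ract_add[OF z nz e] eq by simp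
  also have "\<dots> = \<zero>\<^bsub>L\<^esub>" using abelian_group.r_neg[OF L_group z] L_zero_ract[OF e] by simp
  finally have 0: "y \<oplus>\<^bsub>L\<^esub> \<ominus>\<^bsub>L\<^esub> z = \<zero>\<^bsub>L\<^esub>" using L_torsion[OF s(1) c] s(2) by blast
  have "y = y \<oplus>\<^bsub>L\<^esub> (\<ominus>\<^bsub>L\<^esub> z \<oplus>\<^bsub>L\<^esub> z)"
    using abelian_group.l_neg[OF L_group z] abelian_monoid.r_zero[OF L_monoid y] by simp
  also have "\<dots> = z"
    using abelian_monoid.a_assoc[OF L_monoid y nz z] 0 abelian_monoid.l_zero[OF L_monoid z] by simp
  finally show ?thesis .
qed

definition cls :: "'l \<Rightarrow> 'f \<Rightarrow> ('l \<times> 'f) set" where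
  "cls x s = frac_rel OF emb L `` {(x, s)}"

lemma cls_mem: "x \<in> carrier L \<Longrightarrow> s \<in> OF - {0} \<Longrightarrow>
    (y, t) \<in> cls x s \<longleftrightarrow> y \<in> carrier L \<and> t \<in> OF - {0} \<and> ract L x (emb t) = ract L y (emb s)"
  by (auto simp: cls_def frac_rel_def)

lemma scalar_ext_iff: "X \<in> scalar_ext OF emb L \<longleftrightarrow> (\<exists>x\<in>carrier L. \<exists>s\<in>OF - {0}. X = cls x s)"
  unfolding scalar_ext_def quotient_def cls_def by auto

lemma incl_eq: "scalar_ext_incl OF emb L x = cls x 1"
  by (simp add: scalar_ext_incl_def cls_def)

lemma one_nz: "(1::'f) \<in> OF - {0}" using OF_one by simp

lemma ract_emb_one: "x \<in> carrier L \<Longrightarrow> ract L x (emb 1) = x"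
  using L_ract_one by (simp add: emb_one)

lemma cls_self: "x \<in> carrier L \<Longrightarrow> s \<in> OF - {0} \<Longrightarrow> (x, s) \<in> cls x s"
  by (simp add: cls_mem)

text \<open>The extended pairing does not depend on the chosen fractions: the set in its definition
  is a singleton, by cross-multiplying and cancelling the denominators.\<close>

lemma ext_pairing_cls:
  assumes bil: "\<And>a x y. a \<in> OF \<Longrightarrow> x \<in> carrier L \<Longrightarrow> y \<in> carrier L \<Longrightarrow>
      h (ract L x (emb a)) y = emb a * h x y \<and> h x (ract L y (emb a)) = emb a * h x y"
    and x: "x \<in> carrier L" "s \<in> OF - {0}" and y: "y \<in> carrier L" "t \<in> OF - {0}"
  shows "ext_pairing emb h (cls x s) (cls y t) = emb (inverse (s * t)) * h x y"
proof -
  have val: "emb (inverse (s' * t')) * h x' y' = emb (inverse (s * t)) * h x y"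
    if m: "(x', s') \<in> cls x s" "(y', t') \<in> cls y t" for x' s' y' t'
  proof -
    have x': "x' \<in> carrier L" "s' \<in> OF" "s' \<noteq> 0" "ract L x (emb s') = ract L x' (emb s)"
      using m(1) cls_mem[OF x] by auto
    have y': "y' \<in> carrier L" "t' \<in> OF" "t' \<noteq> 0" "ract L y (emb t') = ract L y' (emb t)"
      using m(2) cls_mem[OF y] by auto
    have st: "s \<in> OF" "s \<noteq> 0" "t \<in> OF" "t \<noteq> 0" using x y by auto
    have 1: "emb s' * h x y = emb s * h x' y"
      using bil[OF x'(2) x(1) y(1)] bil[OF st(1) x'(1) y(1)] x'(4) by simp
    have 2: "emb t' * h x' y = emb t * h x' y'"
      using bil[OF y'(2) x'(1) y(1)] bil[OF st(3) x'(1) y'(1)] y'(4) by simp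
    have "emb (s * t) * h x' y' = emb s * (emb t * h x' y')" by (simp add: emb_mult mult.assoc)
    also have "\<dots> = emb (s * t') * h x' y" unfolding 2[symmetric] by (simp add: emb_mult mult.assoc)
    also have "\<dots> = emb t' * (emb s * h x' y)" by (simp add: emb_mult[symmetric] mult.assoc[symmetric] mult.commute)
    also have "\<dots> = emb (s' * t') * h x y"
      unfolding 1[symmetric] by (simp add: emb_mult[symmetric] mult.assoc[symmetric] mult.commute)
    finally have e: "emb (s * t) * h x' y' = emb (s' * t') * h x y" .
    have "s * t \<noteq> 0" "s' * t' \<noteq> 0" using st x' y' by auto
    then show ?thesis using e by (rule emb_cancel)
  qed
  have "{emb (inverse (s * t)) * h x y | x s y t. (x, s) \<in> cls x' s' \<and> (y, t) \<in> cls y' t'}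
      = {emb (inverse (s' * t')) * h x' y'}" if "x' = x" "s' = s" "y' = y" "t' = t" for x' s' y' t'
    using val cls_self[OF x] cls_self[OF y] unfolding that by blast
  then show ?thesis unfolding ext_pairing_def by simp
qed

lemma cls_zero: "s \<in> OF - {0} \<Longrightarrow> cls \<zero>\<^bsub>L\<^esub> s = cls \<zero>\<^bsub>L\<^esub> 1"
proof -
  have *: "cls \<zero>\<^bsub>L\<^esub> s = {\<zero>\<^bsub>L\<^esub>} \<times> (OF - {0})" if s: "s \<in> OF - {0}" for s
  proof -
    have "(y, t) \<in> cls \<zero>\<^bsub>L\<^esub> s \<longleftrightarrow> y = \<zero>\<^bsub>L\<^esub> \<and> t \<in> OF - {0}" for y t
      using cls_mem[OF L_zero s] L_zero_ract[OF OB_emb] L_torsion[of s y] s L_zero by fastforce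
    then show ?thesis by auto
  qed
  show "s \<in> OF - {0} \<Longrightarrow> ?thesis" using *[of s] *[OF one_nz] by simp
qed

lemma cls_div: "x \<in> carrier L \<Longrightarrow> s \<in> OF - {0} \<Longrightarrow> cls (ract L x (emb s)) s = cls x 1"
proof -
  assume x: "x \<in> carrier L" and s: "s \<in> OF - {0}"
  have e: "emb s \<in> OB" using s OB_emb by simp
  have "(y, t) \<in> cls (ract L x (emb s)) s \<longleftrightarrow> (y, t) \<in> cls x 1" for y t
  proof -
    have "ract L (ract L x (emb s)) (emb t) = ract L y (emb s) \<longleftrightarrow> ract L x (emb t) = ract L y (emb 1)"
      if y: "y \<in> carrier L" and t: "t \<in> OF"
    proof -
      have te: "emb t \<in> OB" using t OB_emb by simp
      have "ract L (ract L x (emb s)) (emb t) = ract L (ract L x (emb t)) (emb s)"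
        using L_ract_mult[OF x e te] L_ract_mult[OF x te e] emb_central[of "emb s" t] by simp
      then show ?thesis using L_cancel[OF L_ract[OF x te] y] s ract_emb_one[OF y] by auto
    qed
    then show ?thesis using cls_mem[OF L_ract[OF x e] s] cls_mem[OF x one_nz] by auto
  qed
  then show ?thesis by auto
qed

text \<open>Clearing denominators on both sides. A fraction \<open>x / s\<close> pairs integrally
  with L when all \<open>h x y\<close> lie in \<open>s\<close> O_B, and it is an element of L when
  \<open>x\<close> is divisible by \<open>s\<close>; torsion-freeness makes this division
  unambiguous.\<close>

lemma pairing_iff_intr:
  "hermitian_pairing OF emb cj OB star L h \<and> perfect_pairing OF emb OB L h \<longleftrightarrow> intr star L h"
proof
  assume H: "hermitian_pairing OF emb cj OB star L h \<and> perfect_pairing OF emb OB L h"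
  have bil: "h (ract L x (emb a)) y = emb a * h x y \<and> h x (ract L y (emb a)) = emb a * h x y"
    if "a \<in> OF" "x \<in> carrier L" "y \<in> carrier L" for a x y
    using H that unfolding hermitian_pairing_def by blast
  have nd: "nondegenerate OF emb L h" using H unfolding hermitian_pairing_def by blast
  have P: "X \<in> scalar_ext OF emb L \<and> (\<forall>y\<in>carrier L. ext_pairing emb h X (cls y 1) \<in> OB)
      \<longleftrightarrow> X \<in> (\<lambda>x. cls x 1) ` carrier L" for X
    using H unfolding perfect_pairing_def incl_eq by blast
  have ev: "ext_pairing emb h (cls x s) (cls y t) = emb (inverse (s * t)) * h x y"
    if "x \<in> carrier L" "s \<in> OF - {0}" "y \<in> carrier L" "t \<in> OF - {0}" for x s y t
    by (rule ext_pairing_cls[OF _ that]) (rule bil)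
  have int: "h x y \<in> OB" if "x \<in> carrier L" "y \<in> carrier L" for x y
  proof -
    have "ext_pairing emb h (cls x 1) (cls y 1) \<in> OB" using P[of "cls x 1"] that by blast
    then show ?thesis using ev[OF that(1) one_nz that(2) one_nz] by (simp add: emb_one)
  qed
  have nondeg: "x = \<zero>\<^bsub>L\<^esub>" if x: "x \<in> carrier L" "\<forall>y\<in>carrier L. h x y = 0" for x
  proof -
    have "cls x 1 \<in> scalar_ext OF emb L" using x(1) one_nz scalar_ext_iff by blast
    moreover have "ext_pairing emb h (cls x 1) Y = 0" if "Y \<in> scalar_ext OF emb L" for Y
      using that scalar_ext_iff[of Y] ev[OF x(1) one_nz] x(2) by auto
    ultimately have "cls x 1 = cls \<zero>\<^bsub>L\<^esub> 1" using nd unfolding nondegenerate_def incl_eq by blast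
    then have "(x, 1) \<in> cls \<zero>\<^bsub>L\<^esub> 1" using cls_self[OF x(1) one_nz] by simp
    then show ?thesis
      using cls_mem[OF L_zero one_nz] ract_emb_one[OF L_zero] ract_emb_one[OF x(1)] by simp
  qed
  have perf: "\<exists>x'\<in>carrier L. x = ract L x' (emb s)"
    if x: "x \<in> carrier L" "s \<in> OF - {0}" "\<forall>y\<in>carrier L. \<exists>\<beta>\<in>OB. h x y = emb s * \<beta>" for x s
  proof -
    have se: "cls x s \<in> scalar_ext OF emb L" using x(1,2) scalar_ext_iff by blast
    have eO: "ext_pairing emb h (cls x s) (cls y 1) \<in> OB" if y: "y \<in> carrier L" for y
    proof -
      obtain \<beta> where b: "\<beta> \<in> OB" "h x y = emb s * \<beta>" using x(3) y by blast
      have "ext_pairing emb h (cls x s) (cls y 1) = emb (inverse s) * (emb s * \<beta>)"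
        using ev[OF x(1,2) y one_nz] b(2) by simp
      also have "\<dots> = \<beta>" using x(2) emb_eq_0_iff by (simp add: emb_inverse mult.assoc[symmetric])
      finally show ?thesis using b(1) by simp
    qed
    have "cls x s \<in> (\<lambda>x. cls x 1) ` carrier L"
      by (rule iffD1[OF P]) (intro conjI ballI se eO)
    then obtain x' where x': "x' \<in> carrier L" "cls x s = cls x' 1" by blast
    then have "(x, s) \<in> cls x' 1" using cls_self[OF x(1,2)] by simp
    then have "ract L x' (emb s) = x" using cls_mem[OF x'(1) one_nz] ract_emb_one[OF x(1)] by simp
    then show ?thesis using x'(1) by blast
  qed
  have hr: "h x (ract L y \<alpha>) = h x y * \<alpha>" if "x \<in> carrier L" "y \<in> carrier L" "\<alpha> \<in> OB" for x y \<alpha>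
  proof -
    have "h (ract L x 1) (ract L y \<alpha>) = cj 1 * h x y * \<alpha>"
      using H that OB_one unfolding hermitian_pairing_def by blast
    then show ?thesis using L_ract_one[OF that(1)] cj_one by simp
  qed
  show "intr star L h"
    unfolding intr_def
  proof (intro conjI)
    show "\<forall>x\<in>carrier L. \<forall>y\<in>carrier L. \<forall>z\<in>carrier L. h (x \<oplus>\<^bsub>L\<^esub> y) z = h x z + h y z"
      using H unfolding hermitian_pairing_def by blast
    show "\<forall>x\<in>carrier L. \<forall>y\<in>carrier L. h x y = cj (h y x)"
      using H unfolding hermitian_pairing_def by blast
    show "\<forall>x\<in>carrier L. \<forall>y\<in>carrier L. \<forall>\<alpha>\<in>OB. h (lact L \<alpha> x) y = h x (lact L (star \<alpha>) y)"
      using H unfolding hermitian_pairing_def by blast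
  qed (use hr int nondeg perf in blast)+
next
  assume H: "intr star L h"
  have sym: "h x y = cj (h y x)" if "x \<in> carrier L" "y \<in> carrier L" for x y
    using H that unfolding intr_def by blast
  have hr: "h x (ract L y \<alpha>) = h x y * \<alpha>" if "x \<in> carrier L" "y \<in> carrier L" "\<alpha> \<in> OB" for x y \<alpha>
    using H that unfolding intr_def by blast
  have hl: "h (ract L x \<alpha>) y = cj \<alpha> * h x y" if "x \<in> carrier L" "y \<in> carrier L" "\<alpha> \<in> OB" for x y \<alpha>
    unfolding sym[OF L_ract[OF that(1,3)] that(2)] hr[OF that(2,1,3)] by (simp add: cj_mult sym[OF that(1,2)])
  have addl: "h (x \<oplus>\<^bsub>L\<^esub> y) z = h x z + h y z" if "x \<in> carrier L" "y \<in> carrier L" "z \<in> carrier L" for x y z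
    using H that unfolding intr_def by blast
  have addr: "h z (x \<oplus>\<^bsub>L\<^esub> y) = h z x + h z y" if "x \<in> carrier L" "y \<in> carrier L" "z \<in> carrier L" for x y z
    unfolding sym[OF that(3) abelian_monoid.a_closed[OF L_monoid that(1,2)]] addl[OF that]
      sym[OF that(3,1)] sym[OF that(3,2)] by (simp add: cj_add)
  have bil: "h (ract L x (emb a)) y = emb a * h x y \<and> h x (ract L y (emb a)) = emb a * h x y"
    if "a \<in> OF" "x \<in> carrier L" "y \<in> carrier L" for a x y
    using hl[OF that(2,3) OB_emb[OF that(1)]] hr[OF that(2,3) OB_emb[OF that(1)]]
      emb_central[of "h x y" a] by (simp add: cj_emb)
  have ev: "ext_pairing emb h (cls x s) (cls y t) = emb (inverse (s * t)) * h x y"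
    if "x \<in> carrier L" "s \<in> OF - {0}" "y \<in> carrier L" "t \<in> OF - {0}" for x s y t
    by (rule ext_pairing_cls[OF _ that]) (rule bil)
  have int: "h x y \<in> OB" if "x \<in> carrier L" "y \<in> carrier L" for x y
    using H that unfolding intr_def by blast
  have nondeg: "x = \<zero>\<^bsub>L\<^esub>" if "x \<in> carrier L" "\<And>y. y \<in> carrier L \<Longrightarrow> h x y = 0" for x
    using H that unfolding intr_def by blast
  have perf: "\<exists>x'\<in>carrier L. x = ract L x' (emb s)"
    if "x \<in> carrier L" "s \<in> OF - {0}" "\<And>y. y \<in> carrier L \<Longrightarrow> \<exists>\<beta>\<in>OB. h x y = emb s * \<beta>" for x s
    using H that unfolding intr_def by blast
  have nz: "emb (inverse (s * t)) \<noteq> 0" if "s \<in> OF - {0}" "t \<in> OF - {0}" for s t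
    using that emb_eq_0_iff by simp
  have "nondegenerate OF emb L h"
    unfolding nondegenerate_def incl_eq
  proof (intro conjI ballI impI)
    fix X assume X: "X \<in> scalar_ext OF emb L" "\<forall>Y\<in>scalar_ext OF emb L. ext_pairing emb h X Y = 0"
    then obtain x s where x: "x \<in> carrier L" "s \<in> OF - {0}" "X = cls x s" using scalar_ext_iff by blast
    have "x = \<zero>\<^bsub>L\<^esub>"
    proof (rule nondeg[OF x(1)])
      fix y assume y: "y \<in> carrier L"
      then have "cls y 1 \<in> scalar_ext OF emb L" using one_nz scalar_ext_iff by blast
      then have "ext_pairing emb h (cls x s) (cls y 1) = 0" using X(2) x(3) by blast
      then show "h x y = 0" using ev[OF x(1,2) y one_nz] nz[OF x(2) one_nz] by simp
    qed
    then show "X = cls \<zero>\<^bsub>L\<^esub> 1" using cls_zero[OF x(2)] x(3) by simp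
  next
    fix X assume X: "X \<in> scalar_ext OF emb L" "\<forall>Y\<in>scalar_ext OF emb L. ext_pairing emb h Y X = 0"
    then obtain x s where x: "x \<in> carrier L" "s \<in> OF - {0}" "X = cls x s" using scalar_ext_iff by blast
    have "x = \<zero>\<^bsub>L\<^esub>"
    proof (rule nondeg[OF x(1)])
      fix y assume y: "y \<in> carrier L"
      then have "cls y 1 \<in> scalar_ext OF emb L" using one_nz scalar_ext_iff by blast
      then have "ext_pairing emb h (cls y 1) (cls x s) = 0" using X(2) x(3) by blast
      then have "h y x = 0" using ev[OF y one_nz x(1,2)] nz[OF one_nz x(2)] by simp
      then show "h x y = 0" using sym[OF x(1) y] cj_zero by simp
    qed
    then show "X = cls \<zero>\<^bsub>L\<^esub> 1" using cls_zero[OF x(2)] x(3) by simp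
  qed
  moreover have "perfect_pairing OF emb OB L h"
    unfolding perfect_pairing_def incl_eq
  proof (intro equalityI subsetI)
    fix X assume "X \<in> {X \<in> scalar_ext OF emb L. \<forall>y\<in>carrier L. ext_pairing emb h X (cls y 1) \<in> OB}"
    then have X: "X \<in> scalar_ext OF emb L" "\<And>y. y \<in> carrier L \<Longrightarrow> ext_pairing emb h X (cls y 1) \<in> OB" by auto
    then obtain x s where x: "x \<in> carrier L" "s \<in> OF - {0}" "X = cls x s" using scalar_ext_iff by blast
    have "\<exists>x'\<in>carrier L. x = ract L x' (emb s)"
    proof (rule perf[OF x(1,2)])
      fix y assume y: "y \<in> carrier L"
      have "emb (inverse s) * h x y \<in> OB" using X(2)[OF y] ev[OF x(1,2) y one_nz] x(3) by simp
      moreover have "h x y = emb s * (emb (inverse s) * h x y)"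
        using x(2) emb_eq_0_iff by (simp add: emb_inverse mult.assoc[symmetric])
      ultimately show "\<exists>\<beta>\<in>OB. h x y = emb s * \<beta>" by blast
    qed
    then show "X \<in> (\<lambda>x. cls x 1) ` carrier L" using cls_div[OF _ x(2)] x(3) by blast
  next
    fix X assume "X \<in> (\<lambda>x. cls x 1) ` carrier L"
    then obtain x where x: "x \<in> carrier L" "X = cls x 1" by blast
    have "ext_pairing emb h X (cls y 1) \<in> OB" if "y \<in> carrier L" for y
      using ev[OF x(1) one_nz that one_nz] int[OF x(1) that] x(2) by (simp add: emb_one)
    then show "X \<in> {X \<in> scalar_ext OF emb L. \<forall>y\<in>carrier L. ext_pairing emb h X (cls y 1) \<in> OB}"
      using x one_nz scalar_ext_iff by blast
  qed
  moreover have "h (ract L x \<alpha>) (ract L y \<beta>) = cj \<alpha> * h x y * \<beta>"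
    if "\<alpha> \<in> OB" "\<beta> \<in> OB" "x \<in> carrier L" "y \<in> carrier L" for \<alpha> \<beta> x y
    using hr[OF L_ract[OF that(3,1)] that(4,2)] hl[OF that(3,4,1)] by simp
  moreover have "h (lact L \<alpha> x) y = h x (lact L (star \<alpha>) y)"
    if "\<alpha> \<in> OB" "x \<in> carrier L" "y \<in> carrier L" for \<alpha> x y
    using H that unfolding intr_def by blast
  ultimately show "hermitian_pairing OF emb cj OB star L h \<and> perfect_pairing OF emb OB L h"
    unfolding hermitian_pairing_def using addl addr bil sym by blast
qed

end

section \<open>Transport of pairings along isomorphisms\<close>

lemma iso_zero:
  assumes f: "bilattice_iso OB L M f" and LM: "abelian_group L" "abelian_group M"
  shows "f \<zero>\<^bsub>L\<^esub> = \<zero>\<^bsub>M\<^esub>"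
proof -
  have z: "\<zero>\<^bsub>L\<^esub> \<in> carrier L" using LM(1) by (simp add: abelian_group.axioms abelian_monoid.zero_closed)
  then have "f \<zero>\<^bsub>L\<^esub> \<in> carrier M" using f by (auto simp: bilattice_iso_def bij_betw_def)
  moreover have "f (\<zero>\<^bsub>L\<^esub> \<oplus>\<^bsub>L\<^esub> \<zero>\<^bsub>L\<^esub>) = f \<zero>\<^bsub>L\<^esub> \<oplus>\<^bsub>M\<^esub> f \<zero>\<^bsub>L\<^esub>"
    using f z unfolding bilattice_iso_def by blast
  moreover have "\<zero>\<^bsub>L\<^esub> \<oplus>\<^bsub>L\<^esub> \<zero>\<^bsub>L\<^esub> = \<zero>\<^bsub>L\<^esub>"
    using abelian_monoid.l_zero[OF _ z] LM(1) by (simp add: abelian_group.axioms)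
  ultimately show ?thesis using idem_zero[OF LM(2)] by simp
qed

lemma intr_pull:
  assumes f: "bilattice_iso OB L M f" and L: "bilattice OF emb OB L" and z: "f \<zero>\<^bsub>L\<^esub> = \<zero>\<^bsub>M\<^esub>"
    and st: "\<And>\<alpha>. \<alpha> \<in> OB \<Longrightarrow> star \<alpha> \<in> OB"
    and k: "intr star M k"
  shows "intr star L (\<lambda>x y. k (f x) (f y))"
proof -
  have bij: "bij_betw f (carrier L) (carrier M)"
    and add: "\<And>x y. x \<in> carrier L \<Longrightarrow> y \<in> carrier L \<Longrightarrow> f (x \<oplus>\<^bsub>L\<^esub> y) = f x \<oplus>\<^bsub>M\<^esub> f y"
    and lm: "\<And>\<alpha> x. \<alpha> \<in> OB \<Longrightarrow> x \<in> carrier L \<Longrightarrow> f (lact L \<alpha> x) = lact M \<alpha> (f x)"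
    and rm: "\<And>\<alpha> x. \<alpha> \<in> OB \<Longrightarrow> x \<in> carrier L \<Longrightarrow> f (ract L x \<alpha>) = ract M (f x) \<alpha>"
    using f unfolding bilattice_iso_def by blast+
  have fM: "f x \<in> carrier M" if "x \<in> carrier L" for x using bij that by (auto simp: bij_betw_def)
  have inj: "x = y" if "f x = f y" "x \<in> carrier L" "y \<in> carrier L" for x y
    using bij that by (auto simp: bij_betw_def inj_on_def)
  have surj: "\<exists>x\<in>carrier L. y = f x" if "y \<in> carrier M" for y using bij that by (auto simp: bij_betw_def)
  have k_add: "k (x \<oplus>\<^bsub>M\<^esub> y) w = k x w + k y w" if "x \<in> carrier M" "y \<in> carrier M" "w \<in> carrier M" for x y w
    using k that unfolding intr_def by blast
  have k_sym: "k x y = cj (k y x)" if "x \<in> carrier M" "y \<in> carrier M" for x y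
    using k that unfolding intr_def by blast
  have k_rm: "k x (ract M y \<alpha>) = k x y * \<alpha>" if "x \<in> carrier M" "y \<in> carrier M" "\<alpha> \<in> OB" for x y \<alpha>
    using k that unfolding intr_def by blast
  have k_lm: "k (lact M \<alpha> x) y = k x (lact M (star \<alpha>) y)" if "x \<in> carrier M" "y \<in> carrier M" "\<alpha> \<in> OB" for x y \<alpha>
    using k that unfolding intr_def by blast
  have k_OB: "k x y \<in> OB" if "x \<in> carrier M" "y \<in> carrier M" for x y
    using k that unfolding intr_def by blast
  show ?thesis
    unfolding intr_def
  proof (intro conjI ballI impI)
    fix x y z assume "x \<in> carrier L" "y \<in> carrier L" "z \<in> carrier L"
    then show "k (f (x \<oplus>\<^bsub>L\<^esub> y)) (f z) = k (f x) (f z) + k (f y) (f z)"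
      using k_add fM add by simp
  next
    fix x y assume "x \<in> carrier L" "y \<in> carrier L"
    then show "k (f x) (f y) = cj (k (f y) (f x))" using k_sym fM by blast
  next
    fix x y \<alpha> assume "x \<in> carrier L" "y \<in> carrier L" "\<alpha> \<in> OB"
    then show "k (f x) (f (ract L y \<alpha>)) = k (f x) (f y) * \<alpha>" using k_rm fM rm by simp
  next
    fix x y \<alpha> assume "x \<in> carrier L" "y \<in> carrier L" "\<alpha> \<in> OB"
    then show "k (f (lact L \<alpha> x)) (f y) = k (f x) (f (lact L (star \<alpha>) y))"
      using k_lm fM lm st by simp
  next
    fix x y assume "x \<in> carrier L" "y \<in> carrier L"
    then show "k (f x) (f y) \<in> OB" using k_OB fM by blast
  next
    fix x assume x: "x \<in> carrier L" "\<forall>y\<in>carrier L. k (f x) (f y) = 0"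
    have "\<forall>y\<in>carrier M. k (f x) y = 0" using x(2) surj by blast
    then have "f x = \<zero>\<^bsub>M\<^esub>" using k fM[OF x(1)] unfolding intr_def by blast
    then show "x = \<zero>\<^bsub>L\<^esub>" using inj x(1) z L_zero[OF L] by simp
  next
    fix x s assume x: "x \<in> carrier L" "s \<in> OF - {0}" "\<forall>y\<in>carrier L. \<exists>\<beta>\<in>OB. k (f x) (f y) = emb s * \<beta>"
    have "\<forall>y\<in>carrier M. \<exists>\<beta>\<in>OB. k (f x) y = emb s * \<beta>" using x(3) surj by blast
    then have "\<exists>x'\<in>carrier M. f x = ract M x' (emb s)" using k fM[OF x(1)] x(2) unfolding intr_def by blast
    then obtain x' where x': "x' \<in> carrier L" "f x = ract M (f x') (emb s)" using surj by blast
    have e: "emb s \<in> OB" using x(2) OB_emb by simp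
    have "f x = f (ract L x' (emb s))" using x' rm[OF e x'(1)] by simp
    then have "x = ract L x' (emb s)" using inj x(1) L_ract[OF L x'(1) e] by blast
    then show "\<exists>x'\<in>carrier L. x = ract L x' (emb s)" using x'(1) by blast
  qed
qed

lemma iso_trans: "bilattice_iso OB L M f \<Longrightarrow> bilattice_iso OB M P g \<Longrightarrow> bilattice_iso OB L P (\<lambda>x. g (f x))"
proof -
  assume f: "bilattice_iso OB L M f" and g: "bilattice_iso OB M P g"
  have fM: "f x \<in> carrier M" if "x \<in> carrier L" for x
    using f that by (auto simp: bilattice_iso_def bij_betw_def)
  have "bij_betw (g \<circ> f) (carrier L) (carrier P)"
    using f g unfolding bilattice_iso_def by (blast intro: bij_betw_trans)
  then show ?thesis using f g fM unfolding bilattice_iso_def comp_def by simp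
qed

end

section \<open>The coordinate model\<close>

declare split_paired_All [simp del] split_paired_Ex [simp del]

lemma sum_fun_apply: "(\<Sum>j\<in>J. f j) i = (\<Sum>j\<in>J. f j i)" for f :: "'j \<Rightarrow> 'i \<Rightarrow> 'a::comm_monoid_add"
  by (induction J rule: infinite_finite_induct) (simp_all add: plus_fun_def zero_fun_def)

context quaternion_setting begin

lemma sig_simps: "a \<in> K \<Longrightarrow> b \<in> K \<Longrightarrow> sig s (a + b) = sig s a + sig s b"
  "a \<in> K \<Longrightarrow> b \<in> K \<Longrightarrow> sig s (a * b) = sig s a * sig s b"
  "sig s (emb x) = emb x" "sig s 0 = 0" "sig s 1 = 1"
  by (simp_all add: sig_def sg_add sg_mult sg_emb sg_zero sg_one)

lemma tau_simps: "tau s (\<alpha> + \<beta>) = tau s \<alpha> + tau s \<beta>" "tau s (\<alpha> * \<beta>) = tau s \<alpha> * tau s \<beta>"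
  "tau s 1 = 1" "tau s (emb a) = emb a"
  using Pi_ne0 emb_central[of "inverse PiB" a] by (simp_all add: tau_def algebra_simps Pi_cancel)

lemma k12_emb: "k1 (emb a) = emb a" "k2 (emb a) = 0" "k1 1 = 1" "k2 1 = 0"
  using k12_K[OF K_emb] k12_K[OF K_one] by simp_all

text \<open>The embeddings \<open>\<phi>_1\<close> and \<open>\<phi>_2\<close> in coordinates, for
  all indices at once: on an E-F pair of sign True the scalar acts by the matrix with rows
  \<open>k1, k2 \<pi>\<close> and \<open>sg k2, sg k1\<close>, and for False with \<open>sg\<close>
  applied to the entries. The action is defined on all functions, independently of an index
  set.\<close>

definition mlm :: "'b \<Rightarrow> (kind \<times> nat \<Rightarrow> 'b) \<Rightarrow> kind \<times> nat \<Rightarrow> 'b" where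
  "mlm \<alpha> x = (\<lambda>(k, i). case k of
      GK s \<Rightarrow> tau s \<alpha> * x (GK s, i)
    | EK s \<Rightarrow> sig s (k1 \<alpha>) * x (EK s, i) + emb \<pi> * (sig s (k2 \<alpha>) * x (FK s, i))
    | FK s \<Rightarrow> sig (\<not> s) (k1 \<alpha>) * x (FK s, i) + sig (\<not> s) (k2 \<alpha>) * x (EK s, i))"

definition mrm :: "(kind \<times> nat \<Rightarrow> 'b) \<Rightarrow> 'b \<Rightarrow> kind \<times> nat \<Rightarrow> 'b" where
  "mrm x \<alpha> = (\<lambda>j. x j * \<alpha>)"

lemma mlm_simps:
  "mlm \<alpha> x (GK s, i) = tau s \<alpha> * x (GK s, i)"
  "mlm \<alpha> x (EK s, i) = sig s (k1 \<alpha>) * x (EK s, i) + emb \<pi> * (sig s (k2 \<alpha>) * x (FK s, i))"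
  "mlm \<alpha> x (FK s, i) = sig (\<not> s) (k1 \<alpha>) * x (FK s, i) + sig (\<not> s) (k2 \<alpha>) * x (EK s, i)"
  by (simp_all add: mlm_def)

lemma coord_eqI:
  fixes x y :: "kind \<times> nat \<Rightarrow> 'z"
  assumes "\<And>s i. x (GK s, i) = y (GK s, i)" "\<And>s i. x (EK s, i) = y (EK s, i)" "\<And>s i. x (FK s, i) = y (FK s, i)"
  shows "x = y"
proof
  fix j :: "kind \<times> nat"
  obtain k i where j: "j = (k, i)" by (cases j)
  show "x j = y j" unfolding j using assms by (cases k) simp_all
qed

text \<open>Multiplicativity of the matrices of \<open>mlm\<close>, written in entries.\<close>

lemma sig_k12_mult:
  "sig s (k1 (\<alpha> * \<beta>)) = sig s (k1 \<alpha>) * sig s (k1 \<beta>) + emb \<pi> * (sig s (k2 \<alpha>) * sig (\<not> s) (k2 \<beta>))"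
  "sig s (k2 (\<alpha> * \<beta>)) = sig s (k1 \<alpha>) * sig s (k2 \<beta>) + sig s (k2 \<alpha>) * sig (\<not> s) (k1 \<beta>)"
proof -
  note m = k12(1)[of \<alpha>] k12(2)[of \<alpha>] k12(1)[of \<beta>] k12(2)[of \<beta>]
  note g = sg_K[OF m(3)] sg_K[OF m(4)]
  show "sig s (k1 (\<alpha> * \<beta>)) = sig s (k1 \<alpha>) * sig s (k1 \<beta>) + emb \<pi> * (sig s (k2 \<alpha>) * sig (\<not> s) (k2 \<beta>))"
    unfolding k12_mult by (simp add: sig_simps m g K_mult K_emb sig_sg)
  show "sig s (k2 (\<alpha> * \<beta>)) = sig s (k1 \<alpha>) * sig s (k2 \<beta>) + sig s (k2 \<alpha>) * sig (\<not> s) (k1 \<beta>)"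
    unfolding k12_mult by (simp add: sig_simps m g K_mult K_emb sig_sg)
qed

lemma model: "ambient_bimodule vF emb cj sg vB OF OB OK K \<pi> PiB c mlm mrm"
proof unfold_locales
  fix \<alpha> \<beta> :: 'b and x y :: "kind \<times> nat \<Rightarrow> 'b" and a :: 'f
  note kk = k12(1)[of \<alpha>] k12(2)[of \<alpha>] k12(1)[of \<beta>] k12(2)[of \<beta>]
  show "mlm \<alpha> (x + y) = mlm \<alpha> x + mlm \<alpha> y"
    by (rule coord_eqI) (simp_all add: mlm_simps plus_fun_def distrib_left)
  show "mrm (x + y) \<alpha> = mrm x \<alpha> + mrm y \<alpha>"
    by (simp add: mrm_def plus_fun_def distrib_right)
  show "mlm (\<alpha> + \<beta>) x = mlm \<alpha> x + mlm \<beta> x"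
    by (rule coord_eqI) (simp_all add: mlm_simps plus_fun_def tau_simps k12_add sig_simps kk distrib_right distrib_left)
  show "mrm x (\<alpha> + \<beta>) = mrm x \<alpha> + mrm x \<beta>"
    by (simp add: mrm_def plus_fun_def distrib_left)
  show "mlm (\<alpha> * \<beta>) x = mlm \<alpha> (mlm \<beta> x)"
  proof (rule coord_eqI)
    fix s i
    show "mlm (\<alpha> * \<beta>) x (GK s, i) = mlm \<alpha> (mlm \<beta> x) (GK s, i)"
      by (simp add: mlm_simps tau_simps mult.assoc)
    show "mlm (\<alpha> * \<beta>) x (EK s, i) = mlm \<alpha> (mlm \<beta> x) (EK s, i)"
      unfolding mlm_simps sig_k12_mult distrib_left distrib_right mult.assoc emb_central2[of "sig s (k1 \<alpha>)" \<pi>]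
      by (simp only: add.assoc add.left_commute add.commute)
    show "mlm (\<alpha> * \<beta>) x (FK s, i) = mlm \<alpha> (mlm \<beta> x) (FK s, i)"
      unfolding mlm_simps sig_k12_mult distrib_left distrib_right mult.assoc emb_central2[of "sig (\<not> s) (k2 \<alpha>)" \<pi>]
      by (simp add: add.assoc add.left_commute add.commute)
  qed
  show "mrm x (\<alpha> * \<beta>) = mrm (mrm x \<alpha>) \<beta>" by (simp add: mrm_def mult.assoc)
  show "mlm \<alpha> (mrm x \<beta>) = mrm (mlm \<alpha> x) \<beta>"
    by (rule coord_eqI) (simp_all add: mlm_simps mrm_def distrib_right mult.assoc)
  show "mlm 1 x = x" by (rule coord_eqI) (simp_all add: mlm_simps tau_simps k12_emb sig_simps)
  show "mrm x 1 = x" by (simp add: mrm_def)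
  show "mlm (emb a) x = mrm x (emb a)"
    by (rule coord_eqI) (simp_all add: mlm_simps tau_simps k12_emb sig_simps mrm_def emb_central)
qed

interpretation M: ambient_bimodule vF emb cj sg vB OF OB OK K \<pi> PiB c mlm mrm
  by (rule model)

definition NJ :: "(kind \<times> nat) set \<Rightarrow> (kind \<times> nat \<Rightarrow> 'b) set" where
  "NJ J = {x. (\<forall>j\<in>J. x j \<in> OB) \<and> (\<forall>j. j \<notin> J \<longrightarrow> x j = 0)}"

definition dl :: "kind \<times> nat \<Rightarrow> kind \<times> nat \<Rightarrow> 'b" where
  "dl j = (\<lambda>i. if i = j then 1 else 0)"

text \<open>The coordinate lattice repackaged as a record, through which abstract bilattices are
  compared with it.\<close>

definition Vrec :: "(kind \<times> nat) set \<Rightarrow> ('b, kind \<times> nat \<Rightarrow> 'b) bimodule" where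
  "Vrec J = \<lparr> carrier = NJ J, mult = undefined, one = undefined, zero = (\<lambda>_. 0),
     add = (\<lambda>x y j. x j + y j), lact = mlm, ract = mrm \<rparr>"

lemma Vrec_simps: "carrier (Vrec J) = NJ J" "\<zero>\<^bsub>Vrec J\<^esub> = 0" "x \<oplus>\<^bsub>Vrec J\<^esub> y = x + y"
  "lact (Vrec J) = mlm" "ract (Vrec J) = mrm"
  by (simp_all add: Vrec_def zero_fun_def plus_fun_def)

lemma NJ_mem: "x \<in> NJ J \<longleftrightarrow> (\<forall>j. x j \<in> OB \<and> (j \<notin> J \<longrightarrow> x j = 0))"
  using OB_zero by (auto simp: NJ_def)

lemma mlm_NJ:
  assumes x: "x \<in> NJ (JJ A C)" and a: "\<alpha> \<in> OB"
  shows "mlm \<alpha> x \<in> NJ (JJ A C)"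
proof -
  have O: "x j \<in> OB" for j using x unfolding NJ_mem by blast
  have k: "sig s (k1 \<alpha>) \<in> OB" "sig s (k2 \<alpha>) \<in> OB" for s
    using k12_OK[OF a] OB_OK[OF sig_OK, of _ s] by simp_all
  have piO: "emb \<pi> \<in> OB" using ge_pi vge_mono[OF vB(1), of 1 "emb \<pi>" 0] OB_iff by simp
  have z: "x j = 0" if "j \<notin> JJ A C" for j using x that unfolding NJ_mem by blast
  have "mlm \<alpha> x j \<in> OB \<and> (j \<notin> JJ A C \<longrightarrow> mlm \<alpha> x j = 0)" for j
  proof -
    obtain q i where j: "j = (q, i)" by (cases j)
    show ?thesis
    proof (cases q)
      case (GK s)
      show ?thesis unfolding j GK mlm_simps using OB_mult[OF tau_OB[OF a] O] z[of "(GK s, i)"] by simp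
    next
      case (EK s)
      have "x (EK s, i) = 0" "x (FK s, i) = 0" if "(EK s, i) \<notin> JJ A C"
        using z[of "(EK s, i)"] z[of "(FK s, i)"] that by (simp_all add: JJ_iff)
      then show ?thesis unfolding j EK mlm_simps
        using OB_add[OF OB_mult[OF k(1) O] OB_mult[OF piO OB_mult[OF k(2) O]]] by simp
    next
      case (FK s)
      have "x (EK s, i) = 0" "x (FK s, i) = 0" if "(FK s, i) \<notin> JJ A C"
        using z[of "(EK s, i)"] z[of "(FK s, i)"] that by (simp_all add: JJ_iff)
      then show ?thesis unfolding j FK mlm_simps
        using OB_add[OF OB_mult[OF k(1) O] OB_mult[OF k(2) O]] by simp
    qed
  qed
  then show ?thesis unfolding NJ_mem by blast
qed

lemma lat_NJ: "M.lat (NJ (JJ A C))"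
  unfolding M.lat_def
proof (intro conjI ballI)
  fix x \<alpha> assume "x \<in> NJ (JJ A C)" "\<alpha> \<in> OB"
  then show "mlm \<alpha> x \<in> NJ (JJ A C)" by (rule mlm_NJ)
qed (simp_all add: OB_add OB_mult OB_zero NJ_mem mrm_def plus_fun_def zero_fun_def)

lemma lincomb_dl: "finite J \<Longrightarrow> M.lincomb J dl a = (\<lambda>i. if i \<in> J then a i else 0)"
proof
  fix i assume J: "finite J"
  have "M.lincomb J dl a i = (\<Sum>j\<in>J. if i = j then a j else 0)"
    unfolding M.lincomb_def sum_fun_apply by (rule sum.cong[OF refl]) (simp add: mrm_def dl_def)
  also have "\<dots> = (if i \<in> J then a i else 0)" using J by simp
  finally show "M.lincomb J dl a i = (if i \<in> J then a i else 0)" .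
qed

lemma dl_basis: assumes J: "finite J" shows "M.rbasis J dl (NJ J)"
proof (rule M.rbasisI[OF J])
  fix a :: "kind \<times> nat \<Rightarrow> 'b" assume "\<And>j. j \<in> J \<Longrightarrow> a j \<in> OB"
  then show "M.lincomb J dl a \<in> NJ J" using OB_zero unfolding lincomb_dl[OF J] by (simp add: NJ_mem)
next
  fix x assume x: "x \<in> NJ J"
  have "x = (\<lambda>i. if i \<in> J then x i else 0)"
  proof
    fix i show "x i = (if i \<in> J then x i else 0)" using x unfolding NJ_mem by simp
  qed
  moreover have "\<forall>j\<in>J. x j \<in> OB" using x unfolding NJ_mem by blast
  ultimately show "\<exists>a. (\<forall>j\<in>J. a j \<in> OB) \<and> x = M.lincomb J dl a"
    unfolding lincomb_dl[OF J] by (intro exI[of _ x] conjI)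
next
  fix a :: "kind \<times> nat \<Rightarrow> 'b" and j assume a: "M.lincomb J dl a = 0" and j: "j \<in> J"
  have "M.lincomb J dl a j = 0" unfolding a by simp
  then show "a j = 0" using j unfolding lincomb_dl[OF J] by simp
qed

lemma dl_typed: "M.typed (JJ A C) dl"
  unfolding M.typed_def
proof (intro conjI allI impI)
  fix s i
  show "M.ty s (dl (GK s, i))" unfolding M.ty_def
    by (intro ballI, rule coord_eqI) (auto simp: mlm_simps mrm_def dl_def)
  show "M.te s (dl (EK s, i))" unfolding M.te_def
    by (intro ballI, rule coord_eqI) (auto simp: mlm_simps mrm_def dl_def k12_K OK_K sig_simps)
  show "dl (FK s, i) = mlm PiB (dl (EK s, i))"
    by (rule coord_eqI) (auto simp: mlm_simps dl_def k12_Pi sig_simps)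
qed (simp_all add: JJ_iff)

lemma Vrec_bilattice:
  assumes fin: "finite (JJ A C)"
  shows "bilattice OF emb OB (Vrec (JJ A C))"
proof -
  let ?V = "Vrec (JJ A C)"
  have grp: "abelian_group ?V"
  proof (rule abelian_groupI)
    fix x assume x: "x \<in> carrier ?V"
    show "\<exists>y\<in>carrier ?V. y \<oplus>\<^bsub>?V\<^esub> x = \<zero>\<^bsub>?V\<^esub>"
      using x OB_minus by (intro bexI[of _ "- x"]) (simp_all add: Vrec_simps NJ_mem)
  qed (simp_all add: Vrec_simps NJ_mem OB_add OB_zero plus_fun_def zero_fun_def add.assoc add.commute add.left_commute)
  have L: "mlm \<alpha> x \<in> NJ (JJ A C)" "mrm x \<alpha> \<in> NJ (JJ A C)" if "\<alpha> \<in> OB" "x \<in> NJ (JJ A C)" for \<alpha> x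
    using lat_NJ that unfolding M.lat_def by blast+
  have "bimodule_axioms OB ?V"
    unfolding bimodule_axioms_def Vrec_simps
    by (intro conjI ballI grp L; (assumption | simp only: M.lm_add M.rm_add M.lm_addl M.rm_addr M.lm_mult
        M.rm_mult M.lm_rm M.lm_one M.rm_one))
  moreover have "\<exists>S. finite S \<and> S \<subseteq> carrier ?V \<and> (\<forall>N. sub_bimodule OB ?V N \<and> S \<subseteq> N \<longrightarrow> N = carrier ?V)"
  proof (intro exI[of _ "dl ` JJ A C"] conjI allI impI)
    show "finite (dl ` JJ A C)" using fin by simp
    show "dl ` JJ A C \<subseteq> carrier ?V" using M.rbasis_in[OF dl_basis[OF fin]] by (auto simp: Vrec_simps)
    fix N assume N: "sub_bimodule OB ?V N \<and> dl ` JJ A C \<subseteq> N"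
    then have latN: "M.lat N" and sub: "N \<subseteq> NJ (JJ A C)"
      unfolding sub_bimodule_def M.lat_def Vrec_simps by blast+
    show "N = carrier ?V"
    proof
      show "N \<subseteq> carrier ?V" using sub by (simp add: Vrec_simps)
      show "carrier ?V \<subseteq> N"
      proof
        fix x assume "x \<in> carrier ?V"
        then have "x \<in> NJ (JJ A C)" by (simp add: Vrec_simps)
        from M.rbasis_mem[OF dl_basis[OF fin], of x, THEN iffD1, OF this]
        obtain a where a: "\<forall>j\<in>JJ A C. a j \<in> OB" "x = M.lincomb (JJ A C) dl a" by (elim exE conjE)
        have "dl j \<in> N" if "j \<in> JJ A C" for j using N that by blast
        then show "x \<in> N" unfolding a(2) using M.lat_lincomb[OF latN, of "JJ A C" dl a] a(1) by simp
      qed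
    qed
  qed
  moreover have "\<forall>a\<in>OF. \<forall>x\<in>carrier ?V. lact ?V (emb a) x = ract ?V x (emb a)"
    by (simp add: Vrec_simps M.lm_emb)
  moreover have "\<forall>a\<in>OF. \<forall>x\<in>carrier ?V. ract ?V x (emb a) = \<zero>\<^bsub>?V\<^esub> \<longrightarrow> a = 0 \<or> x = \<zero>\<^bsub>?V\<^esub>"
  proof (intro ballI impI)
    fix a x assume "ract ?V x (emb a) = \<zero>\<^bsub>?V\<^esub>"
    then have "x j * emb a = 0" for j unfolding Vrec_simps mrm_def by (metis zero_fun_apply)
    then show "a = 0 \<or> x = \<zero>\<^bsub>?V\<^esub>" using emb_eq_0_iff by (auto simp: Vrec_simps zero_fun_def)
  qed
  ultimately show ?thesis unfolding bilattice_def by blast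
qed

lemma intr_Vrec_sd: "intr pr (Vrec (JJ A C)) h \<longleftrightarrow> M.sd (NJ (JJ A C)) h"
  unfolding intr_def M.sd_def Vrec_simps using lat_NJ by simp

text \<open>Replacing \<open>y\<close> by \<open>w y\<close> changes the adjoint involution by
  conjugation with \<open>w\<close>; hermitian symmetry survives because \<open>w\<close> is its own
  adjoint, and perfectness because \<open>w\<close> is a unit. It is applied with \<open>u\<close>
  to pass from \<open>*\<close> to the primed involution, and with \<open>inverse u\<close> to
  return.\<close>

lemma intr_twist:
  assumes h: "intr s1 (Vrec (JJ A C)) h"
    and w: "w \<in> OB" "inverse w \<in> OB" "w \<noteq> 0"
    and s: "\<And>\<alpha>. s1 \<alpha> = w * s2 \<alpha> * inverse w" "s1 w = w" "\<And>\<alpha>. \<alpha> \<in> OB \<Longrightarrow> s2 \<alpha> \<in> OB"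
  shows "intr s2 (Vrec (JJ A C)) (\<lambda>x y. h x (mlm w y))"
proof -
  let ?N = "NJ (JJ A C)"
  have wN: "mlm w x \<in> ?N" if "x \<in> ?N" for x using mlm_NJ[OF that w(1)] .
  have wiN: "mlm (inverse w) x \<in> ?N" if "x \<in> ?N" for x using mlm_NJ[OF that w(2)] .
  have ww: "mlm w (mlm (inverse w) x) = x" for x using w(3) by (simp add: M.lm_mult[symmetric] M.lm_one)
  have add: "h (x + y) z = h x z + h y z" if "x \<in> ?N" "y \<in> ?N" "z \<in> ?N" for x y z
    using h that unfolding intr_def Vrec_simps by blast
  have sym: "h x y = cj (h y x)" if "x \<in> ?N" "y \<in> ?N" for x y
    using h that unfolding intr_def Vrec_simps by blast
  have rm: "h x (mrm y \<alpha>) = h x y * \<alpha>" if "x \<in> ?N" "y \<in> ?N" "\<alpha> \<in> OB" for x y \<alpha>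
    using h that unfolding intr_def Vrec_simps by blast
  have lm: "h (mlm \<alpha> x) y = h x (mlm (s1 \<alpha>) y)" if "x \<in> ?N" "y \<in> ?N" "\<alpha> \<in> OB" for x y \<alpha>
    using h that unfolding intr_def Vrec_simps by blast
  have int: "h x y \<in> OB" if "x \<in> ?N" "y \<in> ?N" for x y
    using h that unfolding intr_def Vrec_simps by blast
  have nd: "x = 0" if "x \<in> ?N" "\<forall>y\<in>?N. h x y = 0" for x
    using h that unfolding intr_def Vrec_simps by blast
  have pf: "\<exists>x'\<in>?N. x = mrm x' (emb s)" if "x \<in> ?N" "s \<in> OF - {0}" "\<forall>y\<in>?N. \<exists>\<beta>\<in>OB. h x y = emb s * \<beta>" for x s
    using h that unfolding intr_def Vrec_simps by blast
  show ?thesis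
    unfolding intr_def Vrec_simps
  proof (intro conjI ballI impI)
    fix x y z assume "x \<in> ?N" "y \<in> ?N" "z \<in> ?N"
    then show "h (x + y) (mlm w z) = h x (mlm w z) + h y (mlm w z)" using add wN by blast
  next
    fix x y assume xy: "x \<in> ?N" "y \<in> ?N"
    have "h x (mlm w y) = cj (h (mlm w y) x)" by (rule sym[OF xy(1) wN[OF xy(2)]])
    \<comment> \<open>Self-adjointness of \<open>w\<close> is used here.\<close>
    also have "h (mlm w y) x = h y (mlm w x)" using lm[OF xy(2,1) w(1)] s(2) by simp
    finally show "h x (mlm w y) = cj (h y (mlm w x))" .
    show "h x (mlm w y) \<in> OB" by (rule int[OF xy(1) wN[OF xy(2)]])
  next
    fix x y \<alpha> assume "x \<in> ?N" "y \<in> ?N" "\<alpha> \<in> OB"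
    then show "h x (mlm w (mrm y \<alpha>)) = h x (mlm w y) * \<alpha>" using rm wN by (simp add: M.lm_rm)
  next
    fix x y \<alpha> assume xy: "x \<in> ?N" "y \<in> ?N" "\<alpha> \<in> OB"
    have "s1 \<alpha> * w = w * s2 \<alpha>" unfolding s(1) using w(3) by (simp add: mult.assoc)
    then show "h (mlm \<alpha> x) (mlm w y) = h x (mlm w (mlm (s2 \<alpha>) y))"
      using lm[OF xy(1) wN[OF xy(2)] xy(3)] by (simp add: M.lm_mult[symmetric])
  next
    fix x assume x: "x \<in> ?N" "\<forall>y\<in>?N. h x (mlm w y) = 0"
    have "\<forall>y\<in>?N. h x y = 0"
    proof
      fix y assume y: "y \<in> ?N"
      have "h x (mlm w (mlm (inverse w) y)) = 0" using x(2) wiN[OF y] by blast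
      then show "h x y = 0" unfolding ww .
    qed
    then show "x = 0" using nd x(1) by blast
  next
    fix x s assume x: "x \<in> ?N" "s \<in> OF - {0}" "\<forall>y\<in>?N. \<exists>\<beta>\<in>OB. h x (mlm w y) = emb s * \<beta>"
    have "\<forall>y\<in>?N. \<exists>\<beta>\<in>OB. h x y = emb s * \<beta>"
    proof
      fix y assume y: "y \<in> ?N"
      have "\<exists>\<beta>\<in>OB. h x (mlm w (mlm (inverse w) y)) = emb s * \<beta>" using x(3) wiN[OF y] by blast
      then show "\<exists>\<beta>\<in>OB. h x y = emb s * \<beta>" unfolding ww .
    qed
    then show "\<exists>x'\<in>?N. x = mrm x' (emb s)" using pf x(1,2) by blast
  qed
qed

section \<open>The standard form\<close>

text \<open>The product of the standard Gram matrix with a coordinate vector, written entrywise;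
  \<open>Gram_sum\<close> gives the comparison.\<close>

definition gpart :: "(kind \<times> nat \<Rightarrow> 'b) \<Rightarrow> kind \<times> nat \<Rightarrow> 'b" where
  "gpart y = (\<lambda>(k, i). case k of GK s \<Rightarrow> y (GK (\<not> s), i) | EK s \<Rightarrow> c * y (FK s, i) | FK s \<Rightarrow> - (c * y (EK s, i)))"

lemma gpart_simps: "gpart y (GK s, i) = y (GK (\<not> s), i)" "gpart y (EK s, i) = c * y (FK s, i)"
  "gpart y (FK s, i) = - (c * y (EK s, i))"
  by (simp_all add: gpart_def)

definition stdform :: "nat \<Rightarrow> (bool \<Rightarrow> nat) \<Rightarrow> (kind \<times> nat \<Rightarrow> 'b) \<Rightarrow> (kind \<times> nat \<Rightarrow> 'b) \<Rightarrow> 'b" where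
  "stdform r t x y = (\<Sum>j\<in>std_index r t. cj (x j) * gpart y j)"

lemma finite_std: "finite (std_index r t)"
  unfolding std_index_def by (rule finite_JJ) simp_all

definition gblock :: "(kind \<times> nat \<Rightarrow> 'b) \<Rightarrow> (kind \<times> nat \<Rightarrow> 'b) \<Rightarrow> nat \<Rightarrow> 'b" where
  "gblock x y i = cj (x (GK True, i)) * y (GK False, i) + cj (x (GK False, i)) * y (GK True, i)"

definition eblock :: "bool \<Rightarrow> (kind \<times> nat \<Rightarrow> 'b) \<Rightarrow> (kind \<times> nat \<Rightarrow> 'b) \<Rightarrow> nat \<Rightarrow> 'b" where
  "eblock s x y i = cj (x (EK s, i)) * (c * y (FK s, i)) - cj (x (FK s, i)) * (c * y (EK s, i))"

lemma stdform_blocks: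
  "stdform r t x y = (\<Sum>i<r. gblock x y i) + (\<Sum>i<t True. eblock True x y i) + (\<Sum>i<t False. eblock False x y i)"
  unfolding stdform_def std_index_def
  by (subst sum_JJ) (simp_all add: gpart_simps gblock_def eblock_def sum.distrib)

lemma Gram_sum:
  assumes "i \<in> std_index r t"
  shows "(\<Sum>j\<in>std_index r t. Gram i j * y j) = gpart y i"
proof -
  obtain k l where i: "i = (k, l)" by (cases i)
  have one: "(\<Sum>j\<in>std_index r t. Gram i j * y j) = Gram i j0 * y j0"
    if "j0 \<in> std_index r t" "\<And>j. j \<noteq> j0 \<Longrightarrow> Gram i j = 0" for j0
  proof -
    have "(\<Sum>j\<in>std_index r t. Gram i j * y j) = (\<Sum>j\<in>std_index r t. if j = j0 then Gram i j0 * y j0 else 0)"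
      by (rule sum.cong[OF refl]) (use that(2) in auto)
    then show ?thesis using finite_std that(1) by simp
  qed
  show ?thesis
  proof (cases k)
    case (GK s)
    have "Gram i j = 0" if n: "j \<noteq> (GK (\<not> s), l)" for j
    proof -
      obtain q m where j: "j = (q, m)" by (cases j)
      show ?thesis using n unfolding i j GK by (cases q) (auto simp: Gram_def)
    qed
    then show ?thesis using one[of "(GK (\<not> s), l)"] assms unfolding i GK
      by (simp add: std_index_def JJ_iff Gram_def gpart_simps)
  next
    case (EK s)
    have "Gram i j = 0" if n: "j \<noteq> (FK s, l)" for j
    proof -
      obtain q m where j: "j = (q, m)" by (cases j)
      show ?thesis using n unfolding i j EK by (cases q) (auto simp: Gram_def)
    qed
    then show ?thesis using one[of "(FK s, l)"] assms unfolding i EK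
      by (simp add: std_index_def JJ_iff Gram_def gpart_simps)
  next
    case (FK s)
    have "Gram i j = 0" if n: "j \<noteq> (EK s, l)" for j
    proof -
      obtain q m where j: "j = (q, m)" by (cases j)
      show ?thesis using n unfolding i j FK by (cases q) (auto simp: Gram_def)
    qed
    then show ?thesis using one[of "(EK s, l)"] assms unfolding i FK
      by (simp add: std_index_def JJ_iff Gram_def gpart_simps)
  qed
qed

lemma pr_coords: "k1 (pr \<alpha>) = k1 \<alpha>" "k2 (pr \<alpha>) = - sg (k2 \<alpha>)"
proof -
  note m = k12(1)[of \<alpha>] k12(2)[of \<alpha>]
  have "pr \<alpha> = PiB * cj (k1 \<alpha> + k2 \<alpha> * PiB) * inverse PiB" unfolding pr_def using k12(3)[of \<alpha>] by simp
  also have "\<dots> = pr (k1 \<alpha>) + PiB * cj (k2 \<alpha> * PiB) * inverse PiB"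
    by (simp add: pr_def cj_add algebra_simps)
  also have "PiB * cj (k2 \<alpha> * PiB) * inverse PiB = - (PiB * (PiB * sg (k2 \<alpha>)) * inverse PiB)"
    using cj_K[OF m(2)] by (simp add: cj_mult cj_Pi)
  also have "PiB * sg (k2 \<alpha>) = k2 \<alpha> * PiB" using Pi_K[OF sg_K[OF m(2)]] sg_sg[OF m(2)] by simp
  also have "- (PiB * (k2 \<alpha> * PiB) * inverse PiB) = - (PiB * k2 \<alpha>)" using Pi_ne0 by (simp add: mult.assoc)
  also have "\<dots> = - sg (k2 \<alpha>) * PiB" using Pi_K[OF m(2)] by simp
  finally have e: "pr \<alpha> = k1 \<alpha> + - sg (k2 \<alpha>) * PiB" using pr_K[OF m(1)] by simp
  show "k1 (pr \<alpha>) = k1 \<alpha>" "k2 (pr \<alpha>) = - sg (k2 \<alpha>)"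
    unfolding e using k12_eq[OF m(1) K_minus[OF sg_K[OF m(2)]]] by blast+
qed

lemma sig_minus: "a \<in> K \<Longrightarrow> sig s (- a) = - sig s a"
  by (simp add: sig_def sg_minus)

lemma gblock_adjoint: "gblock (mlm \<alpha> x) y i = gblock x (mlm (pr \<alpha>) y) i"
  using cj_tau[of True \<alpha>] cj_tau[of False \<alpha>] by (simp add: gblock_def mlm_simps cj_mult mult.assoc)

text \<open>The adjoint scalar has coordinates \<open>k1 \<alpha>\<close> and
  \<open>- sg (k2 \<alpha>)\<close>. Its sign matches the opposite signs of the two entries
  \<open>c\<close> and \<open>- c\<close> of the block, its \<open>sg\<close> matches the two
  characters of E and F, and \<open>c\<close> commutes with all of K.\<close>

lemma eblock_adjoint: "eblock s (mlm \<alpha> x) y i = eblock s x (mlm (pr \<alpha>) y) i"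
proof -
  note m = k12(1)[of \<alpha>] k12(2)[of \<alpha>]
  define a a' b b' where "a = sig s (k1 \<alpha>)" and "a' = sig (\<not> s) (k1 \<alpha>)" and "b = sig s (k2 \<alpha>)" and "b' = sig (\<not> s) (k2 \<alpha>)"
  have K': "a \<in> K" "a' \<in> K" "b \<in> K" "b' \<in> K" using m sig_K by (auto simp: a_def a'_def b_def b'_def)
  have cjs: "cj a = a'" "cj a' = a" "cj b = b'" "cj b' = b"
    using cj_sig[OF m(1)] cj_sig[OF m(2)] by (auto simp: a_def a'_def b_def b'_def)
  have pb: "sig s (k1 (pr \<alpha>)) = a" "sig (\<not> s) (k1 (pr \<alpha>)) = a'" "sig s (k2 (pr \<alpha>)) = - b'" "sig (\<not> s) (k2 (pr \<alpha>)) = - b"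
    unfolding pr_coords using sig_minus[OF sg_K[OF m(2)]] sig_sg[OF m(2)] by (auto simp: a_def a'_def b_def b'_def)
  define X X' Y Y' where "X = cj (x (EK s, i))" and "X' = cj (x (FK s, i))" and "Y = y (EK s, i)" and "Y' = y (FK s, i)"
  have cc: "a' * (c * z) = c * (a' * z)" "a * (c * z) = c * (a * z)" "b * (c * z) = c * (b * z)" "b' * (c * z) = c * (b' * z)" for z
    using K_comm[OF K'(1) c_K] K_comm[OF K'(2) c_K] K_comm[OF K'(3) c_K] K_comm[OF K'(4) c_K]
    by (simp_all add: mult.assoc[symmetric])
  have xe: "cj (emb \<pi> * (b * x (FK s, i))) = X' * (b' * emb \<pi>)"
    by (simp add: cj_mult cj_emb cjs X'_def mult.assoc)
  have pc: "b' * (emb \<pi> * (c * z)) = c * (emb \<pi> * (b' * z))" for z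
    using cc(4)[of "emb \<pi> * z"] emb_central2[of c \<pi> z] emb_central2[of b' \<pi> z] by simp
  have "eblock s (mlm \<alpha> x) y i = (X * a' + X' * (b' * emb \<pi>)) * (c * Y') - (X' * a + X * b) * (c * Y)"
    unfolding eblock_def mlm_simps a_def[symmetric] a'_def[symmetric] b_def[symmetric] b'_def[symmetric] cj_add xe
    by (simp add: cj_mult cjs X_def X'_def Y_def Y'_def)
  also have "\<dots> = X * (c * (a' * Y' + - b * Y)) - X' * (c * (a * Y + emb \<pi> * (- b' * Y')))"
    by (simp add: distrib_left distrib_right right_diff_distrib left_diff_distrib mult.assoc cc pc)
  also have "\<dots> = eblock s x (mlm (pr \<alpha>) y) i"
    unfolding eblock_def mlm_simps pb X_def X'_def Y_def Y'_def ..
  finally show ?thesis .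
qed

lemma cj_c: "cj c = - c"
  using cj_K[OF c_K] sg_c by simp

lemma cj_Gram: "cj (Gram j i) = Gram i j"
proof -
  obtain k l where i: "i = (k, l)" by (cases i)
  obtain q m where j: "j = (q, m)" by (cases j)
  show ?thesis unfolding i j
    by (cases k; cases q) (auto simp: Gram_def cj_c cj_zero cj_one cj_minus)
qed

lemma gpart_dl:
  assumes "j0 \<in> std_index r t" "j \<in> std_index r t"
  shows "gpart (dl j0) j = Gram j j0"
proof -
  have "gpart (dl j0) j = (\<Sum>i\<in>std_index r t. if i = j0 then Gram j j0 else 0)"
    unfolding Gram_sum[OF assms(2), symmetric] by (rule sum.cong[OF refl]) (simp add: dl_def)
  then show ?thesis using finite_std assms(1) by simp
qed

text \<open>Every column of the standard Gram matrix has a single nonzero entry, and it is a unit.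
  Each coordinate can therefore be recovered from one pairing, which gives both nondegeneracy and
  perfectness.\<close>

lemma stdform_dual:
  assumes "j1 \<in> std_index r t"
  shows "\<exists>j0\<in>std_index r t. \<exists>e. (e = 1 \<or> e = c \<or> e = - c) \<and> (\<forall>x. stdform r t x (dl j0) = cj (x j1) * e)"
proof -
  obtain k l where j1: "j1 = (k, l)" by (cases j1)
  have main: ?thesis if j0: "j0 \<in> std_index r t" and e: "Gram j1 j0 = 1 \<or> Gram j1 j0 = c \<or> Gram j1 j0 = - c"
    and z: "\<And>j. j \<noteq> j1 \<Longrightarrow> Gram j j0 = 0" for j0
  proof -
    have "stdform r t x (dl j0) = cj (x j1) * Gram j1 j0" for x
    proof -
      have "stdform r t x (dl j0) = (\<Sum>j\<in>std_index r t. if j = j1 then cj (x j1) * Gram j1 j0 else 0)"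
        unfolding stdform_def by (rule sum.cong[OF refl]) (use z gpart_dl[OF j0] in auto)
      then show ?thesis using finite_std assms by simp
    qed
    then show ?thesis using j0 e by blast
  qed
  show ?thesis
  proof (cases k)
    case (GK s)
    show ?thesis
    proof (rule main[of "(GK (\<not> s), l)"])
      fix j assume "j \<noteq> j1"
      then show "Gram j (GK (\<not> s), l) = 0"
        unfolding j1 GK by (cases j, cases "fst j") (auto simp: Gram_def)
    qed (use assms in \<open>auto simp: j1 GK std_index_def JJ_iff Gram_def\<close>)
  next
    case (EK s)
    show ?thesis
    proof (rule main[of "(FK s, l)"])
      fix j assume "j \<noteq> j1"
      then show "Gram j (FK s, l) = 0"
        unfolding j1 EK by (cases j, cases "fst j") (auto simp: Gram_def)
    qed (use assms in \<open>auto simp: j1 EK std_index_def JJ_iff Gram_def\<close>)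
  next
    case (FK s)
    show ?thesis
    proof (rule main[of "(EK s, l)"])
      fix j assume "j \<noteq> j1"
      then show "Gram j (EK s, l) = 0"
        unfolding j1 FK by (cases j, cases "fst j") (auto simp: Gram_def)
    qed (use assms in \<open>auto simp: j1 FK std_index_def JJ_iff Gram_def\<close>)
  qed
qed

lemma gblock_sym: "cj (gblock y x i) = gblock x y i"
  by (simp add: gblock_def cj_add cj_mult cj_cj add.commute)

lemma eblock_sym: "cj (eblock s y x i) = eblock s x y i"
  by (simp add: eblock_def cj_diff cj_mult cj_cj cj_c mult.assoc)

lemma stdform_intr: "intr pr (Vrec (std_index r t)) (stdform r t)"
proof -
  let ?J = "std_index r t"
  have gO: "gpart y j \<in> OB" if "y \<in> NJ ?J" for y j
  proof -
    have O: "y i \<in> OB" for i using that unfolding NJ_mem by blast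
    obtain k l where j: "j = (k, l)" by (cases j)
    show ?thesis unfolding j by (cases k) (simp_all add: gpart_simps O OB_mult c_OB OB_minus)
  qed
  have dN: "dl j \<in> NJ ?J" if "j \<in> ?J" for j using M.rbasis_in[OF dl_basis[OF finite_std] that] .
  have un: "e \<noteq> 0 \<and> inverse e \<in> OB" if "e = 1 \<or> e = c \<or> e = - c" for e
    using that c_ne0 ci_OB OB_one OB_minus[OF ci_OB] by auto
  show ?thesis
    unfolding intr_def Vrec_simps
  proof (intro conjI ballI impI)
    fix x y z show "stdform r t (x + y) z = stdform r t x z + stdform r t y z"
      by (simp add: stdform_def cj_add distrib_right sum.distrib)
  next
    fix x y show "stdform r t x y = cj (stdform r t y x)"
      unfolding stdform_blocks by (simp add: cj_add cj_sum gblock_sym eblock_sym)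
  next
    fix x y \<alpha>
    have "gpart (mrm y \<alpha>) j = gpart y j * \<alpha>" for j
    proof -
      obtain k l where j: "j = (k, l)" by (cases j)
      show ?thesis unfolding j by (cases k) (simp_all add: gpart_simps mrm_def mult.assoc)
    qed
    then show "stdform r t x (mrm y \<alpha>) = stdform r t x y * \<alpha>"
      by (simp add: stdform_def sum_distrib_right mult.assoc)
  next
    fix x y \<alpha> show "stdform r t (mlm \<alpha> x) y = stdform r t x (mlm (pr \<alpha>) y)"
      unfolding stdform_blocks gblock_adjoint eblock_adjoint ..
  next
    fix x y assume xy: "x \<in> NJ ?J" "y \<in> NJ ?J"
    have "cj (x j) * gpart y j \<in> OB" for j
      using OB_mult[OF OB_cj gO[OF xy(2)]] xy(1) unfolding NJ_mem by blast
    then show "stdform r t x y \<in> OB"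
      unfolding stdform_def OB_iff by (intro vge_sum[OF vB(1)]) blast
  next
    fix x assume x: "x \<in> NJ ?J" "\<forall>y\<in>NJ ?J. stdform r t x y = 0"
    have "x j = 0" if j: "j \<in> ?J" for j
    proof -
      obtain j0 e where 0: "j0 \<in> ?J" "e = 1 \<or> e = c \<or> e = - c" "stdform r t x (dl j0) = cj (x j) * e"
        using stdform_dual[OF j] by blast
      have "cj (x j) * e = 0" using x(2) dN[OF 0(1)] 0(3) by simp
      then show ?thesis using un[OF 0(2)] cj_eq_0_iff by simp
    qed
    moreover have "x j = 0" if "j \<notin> ?J" for j using x(1) that unfolding NJ_mem by blast
    ultimately show "x = 0" by (intro ext) (metis zero_fun_apply)
  next
    fix x s assume x: "x \<in> NJ ?J" "s \<in> OF - {0}" "\<forall>y\<in>NJ ?J. \<exists>\<beta>\<in>OB. stdform r t x y = emb s * \<beta>"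
    have s: "emb s \<noteq> 0" using x(2) emb_eq_0_iff by simp
    \<comment> \<open>Division takes place in the ambient bimodule; each coordinate is then shown to
      be integral, using the pairing that isolates it.\<close>
    define x' where "x' = mrm x (inverse (emb s))"
    have "x' j \<in> OB \<and> (j \<notin> ?J \<longrightarrow> x' j = 0)" for j
    proof (cases "j \<in> ?J")
      case True
      obtain j0 e where 0: "j0 \<in> ?J" "e = 1 \<or> e = c \<or> e = - c" "stdform r t x (dl j0) = cj (x j) * e"
        using stdform_dual[OF True] by blast
      obtain \<beta> where b: "\<beta> \<in> OB" "cj (x j) * e = emb s * \<beta>" using x(3) dN[OF 0(1)] 0(3) by metis
      have "cj (x j) = cj (x j) * e * inverse e" using un[OF 0(2)] by (simp add: mult.assoc)
      then have "cj (x j) = emb s * (\<beta> * inverse e)" unfolding b(2) by (simp add: mult.assoc)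
      then have "cj (cj (x j)) = cj (\<beta> * inverse e) * emb s" by (simp only: cj_mult[of "emb s"] cj_emb)
      then have "x' j = cj (\<beta> * inverse e)" using s by (simp add: x'_def mrm_def cj_cj mult.assoc)
      then show ?thesis using OB_cj[OF OB_mult[OF b(1)]] un[OF 0(2)] True by simp
    next
      case False
      then show ?thesis using x(1) OB_zero by (simp add: x'_def mrm_def NJ_mem)
    qed
    then have "x' \<in> NJ ?J" unfolding NJ_mem by blast
    moreover have "x = mrm x' (emb s)" using s by (simp add: x'_def mrm_def mult.assoc)
    ultimately show "\<exists>x'\<in>NJ ?J. x = mrm x' (emb s)" by blast
  qed
qed

text \<open>A typed basis has the same left multiplication table as the standard one, so the
  right-linear change of basis is also left-linear.\<close>

lemma lincomb_mlm:
  assumes t: "M.typed (std_index r t) b" and \<alpha>: "\<alpha> \<in> OB"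
  shows "M.lincomb (std_index r t) b (mlm \<alpha> x) = mlm \<alpha> (M.lincomb (std_index r t) b x)"
proof -
  let ?J = "std_index r t"
  define f where "f j = mrm (b j) (mlm \<alpha> x j)" for j
  define g where "g j = mlm \<alpha> (mrm (b j) (x j))" for j
  have G: "f (GK s, i) = g (GK s, i)" if "i < r" for s i
  proof -
    have "(GK s, i) \<in> ?J" using that by (simp add: std_index_def JJ_iff)
    then have "M.ty s (b (GK s, i))" using t unfolding M.typed_def by blast
    then have "mlm \<alpha> (b (GK s, i)) = mrm (b (GK s, i)) (tau s \<alpha>)" using \<alpha> unfolding M.ty_def by blast
    then show ?thesis by (simp add: f_def g_def mlm_simps M.rm_mult M.lm_rm)
  qed
  \<comment> \<open>\<open>\<Pi>\<close> mixes the two members of a pair, so only the sums over a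
    pair agree, not the individual terms.\<close>
  have E: "f (EK s, i) + f (FK s, i) = g (EK s, i) + g (FK s, i)" if "i < t s" for s i
  proof -
    have "(EK s, i) \<in> ?J" using that by (simp add: std_index_def JJ_iff)
    then have e: "M.te s (b (EK s, i))" "b (FK s, i) = mlm PiB (b (EK s, i))" using t unfolding M.typed_def by blast+
    define u v where "u = b (EK s, i)" and "v = b (FK s, i)"
    have v: "v = mlm PiB u" "M.te (\<not> s) v" using e M.te_Pi[OF e(1)] by (simp_all add: u_def v_def)
    have k: "k1 \<alpha> \<in> OK" "k2 \<alpha> \<in> OK" using k12_OK[OF \<alpha>] by blast+
    have te: "mlm a u = mrm u (sig s a)" "mlm a v = mrm v (sig (\<not> s) a)" if "a \<in> OK" for a
      using e(1) v(2) that unfolding M.te_def u_def by blast+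
    have Pv: "mlm PiB v = mrm u (emb \<pi>)" by (simp add: v(1) M.lm_mult[symmetric] PiB(3) M.lm_emb)
    have \<alpha>e: "mlm \<alpha> w = mlm (k1 \<alpha>) w + mlm (k2 \<alpha>) (mlm PiB w)" for w
      by (subst k12(3)[of \<alpha>]) (simp add: M.lm_addl M.lm_mult)
    have \<alpha>u: "mlm \<alpha> u = mrm u (sig s (k1 \<alpha>)) + mrm v (sig (\<not> s) (k2 \<alpha>))"
      unfolding \<alpha>e[of u] v(1)[symmetric] te(1)[OF k(1)] te(2)[OF k(2)] ..
    have \<alpha>v: "mlm \<alpha> v = mrm v (sig (\<not> s) (k1 \<alpha>)) + mrm u (emb \<pi> * sig s (k2 \<alpha>))"
      unfolding \<alpha>e[of v] Pv M.lm_rm te(2)[OF k(1)] te(1)[OF k(2)] M.rm_mult[symmetric] emb_central ..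
    show ?thesis
      unfolding f_def g_def mlm_simps u_def[symmetric] v_def[symmetric] M.lm_rm \<alpha>u \<alpha>v
      by (simp add: M.rm_add M.rm_addr M.rm_mult add.assoc add.left_commute add.commute)
  qed
  have "sum f ?J = sum g ?J"
    unfolding std_index_def by (subst (1 2) sum_JJ) (use G E in \<open>auto intro!: arg_cong2[of _ _ _ _ "(+)"] sum.cong\<close>)
  then show ?thesis unfolding M.lincomb_def M.lm_sum f_def g_def .
qed

text \<open>Sending the standard basis to a hyperbolic one is a bilattice automorphism, because both
  bases are typed, and it carries the standard form to \<open>h\<close>, because the Gram matrix is
  standard.\<close>

lemma hyperbolic_isometry:
  assumes h: "intr pr (Vrec (std_index r t)) h" and b: "M.hyperbolic (NJ (std_index r t)) h r t b"
  shows "isometric OB (Vrec (std_index r t), stdform r t) (Vrec (std_index r t), h)"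
proof -
  let ?J = "std_index r t"
  have sdh: "M.sd (NJ ?J) h" using h intr_Vrec_sd unfolding std_index_def by blast
  interpret S: selfdual vF emb cj sg vB OF OB OK K \<pi> PiB c mlm mrm "NJ ?J" h
    by unfold_locales (rule sdh)
  have rb: "M.rbasis ?J b (NJ ?J)" and ty: "M.typed ?J b"
    and gr: "\<And>i j. i \<in> ?J \<Longrightarrow> j \<in> ?J \<Longrightarrow> h (b i) (b j) = Gram i j"
    using b unfolding M.hyperbolic_def by blast+
  define f where "f x = M.lincomb ?J b x" for x
  have xO: "x j \<in> OB" if "x \<in> NJ ?J" for x j using that unfolding NJ_mem by blast
  have add: "f (x + y) = f x + f y" for x y
    unfolding f_def M.lincomb_add by (simp add: plus_fun_def)
  have fN: "f x \<in> NJ ?J" if "x \<in> NJ ?J" for x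
  proof (rule M.rbasis_mem[OF rb, THEN iffD2], intro exI conjI ballI)
    show "f x = M.lincomb ?J b x" by (rule f_def)
  qed (rule xO[OF that])
  have bij: "bij_betw f (NJ ?J) (NJ ?J)"
  proof (rule bij_betwI')
    fix x y assume xy: "x \<in> NJ ?J" "y \<in> NJ ?J"
    show "f x = f y \<longleftrightarrow> x = y"
    proof
      assume e: "f x = f y"
      have "M.lincomb ?J b (\<lambda>j. x j + - y j) = M.lincomb ?J b x + - M.lincomb ?J b y"
        by (simp only: M.lincomb_add[symmetric] M.lincomb_minus[symmetric])
      also have "\<dots> = 0" using e unfolding f_def by (simp only: add.right_inverse)
      finally have z: "M.lincomb ?J b (\<lambda>j. x j + - y j) = 0" .
      show "x = y"
      proof
        fix j
        show "x j = y j"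
        proof (cases "j \<in> ?J")
          case True
          have "x j + - y j = 0"
            by (rule M.rbasis_indep[OF rb, of "\<lambda>j. x j + - y j" j, OF _ z True])
              (use OB_diff[OF xO[OF xy(1)] xO[OF xy(2)]] in simp)
          then show ?thesis by simp
        next
          case False
          then show ?thesis using xy unfolding NJ_mem by simp
        qed
      qed
    qed simp
  next
    fix x assume "x \<in> NJ ?J" then show "f x \<in> NJ ?J" by (rule fN)
  next
    fix y assume "y \<in> NJ ?J"
    from M.rbasis_mem[OF rb, of y, THEN iffD1, OF this]
    obtain a where a: "\<forall>j\<in>?J. a j \<in> OB" "y = M.lincomb ?J b a" by (elim exE conjE)
    define x where "x = (\<lambda>j. if j \<in> ?J then a j else 0)"
    have "x \<in> NJ ?J" unfolding NJ_mem using a(1) OB_zero by (simp add: x_def)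
    moreover have "y = f x" unfolding a(2) f_def by (rule M.lincomb_cong) (simp_all add: x_def)
    ultimately show "\<exists>x\<in>NJ ?J. y = f x" by blast
  qed
  have "h (f x) (f y) = stdform r t x y" if x: "x \<in> NJ ?J" and y: "y \<in> NJ ?J" for x y
  proof -
    have bN: "b j \<in> NJ ?J" if "j \<in> ?J" for j using M.rbasis_in[OF rb that] .
    have 1: "h (f x) (b j) = (\<Sum>i\<in>?J. cj (x i) * Gram i j)" if j: "j \<in> ?J" for j
    proof -
      have "h (b j) (f x) = (\<Sum>i\<in>?J. h (b j) (b i) * x i)"
        unfolding f_def by (rule S.h_lincomb[OF bN[OF j] bN xO[OF x]])
      also have "\<dots> = (\<Sum>i\<in>?J. Gram j i * x i)" by (rule sum.cong[OF refl]) (simp add: gr j)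
      finally have "cj (h (b j) (f x)) = (\<Sum>i\<in>?J. cj (x i) * Gram i j)" by (simp add: cj_sum cj_mult cj_Gram)
      then show ?thesis using S.h_sym[OF fN[OF x] bN[OF j]] by simp
    qed
    have "h (f x) (f y) = (\<Sum>j\<in>?J. h (f x) (b j) * y j)"
      unfolding f_def[of y] by (rule S.h_lincomb[OF fN[OF x] bN xO[OF y]])
    also have "\<dots> = (\<Sum>j\<in>?J. \<Sum>i\<in>?J. cj (x i) * (Gram i j * y j))"
      by (rule sum.cong[OF refl]) (simp add: 1 sum_distrib_right mult.assoc)
    also have "\<dots> = (\<Sum>i\<in>?J. \<Sum>j\<in>?J. cj (x i) * (Gram i j * y j))" by (rule sum.swap)
    also have "\<dots> = stdform r t x y"
      unfolding stdform_def by (rule sum.cong[OF refl]) (simp add: sum_distrib_left[symmetric] Gram_sum)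
    finally show ?thesis .
  qed
  moreover have "bilattice_iso OB (Vrec ?J) (Vrec ?J) f"
    unfolding bilattice_iso_def Vrec_simps
  proof (intro conjI ballI bij add)
    fix \<alpha> x assume "\<alpha> \<in> OB"
    then show "f (mlm \<alpha> x) = mlm \<alpha> (f x)" unfolding f_def by (rule lincomb_mlm[OF ty])
    show "f (mrm x \<alpha>) = mrm (f x) \<alpha>" unfolding f_def M.lincomb_rm by (simp add: mrm_def)
  qed
  ultimately show ?thesis unfolding isometric_def by (auto simp: Vrec_simps)
qed

section \<open>Coordinates on external direct sums\<close>

lemma column_carrier:
  "v \<in> carrier (column_bilattice R m \<psi>) \<longleftrightarrow> v \<in> carrier_vec m \<and> (\<forall>e<m. v $ e \<in> R)"
  by (auto simp: column_bilattice_def vec_set_def)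

text \<open>\<open>idx n e\<close> is the coordinate of entry \<open>e\<close> of summand
  \<open>n\<close>, with inverse \<open>p1\<close>, \<open>p2\<close>. This general form serves two
  families with different orders of summands, the structural invariant and the orthogonal
  sum.\<close>

lemma direct_sum_coords:
  fixes Ms :: "('b, 'b vec) bimodule list"
  assumes Ms: "\<And>n. n < length Ms \<Longrightarrow> Ms ! n = column_bilattice OB (d n) (\<phi> n)"
    and idx: "\<And>n e. n < length Ms \<Longrightarrow> e < d n \<Longrightarrow> idx n e \<in> JJ A C \<and> p1 (idx n e) = n \<and> p2 (idx n e) = e"
    and p: "\<And>j. j \<in> JJ A C \<Longrightarrow> p1 j < length Ms \<and> p2 j < d (p1 j) \<and> idx (p1 j) (p2 j) = j"
    and car: "\<And>n \<alpha>. n < length Ms \<Longrightarrow> \<alpha> \<in> OB \<Longrightarrow> \<phi> n \<alpha> \<in> carrier_mat (d n) (d n)"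
    and act: "\<And>n e \<alpha> x. n < length Ms \<Longrightarrow> e < d n \<Longrightarrow> \<alpha> \<in> OB \<Longrightarrow>
      mlm \<alpha> x (idx n e) = (\<Sum>e'<d n. \<phi> n \<alpha> $$ (e, e') * x (idx n e'))"
  shows "bilattice_iso OB (direct_sum Ms) (Vrec (JJ A C)) (\<lambda>xs j. if j \<in> JJ A C then (xs ! p1 j) $ p2 j else 0)"
proof -
  let ?J = "JJ A C" and ?D = "direct_sum Ms"
  define f where "f xs = (\<lambda>j. if j \<in> ?J then (xs ! p1 j) $ p2 j else 0)" for xs :: "'b vec list"
  have car_iff: "xs \<in> carrier ?D \<longleftrightarrow> length xs = length Ms \<and>
      (\<forall>n<length Ms. xs ! n \<in> carrier_vec (d n) \<and> (\<forall>e<d n. xs ! n $ e \<in> OB))" for xs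
  proof -
    have "xs \<in> carrier ?D \<longleftrightarrow> length xs = length Ms \<and> (\<forall>n<length Ms. xs ! n \<in> carrier (Ms ! n))"
      by (auto simp: direct_sum_def list_all2_conv_all_nth)
    then show ?thesis using Ms by (simp add: column_carrier)
  qed
  have fi: "f xs (idx n e) = xs ! n $ e" if "n < length Ms" "e < d n" for xs n e
    using idx[OF that] by (simp add: f_def)
  have fN: "f xs \<in> NJ ?J" if xs: "xs \<in> carrier ?D" for xs
    using xs p OB_zero unfolding NJ_mem f_def car_iff by auto
  have bij: "bij_betw f (carrier ?D) (NJ ?J)"
  proof (rule bij_betwI')
    fix xs ys assume xy: "xs \<in> carrier ?D" "ys \<in> carrier ?D"
    show "f xs = f ys \<longleftrightarrow> xs = ys"
    proof
      assume e: "f xs = f ys"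
      show "xs = ys"
      proof (rule nth_equalityI)
        show "length xs = length ys" using xy unfolding car_iff by simp
        fix n assume "n < length xs"
        then have n: "n < length Ms" using xy unfolding car_iff by simp
        show "xs ! n = ys ! n"
        proof (rule eq_vecI)
          show "dim_vec (xs ! n) = dim_vec (ys ! n)" using xy n unfolding car_iff by auto
          fix e' assume "e' < dim_vec (ys ! n)"
          then have "e' < d n" using xy n unfolding car_iff by auto
          then show "xs ! n $ e' = ys ! n $ e'" using e fi[OF n] by metis
        qed
      qed
    qed simp
  next
    fix xs assume "xs \<in> carrier ?D" then show "f xs \<in> NJ ?J" by (rule fN)
  next
    fix x assume x: "x \<in> NJ ?J"
    define xs where "xs = map (\<lambda>n. vec (d n) (\<lambda>e. x (idx n e))) [0..<length Ms]"
    have "xs \<in> carrier ?D" unfolding car_iff using x unfolding NJ_mem by (simp add: xs_def)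
    moreover have "x j = f xs j" for j
    proof (cases "j \<in> ?J")
      case True
      then show ?thesis using p[OF True] by (simp add: f_def xs_def)
    next
      case False
      then show ?thesis using x unfolding NJ_mem f_def by simp
    qed
    ultimately show "\<exists>xs\<in>carrier ?D. x = f xs" by blast
  qed
  have "bilattice_iso OB ?D (Vrec ?J) f"
    unfolding bilattice_iso_def
  proof (intro conjI ballI)
    show "bij_betw f (carrier ?D) (carrier (Vrec ?J))" using bij by (simp add: Vrec_simps)
  next
    fix xs ys assume xy: "xs \<in> carrier ?D" "ys \<in> carrier ?D"
    have "f (xs \<oplus>\<^bsub>?D\<^esub> ys) j = f xs j + f ys j" for j
    proof (cases "j \<in> ?J")
      case True
      have n: "p1 j < length Ms" "p2 j < d (p1 j)" using p[OF True] by auto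
      have "(xs \<oplus>\<^bsub>?D\<^esub> ys) ! p1 j = xs ! p1 j + ys ! p1 j"
        using n xy Ms[OF n(1)] unfolding car_iff by (simp add: direct_sum_def column_bilattice_def)
      moreover have "p2 j < dim_vec (ys ! p1 j)" using n xy unfolding car_iff by auto
      ultimately show ?thesis using True by (simp add: f_def)
    qed (simp add: f_def)
    then show "f (xs \<oplus>\<^bsub>?D\<^esub> ys) = f xs \<oplus>\<^bsub>Vrec ?J\<^esub> f ys" by (intro ext) (simp add: Vrec_def)
  next
    fix \<alpha> xs assume a: "\<alpha> \<in> OB" and xs: "xs \<in> carrier ?D"
    have "f (lact ?D \<alpha> xs) j = mlm \<alpha> (f xs) j" for j
    proof (cases "j \<in> ?J")
      case True
      have n: "p1 j < length Ms" "p2 j < d (p1 j)" "idx (p1 j) (p2 j) = j" using p[OF True] by auto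
      have "lact ?D \<alpha> xs ! p1 j = \<phi> (p1 j) \<alpha> *\<^sub>v (xs ! p1 j)"
        using n xs Ms[OF n(1)] unfolding car_iff by (simp add: direct_sum_def column_bilattice_def)
      moreover have "dim_vec (xs ! p1 j) = d (p1 j)" using n xs unfolding car_iff by auto
      ultimately have "f (lact ?D \<alpha> xs) j = (\<Sum>e'<d (p1 j). \<phi> (p1 j) \<alpha> $$ (p2 j, e') * xs ! p1 j $ e')"
        using True car[OF n(1) a] n(2) by (simp add: f_def scalar_prod_def lessThan_atLeast0)
      also have "\<dots> = (\<Sum>e'<d (p1 j). \<phi> (p1 j) \<alpha> $$ (p2 j, e') * f xs (idx (p1 j) e'))"
        by (rule sum.cong[OF refl]) (simp add: fi[OF n(1)])
      also have "\<dots> = mlm \<alpha> (f xs) j" using act[OF n(1,2) a] n(3) by simp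
      finally show ?thesis .
    next
      case False
      then show ?thesis using mlm_NJ[OF fN[OF xs] a] unfolding NJ_mem by (simp add: f_def)
    qed
    then show "f (lact ?D \<alpha> xs) = lact (Vrec ?J) \<alpha> (f xs)" unfolding Vrec_simps by (rule ext)
    have "f (ract ?D xs \<alpha>) j = f xs j * \<alpha>" for j
    proof (cases "j \<in> ?J")
      case True
      have n: "p1 j < length Ms" "p2 j < d (p1 j)" "idx (p1 j) (p2 j) = j" using p[OF True] by auto
      have "ract ?D xs \<alpha> ! p1 j = map_vec (\<lambda>z. z * \<alpha>) (xs ! p1 j)"
        using n xs Ms[OF n(1)] unfolding car_iff by (simp add: direct_sum_def column_bilattice_def)
      moreover have "dim_vec (xs ! p1 j) = d (p1 j)" using n xs unfolding car_iff by auto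
      ultimately show ?thesis using True n by (simp add: f_def)
    qed (simp add: f_def)
    then show "f (ract ?D xs \<alpha>) = ract (Vrec ?J) (f xs) \<alpha>" unfolding Vrec_simps mrm_def by (rule ext)
  qed
  then show ?thesis unfolding f_def .
qed

section \<open>Inverses and composition of isomorphisms and isometries\<close>

definition opclosed :: "('b, 'l) bimodule \<Rightarrow> bool" where
  "opclosed L \<longleftrightarrow> (\<forall>x\<in>carrier L. \<forall>y\<in>carrier L. x \<oplus>\<^bsub>L\<^esub> y \<in> carrier L) \<and>
     (\<forall>\<alpha>\<in>OB. \<forall>x\<in>carrier L. lact L \<alpha> x \<in> carrier L \<and> ract L x \<alpha> \<in> carrier L)"

lemma opclosedD: "opclosed L \<Longrightarrow> x \<in> carrier L \<Longrightarrow> y \<in> carrier L \<Longrightarrow> x \<oplus>\<^bsub>L\<^esub> y \<in> carrier L"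
  "opclosed L \<Longrightarrow> \<alpha> \<in> OB \<Longrightarrow> x \<in> carrier L \<Longrightarrow> lact L \<alpha> x \<in> carrier L"
  "opclosed L \<Longrightarrow> \<alpha> \<in> OB \<Longrightarrow> x \<in> carrier L \<Longrightarrow> ract L x \<alpha> \<in> carrier L"
  unfolding opclosed_def by blast+

lemma opclosed_bilattice: "bilattice OF emb OB L \<Longrightarrow> opclosed L"
  unfolding opclosed_def
  using abelian_monoid.a_closed[OF L_monoid] L_lact L_ract by (intro conjI ballI)

lemma isoD:
  assumes "bilattice_iso OB L M f"
  shows "bij_betw f (carrier L) (carrier M)"
    and "x \<in> carrier L \<Longrightarrow> f x \<in> carrier M"
    and "x \<in> carrier L \<Longrightarrow> y \<in> carrier L \<Longrightarrow> f x = f y \<Longrightarrow> x = y"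
    and "x \<in> carrier L \<Longrightarrow> y \<in> carrier L \<Longrightarrow> f (x \<oplus>\<^bsub>L\<^esub> y) = f x \<oplus>\<^bsub>M\<^esub> f y"
    and "\<alpha> \<in> OB \<Longrightarrow> x \<in> carrier L \<Longrightarrow> f (lact L \<alpha> x) = lact M \<alpha> (f x)"
    and "\<alpha> \<in> OB \<Longrightarrow> x \<in> carrier L \<Longrightarrow> f (ract L x \<alpha>) = ract M (f x) \<alpha>"
proof -
  show b: "bij_betw f (carrier L) (carrier M)" using assms unfolding bilattice_iso_def by blast
  show "x \<in> carrier L \<Longrightarrow> f x \<in> carrier M" by (rule bij_betwE[OF b, rule_format])
  show "x \<in> carrier L \<Longrightarrow> y \<in> carrier L \<Longrightarrow> f x = f y \<Longrightarrow> x = y"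
    using bij_betw_imp_inj_on[OF b] by (simp add: inj_on_def)
  show "x \<in> carrier L \<Longrightarrow> y \<in> carrier L \<Longrightarrow> f (x \<oplus>\<^bsub>L\<^esub> y) = f x \<oplus>\<^bsub>M\<^esub> f y"
    using assms unfolding bilattice_iso_def by blast
  show "\<alpha> \<in> OB \<Longrightarrow> x \<in> carrier L \<Longrightarrow> f (lact L \<alpha> x) = lact M \<alpha> (f x)"
    using assms unfolding bilattice_iso_def by blast
  show "\<alpha> \<in> OB \<Longrightarrow> x \<in> carrier L \<Longrightarrow> f (ract L x \<alpha>) = ract M (f x) \<alpha>"
    using assms unfolding bilattice_iso_def by blast
qed

text \<open>Closure of \<open>L\<close> under its operations places sums and multiples of preimages
  back in the domain, where inverting \<open>f\<close> is legitimate. It is available even before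
  \<open>L\<close> is known to be a bilattice.\<close>

lemma iso_inverse:
  assumes f: "bilattice_iso OB L M f" and L: "opclosed L"
  shows "bilattice_iso OB M L (inv_into (carrier L) f)"
    and "x \<in> carrier L \<Longrightarrow> inv_into (carrier L) f (f x) = x"
    and "y \<in> carrier M \<Longrightarrow> f (inv_into (carrier L) f y) = y"
    and "y \<in> carrier M \<Longrightarrow> inv_into (carrier L) f y \<in> carrier L"
proof -
  let ?g = "inv_into (carrier L) f"
  have bij: "bij_betw f (carrier L) (carrier M)" by (rule isoD(1)[OF f])
  have g: "?g y \<in> carrier L" "f (?g y) = y" if "y \<in> carrier M" for y
    using bij that by (auto simp: bij_betw_def inv_into_into f_inv_into_f)
  have gf: "?g (f x) = x" if "x \<in> carrier L" for x using bij that by (simp add: bij_betw_def)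
  show "x \<in> carrier L \<Longrightarrow> ?g (f x) = x" "y \<in> carrier M \<Longrightarrow> f (?g y) = y" "y \<in> carrier M \<Longrightarrow> ?g y \<in> carrier L"
    using g gf by blast+
  show "bilattice_iso OB M L ?g"
    unfolding bilattice_iso_def
  proof (intro conjI ballI)
    show "bij_betw ?g (carrier M) (carrier L)" using bij by (rule bij_betw_inv_into)
  next
    fix x y assume xy: "x \<in> carrier M" "y \<in> carrier M"
    have "?g (f (?g x \<oplus>\<^bsub>L\<^esub> ?g y)) = ?g x \<oplus>\<^bsub>L\<^esub> ?g y"
      by (rule gf[OF opclosedD(1)[OF L g(1)[OF xy(1)] g(1)[OF xy(2)]]])
    then show "?g (x \<oplus>\<^bsub>M\<^esub> y) = ?g x \<oplus>\<^bsub>L\<^esub> ?g y"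
      unfolding isoD(4)[OF f g(1)[OF xy(1)] g(1)[OF xy(2)]] g(2)[OF xy(1)] g(2)[OF xy(2)] .
  next
    fix \<alpha> x assume a: "\<alpha> \<in> OB" and x: "x \<in> carrier M"
    show "?g (lact M \<alpha> x) = lact L \<alpha> (?g x)"
      using gf[OF opclosedD(2)[OF L a g(1)[OF x]]] unfolding isoD(5)[OF f a g(1)[OF x]] g(2)[OF x] .
    show "?g (ract M x \<alpha>) = ract L (?g x) \<alpha>"
      using gf[OF opclosedD(3)[OF L a g(1)[OF x]]] unfolding isoD(6)[OF f a g(1)[OF x]] g(2)[OF x] .
  qed
qed

lemma isometric_iff: "isometric OB (L, h) (M, k) \<longleftrightarrow>
    (\<exists>f. bilattice_iso OB L M f \<and> (\<forall>x\<in>carrier L. \<forall>y\<in>carrier L. k (f x) (f y) = h x y))"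
  by (simp add: isometric_def)

lemma isometric_sym: "isometric OB (L, h) (M, k) \<Longrightarrow> opclosed L \<Longrightarrow> isometric OB (M, k) (L, h)"
proof -
  assume "isometric OB (L, h) (M, k)" and L: "opclosed L"
  then obtain f where f: "bilattice_iso OB L M f" "\<And>x y. x \<in> carrier L \<Longrightarrow> y \<in> carrier L \<Longrightarrow> k (f x) (f y) = h x y"
    unfolding isometric_iff by blast
  note g = iso_inverse[OF f(1) L]
  show ?thesis unfolding isometric_iff
  proof (intro exI conjI ballI)
    show "bilattice_iso OB M L (inv_into (carrier L) f)" by (rule g(1))
    fix x y assume x: "x \<in> carrier M" and y: "y \<in> carrier M"
    show "h (inv_into (carrier L) f x) (inv_into (carrier L) f y) = k x y"
      using f(2)[OF g(4)[OF x] g(4)[OF y]] unfolding g(3)[OF x] g(3)[OF y] by simp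
  qed
qed

lemma isometric_trans:
  "isometric OB (L, h) (M, k) \<Longrightarrow> isometric OB (M, k) (P, l) \<Longrightarrow> isometric OB (L, h) (P, l)"
proof -
  assume "isometric OB (L, h) (M, k)" "isometric OB (M, k) (P, l)"
  then obtain f g where f: "bilattice_iso OB L M f" "\<And>x y. x \<in> carrier L \<Longrightarrow> y \<in> carrier L \<Longrightarrow> k (f x) (f y) = h x y"
    and g: "bilattice_iso OB M P g" "\<And>x y. x \<in> carrier M \<Longrightarrow> y \<in> carrier M \<Longrightarrow> l (g x) (g y) = k x y"
    unfolding isometric_iff by blast
  show ?thesis unfolding isometric_iff
  proof (intro exI conjI ballI)
    show "bilattice_iso OB L P (\<lambda>x. g (f x))" by (rule iso_trans[OF f(1) g(1)])
    fix x y assume x: "x \<in> carrier L" and y: "y \<in> carrier L"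
    show "l (g (f x)) (g (f y)) = h x y"
      unfolding g(2)[OF isoD(2)[OF f(1) x] isoD(2)[OF f(1) y]] by (rule f(2)[OF x y])
  qed
qed

text \<open>Each axiom is checked after applying the injective map \<open>f\<close>, where it holds
  in the coordinate model. Generators are the preimages of the standard basis. It serves to
  recognize the explicit direct sum as a bilattice in the existence statement.\<close>

lemma bilattice_pull:
  assumes f: "bilattice_iso OB L (Vrec (JJ A C)) f" and L: "opclosed L"
    and z: "\<zero>\<^bsub>L\<^esub> \<in> carrier L" "f \<zero>\<^bsub>L\<^esub> = 0" and fin: "finite (JJ A C)"
  shows "bilattice OF emb OB L"
proof -
  let ?V = "Vrec (JJ A C)"
  note g = iso_inverse[OF f L, unfolded Vrec_simps]
  note inj = isoD(3)[OF f]
  note hom = isoD(4,5,6)[OF f, unfolded Vrec_simps] z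
  note cl = opclosedD[OF L]
  have grp: "abelian_group L"
  proof (rule abelian_groupI)
    fix x assume x: "x \<in> carrier L"
    have "- f x \<in> NJ (JJ A C)"
      using isoD(2)[OF f x] OB_minus unfolding Vrec_simps NJ_mem by simp
    then show "\<exists>y\<in>carrier L. y \<oplus>\<^bsub>L\<^esub> x = \<zero>\<^bsub>L\<^esub>"
      using g(3,4) x inj cl hom by (intro bexI[of _ "inv_into (carrier L) f (- f x)"]) simp_all
  qed (rule inj; simp add: cl hom add.assoc add.commute | simp add: cl z)+
  have "bimodule_axioms OB L"
    unfolding bimodule_axioms_def
  proof (intro conjI ballI grp cl; (assumption)?)
  qed (rule inj; simp add: cl hom OB_add OB_mult OB_one M.lm_add M.rm_add M.lm_addl M.rm_addr M.lm_mult
        M.rm_mult M.lm_rm M.lm_one M.rm_one)+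
  moreover have "\<forall>a\<in>OF. \<forall>x\<in>carrier L. lact L (emb a) x = ract L x (emb a)"
    by (intro ballI, rule inj) (simp_all add: cl hom OB_emb M.lm_emb)
  moreover have "\<forall>a\<in>OF. \<forall>x\<in>carrier L. ract L x (emb a) = \<zero>\<^bsub>L\<^esub> \<longrightarrow> a = 0 \<or> x = \<zero>\<^bsub>L\<^esub>"
  proof (intro ballI impI)
    fix a x assume a: "a \<in> OF" and x: "x \<in> carrier L" and 0: "ract L x (emb a) = \<zero>\<^bsub>L\<^esub>"
    have "mrm (f x) (emb a) = 0" using hom(3)[OF OB_emb[OF a] x] 0 z(2) by simp
    then have *: "f x j * emb a = 0" for j unfolding mrm_def by (metis zero_fun_apply)
    show "a = 0 \<or> x = \<zero>\<^bsub>L\<^esub>"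
    proof (cases "a = 0")
      case False
      then have "f x j = 0" for j using * emb_eq_0_iff by simp
      then have "f x = f \<zero>\<^bsub>L\<^esub>" unfolding z(2) by (intro ext) simp
      then show ?thesis using inj x z(1) by blast
    qed simp
  qed
  moreover have "\<exists>S. finite S \<and> S \<subseteq> carrier L \<and> (\<forall>N. sub_bimodule OB L N \<and> S \<subseteq> N \<longrightarrow> N = carrier L)"
  proof (intro exI[of _ "inv_into (carrier L) f ` dl ` JJ A C"] conjI allI impI)
    have dN: "dl j \<in> NJ (JJ A C)" if "j \<in> JJ A C" for j using M.rbasis_in[OF dl_basis[OF fin] that] .
    show "finite (inv_into (carrier L) f ` dl ` JJ A C)" using fin by simp
    show "inv_into (carrier L) f ` dl ` JJ A C \<subseteq> carrier L" using g(4) dN by blast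
    fix N assume N: "sub_bimodule OB L N \<and> inv_into (carrier L) f ` dl ` JJ A C \<subseteq> N"
    have NL: "N \<subseteq> carrier L" and N0: "\<zero>\<^bsub>L\<^esub> \<in> N" and Na: "\<And>x y. x \<in> N \<Longrightarrow> y \<in> N \<Longrightarrow> x \<oplus>\<^bsub>L\<^esub> y \<in> N"
      and Nm: "\<And>\<alpha> x. \<alpha> \<in> OB \<Longrightarrow> x \<in> N \<Longrightarrow> lact L \<alpha> x \<in> N \<and> ract L x \<alpha> \<in> N"
      using N unfolding sub_bimodule_def by blast+
    have lat: "M.lat (f ` N)"
      unfolding M.lat_def
    proof (intro conjI ballI)
      show "0 \<in> f ` N" using N0 z(2) by (metis image_eqI)
    next
      fix x y assume "x \<in> f ` N" "y \<in> f ` N"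
      then obtain x' y' where *: "x' \<in> N" "y' \<in> N" "x = f x'" "y = f y'" by blast
      then have "f (x' \<oplus>\<^bsub>L\<^esub> y') = x + y" using hom(1) NL by blast
      then show "x + y \<in> f ` N" using Na * by (metis image_eqI)
    next
      fix x \<alpha> assume "x \<in> f ` N" and a: "\<alpha> \<in> OB"
      then obtain x' where *: "x' \<in> N" "x = f x'" by blast
      then have "f (lact L \<alpha> x') = mlm \<alpha> x" "f (ract L x' \<alpha>) = mrm x \<alpha>" using hom(2,3) NL a by blast+
      then show "mlm \<alpha> x \<in> f ` N" "mrm x \<alpha> \<in> f ` N" using Nm[OF a] * by (metis image_eqI)+
    qed
    have dfN: "dl j \<in> f ` N" if j: "j \<in> JJ A C" for j
    proof -
      have "inv_into (carrier L) f (dl j) \<in> N" using N j by blast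
      then show ?thesis using g(3)[OF dN[OF j]] by (metis image_eqI)
    qed
    show "N = carrier L"
    proof (rule antisym[OF NL], rule subsetI)
      fix x assume x: "x \<in> carrier L"
      have "f x \<in> NJ (JJ A C)" using isoD(2)[OF f x] unfolding Vrec_simps .
      from M.rbasis_mem[OF dl_basis[OF fin], of "f x", THEN iffD1, OF this]
      obtain a where a: "\<forall>j\<in>JJ A C. a j \<in> OB" "f x = M.lincomb (JJ A C) dl a" by (elim exE conjE)
      have "f x \<in> f ` N" unfolding a(2) using M.lat_lincomb[OF lat, of "JJ A C" dl a] a(1) dfN by simp
      then obtain x' where "x' \<in> N" "f x = f x'" by blast
      then show "x \<in> N" using inj[OF x, of x'] NL by blast
    qed
  qed
  ultimately show ?thesis unfolding bilattice_def by blast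
qed

section \<open>Coordinates of the standard bilattices\<close>

lemma direct_sum_opclosed:
  fixes Ms :: "('b, 'b vec) bimodule list"
  assumes Ms: "\<And>n. n < length Ms \<Longrightarrow> Ms ! n = column_bilattice OB (d n) (\<phi> n)"
    and car: "\<And>n \<alpha>. n < length Ms \<Longrightarrow> \<alpha> \<in> OB \<Longrightarrow> \<phi> n \<alpha> \<in> carrier_mat (d n) (d n)"
    and ent: "\<And>n \<alpha> e e'. n < length Ms \<Longrightarrow> \<alpha> \<in> OB \<Longrightarrow> e < d n \<Longrightarrow> e' < d n \<Longrightarrow> \<phi> n \<alpha> $$ (e, e') \<in> OB"
  shows "opclosed (direct_sum Ms)" "\<zero>\<^bsub>direct_sum Ms\<^esub> \<in> carrier (direct_sum Ms)"
    "n < length Ms \<Longrightarrow> \<zero>\<^bsub>direct_sum Ms\<^esub> ! n = 0\<^sub>v (d n)"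
proof -
  let ?D = "direct_sum Ms"
  have car_iff: "xs \<in> carrier ?D \<longleftrightarrow> length xs = length Ms \<and>
      (\<forall>n<length Ms. xs ! n \<in> carrier_vec (d n) \<and> (\<forall>e<d n. xs ! n $ e \<in> OB))" for xs
  proof -
    have "xs \<in> carrier ?D \<longleftrightarrow> length xs = length Ms \<and> (\<forall>n<length Ms. xs ! n \<in> carrier (Ms ! n))"
      by (auto simp: direct_sum_def list_all2_conv_all_nth)
    then show ?thesis using Ms by (simp add: column_carrier)
  qed
  have add: "xs \<oplus>\<^bsub>?D\<^esub> ys \<in> carrier ?D" if xy: "xs \<in> carrier ?D" "ys \<in> carrier ?D" for xs ys
    unfolding car_iff
  proof (intro conjI allI impI)
    show "length (xs \<oplus>\<^bsub>?D\<^esub> ys) = length Ms" using xy unfolding car_iff by (simp add: direct_sum_def)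
    fix n assume n: "n < length Ms"
    have e: "(xs \<oplus>\<^bsub>?D\<^esub> ys) ! n = xs ! n + ys ! n"
      using n xy Ms[OF n] unfolding car_iff by (simp add: direct_sum_def column_bilattice_def)
    have v: "xs ! n \<in> carrier_vec (d n)" "ys ! n \<in> carrier_vec (d n)" using xy n unfolding car_iff by blast+
    show "(xs \<oplus>\<^bsub>?D\<^esub> ys) ! n \<in> carrier_vec (d n)" unfolding e using v by simp
    fix i assume i: "i < d n"
    have "xs ! n $ i \<in> OB" "ys ! n $ i \<in> OB" using xy n i unfolding car_iff by blast+
    then show "(xs \<oplus>\<^bsub>?D\<^esub> ys) ! n $ i \<in> OB" unfolding e using v i by (simp add: OB_add)
  qed
  have lact: "lact ?D \<alpha> xs \<in> carrier ?D" if a: "\<alpha> \<in> OB" and xs: "xs \<in> carrier ?D" for \<alpha> xs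
    unfolding car_iff
  proof (intro conjI allI impI)
    show "length (lact ?D \<alpha> xs) = length Ms" using xs unfolding car_iff by (simp add: direct_sum_def)
    fix n assume n: "n < length Ms"
    have e: "lact ?D \<alpha> xs ! n = \<phi> n \<alpha> *\<^sub>v (xs ! n)"
      using n xs Ms[OF n] unfolding car_iff by (simp add: direct_sum_def column_bilattice_def)
    have v: "xs ! n \<in> carrier_vec (d n)" using xs n unfolding car_iff by blast
    show "lact ?D \<alpha> xs ! n \<in> carrier_vec (d n)" unfolding e using car[OF n a] v by simp
    fix i assume i: "i < d n"
    have "\<phi> n \<alpha> $$ (i, e') * xs ! n $ e' \<in> OB" if "e' < d n" for e'
      using OB_mult[OF ent[OF n a i that]] xs n that unfolding car_iff by blast
    then have "ge 0 (\<Sum>e'<d n. \<phi> n \<alpha> $$ (i, e') * xs ! n $ e')"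
      unfolding OB_iff by (intro vge_sum[OF vB(1)]) simp
    then show "lact ?D \<alpha> xs ! n $ i \<in> OB"
      unfolding e OB_iff using car[OF n a] v i by (simp add: scalar_prod_def lessThan_atLeast0)
  qed
  have ract: "ract ?D xs \<alpha> \<in> carrier ?D" if a: "\<alpha> \<in> OB" and xs: "xs \<in> carrier ?D" for \<alpha> xs
    unfolding car_iff
  proof (intro conjI allI impI)
    show "length (ract ?D xs \<alpha>) = length Ms" using xs unfolding car_iff by (simp add: direct_sum_def)
    fix n assume n: "n < length Ms"
    have e: "ract ?D xs \<alpha> ! n = map_vec (\<lambda>z. z * \<alpha>) (xs ! n)"
      using n xs Ms[OF n] unfolding car_iff by (simp add: direct_sum_def column_bilattice_def)
    have v: "xs ! n \<in> carrier_vec (d n)" using xs n unfolding car_iff by blast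
    show "ract ?D xs \<alpha> ! n \<in> carrier_vec (d n)" unfolding e using v by simp
    fix i assume i: "i < d n"
    have "xs ! n $ i \<in> OB" using xs n i unfolding car_iff by blast
    then show "ract ?D xs \<alpha> ! n $ i \<in> OB" unfolding e using v i a by (simp add: OB_mult)
  qed
  show "opclosed ?D" unfolding opclosed_def using add lact ract by blast
  have z: "(\<zero>\<^bsub>?D\<^esub>) ! n = 0\<^sub>v (d n)" if "n < length Ms" for n
    using that Ms[OF that] by (simp add: direct_sum_def column_bilattice_def)
  then show "n < length Ms \<Longrightarrow> \<zero>\<^bsub>?D\<^esub> ! n = 0\<^sub>v (d n)" .
  have "length (\<zero>\<^bsub>?D\<^esub>) = length Ms" by (simp add: direct_sum_def)
  then show "\<zero>\<^bsub>?D\<^esub> \<in> carrier ?D" unfolding car_iff using z OB_zero by simp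
qed

lemma less_2: "e < 2 \<longleftrightarrow> e = 0 \<or> e = Suc 0" for e :: nat
  by auto

lemma phi_entries:
  assumes "\<alpha> \<in> OB"
  shows "emb_phi1 OK sg (emb \<pi>) PiB \<alpha> \<in> carrier_mat 2 2"
    "emb_phi1 OK sg (emb \<pi>) PiB \<alpha> $$ (0, 0) = k1 \<alpha>" "emb_phi1 OK sg (emb \<pi>) PiB \<alpha> $$ (0, Suc 0) = k2 \<alpha> * emb \<pi>"
    "emb_phi1 OK sg (emb \<pi>) PiB \<alpha> $$ (Suc 0, 0) = sg (k2 \<alpha>)" "emb_phi1 OK sg (emb \<pi>) PiB \<alpha> $$ (Suc 0, Suc 0) = sg (k1 \<alpha>)"
    "emb_phi2 OK sg (emb \<pi>) PiB \<alpha> \<in> carrier_mat 2 2"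
    "emb_phi2 OK sg (emb \<pi>) PiB \<alpha> $$ (0, 0) = sg (k1 \<alpha>)" "emb_phi2 OK sg (emb \<pi>) PiB \<alpha> $$ (0, Suc 0) = sg (k2 \<alpha>) * emb \<pi>"
    "emb_phi2 OK sg (emb \<pi>) PiB \<alpha> $$ (Suc 0, 0) = k2 \<alpha>" "emb_phi2 OK sg (emb \<pi>) PiB \<alpha> $$ (Suc 0, Suc 0) = k1 \<alpha>"
    "emb_phi3 PiB \<alpha> \<in> carrier_mat 2 2"
    "emb_phi3 PiB \<alpha> $$ (0, 0) = \<alpha>" "emb_phi3 PiB \<alpha> $$ (0, Suc 0) = 0"
    "emb_phi3 PiB \<alpha> $$ (Suc 0, 0) = 0" "emb_phi3 PiB \<alpha> $$ (Suc 0, Suc 0) = tau False \<alpha>"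
proof -
  have c2: "diag2 x y \<in> carrier_mat 2 2" "mat_of_rows_list 2 [[0, x], [1, 0]] \<in> carrier_mat 2 2" for x y :: 'b
    by (auto simp: diag2_def mat_of_rows_list_def)
  show "emb_phi1 OK sg (emb \<pi>) PiB \<alpha> \<in> carrier_mat 2 2" "emb_phi2 OK sg (emb \<pi>) PiB \<alpha> \<in> carrier_mat 2 2"
    "emb_phi3 PiB \<alpha> \<in> carrier_mat 2 2"
    using OK_coords_eq[OF assms] c2(1) add_carrier_mat[OF mult_carrier_mat[OF c2(1) c2(2)]]
    by (simp_all add: emb_phi1_def emb_phi2_def emb_phi3_def)
qed (use OK_coords_eq[OF assms] in \<open>simp_all add: emb_phi1_def emb_phi2_def emb_phi3_def emb_tau_def
    tau_def diag2_def mat_of_rows_list_def scalar_prod_def numeral_2_eq_2\<close>)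

text \<open>The summands O and P contribute one coordinate each, of kind \<open>GK True\<close> and
  \<open>GK False\<close>; L_1 and L_2 contribute E-F pairs of sign True and False.\<close>

lemma invariant_coords:
  fixes r1 r2 t1 t2 :: nat
  defines "Ms \<equiv> replicate r1 (lat_O OB) @ replicate r2 (lat_P OB PiB) @
    replicate t1 (lat_L1 OB OK sg (emb \<pi>) PiB) @ replicate t2 (lat_L2 OB OK sg (emb \<pi>) PiB)"
    and "J \<equiv> JJ (\<lambda>s. if s then {..<r1} else {..<r2}) (\<lambda>s. {..<if s then t1 else t2})"
  shows "opclosed (direct_sum Ms)" "\<zero>\<^bsub>direct_sum Ms\<^esub> \<in> carrier (direct_sum Ms)"
    "\<exists>f. bilattice_iso OB (direct_sum Ms) (Vrec J) f \<and> f \<zero>\<^bsub>direct_sum Ms\<^esub> = 0"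
proof -
  define d :: "nat \<Rightarrow> nat" where "d n = (if n < r1 + r2 then 1 else 2)" for n
  define \<phi> where "\<phi> n = (if n < r1 then (\<lambda>\<alpha>. mat_of_rows_list 1 [[\<alpha>]]) else if n < r1 + r2 then
      (\<lambda>\<alpha>. mat_of_rows_list 1 [[emb_tau PiB \<alpha>]]) else if n < r1 + r2 + t1 then emb_phi1 OK sg (emb \<pi>) PiB
      else emb_phi2 OK sg (emb \<pi>) PiB)" for n
  \<comment> \<open>The offsets \<open>r1\<close>, \<open>r1 + r2\<close> and
    \<open>r1 + r2 + t1\<close> mark where each block of equal summands begins; entry 0 of a
    rank-two summand is its E vector and entry 1 its F vector.\<close>
  define idx :: "nat \<Rightarrow> nat \<Rightarrow> kind \<times> nat" where "idx n e = (if n < r1 then (GK True, n) else if n < r1 + r2 then (GK False, n - r1)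
      else if n < r1 + r2 + t1 then (if e = 0 then EK True else FK True, n - (r1 + r2))
      else (if e = 0 then EK False else FK False, n - (r1 + r2 + t1)))" for n e
  define p1 where "p1 j = (case j of (GK s, i) \<Rightarrow> if s then i else r1 + i
      | (EK s, i) \<Rightarrow> r1 + r2 + (if s then i else t1 + i) | (FK s, i) \<Rightarrow> r1 + r2 + (if s then i else t1 + i))" for j :: "kind \<times> nat"
  define p2 :: "kind \<times> nat \<Rightarrow> nat" where "p2 j = (case j of (FK s, i) \<Rightarrow> 1 | _ \<Rightarrow> 0)" for j
  have len: "length Ms = r1 + r2 + t1 + t2" by (simp add: Ms_def)
  have ent1: "mat_of_rows_list 1 [[\<alpha>]] \<in> carrier_mat 1 1" "mat_of_rows_list 1 [[\<alpha>]] $$ (0, 0) = \<alpha>" for \<alpha> :: 'b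
    by (simp_all add: mat_of_rows_list_def)
  have tau: "emb_tau PiB \<alpha> = tau False \<alpha>" for \<alpha> by (simp add: emb_tau_def tau_def)
  have 1: "Ms ! n = column_bilattice OB (d n) (\<phi> n)" if "n < length Ms" for n
    using that unfolding len by (auto simp: Ms_def nth_append d_def \<phi>_def lat_O_def lat_P_def lat_L1_def lat_L2_def)
  have 2: "idx n e \<in> J \<and> p1 (idx n e) = n \<and> p2 (idx n e) = e" if "n < length Ms" "e < d n" for n e
    using that unfolding len
    by (auto simp: idx_def p1_def p2_def d_def J_def JJ_iff less_2 split: if_splits)
  have 3: "p1 j < length Ms \<and> p2 j < d (p1 j) \<and> idx (p1 j) (p2 j) = j" if "j \<in> J" for j
  proof -
    obtain k i where j: "j = (k, i)" by (cases j)
    show ?thesis using that unfolding len j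
      by (cases k) (auto simp: idx_def p1_def p2_def d_def J_def JJ_iff split: if_splits)
  qed
  have 4: "\<phi> n \<alpha> \<in> carrier_mat (d n) (d n)" if "n < length Ms" "\<alpha> \<in> OB" for n \<alpha>
    using phi_entries[OF that(2)] ent1 by (simp add: \<phi>_def d_def)
  have kO: "k1 \<alpha> \<in> OB" "k2 \<alpha> \<in> OB" "sg (k1 \<alpha>) \<in> OB" "sg (k2 \<alpha>) \<in> OB" if "\<alpha> \<in> OB" for \<alpha>
    using k12_OK[OF that] OB_OK sig_OK[of "k1 \<alpha>" False] sig_OK[of "k2 \<alpha>" False] by (simp_all add: sig_def)
  have piO: "emb \<pi> \<in> OB" using ge_pi vge_mono[OF vB(1), of 1 "emb \<pi>" 0] OB_iff by simp
  have 5: "\<phi> n \<alpha> $$ (e, e') \<in> OB" if "n < length Ms" "\<alpha> \<in> OB" "e < d n" "e' < d n" for n \<alpha> e e'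
    using that(3,4) phi_entries[OF that(2)] ent1 kO[OF that(2)] OB_mult[OF _ piO] tau_OB[OF that(2)] that(2)
    by (auto simp: \<phi>_def d_def less_2 tau split: if_splits)
  have 6: "mlm \<alpha> x (idx n e) = (\<Sum>e'<d n. \<phi> n \<alpha> $$ (e, e') * x (idx n e'))"
    if "n < length Ms" "e < d n" "\<alpha> \<in> OB" for n e \<alpha> x
  proof -
    have "e = 0 \<or> e = Suc 0 \<and> \<not> n < r1 + r2" using that(2) by (auto simp: d_def less_2 split: if_splits)
    then show ?thesis
      using phi_entries[OF that(3)] ent1 emb_central[of _ \<pi>]
      by (auto simp: \<phi>_def d_def idx_def tau mlm_simps sig_def tau_def numeral_2_eq_2 mult.assoc[symmetric]
          add.commute split: if_splits)
  qed
  show "opclosed (direct_sum Ms)"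
    by (rule direct_sum_opclosed(1)[of Ms d \<phi>]; (rule 1 4 5; assumption))
  show "\<zero>\<^bsub>direct_sum Ms\<^esub> \<in> carrier (direct_sum Ms)"
    by (rule direct_sum_opclosed(2)[of Ms d \<phi>]; (rule 1 4 5; assumption))
  have O3: "\<zero>\<^bsub>direct_sum Ms\<^esub> ! n = 0\<^sub>v (d n)" if "n < length Ms" for n
    by (rule direct_sum_opclosed(3)[of Ms d \<phi>, OF _ _ _ that]; (rule 1 4 5; assumption))
  have iso: "bilattice_iso OB (direct_sum Ms) (Vrec J) (\<lambda>xs j. if j \<in> J then (xs ! p1 j) $ p2 j else 0)"
    unfolding J_def
    by (rule direct_sum_coords[of Ms d \<phi> idx _ _ p1 p2];
        (rule 1 2[unfolded J_def] 3[unfolded J_def] 4 6; assumption))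
  have "(\<lambda>j. if j \<in> J then (\<zero>\<^bsub>direct_sum Ms\<^esub> ! p1 j) $ p2 j else 0) = 0"
    using O3 3 by (intro ext) simp
  then show "\<exists>f. bilattice_iso OB (direct_sum Ms) (Vrec J) f \<and> f \<zero>\<^bsub>direct_sum Ms\<^esub> = 0"
    using iso by (intro exI conjI)
qed

lemma sum_lessThan_add: "(\<Sum>i<m + n. f i) = (\<Sum>i<m. f i) + (\<Sum>i<n. f (m + i))"
  for f :: "nat \<Rightarrow> 'x::comm_monoid_add"
  by (induction n) (simp_all add: add.assoc)

lemma gram_pairing_2:
  assumes "dim_vec x = 2" "dim_vec y = 2"
  shows "gram_pairing cj (mat_of_rows_list 2 [[0, p], [q, 0]]) x y = cj (x $ 0) * (p * y $ Suc 0) + cj (x $ Suc 0) * (q * y $ 0)"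
  using assms by (simp add: gram_pairing_def mat_of_rows_list_def numeral_2_eq_2 mult.assoc)

text \<open>Since \<open>\<phi>_3\<close> is the direct sum of the identity and
  \<open>\<tau>\<close>, each copy of M_3 supplies one \<open>GK\<close> coordinate of either sign,
  whence the common bound \<open>r\<close>. The sum of the block pairings is then
  \<open>stdform\<close> regrouped by index.\<close>

lemma orthogonal_sum_coords:
  fixes r t1 t2 :: nat
  defines "Ps \<equiv> replicate t1 (lat_M1 cj OB OK sg (emb \<pi>) PiB c) @ replicate t2 (lat_M2 cj OB OK sg (emb \<pi>) PiB c) @
    replicate r (lat_M3 cj OB PiB)"
    and "t \<equiv> \<lambda>s. if s then t1 else t2"
  shows "opclosed (fst (orthogonal_sum Ps))"
    "isometric OB (orthogonal_sum Ps) (Vrec (std_index r t), stdform r t)"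
proof -
  define Ms where "Ms = map fst Ps"
  define \<phi> where "\<phi> n = (if n < t1 then emb_phi1 OK sg (emb \<pi>) PiB else if n < t1 + t2 then emb_phi2 OK sg (emb \<pi>) PiB
      else emb_phi3 PiB)" for n
  define idx :: "nat \<Rightarrow> nat \<Rightarrow> kind \<times> nat" where "idx n e = (if n < t1 then (if e = 0 then EK True else FK True, n)
      else if n < t1 + t2 then (if e = 0 then EK False else FK False, n - t1) else (GK (e = 0), n - (t1 + t2)))" for n e
  define p1 where "p1 j = (case j of (GK s, i) \<Rightarrow> t1 + t2 + i
      | (EK s, i) \<Rightarrow> (if s then i else t1 + i) | (FK s, i) \<Rightarrow> (if s then i else t1 + i))" for j :: "kind \<times> nat"
  define p2 :: "kind \<times> nat \<Rightarrow> nat" where "p2 j = (case j of (FK s, i) \<Rightarrow> 1 | (GK s, i) \<Rightarrow> if s then 0 else 1 | _ \<Rightarrow> 0)" for j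
  let ?J = "std_index r t"
  have len: "length Ms = t1 + t2 + r" "length Ps = t1 + t2 + r" by (simp_all add: Ms_def Ps_def)
  have 1: "Ms ! n = column_bilattice OB 2 (\<phi> n)" if "n < length Ms" for n
    using that unfolding len
    by (auto simp: Ms_def Ps_def nth_append \<phi>_def lat_M1_def lat_M2_def lat_M3_def lat_L1_def lat_L2_def lat_L3_def)
  have 2: "idx n e \<in> ?J \<and> p1 (idx n e) = n \<and> p2 (idx n e) = e" if "n < length Ms" "e < 2" for n e
    using that unfolding len
    by (auto simp: idx_def p1_def p2_def std_index_def JJ_iff less_2 t_def split: if_splits)
  have 3: "p1 j < length Ms \<and> p2 j < 2 \<and> idx (p1 j) (p2 j) = j" if "j \<in> ?J" for j
  proof -
    obtain k i where j: "j = (k, i)" by (cases j)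
    show ?thesis using that unfolding len j
      by (cases k) (auto simp: idx_def p1_def p2_def std_index_def JJ_iff t_def split: if_splits)
  qed
  have 4: "\<phi> n \<alpha> \<in> carrier_mat 2 2" if "n < length Ms" "\<alpha> \<in> OB" for n \<alpha>
    using phi_entries[OF that(2)] by (simp add: \<phi>_def)
  have kO: "k1 \<alpha> \<in> OB" "k2 \<alpha> \<in> OB" "sg (k1 \<alpha>) \<in> OB" "sg (k2 \<alpha>) \<in> OB" if "\<alpha> \<in> OB" for \<alpha>
    using k12_OK[OF that] OB_OK sig_OK[of "k1 \<alpha>" False] sig_OK[of "k2 \<alpha>" False] by (simp_all add: sig_def)
  have piO: "emb \<pi> \<in> OB" using ge_pi vge_mono[OF vB(1), of 1 "emb \<pi>" 0] OB_iff by simp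
  have 5: "\<phi> n \<alpha> $$ (e, e') \<in> OB" if "n < length Ms" "\<alpha> \<in> OB" "e < 2" "e' < 2" for n \<alpha> e e'
    using that(3,4) phi_entries[OF that(2)] kO[OF that(2)] OB_mult[OF _ piO] tau_OB[OF that(2)] that(2) OB_zero
    by (auto simp: \<phi>_def less_2 split: if_splits)
  have 6: "mlm \<alpha> x (idx n e) = (\<Sum>e'<2. \<phi> n \<alpha> $$ (e, e') * x (idx n e'))"
    if "n < length Ms" "e < 2" "\<alpha> \<in> OB" for n e \<alpha> x
  proof -
    have "e = 0 \<or> e = Suc 0" using that(2) by (simp add: less_2)
    then show ?thesis
      using phi_entries[OF that(3)] emb_central[of _ \<pi>]
      by (auto simp: \<phi>_def idx_def mlm_simps sig_def tau_def numeral_2_eq_2 mult.assoc[symmetric]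
          add.commute split: if_splits)
  qed
  have D: "fst (orthogonal_sum Ps) = direct_sum Ms" by (simp add: orthogonal_sum_def Ms_def)
  show "opclosed (fst (orthogonal_sum Ps))"
    unfolding D by (rule direct_sum_opclosed(1)[of Ms "\<lambda>_. 2" \<phi>]; (rule 1 4 5; assumption))
  define f where "f xs = (\<lambda>j. if j \<in> ?J then (xs ! p1 j) $ p2 j else 0)" for xs :: "'b vec list"
  have iso: "bilattice_iso OB (direct_sum Ms) (Vrec ?J) f"
    unfolding f_def std_index_def
    by (rule direct_sum_coords[of Ms "\<lambda>_. 2" \<phi> idx _ _ p1 p2];
        (rule 1 2[unfolded std_index_def] 3[unfolded std_index_def] 4 6; assumption))
  have form: "stdform r t (f xs) (f ys) = (\<Sum>i<length Ps. snd (Ps ! i) (xs ! i) (ys ! i))"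
    if xs: "xs \<in> carrier (direct_sum Ms)" and ys: "ys \<in> carrier (direct_sum Ms)" for xs ys
  proof -
    have dim: "dim_vec (zs ! n) = 2" if "zs \<in> carrier (direct_sum Ms)" "n < t1 + t2 + r" for zs n
    proof -
      have "zs ! n \<in> carrier (Ms ! n)" "n < length Ms"
        using that len by (auto simp: direct_sum_def list_all2_conv_all_nth)
      then show ?thesis using 1 by (auto simp: column_carrier)
    qed
    have fv: "f zs (EK True, i) = zs ! i $ 0" "f zs (FK True, i) = zs ! i $ Suc 0" if "i < t1" for zs i
      using that by (simp_all add: f_def std_index_def JJ_iff t_def p1_def p2_def)
    have fv2: "f zs (EK False, i) = zs ! (t1 + i) $ 0" "f zs (FK False, i) = zs ! (t1 + i) $ Suc 0" if "i < t2" for zs i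
      using that by (simp_all add: f_def std_index_def JJ_iff t_def p1_def p2_def)
    have fv3: "f zs (GK True, i) = zs ! (t1 + t2 + i) $ 0" "f zs (GK False, i) = zs ! (t1 + t2 + i) $ Suc 0" if "i < r" for zs i
      using that by (simp_all add: f_def std_index_def JJ_iff p1_def p2_def)
    have A: "snd (Ps ! i) (xs ! i) (ys ! i) = eblock True (f xs) (f ys) i" if i: "i < t1" for i
    proof -
      have "snd (Ps ! i) = gram_pairing cj (mat_of_rows_list 2 [[0, c], [- c, 0]])"
        using i by (simp add: Ps_def nth_append lat_M1_def)
      then show ?thesis using gram_pairing_2[OF dim[OF xs] dim[OF ys]] i fv[OF i] by (simp add: eblock_def)
    qed
    have B: "snd (Ps ! (t1 + i)) (xs ! (t1 + i)) (ys ! (t1 + i)) = eblock False (f xs) (f ys) i" if i: "i < t2" for i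
    proof -
      have "snd (Ps ! (t1 + i)) = gram_pairing cj (mat_of_rows_list 2 [[0, c], [- c, 0]])"
        using i by (simp add: Ps_def nth_append lat_M2_def)
      then show ?thesis using gram_pairing_2[OF dim[OF xs] dim[OF ys]] i fv2[OF i] by (simp add: eblock_def)
    qed
    have C: "snd (Ps ! (t1 + t2 + i)) (xs ! (t1 + t2 + i)) (ys ! (t1 + t2 + i)) = gblock (f xs) (f ys) i" if i: "i < r" for i
    proof -
      have "snd (Ps ! (t1 + t2 + i)) = gram_pairing cj (mat_of_rows_list 2 [[0, 1], [1, 0]])"
        using i by (simp add: Ps_def nth_append lat_M3_def)
      then show ?thesis using gram_pairing_2[OF dim[OF xs] dim[OF ys]] i fv3[OF i] by (simp add: gblock_def)
    qed
    show ?thesis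
      unfolding len(2) sum_lessThan_add stdform_blocks using A B C by (simp add: t_def add.commute add.left_commute)
  qed
  have "orthogonal_sum Ps = (direct_sum Ms, \<lambda>xs ys. \<Sum>i<length Ps. snd (Ps ! i) (xs ! i) (ys ! i))"
    by (simp add: orthogonal_sum_def Ms_def)
  then show "isometric OB (orthogonal_sum Ps) (Vrec ?J, stdform r t)"
    using iso form by (auto simp: isometric_iff)
qed

section \<open>Classification\<close>

text \<open>A central factor changes neither \<open>star\<close> nor the vanishing of the trace, and
  it shifts \<open>vB \<gamma>\<close> by an arbitrary even number. An odd valuation can thus be
  brought to 1.\<close>

lemma normalised_gamma:
  assumes \<gamma>: "\<gamma> \<noteq> 0" "\<gamma> + cj \<gamma> = 0" "odd (vB \<gamma>)" and star: "\<And>\<alpha>. star \<alpha> = \<gamma> * cj \<alpha> * inverse \<gamma>"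
  shows "\<exists>\<gamma>' u. \<gamma>' \<noteq> 0 \<and> \<gamma>' + cj \<gamma>' = 0 \<and> (\<forall>\<alpha>. star \<alpha> = \<gamma>' * cj \<alpha> * inverse \<gamma>') \<and> vB \<gamma>' = 1 \<and>
    u \<in> unit_set OB \<and> \<gamma>' = u * PiB"
proof -
  obtain k where k: "vB \<gamma> = 2 * k + 1" using \<gamma>(3) by (rule oddE)
  obtain a where a: "a \<noteq> 0" "vF a = - k" using val_surj[OF vF] by blast
  have ea: "emb a \<noteq> 0" using a emb_eq_0_iff by simp
  define \<gamma>' where "\<gamma>' = emb a * \<gamma>"
  have g0: "\<gamma>' \<noteq> 0" using ea \<gamma>(1) by (simp add: \<gamma>'_def)
  have v: "vB \<gamma>' = 1" using val_mult[OF vB(1) ea \<gamma>(1)] val_emb[OF a(1)] a(2) k by (simp add: \<gamma>'_def)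
  have "\<gamma>' + cj \<gamma>' = emb a * (\<gamma> + cj \<gamma>)"
    using emb_central[of "cj \<gamma>" a] by (simp add: \<gamma>'_def cj_mult cj_emb distrib_left)
  then have s: "\<gamma>' + cj \<gamma>' = 0" using \<gamma>(2) by simp
  have st: "star \<alpha> = \<gamma>' * cj \<alpha> * inverse \<gamma>'" for \<alpha>
  proof -
    have "\<gamma>' * cj \<alpha> * inverse \<gamma>' = emb a * (\<gamma> * cj \<alpha> * inverse \<gamma>) * inverse (emb a)"
      using ea \<gamma>(1) by (simp add: \<gamma>'_def nonzero_inverse_mult_distrib mult.assoc)
    also have "\<dots> = star \<alpha>" unfolding star emb_central[symmetric] using ea by (simp add: mult.assoc)
    finally show ?thesis by simp
  qed
  define u where "u = \<gamma>' * inverse PiB"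
  have u0: "u \<noteq> 0" using g0 Pi_ne0 by (simp add: u_def)
  have "vB u = 0" unfolding u_def
    using val_mult[OF vB(1) g0, of "inverse PiB"] Pi_ne0 val_inverse[OF vB(1) Pi_ne0] v val_Pi by simp
  then have "u \<in> unit_set OB"
    using u0 val_inverse[OF vB(1) u0] by (simp add: unit_set_def OB_iff vge_def)
  moreover have "\<gamma>' = u * PiB" using Pi_ne0 by (simp add: u_def mult.assoc)
  ultimately show ?thesis using g0 s st v by blast
qed

text \<open>From \<open>\<gamma> = u * PiB\<close> the involution \<open>star\<close> is
  \<open>pr\<close> conjugated by \<open>u\<close>. The condition that \<open>\<gamma>\<close> has
  trace zero becomes \<open>PiB * cj u = u * PiB\<close>, which says that \<open>u\<close> is
  self-adjoint for both involutions.\<close>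

lemma twist_facts:
  assumes \<gamma>: "\<gamma> \<noteq> 0" "\<gamma> + cj \<gamma> = 0" and star: "\<And>\<alpha>. star \<alpha> = \<gamma> * cj \<alpha> * inverse \<gamma>"
    and u: "u \<in> unit_set OB" "\<gamma> = u * PiB"
  shows "u \<in> OB" "inverse u \<in> OB" "u \<noteq> 0" "star \<alpha> = u * pr \<alpha> * inverse u" "star u = u"
    "pr \<alpha> = inverse u * star \<alpha> * inverse (inverse u)" "pr (inverse u) = inverse u" "\<alpha> \<in> OB \<Longrightarrow> star \<alpha> \<in> OB"
proof -
  show U: "u \<in> OB" "inverse u \<in> OB" "u \<noteq> 0" using u(1) by (auto simp: unit_set_def)
  show st: "star \<alpha> = u * pr \<alpha> * inverse u" for \<alpha>
    unfolding star u(2) pr_def using U(3) Pi_ne0 by (simp add: nonzero_inverse_mult_distrib mult.assoc)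
  have "cj \<gamma> = - \<gamma>" using \<gamma>(2) by (simp add: eq_neg_iff_add_eq_0 add.commute)
  then have "PiB * cj u = u * PiB" unfolding u(2) by (simp add: cj_mult cj_Pi)
  then have pu: "pr u = u" unfolding pr_def using Pi_ne0 by (simp add: mult.assoc)
  show "star u = u" unfolding st pu using U(3) by (simp add: mult.assoc)
  show "pr \<alpha> = inverse u * star \<alpha> * inverse (inverse u)"
    unfolding st using U(3) by (simp add: mult.assoc) (simp add: mult.assoc[symmetric])
  have "pr (inverse u) * pr u = pr (u * inverse u)"
    using Pi_ne0 by (simp add: pr_def cj_mult mult.assoc Pi_cancel)
  also have "\<dots> = 1" using U(3) Pi_ne0 by (simp add: pr_def cj_one)
  finally have "pr (inverse u) * u = 1" unfolding pu .
  then show "pr (inverse u) = inverse u" using U(3) by (metis mult.assoc mult.right_neutral right_inverse mult_1_left)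
  show "\<alpha> \<in> OB \<Longrightarrow> star \<alpha> \<in> OB" unfolding st using OB_mult[OF OB_mult[OF U(1) pr_OB] U(2)] .
qed

lemma intr_transfer:
  assumes F: "bilattice_iso OB L (Vrec (JJ A C)) F" and L: "bilattice OF emb OB L" and fin: "finite (JJ A C)"
    and star: "\<And>\<alpha>. \<alpha> \<in> OB \<Longrightarrow> star \<alpha> \<in> OB" and h: "intr star L h"
  shows "intr star (Vrec (JJ A C)) (\<lambda>x y. h (inv_into (carrier L) F x) (inv_into (carrier L) F y))"
proof -
  note V = Vrec_bilattice[OF fin]
  note G = iso_inverse(1)[OF F opclosed_bilattice[OF L]]
  show ?thesis
    by (rule intr_pull[where f = "inv_into (carrier L) F", OF G V iso_zero[OF G L_group[OF V] L_group[OF L]] _ h])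
      (rule star)
qed

lemma pairing_exists:
  assumes F: "bilattice_iso OB L (Vrec (std_index r t)) F" and L: "bilattice OF emb OB L"
    and \<gamma>: "\<gamma> \<noteq> 0" "\<gamma> + cj \<gamma> = 0" and star: "\<And>\<alpha>. star \<alpha> = \<gamma> * cj \<alpha> * inverse \<gamma>"
    and u: "u \<in> unit_set OB" "\<gamma> = u * PiB"
  shows "\<exists>h. hermitian_pairing OF emb cj OB star L h \<and> perfect_pairing OF emb OB L h"
proof -
  note T = twist_facts[OF \<gamma> star u]
  have fin: "finite (std_index r t)" by (rule finite_std)
  \<comment> \<open>The standard form is hermitian for the primed involution; twisting by
    \<open>inverse u\<close> makes it hermitian for \<open>star\<close>.\<close>
  have base: "intr star (Vrec (std_index r t)) (\<lambda>x y. stdform r t x (mlm (inverse u) y))"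
    unfolding std_index_def
  proof (rule intr_twist[OF stdform_intr[unfolded std_index_def] T(2)])
    show "inverse (inverse u) \<in> OB" "inverse u \<noteq> 0" using T(1,3) by simp_all
    show "pr \<alpha> = inverse u * star \<alpha> * inverse (inverse u)" for \<alpha> by (rule T(6))
    show "pr (inverse u) = inverse u" by (rule T(7))
    show "star \<alpha> \<in> OB" if "\<alpha> \<in> OB" for \<alpha> using T(8) that .
  qed
  have V: "bilattice OF emb OB (Vrec (std_index r t))"
    unfolding std_index_def by (rule Vrec_bilattice[OF fin[unfolded std_index_def]])
  have "intr star L (\<lambda>x y. stdform r t (F x) (mlm (inverse u) (F y)))"
    by (rule intr_pull[OF F L iso_zero[OF F L_group[OF L] L_group[OF V]] _ base]) (rule T(8))
  then show ?thesis using pairing_iff_intr[OF L] by blast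
qed

text \<open>The pairing is carried to coordinates and twisted by \<open>u\<close>, which makes
  \<open>hyperbolic_basis\<close> applicable. The hyperbolic basis gives the equality of counts at
  once, and on a standard index set the isometry with the standard form.\<close>

lemma pairing_structure:
  assumes F: "bilattice_iso OB L (Vrec (JJ A C)) F" and L: "bilattice OF emb OB L"
    and fin: "\<And>s. finite (A s)" "\<And>s. finite (C s)"
    and \<gamma>: "\<gamma> \<noteq> 0" "\<gamma> + cj \<gamma> = 0" and star: "\<And>\<alpha>. star \<alpha> = \<gamma> * cj \<alpha> * inverse \<gamma>"
    and u: "u \<in> unit_set OB" "\<gamma> = u * PiB"
    and h: "hermitian_pairing OF emb cj OB star L h" "perfect_pairing OF emb OB L h"
  shows "card (A True) = card (A False)"
    and "JJ A C = std_index r t \<Longrightarrow> isometric OB (L, \<lambda>x y. h x (lact L u y)) (Vrec (std_index r t), stdform r t)"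
proof -
  note T = twist_facts[OF \<gamma> star u]
  have finJ: "finite (JJ A C)" by (rule finite_JJ[OF fin])
  have cl: "opclosed L" by (rule opclosed_bilattice[OF L])
  note g = iso_inverse[OF F cl]
  let ?g = "inv_into (carrier L) F"
  have hi: "intr star L h" using h pairing_iff_intr[OF L] by blast
  have k: "intr star (Vrec (JJ A C)) (\<lambda>x y. h (?g x) (?g y))"
    by (rule intr_transfer[OF F L finJ _ hi]) (rule T(8))
  define ku where "ku = (\<lambda>x y. h (?g x) (?g (mlm u y)))"
  have ku: "intr pr (Vrec (JJ A C)) ku"
    unfolding ku_def by (rule intr_twist[OF k T(1,2,3) T(4,5)]) (rule pr_OB)
  have sd: "M.sd (NJ (JJ A C)) ku" using ku intr_Vrec_sd by blast
  have H: "card (A True) = card (A False) \<and> (\<exists>b'. M.hyperbolic (NJ (JJ A C)) ku (card (A True)) (\<lambda>s. card (C s)) b')"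
    by (rule M.hyperbolic_basis[OF sd dl_basis[OF finJ] dl_typed fin])
  then show "card (A True) = card (A False)" by blast
  assume J: "JJ A C = std_index r t"
  have "A s = {..<r}" "C s = {..<t s}" for s
  proof -
    have "i \<in> A s \<longleftrightarrow> i < r" "i \<in> C s \<longleftrightarrow> i < t s" for i
      using JJ_iff(1)[of s i A C] JJ_iff(2)[of s i A C] unfolding J by (simp_all add: std_index_def JJ_iff)
    then show "A s = {..<r}" "C s = {..<t s}" by auto
  qed
  then have "\<exists>b'. M.hyperbolic (NJ (std_index r t)) ku r t b'" using H unfolding J by simp
  then obtain b' where b': "M.hyperbolic (NJ (std_index r t)) ku r t b'" ..
  have 1: "isometric OB (Vrec (std_index r t), stdform r t) (Vrec (std_index r t), ku)"
    by (rule hyperbolic_isometry[OF ku[unfolded J] b'])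
  have "opclosed (Vrec (JJ A C))" by (rule opclosed_bilattice[OF Vrec_bilattice[OF finJ]])
  then have 2: "isometric OB (Vrec (std_index r t), ku) (Vrec (std_index r t), stdform r t)"
    using isometric_sym[OF 1] unfolding J by blast
  have 3: "isometric OB (L, \<lambda>x y. h x (lact L u y)) (Vrec (std_index r t), ku)"
    unfolding isometric_iff
  proof (intro exI conjI ballI)
    show "bilattice_iso OB L (Vrec (std_index r t)) F" using F unfolding J .
    fix x y assume x: "x \<in> carrier L" and y: "y \<in> carrier L"
    have "F (lact L u y) = mlm u (F y)" using isoD(5)[OF F T(1) y] by (simp add: Vrec_simps)
    then have "?g (mlm u (F y)) = lact L u y" using g(2)[OF opclosedD(2)[OF cl T(1) y]] by simp
    then show "ku (F x) (F y) = h x (lact L u y)" by (simp add: ku_def g(2)[OF x])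
  qed
  show "isometric OB (L, \<lambda>x y. h x (lact L u y)) (Vrec (std_index r t), stdform r t)"
    by (rule isometric_trans[OF 3 2])
qed

lemma invariant_iso:
  assumes "has_structural_invariant OB OK sg (emb \<pi>) PiB L (r1, r2, t1, t2)"
  shows "\<exists>F. bilattice_iso OB L (Vrec (JJ (\<lambda>s. if s then {..<r1} else {..<r2}) (\<lambda>s. {..<if s then t1 else t2}))) F"
  using assms invariant_coords(3)[of r1 r2 t1 t2] iso_trans
  unfolding has_structural_invariant_def bilattices_isomorphic_def by (simp only: prod.case) blast

lemma invariant_index:
  "JJ (\<lambda>s. if s then {..<r} else {..<r}) (\<lambda>s. {..<if s then t1 else t2}) = std_index r (\<lambda>s. if s then t1 else t2)"
  by (simp add: std_index_def)

lemma classification: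
  assumes L: "bilattice OF emb OB L" and inv: "has_structural_invariant OB OK sg (emb \<pi>) PiB L (r, r, t1, t2)"
    and h: "hermitian_pairing OF emb cj OB star L h" "perfect_pairing OF emb OB L h"
    and \<gamma>: "\<gamma> \<noteq> 0" "\<gamma> + cj \<gamma> = 0" and star: "\<And>\<alpha>. star \<alpha> = \<gamma> * cj \<alpha> * inverse \<gamma>"
    and u: "u \<in> unit_set OB" "\<gamma> = u * PiB"
  shows "isometric OB (L, \<lambda>x y. h x (lact L u y))
    (orthogonal_sum (replicate t1 (lat_M1 cj OB OK sg (emb \<pi>) PiB c) @
       replicate t2 (lat_M2 cj OB OK sg (emb \<pi>) PiB c) @ replicate r (lat_M3 cj OB PiB)))"
    (is "isometric OB _ ?S")
proof -
  obtain F where F: "bilattice_iso OB L (Vrec (JJ (\<lambda>s. if s then {..<r} else {..<r}) (\<lambda>s. {..<if s then t1 else t2}))) F"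
    using invariant_iso[OF inv] by blast
  have 1: "isometric OB (L, \<lambda>x y. h x (lact L u y))
      (Vrec (std_index r (\<lambda>s. if s then t1 else t2)), stdform r (\<lambda>s. if s then t1 else t2))"
    by (rule pairing_structure(2)[OF F L _ _ \<gamma> star u h invariant_index]) simp_all
  obtain D k where S: "?S = (D, k)" by (cases ?S)
  have "isometric OB (D, k) (Vrec (std_index r (\<lambda>s. if s then t1 else t2)), stdform r (\<lambda>s. if s then t1 else t2))"
    and "opclosed D"
    using orthogonal_sum_coords(1,2)[where r = r and ?t1.0 = t1 and ?t2.0 = t2] unfolding S by simp_all
  then have "isometric OB (Vrec (std_index r (\<lambda>s. if s then t1 else t2)), stdform r (\<lambda>s. if s then t1 else t2)) (D, k)"
    by (rule isometric_sym)
  then show ?thesis unfolding S by (rule isometric_trans[OF 1])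
qed

text \<open>An isomorphism commutes with left multiplication by \<open>u\<close>, so evaluating the
  twisted identity at \<open>inverse u\<close> times \<open>y\<close> removes the twist from both
  sides.\<close>

lemma untwist_isometry:
  assumes N: "bilattice OF emb OB N" and N': "bilattice OF emb OB N'" and u: "u \<in> OB" "inverse u \<in> OB" "u \<noteq> 0"
    and iso: "isometric OB (N, \<lambda>x y. h x (lact N u y)) (N', \<lambda>x y. h' x (lact N' u y))"
  shows "isometric OB (N, h) (N', h')"
proof -
  obtain f where f: "bilattice_iso OB N N' f"
    "\<And>x y. x \<in> carrier N \<Longrightarrow> y \<in> carrier N \<Longrightarrow> h' (f x) (lact N' u (f y)) = h x (lact N u y)"
    using iso unfolding isometric_iff by blast
  show ?thesis unfolding isometric_iff
  proof (intro exI conjI ballI)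
    show "bilattice_iso OB N N' f" by (rule f(1))
    fix x y assume x: "x \<in> carrier N" and y: "y \<in> carrier N"
    have z: "lact N (inverse u) y \<in> carrier N" by (rule L_lact[OF N y u(2)])
    have "lact N (u * inverse u) y = lact N u (lact N (inverse u) y)" "lact N 1 y = y"
      using L_parts[OF N, THEN conjunct2, THEN conjunct2] u y by blast+
    then have e: "lact N u (lact N (inverse u) y) = y" using u(3) by simp
    have "lact N' u (f (lact N (inverse u) y)) = f y"
      unfolding isoD(5)[OF f(1) u(1) z, symmetric] e ..
    then show "h' (f x) (f y) = h x y" using f(2)[OF x z] unfolding e by simp
  qed
qed

end

section \<open>Existence criterion, standard form and uniqueness\<close>

theorem theorem4p1p2:
  fixes vF :: "'f::field \<Rightarrow> int"
    and emb :: "'f \<Rightarrow> 'b::division_ring"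
    and cj star sg :: "'b \<Rightarrow> 'b"
    and vB :: "'b \<Rightarrow> int"
    and OF :: "'f set" and OB OK K :: "'b set"
    and \<pi> :: 'f and PiB c \<gamma> :: 'b
  assumes F: "nonarch_local_field vF" and charF: "CHAR('f) \<noteq> 2"
    and OF: "OF = valuation_ring vF"
    and B: "quaternion_division_algebra emb"
    and cj: "canonical_involution emb cj"
    and OB: "maximal_order vF emb OB"
    and vB: "discrete_valuation vB" "valuation_extends vF emb vB"
    and K: "unramified_quadratic_subfield emb vB K"
    and OK: "OK = K \<inter> valuation_ring vB"
    and sg: "nontrivial_automorphism emb K sg"
    and pi: "\<pi> \<noteq> 0" "vF \<pi> = 1"
    and PiB: "PiB \<in> OB" "bij_betw (\<lambda>(a, b). a + b * PiB) (OK \<times> OK) OB"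
            "PiB * PiB = emb \<pi>" "\<And>a. a \<in> OK \<Longrightarrow> PiB * a = sg a * PiB"
    and c: "c \<in> unit_set OK" "c + sg c = 0"
    and \<gamma>: "\<gamma> \<noteq> 0" "\<gamma> + cj \<gamma> = 0" "odd (vB \<gamma>)"
    and star: "\<And>\<alpha>. star \<alpha> = \<gamma> * cj \<alpha> * inverse \<gamma>"
  shows
    "(\<forall>(L :: ('b, 'l) bimodule) r1 r2 t1 t2.
        bilattice OF emb OB L \<and>
        has_structural_invariant OB OK sg (emb \<pi>) PiB L (r1, r2, t1, t2) \<longrightarrow>
        ((\<exists>h. hermitian_pairing OF emb cj OB star L h \<and> perfect_pairing OF emb OB L h) \<longleftrightarrow>
         r1 = r2)) \<and>
     (\<forall>(L :: ('b, 'l) bimodule) r t1 t2 h \<gamma>' u.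
        bilattice OF emb OB L \<and>
        has_structural_invariant OB OK sg (emb \<pi>) PiB L (r, r, t1, t2) \<and>
        hermitian_pairing OF emb cj OB star L h \<and> perfect_pairing OF emb OB L h \<and>
        \<gamma>' \<noteq> 0 \<and> \<gamma>' + cj \<gamma>' = 0 \<and> (\<forall>\<alpha>. star \<alpha> = \<gamma>' * cj \<alpha> * inverse \<gamma>') \<and>
        vB \<gamma>' = 1 \<and> u \<in> unit_set OB \<and> \<gamma>' = u * PiB \<longrightarrow>
        isometric OB (L, \<lambda>x y. h x (lact L u y))
          (orthogonal_sum
            (replicate t1 (lat_M1 cj OB OK sg (emb \<pi>) PiB c) @
             replicate t2 (lat_M2 cj OB OK sg (emb \<pi>) PiB c) @
             replicate r (lat_M3 cj OB PiB)))) \<and>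
     (\<forall>r t1 t2.
        (\<exists>(N :: ('b, 'b vec list) bimodule) h.
           has_structural_invariant OB OK sg (emb \<pi>) PiB N (r, r, t1, t2) \<and>
           self_dual_hermitian_bilattice OF emb cj OB star N h) \<and>
        (\<forall>(N :: ('b, 'l) bimodule) h (N' :: ('b, 'm) bimodule) h'.
           has_structural_invariant OB OK sg (emb \<pi>) PiB N (r, r, t1, t2) \<and>
           self_dual_hermitian_bilattice OF emb cj OB star N h \<and>
           has_structural_invariant OB OK sg (emb \<pi>) PiB N' (r, r, t1, t2) \<and>
           self_dual_hermitian_bilattice OF emb cj OB star N' h' \<longrightarrow>
           isometric OB (N, h) (N', h')))"
proof -
  interpret quaternion_setting vF emb cj sg vB OF OB OK K \<pi> PiB c
    by unfold_locales (fact F charF OF B cj OB vB K OK sg pi PiB c)+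
  \<comment> \<open>An auxiliary normalization for the statements in which \<open>u\<close> does not
    occur: existence of a pairing and uniqueness up to isometry.\<close>
  obtain \<gamma>0 u0 where g0: "\<gamma>0 \<noteq> 0" "\<gamma>0 + cj \<gamma>0 = 0" "\<And>\<alpha>. star \<alpha> = \<gamma>0 * cj \<alpha> * inverse \<gamma>0"
    "u0 \<in> unit_set OB" "\<gamma>0 = u0 * PiB"
    using normalised_gamma[OF \<gamma> star] by blast
  have u0: "u0 \<in> OB" "inverse u0 \<in> OB" "u0 \<noteq> 0" using g0(4) by (auto simp: unit_set_def)
  have 1: "(\<exists>h. hermitian_pairing OF emb cj OB star L h \<and> perfect_pairing OF emb OB L h) \<longleftrightarrow> r1 = r2"
    if L: "bilattice OF emb OB L" and inv: "has_structural_invariant OB OK sg (emb \<pi>) PiB L (r1, r2, t1, t2)"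
    for L :: "('b, 'l) bimodule" and r1 r2 t1 t2
  proof -
    obtain F where F: "bilattice_iso OB L (Vrec (JJ (\<lambda>s. if s then {..<r1} else {..<r2}) (\<lambda>s. {..<if s then t1 else t2}))) F"
      using invariant_iso[OF inv] by blast
    show ?thesis
    proof
      assume "\<exists>h. hermitian_pairing OF emb cj OB star L h \<and> perfect_pairing OF emb OB L h"
      then obtain h where h: "hermitian_pairing OF emb cj OB star L h" "perfect_pairing OF emb OB L h" by blast
      show "r1 = r2" using pairing_structure(1)[OF F L _ _ g0 h] by simp
    next
      assume "r1 = r2"
      then show "\<exists>h. hermitian_pairing OF emb cj OB star L h \<and> perfect_pairing OF emb OB L h"
        using pairing_exists[OF F[unfolded \<open>r1 = r2\<close> invariant_index] L g0] by blast
    qed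
  qed
  have 3: "\<exists>(N :: ('b, 'b vec list) bimodule) h.
      has_structural_invariant OB OK sg (emb \<pi>) PiB N (r, r, t1, t2) \<and>
      self_dual_hermitian_bilattice OF emb cj OB star N h" for r t1 t2
  proof -
    \<comment> \<open>The defining direct sum itself has the required invariant through the identity
      map.\<close>
    define N where "N = direct_sum (replicate r (lat_O OB) @ replicate r (lat_P OB PiB) @
      replicate t1 (lat_L1 OB OK sg (emb \<pi>) PiB) @ replicate t2 (lat_L2 OB OK sg (emb \<pi>) PiB))"
    note I = invariant_coords[of r r t1 t2, folded N_def, unfolded invariant_index]
    obtain F where F: "bilattice_iso OB N (Vrec (std_index r (\<lambda>s. if s then t1 else t2))) F" "F \<zero>\<^bsub>N\<^esub> = 0"
      using I(3) by blast
    have N: "bilattice OF emb OB N"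
      by (rule bilattice_pull[OF F(1)[unfolded std_index_def] I(1,2) F(2) finite_std[unfolded std_index_def]])
    have "bilattice_iso OB N N (\<lambda>x. x)" by (simp add: bilattice_iso_def bij_betw_def)
    then have "has_structural_invariant OB OK sg (emb \<pi>) PiB N (r, r, t1, t2)"
      unfolding has_structural_invariant_def bilattices_isomorphic_def N_def by auto
    then show ?thesis using pairing_exists[OF F(1) N g0] N unfolding self_dual_hermitian_bilattice_def by blast
  qed
  have 4: "isometric OB (N, h) (N', h')"
    if "has_structural_invariant OB OK sg (emb \<pi>) PiB N (r, r, t1, t2)"
      "self_dual_hermitian_bilattice OF emb cj OB star N h"
      "has_structural_invariant OB OK sg (emb \<pi>) PiB N' (r, r, t1, t2)"
      "self_dual_hermitian_bilattice OF emb cj OB star N' h'"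
    for r t1 t2 and N :: "('b, 'l) bimodule" and h and N' :: "('b, 'm) bimodule" and h'
  proof -
    have N: "bilattice OF emb OB N" "hermitian_pairing OF emb cj OB star N h" "perfect_pairing OF emb OB N h"
      and N': "bilattice OF emb OB N'" "hermitian_pairing OF emb cj OB star N' h'" "perfect_pairing OF emb OB N' h'"
      using that(2,4) unfolding self_dual_hermitian_bilattice_def by blast+
    obtain D k where S: "orthogonal_sum (replicate t1 (lat_M1 cj OB OK sg (emb \<pi>) PiB c) @
       replicate t2 (lat_M2 cj OB OK sg (emb \<pi>) PiB c) @ replicate r (lat_M3 cj OB PiB)) = (D, k)" by fastforce
    \<comment> \<open>Both lattices are twisted by the same \<open>u0\<close>, so after comparison
      with the common orthogonal sum the twist can be undone simultaneously.\<close>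
    have a: "isometric OB (N, \<lambda>x y. h x (lact N u0 y)) (D, k)"
      using classification[OF N(1) that(1) N(2,3) g0] unfolding S .
    have b: "isometric OB (N', \<lambda>x y. h' x (lact N' u0 y)) (D, k)"
      using classification[OF N'(1) that(3) N'(2,3) g0] unfolding S .
    show ?thesis
      by (rule untwist_isometry[OF N(1) N'(1) u0 isometric_trans[OF a isometric_sym[OF b opclosed_bilattice[OF N'(1)]]]])
  qed
  show ?thesis
  proof (intro conjI allI impI)
    fix L :: "('b, 'l) bimodule" and r1 r2 t1 t2
    assume "bilattice OF emb OB L \<and> has_structural_invariant OB OK sg (emb \<pi>) PiB L (r1, r2, t1, t2)"
    then show "(\<exists>h. hermitian_pairing OF emb cj OB star L h \<and> perfect_pairing OF emb OB L h) \<longleftrightarrow> r1 = r2"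
      using 1 by blast
  next
    fix L :: "('b, 'l) bimodule" and r t1 t2 h \<gamma>' u
    assume A: "bilattice OF emb OB L \<and>
        has_structural_invariant OB OK sg (emb \<pi>) PiB L (r, r, t1, t2) \<and>
        hermitian_pairing OF emb cj OB star L h \<and> perfect_pairing OF emb OB L h \<and>
        \<gamma>' \<noteq> 0 \<and> \<gamma>' + cj \<gamma>' = 0 \<and> (\<forall>\<alpha>. star \<alpha> = \<gamma>' * cj \<alpha> * inverse \<gamma>') \<and>
        vB \<gamma>' = 1 \<and> u \<in> unit_set OB \<and> \<gamma>' = u * PiB"
    show "isometric OB (L, \<lambda>x y. h x (lact L u y))
          (orthogonal_sum
            (replicate t1 (lat_M1 cj OB OK sg (emb \<pi>) PiB c) @
             replicate t2 (lat_M2 cj OB OK sg (emb \<pi>) PiB c) @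
             replicate r (lat_M3 cj OB PiB)))"
      by (rule classification[of L r t1 t2 star h \<gamma>' u]) (use A in blast)+
  next
    fix r t1 t2 show "\<exists>(N :: ('b, 'b vec list) bimodule) h.
      has_structural_invariant OB OK sg (emb \<pi>) PiB N (r, r, t1, t2) \<and>
      self_dual_hermitian_bilattice OF emb cj OB star N h" by (rule 3)
  next
    fix r t1 t2 and N :: "('b, 'l) bimodule" and h and N' :: "('b, 'm) bimodule" and h'
    assume A: "has_structural_invariant OB OK sg (emb \<pi>) PiB N (r, r, t1, t2) \<and>
      self_dual_hermitian_bilattice OF emb cj OB star N h \<and>
      has_structural_invariant OB OK sg (emb \<pi>) PiB N' (r, r, t1, t2) \<and>
      self_dual_hermitian_bilattice OF emb cj OB star N' h'"
    show "isometric OB (N, h) (N', h')" by (rule 4[of N r t1 t2 h N' h']) (use A in blast)+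
  qed
qed

end
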